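(* Assume that $1<p<\infty$ and that $X$ is a proper connected metric space equipped with a locally doubling measure $\mu$ supporting a local $p$-Poincaré inequality. Let $\Omega\subset X$ be a nonempty open set. Assume that $X$ is bounded or $p$-parabolic, that $C_p(X\setminus\Omega)=0$ and that $\partial^*\Omega\ne\emptyset$. Then for every $f\in C(\partial^*\Omega)$, $$\overline{P}_\Omega f\equiv\sup_{\partial^*\Omega}f\quad\text{and}\quad\underline{P}_\Omega f\equiv\inf_{\partial^*\Omega}f.$$ In particular, no nonconstant $f\in C(\partial^*\Omega)$ is resolutive. Moreover, all boundary points (i.e. all points of $\partial^*\Omega$) are irregular if $\partial^*\Omega$ contains at least two points.
   Context: $X=(X,d,\mu)$ is a metric space equipped with a positive complete Borel measure $\mu$ with $0<\mu(B)<\infty$ for every ball $B$. Balls are open and come with a fixed centre and radius; $\lambda B(x,r):=B(x,\lambda r)$. $\overline{\mathbf{R}}=[-\infty,\infty]$, $\chi_A$ is the characteristic function of $A$, and continuous functions are real-valued. Upper gradients. A curve is a nonconstant compact rectifiable curve, parameterized by arc length $ds$. A property holds for $p$-almost every curve if there is a nonnegative $\rho\in L^p(X)$ with $\int_\gamma\rho\,ds=\infty$ for every curve $\gamma$ for which it fails. A measurable $g:X\to[0,\infty]$ is a $p$-weak upper gradient of $f:X\to\overline{\mathbf{R}}$ if for $p$-almost all curves $\gamma:[0,l_\gamma]\to X$, $|f(\gamma(0))-f(\gamma(l_\gamma))|\le\int_\gamma g\,ds$, where the left-hand side is $\infty$ if at least one of the terms is infinite. If $f$ has a $p$-weak upper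 gradient in $L^p_{\rm loc}(X)$, then $g_f$ denotes its minimal $p$-weak upper gradient ($g_f\le g$ a.e. for every $p$-weak upper gradient $g\in L^p_{\rm loc}(X)$ of $f$). $N^{1,p}(X)$ is the space of measurable $f$, defined everywhere with values in $\overline{\mathbf{R}}$, with $\|f\|_{N^{1,p}(X)}^p=\int_X|f|^p\,d\mu+\inf_g\int_X g^p\,d\mu<\infty$, infimum over all $p$-weak upper gradients $g$ of $f$. $f\in N^{1,p}_{\rm loc}(X)$ if every $x\in X$ is contained in a ball $B_x$ with $f\in N^{1,p}(B_x)$. For measurable $E\subset X$ these notions are defined by regarding $(E,d|_E,\mu|_E)$ as a metric space. The Sobolev capacity is $C_p(E)=\inf\|f\|_{N^{1,p}(X)}^p$ over $f\in N^{1,p}(X)$ with $f\ge1$ on $E$. Doubling and Poincaré. $\mu$ is doubling within an open set $U$ if there is $C>0$ with $\mu(2B)\le C\mu(B)$ for all balls $B\subset U$. The $p$-Poincaré inequality holds within $U$ if there are $C>0$, $\lambda\ge1$ such that for all balls $B\subset U$ with radius $r_B$, all integrable $u$ on $\lambda B$ and all $p$-weak upper gradients $g$ of $u$ in $\lambda B$, $\frac1{\mu(B)}\int_B|u-u_B|\,d\mu\le Cr_B\bigl(\frac1{\mu(\lambda B)}\int_{\lambda B}g^p\,d\mu\bigr)^{1/p}$, where $u_B=\frac1{\mu(B)}\int_B u\,d\mu$. Each property is local if for every $x\in X$ there is $r>0$ such that it holds within $B(x,r)$. $X$ is proper if all closed bounded sets are compact. Parabolicity. For compact $K\subset X$, $\mathrm{cap}_p(K,X)=\inf_u\int_X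 g_u^p\,d\mu$ over $u\in N^{1,p}(X)$ with $\chi_K\le u\le1$. An unbounded $X$ is $p$-parabolic if $\mathrm{cap}_p(K,X)=0$ for all compact $K\subset X$. Superharmonic functions. For open $G\subset X$, $N^{1,p}_0(G)=\{f|_G:f\in N^{1,p}(X),\ f=0\text{ on }X\setminus G\}$. A function $u\in N^{1,p}_{\rm loc}(G)$ is a superminimizer in $G$ if $\int_{\varphi\ne0}g_u^p\,d\mu\le\int_{\varphi\ne0}g_{u+\varphi}^p\,d\mu$ for all nonnegative $\varphi\in N_0^{1,p}(G)$. $u$ is lsc-regularized if $u(x)=\lim_{r\to0}\operatorname{ess\,inf}_{B(x,r)}u$ for all $x\in G$. $u:G\to(-\infty,\infty]$ is superharmonic in $G$ if $\min\{u,k\}$ is an lsc-regularized superminimizer in $G$ for every $k\in\mathbf{R}$ and $u$ is not identically $\infty$ in any component of $G$; $u$ is subharmonic if $-u$ is superharmonic. Perron solutions. If $X$ is unbounded, $X^*=X\cup\{\infty\}$ is the one-point compactification; if $X$ is bounded, $X^*=X$. $\partial^*\Omega=\partial\Omega\cup\{\infty\}$ if $\Omega$ is unbounded and $\partial^*\Omega=\partial\Omega$ otherwise (with the topology from $X^*$). For $f:\partial^*\Omega\to\overline{\mathbf{R}}$, $\overline{P}_\Omega f(x)=\inf u(x)$ over all superharmonic $u$ in $\Omega$ that are bounded from below and satisfy $\liminf_{\Omega\ni y\to z}u(y)\ge f(z)$ for all $z\in\partial^*\Omega$; $\underline{P}_\Omega f(x)=\sup v(x)$ over all subharmonic $v$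 in $\Omega$ that are bounded from above and satisfy $\limsup_{\Omega\ni y\to z}v(y)\le f(z)$ for all $z\in\partial^*\Omega$. $f$ is resolutive if $\overline{P}_\Omega f=\underline{P}_\Omega f$ and this function is real-valued. A point $x\in\partial^*\Omega$ is regular for $\Omega$ if $\lim_{\Omega\ni y\to x}\overline{P}_\Omega f(y)=f(x)$ for all $f\in C(\partial^*\Omega)$; otherwise it is irregular. *)

theory Defs
  imports "HOL-Analysis.Analysis"
begin

text \<open>
  The space is the whole type \<open>'a\<close>.  A function on a subset \<open>E\<close> is a total function of which
  only the values on \<open>E\<close> matter, and notions on \<open>E\<close> are those of the metric measure space
  \<open>(E, dist, restrict_space M E)\<close>.
\<close>

section \<open>Metric measure spaces\<close>

text \<open>A complete Borel measure is the completion of a measure on the Borel sets.\<close>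

definition complete_borel_measure :: "'a::metric_space measure \<Rightarrow> bool" where
  "complete_borel_measure M \<longleftrightarrow> (\<exists>N. sets N = sets borel \<and> M = completion N)"

definition balls_pos_finite :: "'a::metric_space measure \<Rightarrow> bool" where
  "balls_pos_finite M \<longleftrightarrow>
     (\<forall>x r. r > 0 \<longrightarrow> 0 < emeasure M (ball x r) \<and> emeasure M (ball x r) < \<infinity>)"

definition proper_space :: "'a::metric_space itself \<Rightarrow> bool" where
  "proper_space _ \<longleftrightarrow> (\<forall>S::'a set. closed S \<and> bounded S \<longrightarrow> compact S)"

definition ennreal_powr :: "ennreal \<Rightarrow> real \<Rightarrow> ennreal" where
  "ennreal_powr x p = (if x = \<infinity> then \<infinity> else ennreal (enn2real x powr p))"


section \<open>Curves and weak upper gradients\<close>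

definition curve_length :: "(real \<Rightarrow> 'a::metric_space) \<Rightarrow> real \<Rightarrow> real \<Rightarrow> ennreal" where
  "curve_length \<gamma> a b =
     (SUP (n, t) \<in> {(n::nat, t::nat \<Rightarrow> real). mono_on {..n} t \<and> t ` {..n} \<subseteq> {a..b}}.
        ennreal (\<Sum>i<n. dist (\<gamma> (t i)) (\<gamma> (t (Suc i)))))"

text \<open>
  Nonconstant compact rectifiable curves \<open>\<gamma> : [0, l] \<rightarrow> E\<close>, parameterized by arc length;
  being nonconstant amounts to \<open>l > 0\<close>.
\<close>

definition arc_length_curve :: "'a::metric_space set \<Rightarrow> real \<Rightarrow> (real \<Rightarrow> 'a) \<Rightarrow> bool" where
  "arc_length_curve E l \<gamma> \<longleftrightarrow>
     l > 0 \<and> continuous_on {0..l} \<gamma> \<and> \<gamma> ` {0..l} \<subseteq> E \<and>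
     (\<forall>t\<in>{0..l}. curve_length \<gamma> 0 t = ennreal t)"

text \<open>
  If \<open>g \<circ> \<gamma>\<close> is not Lebesgue measurable this is the lower integral.  For a measurable \<open>g\<close> this
  happens only on a \<open>p\<close>-exceptional family of curves, as \<open>g\<close> agrees a.e. with a Borel function.
\<close>

definition line_integral :: "real \<Rightarrow> (real \<Rightarrow> 'a::metric_space) \<Rightarrow> ('a \<Rightarrow> ennreal) \<Rightarrow> ennreal" where
  "line_integral l \<gamma> g = (\<integral>\<^sup>+t\<in>{0..l}. g (\<gamma> t) \<partial>lebesgue)"

definition almost_every_curve ::
  "real \<Rightarrow> 'a::metric_space measure \<Rightarrow> 'a set \<Rightarrow> (real \<Rightarrow> (real \<Rightarrow> 'a) \<Rightarrow> bool) \<Rightarrow> bool" where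
  "almost_every_curve p M E P \<longleftrightarrow>
     (\<exists>\<rho>::'a \<Rightarrow> ennreal. \<rho> \<in> borel_measurable (restrict_space M E) \<and>
        (\<integral>\<^sup>+x\<in>E. ennreal_powr (\<rho> x) p \<partial>M) < \<infinity> \<and>
        (\<forall>l \<gamma>. arc_length_curve E l \<gamma> \<and> \<not> P l \<gamma> \<longrightarrow> line_integral l \<gamma> \<rho> = \<infinity>))"

definition oscillation :: "ereal \<Rightarrow> ereal \<Rightarrow> ennreal" where
  "oscillation a b = (if \<bar>a\<bar> = \<infinity> \<or> \<bar>b\<bar> = \<infinity> then \<infinity> else e2ennreal \<bar>a - b\<bar>)"

definition weak_upper_gradient ::
  "real \<Rightarrow> 'a::metric_space measure \<Rightarrow> 'a set \<Rightarrow> ('a \<Rightarrow> ennreal) \<Rightarrow> ('a \<Rightarrow> ereal) \<Rightarrow> bool" where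
  "weak_upper_gradient p M E g f \<longleftrightarrow>
     g \<in> borel_measurable (restrict_space M E) \<and>
     almost_every_curve p M E (\<lambda>l \<gamma>. oscillation (f (\<gamma> 0)) (f (\<gamma> l)) \<le> line_integral l \<gamma> g)"

definition locally_p_integrable ::
  "real \<Rightarrow> 'a::metric_space measure \<Rightarrow> 'a set \<Rightarrow> ('a \<Rightarrow> ennreal) \<Rightarrow> bool" where
  "locally_p_integrable p M E g \<longleftrightarrow>
     g \<in> borel_measurable (restrict_space M E) \<and>
     (\<forall>x\<in>E. \<exists>r>0. (\<integral>\<^sup>+y\<in>ball x r \<inter> E. ennreal_powr (g y) p \<partial>M) < \<infinity>)"

definition is_minimal_wug ::
  "real \<Rightarrow> 'a::metric_space measure \<Rightarrow> 'a set \<Rightarrow> ('a \<Rightarrow> ereal) \<Rightarrow> ('a \<Rightarrow> ennreal) \<Rightarrow> bool" where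
  "is_minimal_wug p M E f g \<longleftrightarrow>
     weak_upper_gradient p M E g f \<and> locally_p_integrable p M E g \<and>
     (\<forall>h. weak_upper_gradient p M E h f \<and> locally_p_integrable p M E h \<longrightarrow>
        (AE x in restrict_space M E. g x \<le> h x))"

text \<open>
  Determined up to a.e. equality, and a junk value unless \<open>f\<close> has a weak upper gradient that is
  locally \<open>p\<close>-integrable on \<open>E\<close>.
\<close>

definition minimal_wug ::
  "real \<Rightarrow> 'a::metric_space measure \<Rightarrow> 'a set \<Rightarrow> ('a \<Rightarrow> ereal) \<Rightarrow> 'a \<Rightarrow> ennreal" where
  "minimal_wug p M E f = (SOME g. is_minimal_wug p M E f g)"


section \<open>Newtonian spaces and capacities\<close>

text \<open>The \<open>p\<close>-th power of the Newtonian norm.\<close>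

definition newtonian_norm_p ::
  "real \<Rightarrow> 'a::metric_space measure \<Rightarrow> 'a set \<Rightarrow> ('a \<Rightarrow> ereal) \<Rightarrow> ennreal" where
  "newtonian_norm_p p M E f =
     (\<integral>\<^sup>+x\<in>E. ennreal_powr (e2ennreal \<bar>f x\<bar>) p \<partial>M) +
     (INF g\<in>{g. weak_upper_gradient p M E g f}. \<integral>\<^sup>+x\<in>E. ennreal_powr (g x) p \<partial>M)"

definition newtonian ::
  "real \<Rightarrow> 'a::metric_space measure \<Rightarrow> 'a set \<Rightarrow> ('a \<Rightarrow> ereal) set" where
  "newtonian p M E =
     {f. f \<in> borel_measurable (restrict_space M E) \<and> newtonian_norm_p p M E f < \<infinity>}"

definition newtonian_loc ::
  "real \<Rightarrow> 'a::metric_space measure \<Rightarrow> 'a set \<Rightarrow> ('a \<Rightarrow> ereal) set" where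
  "newtonian_loc p M E =
     {f. \<forall>x\<in>E. \<exists>y\<in>E. \<exists>r>0. x \<in> ball y r \<and> f \<in> newtonian p M (ball y r \<inter> E)}"

definition newtonian_zero ::
  "real \<Rightarrow> 'a::metric_space measure \<Rightarrow> 'a set \<Rightarrow> ('a \<Rightarrow> ereal) set" where
  "newtonian_zero p M G =
     {\<phi>. \<exists>f\<in>newtonian p M UNIV. (\<forall>x\<in>- G. f x = 0) \<and> (\<forall>x\<in>G. \<phi> x = f x)}"

definition sobolev_capacity :: "real \<Rightarrow> 'a::metric_space measure \<Rightarrow> 'a set \<Rightarrow> ennreal" where
  "sobolev_capacity p M E =
     (INF f\<in>{f\<in>newtonian p M UNIV. \<forall>x\<in>E. 1 \<le> f x}. newtonian_norm_p p M UNIV f)"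

definition variational_capacity :: "real \<Rightarrow> 'a::metric_space measure \<Rightarrow> 'a set \<Rightarrow> ennreal" where
  "variational_capacity p M K =
     (INF u\<in>{u\<in>newtonian p M UNIV. \<forall>x. indicator K x \<le> u x \<and> u x \<le> 1}.
        \<integral>\<^sup>+x. ennreal_powr (minimal_wug p M UNIV u x) p \<partial>M)"

definition p_parabolic :: "real \<Rightarrow> 'a::metric_space measure \<Rightarrow> bool" where
  "p_parabolic p M \<longleftrightarrow>
     \<not> bounded (UNIV :: 'a set) \<and> (\<forall>K. compact K \<longrightarrow> variational_capacity p M K = 0)"


section \<open>Doubling and Poincare inequality\<close>

definition doubling_within :: "'a::metric_space measure \<Rightarrow> 'a set \<Rightarrow> bool" where
  "doubling_within M U \<longleftrightarrow>
     (\<exists>C::real. C > 0 \<and> (\<forall>x r. r > 0 \<and> ball x r \<subseteq> U \<longrightarrow>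
        emeasure M (ball x (2 * r)) \<le> ennreal C * emeasure M (ball x r)))"

definition locally_doubling :: "'a::metric_space measure \<Rightarrow> bool" where
  "locally_doubling M \<longleftrightarrow> (\<forall>x. \<exists>r>0. doubling_within M (ball x r))"

definition set_average :: "'a measure \<Rightarrow> 'a set \<Rightarrow> ('a \<Rightarrow> ereal) \<Rightarrow> real" where
  "set_average M B u = (LINT x:B|M. real_of_ereal (u x)) / measure M B"

definition poincare_within :: "real \<Rightarrow> 'a::metric_space measure \<Rightarrow> 'a set \<Rightarrow> bool" where
  "poincare_within p M U \<longleftrightarrow>
     (\<exists>(C::real) (\<sigma>::real). C > 0 \<and> \<sigma> \<ge> 1 \<and>
       (\<forall>x r (u::'a \<Rightarrow> ereal) (g::'a \<Rightarrow> ennreal).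
          r > 0 \<and> ball x r \<subseteq> U \<and>
          u \<in> borel_measurable (restrict_space M (ball x (\<sigma> * r))) \<and>
          (\<integral>\<^sup>+y\<in>ball x (\<sigma> * r). e2ennreal \<bar>u y\<bar> \<partial>M) < \<infinity> \<and>
          weak_upper_gradient p M (ball x (\<sigma> * r)) g u \<longrightarrow>
          (\<integral>\<^sup>+y\<in>ball x r. e2ennreal \<bar>u y - ereal (set_average M (ball x r) u)\<bar> \<partial>M)
              / emeasure M (ball x r)
          \<le> ennreal (C * r) *
             ennreal_powr ((\<integral>\<^sup>+y\<in>ball x (\<sigma> * r). ennreal_powr (g y) p \<partial>M)
                           / emeasure M (ball x (\<sigma> * r))) (1 / p)))"

definition local_poincare :: "real \<Rightarrow> 'a::metric_space measure \<Rightarrow> bool" where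
  "local_poincare p M \<longleftrightarrow> (\<forall>x. \<exists>r>0. poincare_within p M (ball x r))"


section \<open>Superharmonic functions\<close>

text \<open>
  The sum \<open>u + \<phi>\<close> can be of the form \<open>\<infinity> - \<infinity>\<close> only on a set of capacity zero, so the value
  chosen there does not influence the minimal weak upper gradient.
\<close>

definition superminimizer ::
  "real \<Rightarrow> 'a::metric_space measure \<Rightarrow> 'a set \<Rightarrow> ('a \<Rightarrow> ereal) \<Rightarrow> bool" where
  "superminimizer p M G u \<longleftrightarrow>
     u \<in> newtonian_loc p M G \<and>
     (\<forall>\<phi>\<in>newtonian_zero p M G. (\<forall>x\<in>G. 0 \<le> \<phi> x) \<longrightarrow>
        (\<integral>\<^sup>+x\<in>{x\<in>G. \<phi> x \<noteq> 0}. ennreal_powr (minimal_wug p M G u x) p \<partial>M)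
        \<le> (\<integral>\<^sup>+x\<in>{x\<in>G. \<phi> x \<noteq> 0}. ennreal_powr (minimal_wug p M G (\<lambda>y. u y + \<phi> y) x) p \<partial>M))"

definition ess_inf_on :: "'a measure \<Rightarrow> 'a set \<Rightarrow> ('a \<Rightarrow> ereal) \<Rightarrow> ereal" where
  "ess_inf_on M A u = Sup {c. AE x in restrict_space M A. c \<le> u x}"

definition lsc_regularized ::
  "'a::metric_space measure \<Rightarrow> 'a set \<Rightarrow> ('a \<Rightarrow> ereal) \<Rightarrow> bool" where
  "lsc_regularized M G u \<longleftrightarrow>
     (\<forall>x\<in>G. ((\<lambda>r. ess_inf_on M (ball x r \<inter> G) u) \<longlongrightarrow> u x) (at_right 0))"

definition superharmonic ::
  "real \<Rightarrow> 'a::metric_space measure \<Rightarrow> 'a set \<Rightarrow> ('a \<Rightarrow> ereal) \<Rightarrow> bool" where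
  "superharmonic p M G u \<longleftrightarrow>
     (\<forall>x\<in>G. u x \<noteq> -\<infinity>) \<and>
     (\<forall>k::real. superminimizer p M G (\<lambda>x. min (u x) (ereal k)) \<and>
                lsc_regularized M G (\<lambda>x. min (u x) (ereal k))) \<and>
     (\<forall>C\<in>components G. \<exists>x\<in>C. u x \<noteq> \<infinity>)"

definition subharmonic ::
  "real \<Rightarrow> 'a::metric_space measure \<Rightarrow> 'a set \<Rightarrow> ('a \<Rightarrow> ereal) \<Rightarrow> bool" where
  "subharmonic p M G u \<longleftrightarrow> superharmonic p M G (\<lambda>x. - u x)"


section \<open>Perron solutions\<close>

text \<open>
  The extended space, whose points are \<open>Some x\<close> for \<open>x\<close> in the space, together with the point at
  infinity \<open>None\<close> if the space is unbounded.
\<close>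

definition extended_space :: "'a::metric_space option topology" where
  "extended_space =
     (if bounded (UNIV :: 'a set)
      then subtopology (Alexandroff_compactification euclidean) (range Some)
      else Alexandroff_compactification euclidean)"

definition extended_boundary :: "'a::metric_space set \<Rightarrow> 'a option set" where
  "extended_boundary \<Omega> = Some ` frontier \<Omega> \<union> (if bounded \<Omega> then {} else {None})"

definition continuous_boundary_data :: "'a::metric_space set \<Rightarrow> ('a option \<Rightarrow> real) set" where
  "continuous_boundary_data \<Omega> =
     {f. continuous_map (subtopology extended_space (extended_boundary \<Omega>)) euclideanreal f}"

text \<open>The filter of \<open>y \<rightarrow> z\<close> with \<open>y \<in> \<Omega>\<close>, where \<open>z\<close> is a point of the extended boundary.\<close>

definition approach :: "'a::metric_space set \<Rightarrow> 'a option \<Rightarrow> 'a filter" where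
  "approach \<Omega> z = inf (filtercomap Some (nhdsin extended_space z)) (principal \<Omega>)"

definition upper_perron ::
  "real \<Rightarrow> 'a::metric_space measure \<Rightarrow> 'a set \<Rightarrow> ('a option \<Rightarrow> ereal) \<Rightarrow> 'a \<Rightarrow> ereal" where
  "upper_perron p M \<Omega> f x =
     (INF u\<in>{u. superharmonic p M \<Omega> u \<and> (\<exists>m::real. \<forall>y\<in>\<Omega>. ereal m \<le> u y) \<and>
               (\<forall>z\<in>extended_boundary \<Omega>. f z \<le> Liminf (approach \<Omega> z) u)}. u x)"

definition lower_perron ::
  "real \<Rightarrow> 'a::metric_space measure \<Rightarrow> 'a set \<Rightarrow> ('a option \<Rightarrow> ereal) \<Rightarrow> 'a \<Rightarrow> ereal" where
  "lower_perron p M \<Omega> f x =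
     (SUP v\<in>{v. subharmonic p M \<Omega> v \<and> (\<exists>m::real. \<forall>y\<in>\<Omega>. v y \<le> ereal m) \<and>
               (\<forall>z\<in>extended_boundary \<Omega>. Limsup (approach \<Omega> z) v \<le> f z)}. v x)"

definition resolutive ::
  "real \<Rightarrow> 'a::metric_space measure \<Rightarrow> 'a set \<Rightarrow> ('a option \<Rightarrow> ereal) \<Rightarrow> bool" where
  "resolutive p M \<Omega> f \<longleftrightarrow>
     (\<forall>x\<in>\<Omega>. upper_perron p M \<Omega> f x = lower_perron p M \<Omega> f x \<and>
            \<bar>upper_perron p M \<Omega> f x\<bar> \<noteq> \<infinity>)"

definition regular_point ::
  "real \<Rightarrow> 'a::metric_space measure \<Rightarrow> 'a set \<Rightarrow> 'a option \<Rightarrow> bool" where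
  "regular_point p M \<Omega> z \<longleftrightarrow>
     (\<forall>f\<in>continuous_boundary_data \<Omega>.
        (upper_perron p M \<Omega> (\<lambda>w. ereal (f w)) \<longlongrightarrow> ereal (f z)) (approach \<Omega> z))"

end

theory Submission
  imports Defs
begin

text \<open>
  Every superharmonic function \<open>u\<close> in \<open>\<Omega>\<close> that is bounded from below is constant, so the upper
  Perron solution is the smallest constant that dominates \<open>f\<close>, and the lower one is its mirror image.

  For the constancy, capacity zero and parabolicity provide a density \<open>\<rho>\<close> in \<open>L\<^sup>p\<close> along which all
  curves that hit the complement of \<open>\<Omega>\<close> or tend to infinity are infinitely long, and by
  Vitali--Caratheodory \<open>\<rho>\<close> can be taken lower semicontinuous. The \<open>\<rho>\<close>-distance yields cutoff
  functions \<open>\<eta>\<close> of arbitrarily small energy that are compactly supported in \<open>\<Omega>\<close> and tend to 1.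
  Comparing \<open>u \<ge> m\<close> with the maximum of \<open>u\<close> and \<open>m + (k - m) \<eta>\<close> in the superminimizer inequality shows
  that the minimal gradient of \<open>min u k\<close> vanishes. The Poincare inequality makes \<open>min u k\<close> locally
  constant a.e., and connectedness and lsc-regularity do the rest.
\<close>

section \<open>Functions on an interval that are dominated by an integral\<close>

text \<open>Weak upper gradients are handled by calculus in one variable:
  \<open>F \<circ> \<gamma>\<close> is compared with integrals of \<open>g \<circ> \<gamma>\<close>
  over every subinterval, which takes the place of absolute continuity and of a chain rule. As
  \<open>minimal_wug\<close> is a choice, nothing can be said about it before a minimal gradient is
  known to exist; this calls for minima of two gradients and for decreasing limits along curves.
  Small energy comes from scaling alone. The cutoff \<open>min 1 (\<epsilon> * cost)\<close> has the
  gradient \<open>\<epsilon> * \<rho>\<close>, whose energy is \<open>\<epsilon> powr p\<close>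
  times a fixed number, while at each point of \<Omega> the cost of coming close to the complement
  or to infinity grows beyond every bound. Lower semicontinuity of \<rho> serves the limits of
  curves: by Fatou's lemma a limit curve costs no more than the curves that approach it, so that the
  cost is Borel measurable and its blow-up can be proved by compactness. The vanishing gradient has
  to be carried from \<Omega> over to the whole space, because the balls of the Poincare inequality
  may meet the complement of \<Omega>; this is possible because almost no curve meets it.\<close>

definition ac_bound :: "(real \<Rightarrow> real) \<Rightarrow> (real \<Rightarrow> ennreal) \<Rightarrow> real \<Rightarrow> real \<Rightarrow> bool" where
  "ac_bound F h a b \<longleftrightarrow>
     (\<forall>c d. a \<le> c \<and> c \<le> d \<and> d \<le> b \<longrightarrow> ennreal \<bar>F d - F c\<bar> \<le> (\<integral>\<^sup>+t\<in>{c..d}. h t \<partial>lborel))"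

lemma ac_boundI:
  assumes "\<And>c d. a \<le> c \<Longrightarrow> c \<le> d \<Longrightarrow> d \<le> b \<Longrightarrow> ennreal \<bar>F d - F c\<bar> \<le> (\<integral>\<^sup>+t\<in>{c..d}. h t \<partial>lborel)"
  shows "ac_bound F h a b"
  using assms unfolding ac_bound_def by blast

lemma ac_boundD:
  assumes "ac_bound F h a b" "a \<le> c" "c \<le> d" "d \<le> b"
  shows "ennreal \<bar>F d - F c\<bar> \<le> (\<integral>\<^sup>+t\<in>{c..d}. h t \<partial>lborel)"
  using assms unfolding ac_bound_def by blast

lemma ac_bound_mono:
  assumes "ac_bound F h a b" "\<And>t. a \<le> t \<Longrightarrow> t \<le> b \<Longrightarrow> h t \<le> h' t"
  shows "ac_bound F h' a b"
proof (rule ac_boundI)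
  fix c d assume cd: "a \<le> c" "c \<le> d" "d \<le> b"
  show "ennreal \<bar>F d - F c\<bar> \<le> (\<integral>\<^sup>+t\<in>{c..d}. h' t \<partial>lborel)"
    by (rule order_trans[OF ac_boundD[OF assms(1) cd]], intro nn_integral_mono)
       (use assms(2) cd in \<open>auto simp: indicator_def\<close>)
qed

lemma nn_integral_Icc_split:
  fixes h :: "real \<Rightarrow> ennreal"
  assumes [measurable]: "h \<in> borel_measurable borel" and "a \<le> b" "b \<le> c"
  shows "(\<integral>\<^sup>+t\<in>{a..c}. h t \<partial>lborel) = (\<integral>\<^sup>+t\<in>{a..b}. h t \<partial>lborel) + (\<integral>\<^sup>+t\<in>{b..c}. h t \<partial>lborel)"
proof -
  have "(\<integral>\<^sup>+t\<in>{a..c}. h t \<partial>lborel) = (\<integral>\<^sup>+t. h t * indicator {a..b} t + h t * indicator {b..c} t \<partial>lborel)"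
    by (intro nn_integral_cong_AE, rule AE_mp[OF AE_lborel_singleton[of b]])
       (use assms in \<open>auto simp: indicator_def\<close>)
  also have "\<dots> = (\<integral>\<^sup>+t\<in>{a..b}. h t \<partial>lborel) + (\<integral>\<^sup>+t\<in>{b..c}. h t \<partial>lborel)"
    by (rule nn_integral_add) auto
  finally show ?thesis .
qed

lemma nn_integral_Icc_subset:
  fixes h :: "real \<Rightarrow> ennreal"
  assumes "a \<le> c" "d \<le> b"
  shows "(\<integral>\<^sup>+t\<in>{c..d}. h t \<partial>lborel) \<le> (\<integral>\<^sup>+t\<in>{a..b}. h t \<partial>lborel)"
  by (intro nn_integral_mono) (use assms in \<open>auto simp: indicator_def\<close>)

text \<open>A single point has measure zero, so the integrals of \<open>h\<close> over shrinking
  intervals around \<open>x\<close> decrease to 0; finiteness is what monotone convergence from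
  above requires.\<close>

lemma ac_bound_continuous:
  assumes ac: "ac_bound F h a b" and [measurable]: "h \<in> borel_measurable borel"
    and fin: "(\<integral>\<^sup>+t\<in>{a..b}. h t \<partial>lborel) < \<infinity>"
  shows "continuous_on {a..b} F"
proof (rule continuous_onI)
  fix x e :: real assume x: "x \<in> {a..b}" and e: "0 < e"
  let ?I = "\<lambda>n::nat. {x - 1 / Suc n..x + 1 / Suc n} \<inter> {a..b}"
  define f where "f n t = h t * indicator (?I n) t" for n :: nat and t
  have f0: "(\<integral>\<^sup>+t. f 0 t \<partial>lborel) < \<infinity>"
    by (rule le_less_trans[OF _ fin]) (auto intro!: nn_integral_mono simp: f_def indicator_def)
  have mf[measurable]: "f n \<in> borel_measurable lborel" for n
    unfolding f_def by measurable
  have dec: "decseq f"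
  proof (rule decseq_SucI, rule le_funI)
    fix n t
    have "1 / real (Suc (Suc n)) \<le> 1 / real (Suc n)" by (intro divide_left_mono) auto
    then show "f (Suc n) t \<le> f n t" unfolding f_def by (auto simp: indicator_def)
  qed
  have "(INF n. (\<integral>\<^sup>+t. f n t \<partial>lborel)) = (\<integral>\<^sup>+t. (INF n. f n t) \<partial>lborel)"
    by (rule nn_integral_monotone_convergence_INF_decseq[symmetric, OF dec mf f0])
  also have "\<dots> = (\<integral>\<^sup>+t. 0 \<partial>(lborel::real measure))"
  proof (rule nn_integral_cong_AE, rule AE_mp[OF AE_lborel_singleton[of x]], rule AE_I2, rule impI)
    fix t assume "t \<noteq> x"
    then obtain n :: nat where "1 / Suc n < \<bar>t - x\<bar>"
      using nat_approx_posE[of "\<bar>t - x\<bar>"] by auto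
    then have "f n t = 0" by (auto simp: f_def indicator_def)
    then show "(INF n. f n t) = 0"
      by (metis INF_lower UNIV_I le_zero_eq)
  qed
  finally have "(INF n. (\<integral>\<^sup>+t. f n t \<partial>lborel)) < ennreal e" using e by simp
  then obtain n where n: "(\<integral>\<^sup>+t. f n t \<partial>lborel) < ennreal e"
    by (auto simp: INF_less_iff)
  have *: "\<bar>F d - F c\<bar> < e" if "c \<le> d" "{c..d} \<subseteq> ?I n" for c d
  proof -
    have "ennreal \<bar>F d - F c\<bar> \<le> (\<integral>\<^sup>+t\<in>{c..d}. h t \<partial>lborel)"
      using that by (intro ac_boundD[OF ac]) auto
    also have "\<dots> \<le> (\<integral>\<^sup>+t. f n t \<partial>lborel)"
      using that(2) by (intro nn_integral_mono) (auto simp: f_def indicator_def)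
    finally have "ennreal \<bar>F d - F c\<bar> < ennreal e" using n by (rule le_less_trans)
    then show ?thesis by (simp add: ennreal_less_iff)
  qed
  show "\<exists>d>0. \<forall>x'\<in>{a..b}. dist x' x < d \<longrightarrow> dist (F x') (F x) \<le> e"
  proof (intro exI conjI ballI impI)
    show "(0::real) < 1 / Suc n" by simp
    fix y assume y: "y \<in> {a..b}" "dist y x < 1 / Suc n"
    show "dist (F y) (F x) \<le> e"
    proof (cases "x \<le> y")
      case True
      then show ?thesis using *[of x y] x y by (auto simp: dist_real_def)
    next
      case False
      then show ?thesis using *[of y x] x y by (auto simp: dist_real_def)
    qed
  qed
qed

lemma ac_bound_trans:
  fixes h :: "real \<Rightarrow> ennreal" and F :: "real \<Rightarrow> real"
  assumes h: "h \<in> borel_measurable borel" and le: "c \<le> m" "m \<le> d"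
    and 1: "ennreal \<bar>F m - F c\<bar> \<le> (\<integral>\<^sup>+t\<in>{c..m}. h t \<partial>lborel)"
    and 2: "ennreal \<bar>F d - F m\<bar> \<le> (\<integral>\<^sup>+t\<in>{m..d}. h t \<partial>lborel)"
  shows "ennreal \<bar>F d - F c\<bar> \<le> (\<integral>\<^sup>+t\<in>{c..d}. h t \<partial>lborel)"
proof -
  have "ennreal \<bar>F d - F c\<bar> \<le> ennreal (\<bar>F m - F c\<bar> + \<bar>F d - F m\<bar>)"
    by (rule ennreal_leI) auto
  also have "\<dots> = ennreal \<bar>F m - F c\<bar> + ennreal \<bar>F d - F m\<bar>" by simp
  also have "\<dots> \<le> (\<integral>\<^sup>+t\<in>{c..m}. h t \<partial>lborel) + (\<integral>\<^sup>+t\<in>{m..d}. h t \<partial>lborel)"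
    using 1 2 by (rule add_mono)
  finally show ?thesis using nn_integral_Icc_split[OF h le] by simp
qed

text \<open>\<open>Bolzano\<close> is the bisection principle: the bound passes to the union of two
  adjacent intervals, so it suffices to have it near each point.\<close>

lemma ac_bound_local:
  assumes h: "h \<in> borel_measurable borel"
    and loc: "\<And>x. a \<le> x \<Longrightarrow> x \<le> b \<Longrightarrow> \<exists>e>0. ac_bound F h (max a (x - e)) (min b (x + e))"
  shows "ac_bound F h a b"
proof (rule ac_boundI)
  fix c d assume cd: "a \<le> c" "c \<le> d" "d \<le> b"
  define P where "P u v \<longleftrightarrow> (a \<le> u \<longrightarrow> v \<le> b \<longrightarrow> ennreal \<bar>F v - F u\<bar> \<le> (\<integral>\<^sup>+t\<in>{u..v}. h t \<partial>lborel))" for u v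
  have "P c d"
    using cd(2)
  proof (induction rule: Bolzano)
    case (trans u v w)
    then show ?case unfolding P_def by (auto intro: ac_bound_trans[OF h, of u v w])
  next
    case (local x)
    then obtain e where e: "e > 0" "ac_bound F h (max a (x - e)) (min b (x + e))"
      using loc[of x] cd by auto
    show ?case
      unfolding P_def by (intro exI[of _ e] conjI e(1) allI impI ac_boundD[OF e(2)]) auto
  qed
  then show "ennreal \<bar>F d - F c\<bar> \<le> (\<integral>\<^sup>+t\<in>{c..d}. h t \<partial>lborel)"
    using cd unfolding P_def by blast
qed

text \<open>The interval from \<open>x\<close> to \<open>y\<close> is cut at the ends of its
  intersection with \<open>{c..d}\<close>. On the outer pieces the two integrands differ only at end
  points, which form a null set.\<close>

lemma ac_bound_replace_Icc:
  assumes [measurable]: "h \<in> borel_measurable borel" "h' \<in> borel_measurable borel"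
    and ac: "ac_bound F h a b"
    and ac': "\<And>x y. a \<le> x \<Longrightarrow> x \<le> y \<Longrightarrow> y \<le> b \<Longrightarrow> c \<le> x \<Longrightarrow> y \<le> d \<Longrightarrow>
       ennreal \<bar>F y - F x\<bar> \<le> (\<integral>\<^sup>+t\<in>{x..y}. h' t \<partial>lborel)"
  shows "ac_bound F (\<lambda>t. if t \<in> {c..d} then h' t else h t) a b" (is "ac_bound F ?k a b")
proof (rule ac_boundI)
  fix x y assume xy: "a \<le> x" "x \<le> y" "y \<le> b"
  have k: "?k \<in> borel_measurable borel" by measurable
  have off: "ennreal \<bar>F v - F u\<bar> \<le> (\<integral>\<^sup>+t\<in>{u..v}. ?k t \<partial>lborel)"
    if "a \<le> u" "u \<le> v" "v \<le> b" "{u<..<v} \<inter> {c..d} = {}" for u v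
  proof (rule order_trans[OF ac_boundD[OF ac that(1-3)]], rule nn_integral_mono_AE,
      rule AE_mp[OF AE_lborel_singleton[of u]], rule AE_mp[OF AE_lborel_singleton[of v]], rule AE_I2,
      intro impI)
    fix t assume "t \<noteq> u" "t \<noteq> v"
    then have "t \<notin> {c..d}" if "t \<in> {u..v}"
    proof -
      have "t \<in> {u<..<v}" using \<open>t \<noteq> u\<close> \<open>t \<noteq> v\<close> that by simp
      then show ?thesis using \<open>{u<..<v} \<inter> {c..d} = {}\<close> by blast
    qed
    then show "h t * indicator {u..v} t \<le> ?k t * indicator {u..v} t"
      by (auto simp: indicator_def)
  qed
  show "ennreal \<bar>F y - F x\<bar> \<le> (\<integral>\<^sup>+t\<in>{x..y}. ?k t \<partial>lborel)"
  proof (cases "{x<..<y} \<inter> {c..d} = {}")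
    case True
    then show ?thesis by (rule off[OF xy])
  next
    case False
    then have *: "x \<le> max x c" "max x c \<le> min y d" "min y d \<le> y" by auto
    have 2: "ennreal \<bar>F (min y d) - F (max x c)\<bar> \<le> (\<integral>\<^sup>+t\<in>{max x c..min y d}. ?k t \<partial>lborel)"
      by (rule order_trans[OF ac'], use xy * in \<open>auto intro!: nn_integral_mono simp: indicator_def\<close>)
    have 1: "ennreal \<bar>F (max x c) - F x\<bar> \<le> (\<integral>\<^sup>+t\<in>{x..max x c}. ?k t \<partial>lborel)"
      by (rule off) (use xy * in auto)
    have 3: "ennreal \<bar>F y - F (min y d)\<bar> \<le> (\<integral>\<^sup>+t\<in>{min y d..y}. ?k t \<partial>lborel)"
      by (rule off) (use xy * in auto)
    show ?thesis
      by (rule ac_bound_trans[OF k _ _ ac_bound_trans[OF k _ _ 1 2] 3]) (use * in auto)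
  qed
qed

text \<open>An open set is a countable union of closed intervals. Finitely many of them are treated
  by \<open>ac_bound_replace_Icc\<close>, one at a time, and the passage to the limit is monotone
  convergence from above. This is how a better gradient on an open set of parameters is
  exploited.\<close>

lemma ac_bound_open:
  assumes [measurable]: "h \<in> borel_measurable borel" "h' \<in> borel_measurable borel"
    and "open U" and ac: "ac_bound F h a b"
    and fin: "(\<integral>\<^sup>+t\<in>{a..b}. h t \<partial>lborel) < \<infinity>"
    and ac': "\<And>x y. a \<le> x \<Longrightarrow> x \<le> y \<Longrightarrow> y \<le> b \<Longrightarrow> {x..y} \<subseteq> U \<Longrightarrow>
       ennreal \<bar>F y - F x\<bar> \<le> (\<integral>\<^sup>+t\<in>{x..y}. h' t \<partial>lborel)"
  shows "ac_bound F (\<lambda>t. if t \<in> U then h' t else h t) a b"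
proof (rule ac_boundI)
  fix x y assume xy: "a \<le> x" "x \<le> y" "y \<le> b"
  have [measurable]: "U \<in> sets borel" using \<open>open U\<close> by simp
  obtain \<D> where \<D>: "countable \<D>" "\<D> \<subseteq> Pow U" "\<And>X. X \<in> \<D> \<Longrightarrow> \<exists>a b. X = cbox a b" "\<Union>\<D> = U"
    using open_countable_Union_open_cbox[OF \<open>open U\<close>] by metis
  have "\<exists>I :: nat \<Rightarrow> real set. (\<forall>i. \<exists>c d. I i = {c..d}) \<and> (\<Union>i. I i) = U"
  proof (cases "\<D> = {}")
    case True
    then have "U = {}" using \<D>(4) by simp
    then show ?thesis by (intro exI[of _ "\<lambda>_. {1..0}"] conjI allI exI[of _ 1] exI[of _ 0]) auto
  next
    case False
    have "\<exists>c d. from_nat_into \<D> i = {c..d}" for i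
      using \<D>(3)[OF from_nat_into[OF False, of i]] by (auto simp: cbox_interval)
    then show ?thesis
      using \<D>(1,4) False by (intro exI[of _ "from_nat_into \<D>"]) (auto simp: range_from_nat_into)
  qed
  then obtain I :: "nat \<Rightarrow> real set" where I: "\<And>i. \<exists>c d. I i = {c..d}" and UI: "(\<Union>i. I i) = U"
    by metis
  have [measurable]: "I i \<in> sets borel" for i using I[of i] by auto
  define A where "A n = (\<Union>i<n. I i)" for n :: nat
  have [measurable]: "A n \<in> sets borel" for n unfolding A_def by measurable
  have A: "ac_bound F (\<lambda>t. if t \<in> A n then h' t else h t) a b" for n
  proof (induction n)
    case 0
    then show ?case using ac by (simp add: A_def)
  next
    case (Suc n)
    obtain c d where cd: "I n = {c..d}" using I by metis
    have "ac_bound F (\<lambda>t. if t \<in> {c..d} then h' t else (if t \<in> A n then h' t else h t)) a b"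
    proof (rule ac_bound_replace_Icc[OF _ _ Suc])
      fix x y assume "a \<le> x" "x \<le> y" "y \<le> b" "c \<le> x" "y \<le> d"
      moreover have "{x..y} \<subseteq> U" using calculation cd UI by fastforce
      ultimately show "ennreal \<bar>F y - F x\<bar> \<le> (\<integral>\<^sup>+t\<in>{x..y}. h' t \<partial>lborel)" by (intro ac')
    qed measurable
    then show ?case by (rule ac_bound_mono) (auto simp: A_def cd lessThan_Suc)
  qed
  let ?J = "\<lambda>h S. \<integral>\<^sup>+t\<in>S \<inter> {x..y}. h t \<partial>lborel"
  \<comment> \<open>The part of \<open>h\<close> that has not been replaced after \<open>n\<close>
    intervals; it decreases to \<open>h\<close> on the complement of \<open>U\<close>.\<close>
  define f where "f n t = h t * indicator (- A n \<inter> {x..y}) t" for n t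
  have [measurable]: "f n \<in> borel_measurable lborel" for n unfolding f_def by measurable
  have "decseq f"
    by (rule decseq_SucI) (auto simp: f_def le_fun_def A_def indicator_def)
  moreover have "(\<integral>\<^sup>+t. f 0 t \<partial>lborel) < \<infinity>"
    by (rule le_less_trans[OF _ fin]) (use xy in \<open>auto simp: f_def indicator_def intro!: nn_integral_mono\<close>)
  ultimately have "(INF n. (\<integral>\<^sup>+t. f n t \<partial>lborel)) = (\<integral>\<^sup>+t. (INF n. f n t) \<partial>lborel)"
    by (intro nn_integral_monotone_convergence_INF_decseq[symmetric]) auto
  also have "\<dots> \<le> ?J h (- U)"
  proof (rule nn_integral_mono)
    fix t show "(INF n. f n t) \<le> h t * indicator (- U \<inter> {x..y}) t"
    proof (cases "t \<in> U")
      case True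
      then obtain n where "t \<in> A n" unfolding A_def UI[symmetric] by blast
      then have "f n t = 0" by (auto simp: f_def)
      then show ?thesis by (metis INF_lower UNIV_I le_zero_eq zero_le)
    next
      case False
      then have "t \<notin> A 0" by (simp add: A_def)
      then have "f 0 t = h t * indicator (- U \<inter> {x..y}) t"
        using False by (auto simp: f_def indicator_def)
      then show ?thesis by (metis INF_lower UNIV_I)
    qed
  qed
  finally have lim: "(INF n. (\<integral>\<^sup>+t. f n t \<partial>lborel)) \<le> ?J h (- U)" .
  have "ennreal \<bar>F y - F x\<bar> \<le> ?J h' U + (\<integral>\<^sup>+t. f n t \<partial>lborel)" for n
  proof -
    have "ennreal \<bar>F y - F x\<bar> \<le> (\<integral>\<^sup>+t\<in>{x..y}. (if t \<in> A n then h' t else h t) \<partial>lborel)"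
      by (rule ac_boundD[OF A xy])
    also have "\<dots> \<le> (\<integral>\<^sup>+t. h' t * indicator (U \<inter> {x..y}) t + f n t \<partial>lborel)"
      using UI by (intro nn_integral_mono) (auto simp: f_def indicator_def A_def)
    also have "\<dots> = ?J h' U + (\<integral>\<^sup>+t. f n t \<partial>lborel)"
      by (rule nn_integral_add) measurable
    finally show ?thesis .
  qed
  then have "ennreal \<bar>F y - F x\<bar> \<le> (INF n. ?J h' U + (\<integral>\<^sup>+t. f n t \<partial>lborel))"
    by (rule INF_greatest)
  also have "\<dots> = ?J h' U + (INF n. (\<integral>\<^sup>+t. f n t \<partial>lborel))"
    by (simp add: INF_ennreal_const_add)
  also have "\<dots> \<le> ?J h' U + ?J h (- U)" using lim by (rule add_left_mono)
  also have "\<dots> = (\<integral>\<^sup>+t. h' t * indicator (U \<inter> {x..y}) t + h t * indicator (- U \<inter> {x..y}) t \<partial>lborel)"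
    by (rule nn_integral_add[symmetric]) measurable
  also have "\<dots> = (\<integral>\<^sup>+t\<in>{x..y}. (if t \<in> U then h' t else h t) \<partial>lborel)"
    by (intro nn_integral_cong) (auto simp: indicator_def)
  finally show "ennreal \<bar>F y - F x\<bar> \<le> (\<integral>\<^sup>+t\<in>{x..y}. (if t \<in> U then h' t else h t) \<partial>lborel)" .
qed

text \<open>The set where \<open>h'\<close> is the smaller one is merely Borel, while
  \<open>ac_bound_open\<close> wants an open set. Outer regularity of the finite measure with
  density \<open>h'\<close> encloses it in an open set, at the price of an arbitrarily small
  error.\<close>

lemma ac_bound_min:
  assumes [measurable]: "h \<in> borel_measurable borel" "h' \<in> borel_measurable borel"
    and ac: "ac_bound F h a b" "ac_bound F h' a b"
    and fin: "(\<integral>\<^sup>+t\<in>{a..b}. h t \<partial>lborel) < \<infinity>" "(\<integral>\<^sup>+t\<in>{a..b}. h' t \<partial>lborel) < \<infinity>"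
  shows "ac_bound F (\<lambda>t. min (h t) (h' t)) a b"
proof (rule ac_boundI)
  fix x y assume xy: "a \<le> x" "x \<le> y" "y \<le> b"
  define A where "A = {t. h' t < h t}"
  have A[measurable]: "A \<in> sets borel" unfolding A_def by measurable
  define \<nu> where "\<nu> = density lborel (\<lambda>t. h' t * indicator {a..b} t)"
  have \<nu>: "sets \<nu> = sets borel" "emeasure \<nu> (space \<nu>) \<noteq> \<infinity>"
    using fin(2) by (auto simp: \<nu>_def emeasure_density)
  have "ennreal \<bar>F y - F x\<bar> \<le> (\<integral>\<^sup>+t\<in>{x..y}. min (h t) (h' t) \<partial>lborel) + ennreal e" if e: "e > 0" for e
  proof -
    have fA: "emeasure \<nu> A < \<infinity>"
      using \<nu> by (metis emeasure_space infinity_ennreal_def less_top neq_top_trans)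
    have "emeasure \<nu> A + 0 < emeasure \<nu> A + ennreal e"
      using fA e by (intro ennreal_add_left_cancel_less[THEN iffD2]) auto
    then have "emeasure \<nu> A < emeasure \<nu> A + ennreal e" by simp
    then have "\<exists>U\<in>{U. A \<subseteq> U \<and> open U}. emeasure \<nu> U < emeasure \<nu> A + ennreal e"
      using outer_regular[OF \<nu> A] by (simp only: INF_less_iff[symmetric])
    then obtain U where U: "open U" "A \<subseteq> U" "emeasure \<nu> U < emeasure \<nu> A + ennreal e"
      by blast
    have [measurable]: "U \<in> sets borel" using U by simp
    have "emeasure \<nu> U = emeasure \<nu> A + emeasure \<nu> (U - A)"
      using U(2) by (subst plus_emeasure) (auto simp: \<nu>(1) Un_absorb1)
    with U(3) have "emeasure \<nu> (U - A) \<le> ennreal e"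
      using fA by (auto simp: ennreal_add_left_cancel_less)
    moreover have "emeasure \<nu> (U - A) = (\<integral>\<^sup>+t\<in>(U - A) \<inter> {a..b}. h' t \<partial>lborel)"
      by (simp add: \<nu>_def emeasure_density) (auto intro!: nn_integral_cong simp: indicator_def)
    ultimately have UA: "(\<integral>\<^sup>+t\<in>(U - A) \<inter> {a..b}. h' t \<partial>lborel) \<le> ennreal e" by simp
    have "ac_bound F (\<lambda>t. if t \<in> U then h' t else h t) a b"
      by (rule ac_bound_open[OF _ _ U(1) ac(1) fin(1)]) (use ac_boundD[OF ac(2)] in auto)
    then have "ennreal \<bar>F y - F x\<bar> \<le> (\<integral>\<^sup>+t\<in>{x..y}. (if t \<in> U then h' t else h t) \<partial>lborel)"
      by (rule ac_boundD[OF _ xy])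
    also have "\<dots> \<le> (\<integral>\<^sup>+t. min (h t) (h' t) * indicator {x..y} t + h' t * indicator ((U - A) \<inter> {a..b}) t \<partial>lborel)"
      using U(2) xy by (intro nn_integral_mono) (auto simp: indicator_def A_def min_def not_less)
    also have "\<dots> = (\<integral>\<^sup>+t\<in>{x..y}. min (h t) (h' t) \<partial>lborel) + (\<integral>\<^sup>+t\<in>(U - A) \<inter> {a..b}. h' t \<partial>lborel)"
      by (rule nn_integral_add) measurable
    finally show ?thesis by (rule order_trans) (rule add_left_mono[OF UA])
  qed
  then show "ennreal \<bar>F y - F x\<bar> \<le> (\<integral>\<^sup>+t\<in>{x..y}. min (h t) (h' t) \<partial>lborel)"
    by (rule ennreal_le_epsilon) 
qed

text \<open>Between the first and the last zero of \<open>D\<close> in an interval the increment is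
  0 and nothing has to be paid; before and after them \<open>D\<close> is positive, so the
  parameters lie in \<open>S\<close>. Thus a gradient of a nonnegative function may be set to 0
  wherever the function vanishes.\<close>

lemma ac_bound_nonneg:
  assumes [measurable]: "h \<in> borel_measurable borel" "S \<in> sets borel"
    and ac: "ac_bound D h a b" and fin: "(\<integral>\<^sup>+t\<in>{a..b}. h t \<partial>lborel) < \<infinity>"
    and nonneg: "\<And>t. a \<le> t \<Longrightarrow> t \<le> b \<Longrightarrow> 0 \<le> D t"
    and S: "\<And>t. a \<le> t \<Longrightarrow> t \<le> b \<Longrightarrow> 0 < D t \<Longrightarrow> t \<in> S"
  shows "ac_bound D (\<lambda>t. h t * indicator S t) a b" (is "ac_bound D ?k a b")
proof (rule ac_boundI)
  fix x y assume xy: "a \<le> x" "x \<le> y" "y \<le> b"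
  have pos: "ennreal \<bar>D v - D u\<bar> \<le> (\<integral>\<^sup>+t\<in>{u..v}. ?k t \<partial>lborel)"
    if "a \<le> u" "u \<le> v" "v \<le> b" "\<And>t. u < t \<Longrightarrow> t < v \<Longrightarrow> 0 < D t" for u v
  proof (rule order_trans[OF ac_boundD[OF ac that(1-3)]], rule nn_integral_mono_AE,
      rule AE_mp[OF AE_lborel_singleton[of u]], rule AE_mp[OF AE_lborel_singleton[of v]], rule AE_I2,
      intro impI)
    fix t assume "t \<noteq> u" "t \<noteq> v"
    then show "h t * indicator {u..v} t \<le> ?k t * indicator {u..v} t"
      using that S[of t] by (cases "t \<in> {u..v}") auto
  qed
  show "ennreal \<bar>D y - D x\<bar> \<le> (\<integral>\<^sup>+t\<in>{x..y}. ?k t \<partial>lborel)"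
  proof (cases "\<forall>t\<in>{x..y}. 0 < D t")
    case True
    then show ?thesis by (intro pos xy) auto
  next
    case False
    define Z where "Z = {t \<in> {x..y}. D t = 0}"
    have "continuous_on {x..y} D"
      by (rule continuous_on_subset[OF ac_bound_continuous[OF ac _ fin]]) (use xy in auto)
    then have "closed Z"
      unfolding Z_def by (intro continuous_closed_preimage_constant) auto
    then have "compact ({x..y} \<inter> Z)"
      by (intro compact_Int_closed) auto
    moreover have "{x..y} \<inter> Z = Z" by (auto simp: Z_def)
    ultimately have Z: "compact Z" by simp
    have "Z \<noteq> {}"
    proof -
      obtain t where "x \<le> t" "t \<le> y" "\<not> 0 < D t" using False by auto
      moreover have "0 \<le> D t" by (rule nonneg) (use xy calculation in auto)
      ultimately show ?thesis by (auto simp: Z_def)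
    qed
    obtain s where s: "s \<in> Z" "\<And>t. t \<in> Z \<Longrightarrow> s \<le> t"
      using compact_attains_inf[OF Z \<open>Z \<noteq> {}\<close>] by auto
    obtain r where r: "r \<in> Z" "\<And>t. t \<in> Z \<Longrightarrow> t \<le> r"
      using compact_attains_sup[OF Z \<open>Z \<noteq> {}\<close>] by auto
    have *: "x \<le> s" "s \<le> r" "r \<le> y" "D s = 0" "D r = 0" using s r by (auto simp: Z_def)
    have gtS: "0 < D t" if "x \<le> t" "t \<le> y" "t \<notin> Z" for t
      using that nonneg[of t] xy by (auto simp: Z_def)
    have 1: "ennreal \<bar>D s - D x\<bar> \<le> (\<integral>\<^sup>+t\<in>{x..s}. ?k t \<partial>lborel)"
    proof (rule pos)
      fix t assume t: "x < t" "t < s"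
      then have "t \<notin> Z" using s(2)[of t] by auto
      then show "0 < D t" by (rule gtS[rotated 2]) (use t * in auto)
    qed (use xy * in auto)
    have 3: "ennreal \<bar>D y - D r\<bar> \<le> (\<integral>\<^sup>+t\<in>{r..y}. ?k t \<partial>lborel)"
    proof (rule pos)
      fix t assume t: "r < t" "t < y"
      then have "t \<notin> Z" using r(2)[of t] by auto
      then show "0 < D t" by (rule gtS[rotated 2]) (use t * in auto)
    qed (use xy * in auto)
    have 2: "ennreal \<bar>D r - D s\<bar> \<le> (\<integral>\<^sup>+t\<in>{s..r}. ?k t \<partial>lborel)" using * by simp
    have k: "?k \<in> borel_measurable borel" by measurable
    show ?thesis
      by (rule ac_bound_trans[OF k _ _ ac_bound_trans[OF k _ _ 1 2] 3]) (use * in auto)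
  qed
qed


section \<open>Length of curves\<close>

lemma sum_lessThan_add:
  fixes f :: "nat \<Rightarrow> 'b::comm_monoid_add"
  shows "(\<Sum>i<n + k. f i) = (\<Sum>i<n. f i) + (\<Sum>i<k. f (n + i))"
  by (induction k) (simp_all add: ac_simps)

lemma curve_length_upper:
  assumes "mono_on {..n} t" "t ` {..n} \<subseteq> {a..b}"
  shows "ennreal (\<Sum>i<n. dist (\<gamma> (t i)) (\<gamma> (t (Suc i)))) \<le> curve_length \<gamma> a b"
  unfolding curve_length_def by (rule SUP_upper2[of "(n, t)"]) (use assms in auto)

lemma curve_length_least:
  assumes "\<And>n t. mono_on {..n} t \<Longrightarrow> t ` {..n} \<subseteq> {a..b} \<Longrightarrow>
    ennreal (\<Sum>i<n. dist (\<gamma> (t i)) (\<gamma> (t (Suc i)))) \<le> c"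
  shows "curve_length \<gamma> a b \<le> c"
  unfolding curve_length_def by (rule SUP_least) (use assms in auto)

lemma dist_le_curve_length:
  assumes "a \<le> s" "s \<le> t" "t \<le> b"
  shows "ennreal (dist (\<gamma> s) (\<gamma> t)) \<le> curve_length \<gamma> a b"
proof -
  have "mono_on {..1} (\<lambda>i::nat. if i = 0 then s else t)"
    using assms by (auto simp: mono_on_def)
  moreover have "(\<lambda>i::nat. if i = 0 then s else t) ` {..1} \<subseteq> {a..b}" using assms by auto
  ultimately show ?thesis using curve_length_upper[of 1 "\<lambda>i. if i = 0 then s else t" a b \<gamma>] by simp
qed

lemma curve_length_le_lipschitz:
  assumes "a \<le> b" and lip: "\<And>s t. a \<le> s \<Longrightarrow> s \<le> t \<Longrightarrow> t \<le> b \<Longrightarrow> dist (\<gamma> s) (\<gamma> t) \<le> t - s"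
  shows "curve_length \<gamma> a b \<le> ennreal (b - a)"
proof (rule curve_length_least)
  fix n and t :: "nat \<Rightarrow> real" assume t: "mono_on {..n} t" "t ` {..n} \<subseteq> {a..b}"
  have "(\<Sum>i<n. dist (\<gamma> (t i)) (\<gamma> (t (Suc i)))) \<le> (\<Sum>i<n. t (Suc i) - t i)"
  proof (rule sum_mono)
    fix i assume i: "i \<in> {..<n}"
    have "t i \<le> t (Suc i)" by (rule mono_onD[OF t(1)]) (use i in auto)
    moreover have "t i \<in> {a..b}" "t (Suc i) \<in> {a..b}"
      using t(2) i by (auto simp: image_subset_iff)
    ultimately show "dist (\<gamma> (t i)) (\<gamma> (t (Suc i))) \<le> t (Suc i) - t i"
      by (intro lip) auto
  qed
  also have "\<dots> = t n - t 0" by (rule sum_lessThan_telescope)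
  also have "\<dots> \<le> b - a"
  proof -
    have "t n \<in> {a..b}" "t 0 \<in> {a..b}" using t(2) by auto
    then show ?thesis by simp
  qed
  finally show "ennreal (\<Sum>i<n. dist (\<gamma> (t i)) (\<gamma> (t (Suc i)))) \<le> ennreal (b - a)"
    by (rule ennreal_leI)
qed

text \<open>A partition of the long interval is clamped at \<open>b\<close> from both sides, which
  avoids inserting \<open>b\<close> as a new node; conversely, partitions of the two pieces are put
  one after the other.\<close>

lemma curve_length_add:
  assumes "a \<le> b" "b \<le> c"
  shows "curve_length \<gamma> a c = curve_length \<gamma> a b + curve_length \<gamma> b c"
proof (rule antisym)
  show "curve_length \<gamma> a c \<le> curve_length \<gamma> a b + curve_length \<gamma> b c"
  proof (rule curve_length_least)
    fix n and t :: "nat \<Rightarrow> real" assume t: "mono_on {..n} t" "t ` {..n} \<subseteq> {a..c}"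
    define u v where "u i = min (t i) b" and "v i = max (t i) b" for i
    have uv: "mono_on {..n} u" "u ` {..n} \<subseteq> {a..b}" "mono_on {..n} v" "v ` {..n} \<subseteq> {b..c}"
      using t assms unfolding u_def v_def mono_on_def
      by (auto simp: image_subset_iff intro: min.coboundedI1 max.coboundedI1)
    have "(\<Sum>i<n. dist (\<gamma> (t i)) (\<gamma> (t (Suc i))))
      \<le> (\<Sum>i<n. dist (\<gamma> (u i)) (\<gamma> (u (Suc i))) + dist (\<gamma> (v i)) (\<gamma> (v (Suc i))))"
    proof (rule sum_mono)
      fix i assume i: "i \<in> {..<n}"
      have "t i \<le> t (Suc i)" by (rule mono_onD[OF t(1)]) (use i in auto)
      then consider "t (Suc i) \<le> b" "t i \<le> b" | "b \<le> t i" "b \<le> t (Suc i)" | "t i \<le> b" "b \<le> t (Suc i)"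
        by linarith
      then show "dist (\<gamma> (t i)) (\<gamma> (t (Suc i)))
        \<le> dist (\<gamma> (u i)) (\<gamma> (u (Suc i))) + dist (\<gamma> (v i)) (\<gamma> (v (Suc i)))"
        by cases (auto simp: u_def v_def min_def max_def dist_triangle)
    qed
    then have "ennreal (\<Sum>i<n. dist (\<gamma> (t i)) (\<gamma> (t (Suc i))))
      \<le> ennreal (\<Sum>i<n. dist (\<gamma> (u i)) (\<gamma> (u (Suc i)))) + ennreal (\<Sum>i<n. dist (\<gamma> (v i)) (\<gamma> (v (Suc i))))"
      by (simp add: ennreal_leI sum.distrib sum_nonneg flip: ennreal_plus)
    also have "\<dots> \<le> curve_length \<gamma> a b + curve_length \<gamma> b c"
      by (intro add_mono curve_length_upper uv)
    finally show "ennreal (\<Sum>i<n. dist (\<gamma> (t i)) (\<gamma> (t (Suc i)))) \<le> curve_length \<gamma> a b + curve_length \<gamma> b c" .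
  qed
  have *: "ennreal (\<Sum>i<n. dist (\<gamma> (t i)) (\<gamma> (t (Suc i)))) + ennreal (\<Sum>i<m. dist (\<gamma> (s i)) (\<gamma> (s (Suc i))))
      \<le> curve_length \<gamma> a c"
    if t: "mono_on {..n} t" "t ` {..n} \<subseteq> {a..b}" and s: "mono_on {..m} s" "s ` {..m} \<subseteq> {b..c}"
    for n m and t s :: "nat \<Rightarrow> real"
  proof -
    \<comment> \<open>The nodes of \<open>s\<close> follow those of \<open>t\<close> without being
      merged at \<open>b\<close>; the extra step from \<open>t n\<close> to \<open>s 0\<close> can
      only increase the sum.\<close>
    define r where "r i = (if i \<le> n then t i else s (i - Suc n))" for i
    have r: "mono_on {..Suc n + m} r"
    proof (rule mono_onI)
      fix i j assume ij: "i \<in> {..Suc n + m}" "j \<in> {..Suc n + m}" "i \<le> j"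
      consider "j \<le> n" | "i \<le> n" "n < j" | "n < i" by linarith
      then show "r i \<le> r j"
      proof cases
        case 1
        then show ?thesis using ij by (auto simp: r_def intro: mono_onD[OF t(1)])
      next
        case 2
        then have "t i \<le> b" "b \<le> s (j - Suc n)"
          using t(2) s(2) ij by (force simp: image_subset_iff)+
        then show ?thesis using 2 by (simp add: r_def)
      next
        case 3
        then show ?thesis using ij by (auto simp: r_def intro!: mono_onD[OF s(1)])
      qed
    qed
    have r': "r ` {..Suc n + m} \<subseteq> {a..c}"
    proof
      fix x assume "x \<in> r ` {..Suc n + m}"
      then obtain i where i: "i \<le> Suc n + m" "x = r i" by auto
      show "x \<in> {a..c}"
      proof (cases "i \<le> n")
        case True
        then have "t i \<in> {a..b}" using t(2) by auto
        then show ?thesis using True i assms by (auto simp: r_def)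
      next
        case False
        then have "s (i - Suc n) \<in> {b..c}" using s(2) i by (auto simp: image_subset_iff)
        then show ?thesis using False i assms by (auto simp: r_def)
      qed
    qed
    have "(\<Sum>i<n. dist (\<gamma> (t i)) (\<gamma> (t (Suc i)))) + (\<Sum>i<m. dist (\<gamma> (s i)) (\<gamma> (s (Suc i))))
       \<le> (\<Sum>i<Suc n. dist (\<gamma> (r i)) (\<gamma> (r (Suc i)))) + (\<Sum>i<m. dist (\<gamma> (r (Suc n + i))) (\<gamma> (r (Suc (Suc n + i)))))"
      by (intro add_mono) (auto simp: r_def)
    also have "\<dots> = (\<Sum>i<Suc n + m. dist (\<gamma> (r i)) (\<gamma> (r (Suc i))))"
      by (rule sum_lessThan_add[symmetric])
    finally have "ennreal (\<Sum>i<n. dist (\<gamma> (t i)) (\<gamma> (t (Suc i)))) + ennreal (\<Sum>i<m. dist (\<gamma> (s i)) (\<gamma> (s (Suc i))))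
      \<le> ennreal (\<Sum>i<Suc n + m. dist (\<gamma> (r i)) (\<gamma> (r (Suc i))))"
      by (simp add: ennreal_leI sum_nonneg flip: ennreal_plus del: sum.lessThan_Suc)
    also have "\<dots> \<le> curve_length \<gamma> a c" by (rule curve_length_upper[OF r r'])
    finally show ?thesis .
  qed
  define S where "S x y = {(n::nat, t::nat \<Rightarrow> real). mono_on {..n} t \<and> t ` {..n} \<subseteq> {x..y}}" for x y :: real
  have ne: "S a b \<noteq> {}" "S b c \<noteq> {}"
    using assms by (auto simp: S_def mono_on_def intro!: exI[of _ "\<lambda>_. b"])
  let ?s = "\<lambda>(n, t). ennreal (\<Sum>i<n. dist (\<gamma> (t i)) (\<gamma> (t (Suc i))))"
  have "curve_length \<gamma> a b + curve_length \<gamma> b c = (SUP x\<in>S a b. SUP y\<in>S b c. ?s x + ?s y)"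
    unfolding curve_length_def S_def[symmetric] ennreal_SUP_add_right[OF ne(2), symmetric]
    by (rule ennreal_SUP_add_left[OF ne(1), symmetric])
  also have "\<dots> \<le> curve_length \<gamma> a c"
    by (intro SUP_least) (use * in \<open>auto simp: S_def\<close>)
  finally show "curve_length \<gamma> a b + curve_length \<gamma> b c \<le> curve_length \<gamma> a c" .
qed

lemma curve_length_shift:
  "curve_length (\<lambda>t. \<gamma> (x + t)) a b = curve_length \<gamma> (x + a) (x + b)"
proof (rule antisym)
  show "curve_length (\<lambda>t. \<gamma> (x + t)) a b \<le> curve_length \<gamma> (x + a) (x + b)"
  proof (rule curve_length_least)
    fix n and t :: "nat \<Rightarrow> real" assume "mono_on {..n} t" "t ` {..n} \<subseteq> {a..b}"
    then show "ennreal (\<Sum>i<n. dist (\<gamma> (x + t i)) (\<gamma> (x + t (Suc i)))) \<le> curve_length \<gamma> (x + a) (x + b)"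
      by (intro curve_length_upper[of n "\<lambda>i. x + t i"]) (auto simp: mono_on_def)
  qed
  show "curve_length \<gamma> (x + a) (x + b) \<le> curve_length (\<lambda>t. \<gamma> (x + t)) a b"
  proof (rule curve_length_least)
    fix n and t :: "nat \<Rightarrow> real" assume "mono_on {..n} t" "t ` {..n} \<subseteq> {x + a..x + b}"
    then have "ennreal (\<Sum>i<n. dist (\<gamma> (x + (t i - x))) (\<gamma> (x + (t (Suc i) - x)))) \<le> curve_length (\<lambda>t. \<gamma> (x + t)) a b"
      by (intro curve_length_upper[of n "\<lambda>i. t i - x" a b "\<lambda>t. \<gamma> (x + t)"])
         (fastforce simp: mono_on_def image_subset_iff)+
    then show "ennreal (\<Sum>i<n. dist (\<gamma> (t i)) (\<gamma> (t (Suc i)))) \<le> curve_length (\<lambda>t. \<gamma> (x + t)) a b"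
      by simp
  qed
qed

lemma arc_length_curveD:
  assumes "arc_length_curve E l \<gamma>"
  shows "l > 0" "continuous_on {0..l} \<gamma>" "\<And>t. 0 \<le> t \<Longrightarrow> t \<le> l \<Longrightarrow> \<gamma> t \<in> E"
    "\<And>t. 0 \<le> t \<Longrightarrow> t \<le> l \<Longrightarrow> curve_length \<gamma> 0 t = ennreal t"
  using assms unfolding arc_length_curve_def by auto

lemma curve_length_arc:
  assumes "arc_length_curve E l \<gamma>" "0 \<le> a" "a \<le> b" "b \<le> l"
  shows "curve_length \<gamma> a b = ennreal (b - a)"
proof -
  have "ennreal b = ennreal a + curve_length \<gamma> a b"
    using curve_length_add[of 0 a b \<gamma>] arc_length_curveD(4)[OF assms(1)] assms by simp
  moreover have "ennreal b = ennreal a + ennreal (b - a)"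
    using assms by (simp flip: ennreal_plus)
  ultimately show ?thesis by (auto simp: ennreal_add_left_cancel)
qed

lemma arc_length_curve_lipschitz:
  assumes "arc_length_curve E l \<gamma>" "0 \<le> a" "a \<le> b" "b \<le> l"
  shows "dist (\<gamma> a) (\<gamma> b) \<le> b - a"
proof -
  have "ennreal (dist (\<gamma> a) (\<gamma> b)) \<le> ennreal (b - a)"
    using dist_le_curve_length[of a a b b \<gamma>] curve_length_arc[OF assms] assms by simp
  then show ?thesis using assms by (simp add: ennreal_le_iff)
qed

lemma arc_length_curve_sub:
  assumes "arc_length_curve E l \<gamma>" "0 \<le> a" "a < b" "b \<le> l" "\<gamma> ` {a..b} \<subseteq> B"
  shows "arc_length_curve B (b - a) (\<lambda>t. \<gamma> (a + t))"
  unfolding arc_length_curve_def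
proof (intro conjI ballI)
  show "continuous_on {0..b - a} (\<lambda>t. \<gamma> (a + t))"
    by (rule continuous_on_compose2[OF arc_length_curveD(2)[OF assms(1)]])
       (use assms in \<open>auto intro!: continuous_intros\<close>)
  fix t assume "t \<in> {0..b - a}"
  then show "curve_length (\<lambda>t. \<gamma> (a + t)) 0 t = ennreal t"
    using curve_length_arc[OF assms(1), of a "a + t"] assms by (simp add: curve_length_shift)
qed (use assms in auto)

lemma arc_length_curve_mono:
  "arc_length_curve E l \<gamma> \<Longrightarrow> \<gamma> ` {0..l} \<subseteq> B \<Longrightarrow> arc_length_curve B l \<gamma>"
  unfolding arc_length_curve_def by auto

text \<open>The lower integral does not change under completion of the measure, so all line
  integrals can be computed with \<open>lborel\<close>.\<close>

lemma line_integral_lborel: "line_integral l \<gamma> g = (\<integral>\<^sup>+t\<in>{0..l}. g (\<gamma> t) \<partial>lborel)"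
  unfolding line_integral_def by (rule nn_integral_completion)

lemma borel_measurable_along_curve:
  fixes \<gamma> :: "real \<Rightarrow> 'a::metric_space" and g :: "'a \<Rightarrow> ennreal"
  assumes "continuous_on {a..b} \<gamma>" "g \<in> borel_measurable borel"
  shows "(\<lambda>t. g (\<gamma> t) * indicator {a..b} t) \<in> borel_measurable borel"
proof -
  have "(\<lambda>t. g (\<gamma> t)) \<in> borel_measurable (restrict_space borel {a..b})"
    using assms(2) borel_measurable_continuous_on_restrict[OF assms(1)] by (rule measurable_compose_rev)
  then show ?thesis
    by (subst (asm) borel_measurable_restrict_space_iff_ennreal) auto
qed

lemma nn_integral_lborel_shift:
  fixes h :: "real \<Rightarrow> ennreal"
  assumes "(\<lambda>t. h t * indicator {a..b} t) \<in> borel_measurable borel"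
  shows "(\<integral>\<^sup>+t\<in>{0..b - a}. h (a + t) \<partial>lborel) = (\<integral>\<^sup>+t\<in>{a..b}. h t \<partial>lborel)"
  by (subst nn_integral_real_affine[OF assms, of 1 a])
     (auto intro!: nn_integral_cong simp: indicator_def)

lemma nn_integral_lborel_reflect:
  fixes h :: "real \<Rightarrow> ennreal"
  assumes "(\<lambda>t. h t * indicator {0..b} t) \<in> borel_measurable borel"
  shows "(\<integral>\<^sup>+t\<in>{0..b}. h (b - t) \<partial>lborel) = (\<integral>\<^sup>+t\<in>{0..b}. h t \<partial>lborel)"
  by (subst nn_integral_real_affine[OF assms, of "-1" b])
     (auto intro!: nn_integral_cong simp: indicator_def)

text \<open>A 1-Lipschitz map does not increase the length of intervals, so the image of the Lebesgue
  measure of \<open>[0, l]\<close> dominates that of \<open>[0, L]\<close>: first on open sets, by passing to their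
  components, and then on all Borel sets by outer regularity.\<close>

lemma nn_integral_lipschitz_reparam:
  fixes s :: "real \<Rightarrow> real" and H :: "real \<Rightarrow> ennreal"
  assumes lip: "\<And>t t'. t \<le> t' \<Longrightarrow> s t \<le> s t' \<and> s t' - s t \<le> t' - t"
    and l: "0 \<le> l" "s 0 = 0" "s l = L"
    and [measurable]: "H \<in> borel_measurable borel"
  shows "(\<integral>\<^sup>+t\<in>{0..L}. H t \<partial>lborel) \<le> (\<integral>\<^sup>+t\<in>{0..l}. H (s t) \<partial>lborel)"
proof -
  have cont: "continuous_on UNIV s"
  proof (rule continuous_onI)
    fix x e :: real assume "0 < e"
    then show "\<exists>d>0. \<forall>x'\<in>UNIV. dist x' x < d \<longrightarrow> dist (s x') (s x) \<le> e"
    proof (intro exI[of _ e] conjI ballI impI)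
      fix y assume "dist y x < e"
      then show "dist (s y) (s x) \<le> e"
        using lip[of x y] lip[of y x] by (cases "x \<le> y") (auto simp: dist_real_def)
    qed
  qed
  then have [measurable]: "s \<in> borel_measurable borel" by (rule borel_measurable_continuous_onI)
  define \<mu> where "\<mu> = density lborel (indicator {0<..<L})"
  define \<nu> where "\<nu> = distr (density lborel (indicator {0..l})) borel s"
  have sets_\<mu>: "sets \<mu> = sets borel" and sets_\<nu>: "sets \<nu> = sets borel" by (simp_all add: \<mu>_def \<nu>_def)
  have em_\<mu>: "emeasure \<mu> A = emeasure lborel (A \<inter> {0<..<L})" if "A \<in> sets borel" for A
  proof -
    have "emeasure \<mu> A = (\<integral>\<^sup>+t. indicator (A \<inter> {0<..<L}) t \<partial>lborel)"
      unfolding \<mu>_def using that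
      by (subst emeasure_density)
         (auto intro!: nn_integral_cong simp: indicator_def simp del: nn_integral_indicator split: if_splits)
    then show ?thesis using that by simp
  qed
  have em_\<nu>: "emeasure \<nu> A = emeasure lborel (s -` A \<inter> {0..l})" if [measurable]: "A \<in> sets borel" for A
  proof -
    have [measurable]: "s -` A \<in> sets borel"
      using measurable_sets[OF \<open>s \<in> borel_measurable borel\<close> that] by simp
    have "emeasure \<nu> A = emeasure (density lborel (indicator {0..l})) (s -` A)"
      unfolding \<nu>_def by (subst emeasure_distr) auto
    also have "\<dots> = (\<integral>\<^sup>+t. indicator (s -` A \<inter> {0..l}) t \<partial>lborel)"
      by (subst emeasure_density)
         (auto intro!: nn_integral_cong simp: indicator_def simp del: nn_integral_indicator split: if_splits)
    finally show ?thesis by simp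
  qed
  have conn: "emeasure lborel C \<le> emeasure \<nu> C" if C: "connected C" "open C" "C \<subseteq> {0<..<L}" for C
  proof (cases "C = {}")
    case False
    have [measurable]: "C \<in> sets borel" using C(2) by simp
    define \<beta> where "\<beta> = emeasure \<nu> C"
    have "\<beta> \<le> emeasure lborel {0..l}"
      unfolding \<beta>_def by (subst em_\<nu>) (auto intro!: emeasure_mono)
    then have fin: "\<beta> < \<infinity>" using l by (auto simp: le_less_trans)
    \<comment> \<open>Preimages \<open>tx\<close> and \<open>ty\<close> of \<open>x\<close> and
      \<open>y\<close> are at least as far apart as these points, and the whole interval between
      them is mapped into \<open>C\<close>. Hence the diameter of the interval \<open>C\<close> is
      at most \<beta>.\<close>
    have *: "y - x \<le> enn2real \<beta>" if xy: "x \<in> C" "y \<in> C" "x < y" for x y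
    proof -
      have "0 < x" "x < L" "0 < y" "y < L" using xy C(3) by auto
      then obtain tx ty where t: "0 \<le> tx" "tx \<le> l" "s tx = x" "0 \<le> ty" "ty \<le> l" "s ty = y"
        using IVT'[of s 0 x l] IVT'[of s 0 y l] l continuous_on_subset[OF cont] by force
      have "y - x \<le> ty - tx" using lip[of tx ty] lip[of ty tx] t xy by linarith
      moreover have "{tx..ty} \<subseteq> s -` C \<inter> {0..l}"
      proof
        fix u assume u: "u \<in> {tx..ty}"
        then have "s u \<in> {x..y}" using lip[of tx u] lip[of u ty] t by auto
        moreover have "{x..y} \<subseteq> C" using C(1) xy by (metis connected_contains_Icc)
        ultimately show "u \<in> s -` C \<inter> {0..l}" using u t by auto
      qed
      then have "emeasure lborel {tx..ty} \<le> \<beta>"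
        unfolding \<beta>_def by (subst em_\<nu>) (auto intro!: emeasure_mono)
      then have "ennreal (ty - tx) \<le> ennreal (enn2real \<beta>)"
        using fin by (cases "tx \<le> ty") (auto simp: ennreal_neg)
      then have "ty - tx \<le> enn2real \<beta>" by (simp add: ennreal_le_iff)
      ultimately show ?thesis by linarith
    qed
    have bdd: "bdd_above C" "bdd_below C"
      using C(3) by (auto intro: bdd_above_mono[of "{0<..<L}"] bdd_below_mono[of "{0<..<L}"])
    have "Sup C \<le> Inf C + enn2real \<beta>"
    proof (rule cSup_least[OF False])
      fix y assume y: "y \<in> C"
      have "y - enn2real \<beta> \<le> Inf C"
      proof (rule cInf_greatest[OF False])
        fix x assume "x \<in> C"
        then show "y - enn2real \<beta> \<le> x" using *[of x y] y enn2real_nonneg[of \<beta>] by (cases "x < y") linarith+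
      qed
      then show "y \<le> Inf C + enn2real \<beta>" by simp
    qed
    moreover have "C \<subseteq> {Inf C..Sup C}" using bdd by (auto intro: cInf_lower cSup_upper)
    then have "emeasure lborel C \<le> emeasure lborel {Inf C..Sup C}" by (intro emeasure_mono) auto
    moreover have "Inf C \<le> Sup C" using bdd False by (rule cInf_le_cSup[rotated])
    ultimately have "emeasure lborel C \<le> ennreal (enn2real \<beta>)"
      by (auto intro!: ennreal_leI elim!: order_trans)
    then show ?thesis using fin by (simp add: \<beta>_def)
  qed simp
  have op: "emeasure \<mu> U \<le> emeasure \<nu> U" if U: "open U" for U
  proof -
    define V where "V = U \<inter> {0<..<L}"
    have V: "open V" "V \<subseteq> U" "V \<subseteq> {0<..<L}" using U by (auto simp: V_def)
    let ?C = "components V"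
    have C: "open C" "connected C" "C \<subseteq> V" if "C \<in> ?C" for C
      using that open_components[OF V(1)] in_components_connected in_components_subset[of C V] by blast+
    have pw: "pairwise disjnt ?C"
      using pairwise_disjoint_components[of V] by (auto simp: disjnt_def pairwise_def)
    have count: "countable ?C"
      by (rule countable_disjoint_open_subsets) (use C(1) pw in auto)
    have disj: "disjoint_family_on (\<lambda>C. C) ?C"
      using pairwise_disjoint_components[of V] by (auto simp: disjoint_family_on_def pairwise_def)
    have sum: "emeasure N V = (\<integral>\<^sup>+C. emeasure N C \<partial>count_space ?C)" if "sets N = sets borel" for N
      using emeasure_UN_countable[of ?C "\<lambda>C. C" N, OF _ count disj] C(1) that by simp
    have "emeasure \<mu> U = emeasure lborel V"
      using U by (simp add: em_\<mu> V_def)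
    also have "\<dots> = (\<integral>\<^sup>+C. emeasure lborel C \<partial>count_space ?C)" by (rule sum) simp
    also have "\<dots> \<le> (\<integral>\<^sup>+C. emeasure \<nu> C \<partial>count_space ?C)"
    proof (rule nn_integral_mono)
      fix K assume "K \<in> space (count_space ?C)"
      then have K: "K \<in> ?C" by simp
      show "emeasure lborel K \<le> emeasure \<nu> K"
        using C[OF K] V(3) by (intro conn) auto
    qed
    also have "\<dots> = emeasure \<nu> V" by (rule sum[symmetric]) (rule sets_\<nu>)
    also have "\<dots> \<le> emeasure \<nu> U" using U V(2) by (intro emeasure_mono) (auto simp: sets_\<nu>)
    finally show ?thesis .
  qed
  have "\<mu> \<le> \<nu>"
  proof (subst le_measure, simp add: sets_\<mu> sets_\<nu>, rule ballI)
    fix A assume "A \<in> sets \<mu>"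
    then have A: "A \<in> sets borel" by (simp add: sets_\<mu>)
    have fin: "emeasure \<nu> (space \<nu>) \<noteq> \<infinity>"
      using l em_\<nu>[of UNIV] by (simp add: \<nu>_def)
    show "emeasure \<mu> A \<le> emeasure \<nu> A"
      unfolding outer_regular[OF sets_\<nu> fin A]
    proof (rule INF_greatest)
      fix U assume "U \<in> {U. A \<subseteq> U \<and> open U}"
      then show "emeasure \<mu> A \<le> emeasure \<nu> U"
        by (intro order_trans[OF emeasure_mono op]) (auto simp: sets_\<mu>)
    qed
  qed
  then have "nn_integral \<mu> H \<le> nn_integral \<nu> H"
    by (intro nn_integral_mono_measure) (simp_all add: sets_\<mu> sets_\<nu>)
  also have "nn_integral \<nu> H = (\<integral>\<^sup>+t\<in>{0..l}. H (s t) \<partial>lborel)"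
    unfolding \<nu>_def by (subst nn_integral_distr) (auto simp: nn_integral_density mult.commute)
  also have "nn_integral \<mu> H = (\<integral>\<^sup>+t\<in>{0<..<L}. H t \<partial>lborel)"
    unfolding \<mu>_def by (subst nn_integral_density) (auto simp: mult.commute)
  also have "\<dots> = (\<integral>\<^sup>+t\<in>{0..L}. H t \<partial>lborel)"
    by (intro nn_integral_cong_AE, rule AE_mp[OF AE_lborel_singleton[of 0]],
        rule AE_mp[OF AE_lborel_singleton[of L]]) (auto simp: indicator_def)
  finally show ?thesis .
qed

text \<open>Freezing the curve beyond its end points makes it 1-Lipschitz on the whole line, the
  form in which curves enter the cost function.\<close>

lemma lipschitz_curve_clamp:
  assumes "arc_length_curve E l \<gamma>"
  shows "dist (\<gamma> (max 0 (min l s))) (\<gamma> (max 0 (min l t))) \<le> \<bar>s - t\<bar>"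
proof -
  have *: "dist (\<gamma> (max 0 (min l s))) (\<gamma> (max 0 (min l t))) \<le> t - s" if "s \<le> t" for s t
    by (rule order_trans[OF arc_length_curve_lipschitz[OF assms]])
       (use that arc_length_curveD(1)[OF assms] in \<open>auto simp: min_def max_def\<close>)
  show ?thesis using *[of s t] *[of t s] by (cases "s \<le> t") (auto simp: dist_commute)
qed

text \<open>With \<open>s t\<close> the length of the curve up to \<open>t\<close>, points with the
  same value of \<open>s\<close> have the same image, so the curve factors through \<open>s\<close>.
  As \<open>s\<close> is 1-Lipschitz, \<open>nn_integral_lipschitz_reparam\<close> shows that
  integrals do not increase. This carries facts about arc length curves over to Lipschitz
  curves.\<close>

lemma arc_length_reparam:
  fixes \<gamma> :: "real \<Rightarrow> 'a::metric_space"
  assumes lip: "\<And>s t. dist (\<gamma> s) (\<gamma> t) \<le> \<bar>s - t\<bar>" and l: "0 \<le> l" and ne: "\<gamma> 0 \<noteq> \<gamma> l"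
  obtains L \<gamma>' where "arc_length_curve (\<gamma> ` {0..l}) L \<gamma>'" "\<gamma>' 0 = \<gamma> 0" "\<gamma>' L = \<gamma> l"
    "\<And>h. h \<in> borel_measurable borel \<Longrightarrow>
       (\<integral>\<^sup>+t\<in>{0..L}. h (\<gamma>' t) \<partial>lborel) \<le> (\<integral>\<^sup>+t\<in>{0..l}. h (\<gamma> t) \<partial>lborel)"
proof -
  define c where "c t = max 0 (min l t)" for t
  have c: "0 \<le> c t" "c t \<le> l" for t using l by (auto simp: c_def)
  have c_id: "c t = t" if "0 \<le> t" "t \<le> l" for t using that by (auto simp: c_def)
  define s where "s t = enn2real (curve_length \<gamma> 0 (c t))" for t
  have len_le: "curve_length \<gamma> a b \<le> ennreal (b - a)" if "a \<le> b" for a b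
  proof (rule curve_length_le_lipschitz[OF that])
    fix u v :: real assume "u \<le> v"
    then show "dist (\<gamma> u) (\<gamma> v) \<le> v - u" using lip[of u v] by simp
  qed
  have fin: "curve_length \<gamma> 0 (c t) < \<infinity>" for t
    using len_le[OF c(1)[of t]] by (auto intro: le_less_trans)
  have es: "ennreal (s t) = curve_length \<gamma> 0 (c t)" for t
    using fin[of t] by (simp add: s_def)
  have s0: "0 \<le> s t" for t by (simp add: s_def)
  have s_diff: "curve_length \<gamma> a b = ennreal (s b - s a) \<and> s a \<le> s b"
    if "0 \<le> a" "a \<le> b" "b \<le> l" for a b
  proof -
    have *: "ennreal (s b) = ennreal (s a) + curve_length \<gamma> a b"
      using curve_length_add[of 0 a b \<gamma>] that by (simp add: es c_id)
    then have "ennreal (s a) \<le> ennreal (s b)" by simp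
    then have "s a \<le> s b" by (simp add: ennreal_le_iff s0)
    moreover have "ennreal (s b) = ennreal (s a) + ennreal (s b - s a)"
      using calculation s0 by (simp flip: ennreal_plus)
    ultimately show ?thesis using * by (auto simp: ennreal_add_left_cancel)
  qed
  have s_lip: "s t \<le> s t' \<and> s t' - s t \<le> t' - t" if "t \<le> t'" for t t'
  proof -
    have cc: "c t \<le> c t'" "c t' - c t \<le> t' - t" using that by (auto simp: c_def)
    have "s t = s (c t)" "s t' = s (c t')" using c by (simp_all add: s_def c_id)
    moreover have "ennreal (s (c t') - s (c t)) \<le> ennreal (c t' - c t)"
      using s_diff[OF c(1) cc(1) c(2)] len_le[OF cc(1)] by simp
    ultimately show ?thesis using s_diff[OF c(1) cc(1) c(2)] cc by (auto simp: ennreal_le_iff)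
  qed
  define L where "L = s l"
  have s00: "s 0 = 0"
    using len_le[of 0 0] l by (simp add: s_def c_id)
  have cont: "continuous_on UNIV s"
  proof (rule continuous_onI)
    fix x e :: real assume "0 < e"
    then show "\<exists>d>0. \<forall>x'\<in>UNIV. dist x' x < d \<longrightarrow> dist (s x') (s x) \<le> e"
    proof (intro exI[of _ e] conjI ballI impI)
      fix y assume "dist y x < e"
      then show "dist (s y) (s x) \<le> e"
        using s_lip[of x y] s_lip[of y x] by (cases "x \<le> y") (auto simp: dist_real_def)
    qed
  qed
  have "\<exists>t. 0 \<le> t \<and> t \<le> l \<and> s t = \<sigma>" if "\<sigma> \<in> {0..L}" for \<sigma>
    using IVT'[of s 0 \<sigma> l] that l s00 continuous_on_subset[OF cont] by (auto simp: L_def)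
  then obtain \<tau> where \<tau>: "\<And>\<sigma>. \<sigma> \<in> {0..L} \<Longrightarrow> 0 \<le> \<tau> \<sigma> \<and> \<tau> \<sigma> \<le> l \<and> s (\<tau> \<sigma>) = \<sigma>"
    by metis
  have dist_s: "dist (\<gamma> a) (\<gamma> b) \<le> \<bar>s b - s a\<bar>" if "a \<in> {0..l}" "b \<in> {0..l}" for a b
  proof -
    have *: "dist (\<gamma> a) (\<gamma> b) \<le> s b - s a" if "0 \<le> a" "a \<le> b" "b \<le> l" for a b
      using dist_le_curve_length[of a a b b \<gamma>] s_diff[OF that] that by (simp add: ennreal_le_iff)
    show ?thesis using *[of a b] *[of b a] that by (cases "a \<le> b") (auto simp: dist_commute)
  qed
  define \<gamma>' where "\<gamma>' \<sigma> = \<gamma> (\<tau> \<sigma>)" for \<sigma>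
  \<comment> \<open>The right inverse \<tau> of \<open>s\<close> is an arbitrary choice; by
    \<open>dist_s\<close> the curve does not depend on it.\<close>
  have g's: "\<gamma>' (s t) = \<gamma> t" if "t \<in> {0..l}" for t
  proof -
    have "s t \<in> {0..L}" using s0 s_lip[of t l] that by (auto simp: L_def)
    then show ?thesis
      using dist_s[of "\<tau> (s t)" t] \<tau>[of "s t"] that by (auto simp: \<gamma>'_def)
  qed
  have L: "L > 0"
  proof -
    have "0 < dist (\<gamma> 0) (\<gamma> l)" using ne by simp
    also have "\<dots> \<le> \<bar>s l - s 0\<bar>" using l by (intro dist_s) auto
    finally show ?thesis using s00 s0[of l] by (simp add: L_def)
  qed
  have lip': "dist (\<gamma>' a) (\<gamma>' b) \<le> \<bar>b - a\<bar>" if "a \<in> {0..L}" "b \<in> {0..L}" for a b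
    using dist_s[of "\<tau> a" "\<tau> b"] \<tau>[OF that(1)] \<tau>[OF that(2)] by (simp add: \<gamma>'_def)
  have cont': "continuous_on {0..L} \<gamma>'"
  proof (rule continuous_onI)
    fix x e :: real assume "x \<in> {0..L}" "0 < e"
    then show "\<exists>d>0. \<forall>x'\<in>{0..L}. dist x' x < d \<longrightarrow> dist (\<gamma>' x') (\<gamma>' x) \<le> e"
      by (intro exI[of _ e]) (auto simp: dist_real_def abs_minus_commute intro: order_trans[OF lip'])
  qed
  have len: "curve_length \<gamma>' 0 \<sigma> = ennreal \<sigma>" if \<sigma>: "\<sigma> \<in> {0..L}" for \<sigma>
  proof (rule antisym)
    show "curve_length \<gamma>' 0 \<sigma> \<le> ennreal \<sigma>"
    proof -
      have "curve_length \<gamma>' 0 \<sigma> \<le> ennreal (\<sigma> - 0)"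
      proof (rule curve_length_le_lipschitz)
        fix u v assume "0 \<le> u" "u \<le> v" "v \<le> \<sigma>"
        then show "dist (\<gamma>' u) (\<gamma>' v) \<le> v - u" using lip'[of u v] \<sigma> by auto
      qed (use \<sigma> in auto)
      then show ?thesis by simp
    qed
    have "ennreal \<sigma> = curve_length \<gamma> 0 (\<tau> \<sigma>)"
      using es[of "\<tau> \<sigma>"] \<tau>[OF \<sigma>] by (simp add: c_id)
    also have "\<dots> \<le> curve_length \<gamma>' 0 \<sigma>"
    proof (rule curve_length_least)
      fix n and t :: "nat \<Rightarrow> real" assume t: "mono_on {..n} t" "t ` {..n} \<subseteq> {0..\<tau> \<sigma>}"
      have tl: "t i \<in> {0..l}" if "i \<le> n" for i using t(2) that \<tau>[OF \<sigma>] by force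
      have "(\<Sum>i<n. dist (\<gamma> (t i)) (\<gamma> (t (Suc i)))) = (\<Sum>i<n. dist (\<gamma>' (s (t i))) (\<gamma>' (s (t (Suc i)))))"
      proof (rule sum.cong[OF refl])
        fix i assume "i \<in> {..<n}"
        then have "i \<le> n" "Suc i \<le> n" by auto
        then show "dist (\<gamma> (t i)) (\<gamma> (t (Suc i))) = dist (\<gamma>' (s (t i))) (\<gamma>' (s (t (Suc i))))"
          using g's[OF tl] by metis
      qed
      moreover have "mono_on {..n} (\<lambda>i. s (t i))"
        using t(1) s_lip unfolding mono_on_def by blast
      moreover have "(\<lambda>i. s (t i)) ` {..n} \<subseteq> {0..\<sigma>}"
      proof (intro image_subsetI)
        fix i assume "i \<in> {..n}"
        then have "t i \<le> \<tau> \<sigma>" using t(2) by auto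
        then show "s (t i) \<in> {0..\<sigma>}" using s_lip[of "t i" "\<tau> \<sigma>"] \<tau>[OF \<sigma>] s0 by auto
      qed
      ultimately show "ennreal (\<Sum>i<n. dist (\<gamma> (t i)) (\<gamma> (t (Suc i)))) \<le> curve_length \<gamma>' 0 \<sigma>"
        using curve_length_upper[of n "\<lambda>i. s (t i)" 0 \<sigma> \<gamma>'] by simp
    qed
    finally show "ennreal \<sigma> \<le> curve_length \<gamma>' 0 \<sigma>" .
  qed
  show ?thesis
  proof (rule that)
    show "arc_length_curve (\<gamma> ` {0..l}) L \<gamma>'"
      unfolding arc_length_curve_def
    proof (intro conjI ballI image_subsetI)
      fix \<sigma> assume "\<sigma> \<in> {0..L}"
      then show "\<gamma>' \<sigma> \<in> \<gamma> ` {0..l}" using \<tau>[of \<sigma>] unfolding \<gamma>'_def by (intro imageI) simp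
    qed (rule L cont' len; assumption?)+
    show "\<gamma>' 0 = \<gamma> 0" using g's[of 0] l s00 by simp
    show "\<gamma>' L = \<gamma> l" using g's[of l] l by (simp add: L_def)
    fix h :: "'a \<Rightarrow> ennreal" assume h: "h \<in> borel_measurable borel"
    define H where "H t = h (\<gamma>' t) * indicator {0..L} t" for t
    have "H \<in> borel_measurable borel"
      unfolding H_def by (rule borel_measurable_along_curve[OF cont' h])
    then have le: "(\<integral>\<^sup>+t\<in>{0..L}. H t \<partial>lborel) \<le> (\<integral>\<^sup>+t\<in>{0..l}. H (s t) \<partial>lborel)"
      using s_lip l s00 by (intro nn_integral_lipschitz_reparam) (auto simp: L_def)
    have "(\<integral>\<^sup>+t\<in>{0..L}. h (\<gamma>' t) \<partial>lborel) = (\<integral>\<^sup>+t\<in>{0..L}. H t \<partial>lborel)"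
      by (intro nn_integral_cong) (auto simp: H_def indicator_def)
    also note le
    also have "(\<integral>\<^sup>+t\<in>{0..l}. H (s t) \<partial>lborel) \<le> (\<integral>\<^sup>+t\<in>{0..l}. h (\<gamma> t) \<partial>lborel)"
    proof (rule nn_integral_mono)
      fix t show "H (s t) * indicator {0..l} t \<le> h (\<gamma> t) * indicator {0..l} t"
        by (cases "t \<in> {0..l}") (auto simp: H_def g's indicator_def)
    qed
    finally show "(\<integral>\<^sup>+t\<in>{0..L}. h (\<gamma>' t) \<partial>lborel) \<le> (\<integral>\<^sup>+t\<in>{0..l}. h (\<gamma> t) \<partial>lborel)" .
  qed
qed


section \<open>Powers of extended nonnegative reals\<close>

lemma ennreal_powr_simps [simp]:
  "ennreal_powr \<infinity> p = \<infinity>" "ennreal_powr top p = \<infinity>" "ennreal_powr 0 p = 0"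
  by (simp_all add: ennreal_powr_def)

lemma ennreal_powr_ennreal: "0 \<le> x \<Longrightarrow> ennreal_powr (ennreal x) p = ennreal (x powr p)"
  by (simp add: ennreal_powr_def)

lemma borel_measurable_ennreal_powr [measurable]:
  assumes [measurable]: "f \<in> borel_measurable M"
  shows "(\<lambda>x. ennreal_powr (f x) p) \<in> borel_measurable M"
proof -
  have [measurable]: "Measurable.pred M (\<lambda>x. f x = \<infinity>)"
    by (rule pred_eq_const1[OF assms]) simp
  show ?thesis unfolding ennreal_powr_def by measurable
qed

lemma ennreal_powr_mono: "0 \<le> p \<Longrightarrow> x \<le> y \<Longrightarrow> ennreal_powr x p \<le> ennreal_powr y p"
  by (cases x; cases y) (auto simp: ennreal_powr_ennreal top_unique intro!: ennreal_leI powr_mono2)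

lemma ennreal_powr_powr:
  assumes "p > 0" "q > 0" "p * q = 1"
  shows "ennreal_powr (ennreal_powr x p) q = x"
  using assms by (cases x) (auto simp: ennreal_powr_ennreal powr_powr)

lemma ennreal_powr_cmult:
  assumes "c > 0"
  shows "ennreal_powr (ennreal c * x) p = ennreal (c powr p) * ennreal_powr x p"
proof (cases x)
  case (real r)
  then show ?thesis
    using assms by (simp add: ennreal_powr_ennreal powr_mult flip: ennreal_mult)
next
  case top
  then show ?thesis using assms by (simp add: ennreal_mult_top)
qed

text \<open>Follows from \<open>x + y \<le> 2 * max x y\<close>. Only finiteness is drawn from it,
  so the constant does not matter.\<close>

lemma ennreal_powr_add_le:
  assumes "p > 0"
  shows "ennreal_powr (x + y) p \<le> ennreal (2 powr p) * (ennreal_powr x p + ennreal_powr y p)"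
proof -
  have "x + y \<le> ennreal 2 * max x y"
    by (cases "x \<le> y") (simp_all add: max_def mult_2 add_mono)
  then have "ennreal_powr (x + y) p \<le> ennreal_powr (ennreal 2 * max x y) p"
    using assms by (intro ennreal_powr_mono) auto
  also have "\<dots> = ennreal (2 powr p) * ennreal_powr (max x y) p"
    by (rule ennreal_powr_cmult) simp
  also have "\<dots> \<le> ennreal (2 powr p) * (ennreal_powr x p + ennreal_powr y p)"
    by (intro mult_left_mono) (auto simp: max_def)
  finally show ?thesis .
qed

lemma ennreal_powr_eq_0_iff [simp]: "ennreal_powr x p = 0 \<longleftrightarrow> x = 0"
  by (cases x) (auto simp: ennreal_powr_ennreal ennreal_eq_0_iff)


section \<open>Exceptional families of curves\<close>

locale newtonian_space =
  fixes p :: real and M :: "'a::metric_space measure"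
  assumes p_gt_1: "1 < p" and complete_borel: "complete_borel_measure M"
    and balls: "balls_pos_finite M" and proper: "proper_space TYPE('a)"
begin

lemma closed_bounded_imp_compact: "closed S \<Longrightarrow> bounded S \<Longrightarrow> compact (S :: 'a set)"
  using proper unfolding proper_space_def by blast

lemma obtain_borel: obtains N :: "'a measure" where "sets N = sets borel" "M = completion N"
  using complete_borel unfolding complete_borel_measure_def by blast

lemma sets_borel_M: "A \<in> sets borel \<Longrightarrow> A \<in> sets M"
  by (rule obtain_borel) (auto intro: sets_completionI_sets)

lemma space_M [simp]: "space M = UNIV"
  by (rule obtain_borel) (auto dest: sets_eq_imp_space_eq)

lemma borel_measurable_M: "f \<in> borel_measurable borel \<Longrightarrow> f \<in> borel_measurable M"
  by (rule measurable_mono[THEN subsetD, of borel _ borel M]) (auto simp: sets_borel_M)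

lemma emeasure_ball: "r > 0 \<Longrightarrow> 0 < emeasure M (ball x r)" "emeasure M (ball x r) < \<infinity>"
  using balls unfolding balls_pos_finite_def by (cases "r > 0"; force simp: ball_empty)+

lemma null_set_borel:
  assumes "N \<in> null_sets M"
  obtains Z where "Z \<in> sets borel" "Z \<in> null_sets M" "N \<subseteq> Z"
proof -
  obtain B where B: "sets B = sets borel" "M = completion B" by (rule obtain_borel)
  then obtain Z where "Z \<in> null_sets B" "N \<subseteq> Z"
    using assms by (auto simp: null_sets_completion_iff2)
  then show ?thesis
    using B by (intro that[of Z]) (auto simp: null_sets_def intro: null_sets_completionI)
qed

text \<open>Functions measurable for the completed measure need not be measurable along curves.
  Redefining such a function as \<infinity> on a Borel null set gives a Borel function that
  dominates it everywhere on \<open>E\<close> and agrees with it almost everywhere there, so that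
  line integrals grow while \<open>p\<close>-energies stay the same.\<close>

lemma borel_majorant:
  fixes h :: "'a \<Rightarrow> ennreal"
  assumes h: "h \<in> borel_measurable (restrict_space M E)" and E: "open E"
  obtains h' where "h' \<in> borel_measurable borel" "\<And>x. x \<in> E \<Longrightarrow> h x \<le> h' x"
    "\<And>x. x \<notin> E \<Longrightarrow> h' x = 0" "AE x in M. x \<in> E \<longrightarrow> h x = h' x"
proof -
  obtain B where B: "sets B = sets borel" "M = completion B" by (rule obtain_borel)
  have spB: "space B = UNIV" using sets_eq_imp_space_eq[OF B(1)] by simp
  have E': "E \<in> sets M" using E by (intro sets_borel_M) auto
  have "(\<lambda>x. h x * indicator E x) \<in> borel_measurable M"
    using h E' by (subst (asm) borel_measurable_restrict_space_iff_ennreal) auto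
  then obtain g where g: "g \<in> borel_measurable B" "AE x in B. h x * indicator E x = g x"
    using completion_ex_borel_measurable unfolding B(2) by blast
  obtain Z where Z: "{x \<in> space B. h x * indicator E x \<noteq> g x} \<subseteq> Z" "Z \<in> null_sets B"
    using AE_E[OF g(2)] by (metis (no_types, lifting) null_setsI)
  have [measurable]: "g \<in> borel_measurable borel" "Z \<in> sets borel" "E \<in> sets borel"
    using g(1) Z(2) E measurable_cong_sets[OF B(1) refl] B(1) by (auto simp: null_sets_def)
  define h' where "h' x = (if x \<in> Z then \<infinity> else g x) * indicator E x" for x
  show ?thesis
  proof (rule that[of h'])
    show "h' \<in> borel_measurable borel" unfolding h'_def by measurable
    fix x
    show "h x \<le> h' x" if "x \<in> E"
    proof (cases "x \<in> Z")
      case False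
      then have "h x * indicator E x = g x" using Z(1) by (auto simp: spB)
      then show ?thesis using that False by (simp add: h'_def)
    qed (use that in \<open>simp add: h'_def\<close>)
    show "x \<notin> E \<Longrightarrow> h' x = 0" by (simp add: h'_def)
  next
    have "Z \<in> null_sets M" using Z(2) B(2) by (auto intro: null_sets_completionI)
    then show "AE x in M. x \<in> E \<longrightarrow> h x = h' x"
      using Z(1) by (intro AE_I'[of Z]) (auto simp: h'_def spB indicator_def split: if_splits)
  qed
qed

text \<open>Borel measurability, stronger than measurability for \<open>M\<close>, makes \<rho>
  measurable along every continuous curve.\<close>

definition Lp :: "('a \<Rightarrow> ennreal) \<Rightarrow> bool" where
  "Lp \<rho> \<longleftrightarrow> \<rho> \<in> borel_measurable borel \<and> (\<integral>\<^sup>+x. ennreal_powr (\<rho> x) p \<partial>M) < \<infinity>"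

lemma LpD: "Lp \<rho> \<Longrightarrow> \<rho> \<in> borel_measurable borel" "Lp \<rho> \<Longrightarrow> (\<integral>\<^sup>+x. ennreal_powr (\<rho> x) p \<partial>M) < \<infinity>"
  unfolding Lp_def by auto

text \<open>The function \<sigma> is the \<open>p\<close>-th root of a weighted sum of the
  \<open>p\<close>-th powers. One density then controls countably many, each up to its own constant,
  which is all that matters for infinite line integrals.\<close>

lemma Lp_countable:
  assumes \<rho>: "\<And>i::nat. Lp (\<rho> i)"
  shows "\<exists>\<sigma> c. Lp \<sigma> \<and> (\<forall>i. c i > (0::real)) \<and> (\<forall>i x. \<rho> i x \<le> ennreal (c i) * \<sigma> x)"
proof -
  have [measurable]: "\<rho> i \<in> borel_measurable M" for i using \<rho> by (intro borel_measurable_M) (rule LpD)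
  define I where "I i = (\<integral>\<^sup>+x. ennreal_powr (\<rho> i x) p \<partial>M)" for i
  have I: "I i < \<infinity>" for i unfolding I_def by (rule LpD) (rule \<rho>)
  \<comment> \<open>Chosen such that \<open>a i * I i\<close> is at most \<open>(1/2)^i\<close>; the
    summand 1 keeps the denominator positive.\<close>
  define a where "a i = (1/2)^i / (1 + enn2real (I i))" for i
  have a: "a i > 0" for i unfolding a_def by (intro divide_pos_pos) (auto intro: add_pos_nonneg)
  define h where "h x = (\<Sum>i. ennreal (a i) * ennreal_powr (\<rho> i x) p)" for x
  define \<sigma> where "\<sigma> x = ennreal_powr (h x) (1 / p)" for x
  have \<sigma>p: "ennreal_powr (\<sigma> x) p = h x" for x
    unfolding \<sigma>_def using p_gt_1 by (intro ennreal_powr_powr) auto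
  have "(\<integral>\<^sup>+x. h x \<partial>M) = (\<Sum>i. ennreal (a i) * I i)"
    unfolding h_def I_def by (subst nn_integral_suminf) (auto simp: nn_integral_cmult)
  also have "\<dots> \<le> (\<Sum>i. ennreal ((1/2)^i))"
  proof (intro suminf_le)
    fix i
    have "ennreal (a i) * I i = ennreal (a i * enn2real (I i))"
      using I[of i] a[of i] by (simp add: ennreal_mult)
    also have "a i * enn2real (I i) \<le> (1/2)^i"
    proof -
      have "a i * enn2real (I i) \<le> a i * (1 + enn2real (I i))"
        using a[of i] by (intro mult_left_mono) auto
      also have "\<dots> = (1/2)^i"
        using enn2real_nonneg[of "I i"] by (simp add: a_def add_nonneg_eq_0_iff)
      finally show ?thesis .
    qed
    finally show "ennreal (a i) * I i \<le> ennreal ((1/2)^i)" by (simp add: ennreal_leI)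
  qed auto
  also have "\<dots> = ennreal (\<Sum>i. (1/2)^i)" by (rule suminf_ennreal2) (auto simp: summable_geometric)
  finally have fin: "(\<integral>\<^sup>+x. h x \<partial>M) < \<infinity>" by (auto simp: le_less_trans)
  have [measurable]: "\<rho> i \<in> borel_measurable borel" for i using \<rho> by (rule LpD)
  have m: "\<sigma> \<in> borel_measurable borel" unfolding \<sigma>_def h_def by measurable
  define c where "c i = (1 / a i) powr (1 / p)" for i
  show ?thesis
  proof (intro exI[of _ \<sigma>] exI[of _ c] conjI allI)
    show "Lp \<sigma>" unfolding Lp_def \<sigma>p using m fin by simp
    fix i show "c i > 0" using a[of i] by (simp add: c_def)
    fix x
    have "ennreal (a i) * ennreal_powr (\<rho> i x) p \<le> h x"
      unfolding h_def using sum_le_suminf[of "\<lambda>i. ennreal (a i) * ennreal_powr (\<rho> i x) p" "{i}"] by simp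
    then have "ennreal (1 / a i) * (ennreal (a i) * ennreal_powr (\<rho> i x) p) \<le> ennreal (1 / a i) * h x"
      by (rule mult_left_mono) simp
    then have "ennreal_powr (\<rho> i x) p \<le> ennreal (1 / a i) * h x"
      using a[of i] by (simp add: mult.assoc[symmetric] ennreal_mult[symmetric])
    then have "ennreal_powr (ennreal_powr (\<rho> i x) p) (1 / p) \<le> ennreal_powr (ennreal (1 / a i) * h x) (1 / p)"
      using p_gt_1 by (intro ennreal_powr_mono) auto
    also have "\<dots> = ennreal (c i) * \<sigma> x"
      using a[of i] by (simp add: ennreal_powr_cmult c_def \<sigma>_def)
    also have "ennreal_powr (ennreal_powr (\<rho> i x) p) (1 / p) = \<rho> i x"
      using p_gt_1 by (intro ennreal_powr_powr) auto
    finally show "\<rho> i x \<le> ennreal (c i) * \<sigma> x" .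
  qed
qed

lemma Lp_cmult:
  assumes "Lp \<rho>" "c > 0" shows "Lp (\<lambda>x. ennreal c * \<rho> x)"
proof -
  have [measurable]: "\<rho> \<in> borel_measurable borel" "\<rho> \<in> borel_measurable M"
    using assms by (auto intro: LpD borel_measurable_M)
  show ?thesis
    using LpD(2)[OF assms(1)] assms(2) by (auto simp: Lp_def ennreal_powr_cmult nn_integral_cmult ennreal_mult_less_top)
qed

lemma Lp_add:
  assumes "Lp \<rho>" "Lp \<sigma>" shows "Lp (\<lambda>x. \<rho> x + \<sigma> x)"
proof -
  have [measurable]: "\<rho> \<in> borel_measurable borel" "\<rho> \<in> borel_measurable M"
    "\<sigma> \<in> borel_measurable borel" "\<sigma> \<in> borel_measurable M"
    using assms by (auto intro: LpD borel_measurable_M)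
  have "(\<integral>\<^sup>+x. ennreal_powr (\<rho> x + \<sigma> x) p \<partial>M) \<le>
    (\<integral>\<^sup>+x. ennreal (2 powr p) * (ennreal_powr (\<rho> x) p + ennreal_powr (\<sigma> x) p) \<partial>M)"
    using p_gt_1 by (intro nn_integral_mono ennreal_powr_add_le) auto
  also have "\<dots> = ennreal (2 powr p) * ((\<integral>\<^sup>+x. ennreal_powr (\<rho> x) p \<partial>M) + (\<integral>\<^sup>+x. ennreal_powr (\<sigma> x) p \<partial>M))"
    by (simp add: nn_integral_cmult nn_integral_add)
  also have "\<dots> < \<infinity>"
    using LpD(2)[OF assms(1)] LpD(2)[OF assms(2)] by (auto simp: ennreal_mult_less_top)
  finally show ?thesis by (simp add: Lp_def)
qed

lemma line_integral_mono:
  assumes "\<And>t. 0 \<le> t \<Longrightarrow> t \<le> l \<Longrightarrow> g (\<gamma> t) \<le> g' (\<gamma> t)"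
  shows "line_integral l \<gamma> g \<le> line_integral l \<gamma> g'"
  unfolding line_integral_def by (intro nn_integral_mono) (auto simp: indicator_def assms)

lemma line_integral_cmult:
  assumes "continuous_on {0..l} \<gamma>" "g \<in> borel_measurable borel"
  shows "line_integral l \<gamma> (\<lambda>x. c * g x) = c * line_integral l \<gamma> g"
  unfolding line_integral_lborel using borel_measurable_along_curve[OF assms]
  by (subst nn_integral_cmult[symmetric]) (auto simp: mult.assoc)

lemma line_integral_sub:
  assumes "continuous_on {0..l} \<gamma>" "g \<in> borel_measurable borel" "0 \<le> a" "a \<le> b" "b \<le> l"
  shows "line_integral (b - a) (\<lambda>t. \<gamma> (a + t)) g = (\<integral>\<^sup>+t\<in>{a..b}. g (\<gamma> t) \<partial>lborel)"
  unfolding line_integral_lborel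
  by (rule nn_integral_lborel_shift, rule borel_measurable_along_curve[OF continuous_on_subset])
     (use assms in auto)

abbreviation aec where "aec \<equiv> almost_every_curve p M"

lemma aecI:
  assumes "Lp \<rho>" "open E"
    and "\<And>l \<gamma>. arc_length_curve E l \<gamma> \<Longrightarrow> line_integral l \<gamma> \<rho> < \<infinity> \<Longrightarrow> P l \<gamma>"
  shows "aec E P"
  unfolding almost_every_curve_def
proof (intro exI[of _ \<rho>] conjI allI impI)
  show "\<rho> \<in> borel_measurable (restrict_space M E)"
    using LpD(1)[OF assms(1)] by (intro measurable_restrict_space1 borel_measurable_M)
  show "(\<integral>\<^sup>+x\<in>E. ennreal_powr (\<rho> x) p \<partial>M) < \<infinity>"
    by (rule le_less_trans[OF _ LpD(2)[OF assms(1)]]) (auto intro!: nn_integral_mono simp: indicator_def)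
  fix l \<gamma> assume "arc_length_curve E l \<gamma> \<and> \<not> P l \<gamma>"
  then show "line_integral l \<gamma> \<rho> = \<infinity>" using assms(3)[of l \<gamma>] less_top by fastforce
qed

text \<open>Replacing the density by a Borel majorant that vanishes off \<open>E\<close> gives a
  density on the whole space, which can then be tested on curves that leave
  \<open>E\<close>.\<close>

lemma aecE:
  assumes "aec E P" "open E"
  obtains \<rho> where "Lp \<rho>" "\<And>l \<gamma>. arc_length_curve E l \<gamma> \<Longrightarrow> line_integral l \<gamma> \<rho> < \<infinity> \<Longrightarrow> P l \<gamma>"
proof -
  obtain \<rho> where \<rho>: "\<rho> \<in> borel_measurable (restrict_space M E)" "(\<integral>\<^sup>+x\<in>E. ennreal_powr (\<rho> x) p \<partial>M) < \<infinity>"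
    "\<And>l \<gamma>. arc_length_curve E l \<gamma> \<and> \<not> P l \<gamma> \<Longrightarrow> line_integral l \<gamma> \<rho> = \<infinity>"
    using assms(1) unfolding almost_every_curve_def by auto
  obtain \<sigma> where \<sigma>: "\<sigma> \<in> borel_measurable borel" "\<And>x. x \<in> E \<Longrightarrow> \<rho> x \<le> \<sigma> x"
    "\<And>x. x \<notin> E \<Longrightarrow> \<sigma> x = 0" "AE x in M. x \<in> E \<longrightarrow> \<rho> x = \<sigma> x"
    by (rule borel_majorant[OF \<rho>(1) assms(2)]) blast
  show ?thesis
  proof (rule that[of \<sigma>])
    have "(\<integral>\<^sup>+x. ennreal_powr (\<sigma> x) p \<partial>M) = (\<integral>\<^sup>+x\<in>E. ennreal_powr (\<rho> x) p \<partial>M)"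
      by (intro nn_integral_cong_AE, rule AE_mp[OF \<sigma>(4)]) (auto simp: indicator_def \<sigma>(3))
    then show "Lp \<sigma>" using \<sigma>(1) \<rho>(2) by (simp add: Lp_def)
    fix l \<gamma> assume *: "arc_length_curve E l \<gamma>" "line_integral l \<gamma> \<sigma> < \<infinity>"
    have "line_integral l \<gamma> \<rho> \<le> line_integral l \<gamma> \<sigma>"
      by (rule line_integral_mono) (use \<sigma>(2) arc_length_curveD(3)[OF *(1)] in auto)
    then have "line_integral l \<gamma> \<rho> \<noteq> \<infinity>" using *(2) by (auto simp: less_top top_unique)
    then show "P l \<gamma>" using \<rho>(3) *(1) by blast
  qed
qed

text \<open>A curve with finite integral of the common density from \<open>Lp_countable\<close> has
  finite integrals of all the individual densities.\<close>

lemma aec_countable: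
  assumes "open E" "\<And>i::nat. aec E (P i)"
  shows "aec E (\<lambda>l \<gamma>. \<forall>i. P i l \<gamma>)"
proof -
  have "\<exists>\<rho>. Lp \<rho> \<and> (\<forall>l \<gamma>. arc_length_curve E l \<gamma> \<longrightarrow> line_integral l \<gamma> \<rho> < \<infinity> \<longrightarrow> P i l \<gamma>)" for i
    by (rule aecE[OF assms(2,1), of i]) blast
  then obtain \<rho> where \<rho>: "\<And>i. Lp (\<rho> i)"
    "\<And>i l \<gamma>. arc_length_curve E l \<gamma> \<Longrightarrow> line_integral l \<gamma> (\<rho> i) < \<infinity> \<Longrightarrow> P i l \<gamma>"
    by metis
  obtain \<sigma> c where \<sigma>: "Lp \<sigma>" "\<And>i. c i > (0::real)" "\<And>i x. \<rho> i x \<le> ennreal (c i) * \<sigma> x"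
    using Lp_countable[of \<rho>, OF \<rho>(1)] by auto
  show ?thesis
  proof (rule aecI[OF \<sigma>(1) assms(1)], intro allI)
    fix l \<gamma> i assume \<gamma>: "arc_length_curve E l \<gamma>" "line_integral l \<gamma> \<sigma> < \<infinity>"
    have "line_integral l \<gamma> (\<rho> i) \<le> line_integral l \<gamma> (\<lambda>x. ennreal (c i) * \<sigma> x)"
      by (rule line_integral_mono) (rule \<sigma>(3))
    also have "\<dots> = ennreal (c i) * line_integral l \<gamma> \<sigma>"
      by (rule line_integral_cmult[OF arc_length_curveD(2)[OF \<gamma>(1)] LpD(1)[OF \<sigma>(1)]])
    also have "\<dots> < \<infinity>" using \<gamma>(2) by (simp add: ennreal_mult_less_top)
    finally show "P i l \<gamma>" by (rule \<rho>(2)[OF \<gamma>(1)])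
  qed
qed

lemma aec_mono:
  assumes "aec E P" "\<And>l \<gamma>. arc_length_curve E l \<gamma> \<Longrightarrow> P l \<gamma> \<Longrightarrow> Q l \<gamma>"
  shows "aec E Q"
  using assms unfolding almost_every_curve_def by blast

lemma aec_conj:
  assumes "open E" "aec E P" "aec E Q"
  shows "aec E (\<lambda>l \<gamma>. P l \<gamma> \<and> Q l \<gamma>)"
proof -
  have "aec E (\<lambda>l \<gamma>. \<forall>i::nat. if i = 0 then P l \<gamma> else Q l \<gamma>)"
  proof (rule aec_countable[OF assms(1)])
    fix i :: nat show "aec E (\<lambda>l \<gamma>. if i = 0 then P l \<gamma> else Q l \<gamma>)" using assms by (cases "i = 0") auto
  qed
  then show ?thesis by (rule aec_mono) (metis zero_neq_one)
qed

text \<open>An infinite integral along a piece of a curve is infinite along the whole curve. The two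
  open sets are unrelated: the statement serves both to shrink the domain and to look at those
  pieces of a curve that lie in a smaller set.\<close>

lemma aec_sub:
  assumes P: "aec B P" and "open A" "open B"
  shows "aec A (\<lambda>l \<gamma>. \<forall>a b. 0 \<le> a \<longrightarrow> a < b \<longrightarrow> b \<le> l \<longrightarrow> \<gamma> ` {a..b} \<subseteq> B \<longrightarrow> P (b - a) (\<lambda>t. \<gamma> (a + t)))"
proof -
  obtain \<rho> where \<rho>: "Lp \<rho>" "\<And>l \<gamma>. arc_length_curve B l \<gamma> \<Longrightarrow> line_integral l \<gamma> \<rho> < \<infinity> \<Longrightarrow> P l \<gamma>"
    by (rule aecE[OF P assms(3)]) blast
  show ?thesis
  proof (rule aecI[OF \<rho>(1) assms(2)], intro allI impI)
    fix l \<gamma> a b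
    assume \<gamma>: "arc_length_curve A l \<gamma>" "line_integral l \<gamma> \<rho> < \<infinity>" and ab: "0 \<le> a" "a < b" "b \<le> l"
      and B: "\<gamma> ` {a..b} \<subseteq> B"
    have "line_integral (b - a) (\<lambda>t. \<gamma> (a + t)) \<rho> = (\<integral>\<^sup>+t\<in>{a..b}. \<rho> (\<gamma> t) \<partial>lborel)"
      by (rule line_integral_sub[OF arc_length_curveD(2)[OF \<gamma>(1)] LpD(1)[OF \<rho>(1)]]) (use ab in auto)
    also have "\<dots> \<le> line_integral l \<gamma> \<rho>"
      unfolding line_integral_lborel by (rule nn_integral_Icc_subset) (use ab in auto)
    finally show "P (b - a) (\<lambda>t. \<gamma> (a + t))"
      using \<gamma>(2) by (intro \<rho>(2) arc_length_curve_sub[OF \<gamma>(1) ab B]) auto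
  qed
qed

text \<open>The density that is \<infinity> on a Borel null set containing \<open>N\<close> has
  energy 0, and a finite line integral of it forces the curve to spend almost no time in
  \<open>N\<close>.\<close>

lemma aec_null:
  assumes "N \<in> null_sets M" "open E"
  shows "aec E (\<lambda>l \<gamma>. AE t in lborel. t \<in> {0..l} \<longrightarrow> \<gamma> t \<notin> N)"
proof -
  obtain Z where Z: "Z \<in> sets borel" "Z \<in> null_sets M" "N \<subseteq> Z" by (rule null_set_borel[OF assms(1)])
  define \<rho> :: "'a \<Rightarrow> ennreal" where "\<rho> x = \<infinity> * indicator Z x" for x
  have m: "\<rho> \<in> borel_measurable borel" using Z(1) unfolding \<rho>_def by measurable
  have "(\<integral>\<^sup>+x. ennreal_powr (\<rho> x) p \<partial>M) = (\<integral>\<^sup>+x. 0 \<partial>M)"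
    using Z(2) by (intro nn_integral_cong_AE AE_I'[of Z]) (auto simp: \<rho>_def indicator_def split: if_splits)
  then have Lp: "Lp \<rho>" using m by (simp add: Lp_def)
  show ?thesis
  proof (rule aecI[OF Lp assms(2)])
    fix l \<gamma> assume \<gamma>: "arc_length_curve E l \<gamma>" "line_integral l \<gamma> \<rho> < \<infinity>"
    have mm: "(\<lambda>t. \<rho> (\<gamma> t) * indicator {0..l} t) \<in> borel_measurable borel"
      by (rule borel_measurable_along_curve[OF arc_length_curveD(2)[OF \<gamma>(1)] m])
    have "AE t in lborel. \<rho> (\<gamma> t) * indicator {0..l} t \<noteq> \<infinity>"
      by (rule nn_integral_noteq_infinite) (use mm \<gamma>(2) in \<open>auto simp: line_integral_lborel\<close>)
    then show "AE t in lborel. t \<in> {0..l} \<longrightarrow> \<gamma> t \<notin> N"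
      by eventually_elim (use Z(3) in \<open>auto simp: \<rho>_def indicator_def split: if_splits\<close>)
  qed
qed

text \<open>In a proper space an open set is exhausted by the compact sets \<open>K n\<close> of
  points within distance \<open>n\<close> of a base point and at distance at least
  \<open>1 / Suc n\<close> from the complement.\<close>

lemma countable_subcover:
  fixes E :: "'a set"
  assumes "open E" "\<And>C. C \<in> \<C> \<Longrightarrow> open C" "E \<subseteq> \<Union>\<C>"
  shows "\<exists>\<D>. \<D> \<subseteq> \<C> \<and> countable \<D> \<and> E \<subseteq> \<Union>\<D>"
proof -
  obtain x0 :: 'a where True by blast
  define K where "K n = cball x0 (real n) \<inter> (\<Inter>y\<in>- E. - ball y (1 / Suc n))" for n :: nat
  have "compact (K n)" for n
    unfolding K_def by (intro closed_bounded_imp_compact closed_Int closed_INT) (auto simp: closed_Compl)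
  moreover have KE: "K n \<subseteq> E" for n
  proof
    fix x assume "x \<in> K n"
    then show "x \<in> E" unfolding K_def by (cases "x \<in> E") force+
  qed
  ultimately have "\<exists>D\<subseteq>\<C>. finite D \<and> K n \<subseteq> \<Union>D" for n
    using compactE[of "K n" \<C>] assms(2,3) by (metis order_trans)
  then obtain D where D: "\<And>n. D n \<subseteq> \<C>" "\<And>n. finite (D n)" "\<And>n. K n \<subseteq> \<Union>(D n)" by metis
  have "E \<subseteq> (\<Union>n. K n)"
  proof
    fix x assume "x \<in> E"
    then obtain e where e: "e > 0" "ball x e \<subseteq> E" using assms(1) by (auto elim: openE)
    obtain n1 :: nat where n1: "dist x0 x \<le> real n1" using real_arch_simple by blast
    obtain n2 :: nat where n2: "1 / Suc n2 < e" using e(1) nat_approx_posE by blast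
    have "1 / real (Suc (max n1 n2)) \<le> 1 / Suc n2" by (intro divide_left_mono) auto
    then have "x \<in> K (max n1 n2)" using n1 n2 e(2)
      by (force simp: K_def dist_commute subset_iff)
    then show "x \<in> (\<Union>n. K n)" by blast
  qed
  also have "\<dots> \<subseteq> (\<Union>n. \<Union>(D n))" using D(3) by (rule UN_mono[OF subset_refl])
  also have "\<dots> = \<Union>(\<Union>n. D n)" by fast
  finally have 1: "E \<subseteq> \<Union>(\<Union>n. D n)" .
  have 2: "(\<Union>n. D n) \<subseteq> \<C>" using D(1) by (rule UN_least)
  have 3: "countable (\<Union>n. D n)" by (intro countable_UN countableI_type countable_finite D(2))
  show ?thesis using 1 2 3 by (intro exI conjI)
qed

lemma countable_ball_cover:
  fixes E :: "'a set"
  assumes "open E" "E \<noteq> {}" "\<And>x. x \<in> E \<Longrightarrow> \<exists>r>0. Q x r"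
  obtains x r where "\<And>i::nat. x i \<in> E" "\<And>i. r i > 0" "\<And>i. Q (x i) (r i)" "E \<subseteq> (\<Union>i. ball (x i) (r i))"
proof -
  obtain r where r: "\<And>x. x \<in> E \<Longrightarrow> r x > 0 \<and> Q x (r x)" using assms(3) by metis
  have "E \<subseteq> \<Union>((\<lambda>x. ball x (r x)) ` E)"
  proof
    fix x assume "x \<in> E"
    then show "x \<in> \<Union>((\<lambda>x. ball x (r x)) ` E)" using r[of x] by (intro UnionI[of "ball x (r x)"]) auto
  qed
  moreover have "open C" if "C \<in> (\<lambda>x. ball x (r x)) ` E" for C using that by auto
  ultimately obtain \<D> where \<D>: "\<D> \<subseteq> (\<lambda>x. ball x (r x)) ` E" "countable \<D>" "E \<subseteq> \<Union>\<D>"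
    using countable_subcover[OF assms(1), of "(\<lambda>x. ball x (r x)) ` E"] by metis
  then obtain D where D: "D \<subseteq> E" "countable D" "\<D> = (\<lambda>x. ball x (r x)) ` D"
    using countable_subset_image[of \<D>] by (metis (no_types, lifting))
  have "D \<noteq> {}" using \<D>(3) D(3) assms(2) by auto
  define f where "f = from_nat_into D"
  have range: "range f = D" unfolding f_def by (rule range_from_nat_into[OF \<open>D \<noteq> {}\<close> D(2)])
  have fE: "f i \<in> E" for i using D(1) range by blast
  have "\<Union>\<D> = (\<Union>i. ball (f i) (r (f i)))" unfolding D(3) range[symmetric] image_image ..
  then have cov: "E \<subseteq> (\<Union>i. ball (f i) (r (f i)))" using \<D>(3) by (rule back_subst[of "(\<subseteq>) E", rotated])
  show ?thesis
    by (rule that[of f "\<lambda>i. r (f i)"]) (use r[OF fE] fE cov in blast)+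
qed

text \<open>The image of a curve is compact, hence covered by finitely many of countably many balls
  on which \<open>g\<close> has finite energy; one density dominates \<open>g\<close> on each of
  them up to a constant.\<close>

lemma aec_line_integral_finite:
  assumes g: "locally_p_integrable p M E g" and gb: "g \<in> borel_measurable borel" and E: "open E"
  shows "aec E (\<lambda>l \<gamma>. line_integral l \<gamma> g < \<infinity>)"
proof (cases "E = {}")
  case True
  then show ?thesis
  proof (intro aecI[of "\<lambda>_. 0"] E)
    fix l \<gamma> assume "arc_length_curve E l \<gamma>"
    from arc_length_curveD(1)[OF this] arc_length_curveD(3)[OF this, of 0]
    show "line_integral l \<gamma> g < \<infinity>" using True by simp
  qed (simp add: Lp_def)
next
  case False
  have "\<And>x. x \<in> E \<Longrightarrow> \<exists>r>0. (\<integral>\<^sup>+y\<in>ball x r \<inter> E. ennreal_powr (g y) p \<partial>M) < \<infinity>"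
    using g unfolding locally_p_integrable_def by blast
  then obtain x r where x: "\<And>i::nat. x i \<in> E" and r: "\<And>i. r i > 0"
    and int: "\<And>i. (\<integral>\<^sup>+y\<in>ball (x i) (r i) \<inter> E. ennreal_powr (g y) p \<partial>M) < \<infinity>"
    and cover: "E \<subseteq> (\<Union>i. ball (x i) (r i))"
    using countable_ball_cover[OF E False, of "\<lambda>x r. (\<integral>\<^sup>+y\<in>ball x r \<inter> E. ennreal_powr (g y) p \<partial>M) < \<infinity>"]
    by blast
  define B where "B i = ball (x i) (r i) \<inter> E" for i
  have [measurable]: "B i \<in> sets borel" for i using E by (auto simp: B_def)
  have "Lp (\<lambda>y. g y * indicator (B i) y)" for i
  proof -
    have "(\<integral>\<^sup>+y. ennreal_powr (g y * indicator (B i) y) p \<partial>M) = (\<integral>\<^sup>+y\<in>B i. ennreal_powr (g y) p \<partial>M)"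
      by (intro nn_integral_cong) (auto simp: indicator_def)
    moreover have "(\<lambda>y. g y * indicator (B i) y) \<in> borel_measurable borel" using gb by measurable
    ultimately show ?thesis using int[of i] by (simp add: Lp_def B_def)
  qed
  then obtain \<sigma> c where \<sigma>: "Lp \<sigma>" "\<And>i. c i > (0::real)"
    "\<And>i y. g y * indicator (B i) y \<le> ennreal (c i) * \<sigma> y"
    using Lp_countable[of "\<lambda>i y. g y * indicator (B i) y"] by auto
  show ?thesis
  proof (rule aecI[OF \<sigma>(1) E])
    fix l \<gamma> assume \<gamma>: "arc_length_curve E l \<gamma>" "line_integral l \<gamma> \<sigma> < \<infinity>"
    note cont = arc_length_curveD(2)[OF \<gamma>(1)]
    have "compact (\<gamma> ` {0..l})" by (rule compact_continuous_image[OF cont]) simp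
    moreover have "\<gamma> ` {0..l} \<subseteq> (\<Union>i. B i)"
      using arc_length_curveD(3)[OF \<gamma>(1)] cover by (fastforce simp: B_def)
    moreover have "open (B i)" for i using E by (simp add: B_def open_Int)
    ultimately obtain J where J: "finite J" "\<gamma> ` {0..l} \<subseteq> (\<Union>i\<in>J. B i)"
      using compactE_image[of "\<gamma> ` {0..l}" UNIV B] by metis
    have "line_integral l \<gamma> g \<le> (\<integral>\<^sup>+t. (\<Sum>i\<in>J. ennreal (c i) * (\<sigma> (\<gamma> t) * indicator {0..l} t)) \<partial>lborel)"
      unfolding line_integral_lborel
    proof (rule nn_integral_mono)
      fix t show "g (\<gamma> t) * indicator {0..l} t \<le> (\<Sum>i\<in>J. ennreal (c i) * (\<sigma> (\<gamma> t) * indicator {0..l} t))"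
      proof (cases "t \<in> {0..l}")
        case True
        then obtain i where i: "i \<in> J" "\<gamma> t \<in> B i" using J(2) by blast
        have "g (\<gamma> t) \<le> ennreal (c i) * \<sigma> (\<gamma> t)" using \<sigma>(3)[of "\<gamma> t" i] i(2) by simp
        also have "\<dots> \<le> (\<Sum>i\<in>J. ennreal (c i) * \<sigma> (\<gamma> t))" by (rule member_le_sum) (use i J in auto)
        finally show ?thesis using True by simp
      qed simp
    qed
    also have "\<dots> = (\<Sum>i\<in>J. ennreal (c i) * line_integral l \<gamma> \<sigma>)"
      unfolding line_integral_lborel using borel_measurable_along_curve[OF cont LpD(1)[OF \<sigma>(1)]]
      by (subst nn_integral_sum) (auto simp: nn_integral_cmult)
    also have "\<dots> < \<infinity>" using \<gamma>(2) J(1) by (auto simp: ennreal_mult_less_top)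
    finally show "line_integral l \<gamma> g < \<infinity>" .
  qed
qed

end


section \<open>Minimal weak upper gradients\<close>

context newtonian_space
begin

text \<open>A normalized form of a weak upper gradient: Borel, for a real-valued function, and with
  the inequality on all subcurves at once. The function \<open>F\<close> is total, but only its
  values on almost every curve in \<open>E\<close> count, so it may be changed or extended on sets
  that almost no curve meets.\<close>

definition good_ug :: "'a set \<Rightarrow> ('a \<Rightarrow> ennreal) \<Rightarrow> ('a \<Rightarrow> real) \<Rightarrow> bool" where
  "good_ug E g F \<longleftrightarrow> g \<in> borel_measurable borel \<and>
     aec E (\<lambda>l \<gamma>. ac_bound (\<lambda>t. F (\<gamma> t)) (\<lambda>t. g (\<gamma> t) * indicator {0..l} t) 0 l)"

lemma good_ugD:
  assumes "good_ug E g F"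
  shows "g \<in> borel_measurable borel"
    "aec E (\<lambda>l \<gamma>. ac_bound (\<lambda>t. F (\<gamma> t)) (\<lambda>t. g (\<gamma> t) * indicator {0..l} t) 0 l)"
  using assms unfolding good_ug_def by auto

lemma oscillation_ereal [simp]: "oscillation (ereal a) (ereal b) = ennreal \<bar>b - a\<bar>"
  by (simp add: oscillation_def abs_minus_commute)

lemma indicator_Icc_sub:
  fixes h :: "real \<Rightarrow> ennreal"
  assumes "a \<le> c" "d \<le> b"
  shows "(\<integral>\<^sup>+t\<in>{c..d}. h t * indicator {a..b} t \<partial>lborel) = (\<integral>\<^sup>+t\<in>{c..d}. h t \<partial>lborel)"
  by (intro nn_integral_cong) (use assms in \<open>auto simp: indicator_def\<close>)

lemma wugI:
  assumes g: "g \<in> borel_measurable (restrict_space M E)"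
    and f: "\<And>x. x \<in> E \<Longrightarrow> f x = ereal (F x)"
    and ac: "aec E (\<lambda>l \<gamma>. ac_bound (\<lambda>t. F (\<gamma> t)) (\<lambda>t. g (\<gamma> t) * indicator {0..l} t) 0 l)"
  shows "weak_upper_gradient p M E g f"
  unfolding weak_upper_gradient_def
proof (intro conjI g aec_mono[OF ac])
  fix l \<gamma> assume \<gamma>: "arc_length_curve E l \<gamma>"
    and *: "ac_bound (\<lambda>t. F (\<gamma> t)) (\<lambda>t. g (\<gamma> t) * indicator {0..l} t) 0 l"
  note l = arc_length_curveD(1)[OF \<gamma>]
  have "ennreal \<bar>F (\<gamma> l) - F (\<gamma> 0)\<bar> \<le> (\<integral>\<^sup>+t\<in>{0..l}. g (\<gamma> t) * indicator {0..l} t \<partial>lborel)"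
    by (rule ac_boundD[OF *]) (use l in auto)
  then show "oscillation (f (\<gamma> 0)) (f (\<gamma> l)) \<le> line_integral l \<gamma> g"
    using f[OF arc_length_curveD(3)[OF \<gamma>]] l by (simp add: line_integral_lborel indicator_Icc_sub)
qed

lemma good_ug_imp_wug:
  assumes "good_ug E g F" "\<And>x. x \<in> E \<Longrightarrow> f x = ereal (F x)"
  shows "weak_upper_gradient p M E g f"
  by (rule wugI[OF _ assms(2) good_ugD(2)[OF assms(1)]])
     (intro measurable_restrict_space1 borel_measurable_M good_ugD[OF assms(1)])

text \<open>By \<open>aec_sub\<close> the inequality for the end points of almost every curve holds
  for the end points of all its subcurves, and by \<open>borel_majorant\<close> the gradient becomes
  Borel without a change almost everywhere.\<close>

lemma wug_imp_good_ug:
  assumes g: "weak_upper_gradient p M E g f" and E: "open E"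
    and f: "\<And>x. x \<in> E \<Longrightarrow> f x = ereal (F x)"
  obtains g' where "good_ug E g' F" "\<And>x. x \<in> E \<Longrightarrow> g x \<le> g' x" "\<And>x. x \<notin> E \<Longrightarrow> g' x = 0"
    "AE x in M. x \<in> E \<longrightarrow> g x = g' x"
proof -
  have gm: "g \<in> borel_measurable (restrict_space M E)"
    and ae: "aec E (\<lambda>l \<gamma>. oscillation (f (\<gamma> 0)) (f (\<gamma> l)) \<le> line_integral l \<gamma> g)"
    using g unfolding weak_upper_gradient_def by auto
  obtain g' where g': "g' \<in> borel_measurable borel" "\<And>x. x \<in> E \<Longrightarrow> g x \<le> g' x"
    "\<And>x. x \<notin> E \<Longrightarrow> g' x = 0" "AE x in M. x \<in> E \<longrightarrow> g x = g' x"
    by (rule borel_majorant[OF gm E]) metis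
  have "good_ug E g' F"
    unfolding good_ug_def
  proof (intro conjI g'(1) aec_mono[OF aec_sub[OF ae E E]] ac_boundI)
    fix l \<gamma> c d
    assume \<gamma>: "arc_length_curve E l \<gamma>" and cd: "0 \<le> c" "c \<le> d" "d \<le> l"
      and *: "\<forall>a b. 0 \<le> a \<longrightarrow> a < b \<longrightarrow> b \<le> l \<longrightarrow> \<gamma> ` {a..b} \<subseteq> E \<longrightarrow>
        oscillation (f (\<gamma> (a + 0))) (f (\<gamma> (a + (b - a)))) \<le> line_integral (b - a) (\<lambda>t. \<gamma> (a + t)) g"
    have inE: "\<gamma> t \<in> E" if "0 \<le> t" "t \<le> l" for t using arc_length_curveD(3)[OF \<gamma>] that by simp
    show "ennreal \<bar>F (\<gamma> d) - F (\<gamma> c)\<bar> \<le> (\<integral>\<^sup>+t\<in>{c..d}. g' (\<gamma> t) * indicator {0..l} t \<partial>lborel)"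
    proof (cases "c = d")
      case False
      have "\<gamma> ` {c..d} \<subseteq> E" using inE cd by auto
      then have "oscillation (f (\<gamma> c)) (f (\<gamma> d)) \<le> line_integral (d - c) (\<lambda>t. \<gamma> (c + t)) g"
        using *[rule_format, of c d] cd False by simp
      also have "\<dots> \<le> line_integral (d - c) (\<lambda>t. \<gamma> (c + t)) g'"
        by (rule line_integral_mono) (use g'(2) inE cd in auto)
      also have "\<dots> = (\<integral>\<^sup>+t\<in>{c..d}. g' (\<gamma> t) \<partial>lborel)"
        by (rule line_integral_sub[OF arc_length_curveD(2)[OF \<gamma>] g'(1)]) (use cd in auto)
      also have "\<dots> = (\<integral>\<^sup>+t\<in>{c..d}. g' (\<gamma> t) * indicator {0..l} t \<partial>lborel)"
        using cd by (subst indicator_Icc_sub) auto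
      finally show ?thesis using f[OF inE] cd by simp
    qed simp
  qed
  then show ?thesis using g'(2-4) by (rule that)
qed

text \<open>The bound on a piece of a curve is written in the parameter of the whole curve. In this
  form local gradients can be glued along one curve.\<close>

lemma good_ug_sub:
  assumes g: "good_ug B g F" and A: "open A" and B: "open B"
  shows "aec A (\<lambda>l \<gamma>. \<forall>a b. 0 \<le> a \<longrightarrow> a < b \<longrightarrow> b \<le> l \<longrightarrow> \<gamma> ` {a..b} \<subseteq> B \<longrightarrow>
    ac_bound (\<lambda>t. F (\<gamma> t)) (\<lambda>t. g (\<gamma> t) * indicator {0..l} t) a b)"
proof (rule aec_mono[OF aec_sub[OF good_ugD(2)[OF g] A B]], intro allI impI)
  fix l \<gamma> a b
  assume \<gamma>: "arc_length_curve A l \<gamma>" and ab: "0 \<le> a" "a < b" "b \<le> l" "\<gamma> ` {a..b} \<subseteq> B"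
    and *: "\<forall>a b. 0 \<le> a \<longrightarrow> a < b \<longrightarrow> b \<le> l \<longrightarrow> \<gamma> ` {a..b} \<subseteq> B \<longrightarrow>
      ac_bound (\<lambda>t. F (\<gamma> (a + t))) (\<lambda>t. g (\<gamma> (a + t)) * indicator {0..b - a} t) 0 (b - a)"
  have ac: "ac_bound (\<lambda>t. F (\<gamma> (a + t))) (\<lambda>t. g (\<gamma> (a + t)) * indicator {0..b - a} t) 0 (b - a)"
    using * ab by blast
  show "ac_bound (\<lambda>t. F (\<gamma> t)) (\<lambda>t. g (\<gamma> t) * indicator {0..l} t) a b"
  proof (rule ac_boundI)
    fix c d assume cd: "a \<le> c" "c \<le> d" "d \<le> b"
    have "ennreal \<bar>F (\<gamma> (a + (d - a))) - F (\<gamma> (a + (c - a)))\<bar>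
      \<le> (\<integral>\<^sup>+t\<in>{c - a..d - a}. g (\<gamma> (a + t)) * indicator {0..b - a} t \<partial>lborel)"
      by (rule ac_boundD[OF ac]) (use cd in auto)
    also have "\<dots> = (\<integral>\<^sup>+t\<in>{0..b - a}. (g (\<gamma> (a + t)) * indicator {c..d} (a + t)) \<partial>lborel)"
      using cd by (intro nn_integral_cong) (auto simp: indicator_def)
    also have "\<dots> = (\<integral>\<^sup>+t\<in>{a..b}. (g (\<gamma> t) * indicator {c..d} t) \<partial>lborel)"
    proof (rule nn_integral_lborel_shift[where h="\<lambda>t. g (\<gamma> t) * indicator {c..d} t"])
      have "continuous_on {a..b} \<gamma>"
        by (rule continuous_on_subset[OF arc_length_curveD(2)[OF \<gamma>]]) (use ab in auto)
      then have [measurable]: "(\<lambda>t. g (\<gamma> t) * indicator {a..b} t) \<in> borel_measurable borel"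
        by (rule borel_measurable_along_curve) (rule good_ugD[OF g])
      have "(\<lambda>t. (g (\<gamma> t) * indicator {a..b} t) * indicator {c..d} t) \<in> borel_measurable borel" by measurable
      then show "(\<lambda>t. g (\<gamma> t) * indicator {c..d} t * indicator {a..b} t) \<in> borel_measurable borel"
        by (simp add: mult_ac)
    qed
    also have "\<dots> = (\<integral>\<^sup>+t\<in>{c..d}. g (\<gamma> t) * indicator {0..l} t \<partial>lborel)"
      using cd ab by (intro nn_integral_cong) (auto simp: indicator_def)
    finally show "ennreal \<bar>F (\<gamma> d) - F (\<gamma> c)\<bar> \<le> (\<integral>\<^sup>+t\<in>{c..d}. g (\<gamma> t) * indicator {0..l} t \<partial>lborel)"
      by simp
  qed
qed

lemma good_ug_subset:
  assumes "good_ug B g F" "open A" "open B" "A \<subseteq> B"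
  shows "good_ug A g F"
  unfolding good_ug_def
proof (intro conjI aec_mono[OF good_ug_sub[OF assms(1-3)]])
  fix l \<gamma> assume \<gamma>: "arc_length_curve A l \<gamma>"
    and *: "\<forall>a b. 0 \<le> a \<longrightarrow> a < b \<longrightarrow> b \<le> l \<longrightarrow> \<gamma> ` {a..b} \<subseteq> B \<longrightarrow>
      ac_bound (\<lambda>t. F (\<gamma> t)) (\<lambda>t. g (\<gamma> t) * indicator {0..l} t) a b"
  have "\<gamma> ` {0..l} \<subseteq> B" using arc_length_curveD(3)[OF \<gamma>] assms(4) by auto
  then show "ac_bound (\<lambda>t. F (\<gamma> t)) (\<lambda>t. g (\<gamma> t) * indicator {0..l} t) 0 l"
    using * arc_length_curveD(1)[OF \<gamma>] by simp
qed (rule good_ugD[OF assms(1)])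

lemma along_measurable:
  fixes g :: "'a \<Rightarrow> ennreal"
  assumes "arc_length_curve E l \<gamma>" "g \<in> borel_measurable borel"
  shows "(\<lambda>t. g (\<gamma> t) * indicator {0..l} t) \<in> borel_measurable borel"
  by (rule borel_measurable_along_curve[OF arc_length_curveD(2)[OF assms(1)] assms(2)])

lemma along_finite:
  "line_integral l \<gamma> g < \<infinity> \<Longrightarrow> (\<integral>\<^sup>+t\<in>{0..l}. g (\<gamma> t) * indicator {0..l} t \<partial>lborel) < \<infinity>"
  by (simp add: line_integral_lborel indicator_Icc_sub)

lemma locally_p_integrable_mono:
  assumes "locally_p_integrable p M E g" "g' \<in> borel_measurable borel"
    "AE x in M. x \<in> E \<longrightarrow> g' x \<le> g x"
  shows "locally_p_integrable p M E g'"
  unfolding locally_p_integrable_def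
proof (intro conjI ballI)
  show "g' \<in> borel_measurable (restrict_space M E)"
    by (intro measurable_restrict_space1 borel_measurable_M assms)
  fix x assume "x \<in> E"
  then obtain r where r: "r > 0" "(\<integral>\<^sup>+y\<in>ball x r \<inter> E. ennreal_powr (g y) p \<partial>M) < \<infinity>"
    using assms(1) unfolding locally_p_integrable_def by blast
  have "(\<integral>\<^sup>+y\<in>ball x r \<inter> E. ennreal_powr (g' y) p \<partial>M) \<le> (\<integral>\<^sup>+y\<in>ball x r \<inter> E. ennreal_powr (g y) p \<partial>M)"
  proof (rule nn_integral_mono_AE, rule AE_mp[OF assms(3)], rule AE_I2, rule impI)
    fix y assume "y \<in> E \<longrightarrow> g' y \<le> g y"
    then have "y \<in> ball x r \<inter> E \<Longrightarrow> ennreal_powr (g' y) p \<le> ennreal_powr (g y) p"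
      using p_gt_1 by (intro ennreal_powr_mono) auto
    then show "ennreal_powr (g' y) p * indicator (ball x r \<inter> E) y \<le> ennreal_powr (g y) p * indicator (ball x r \<inter> E) y"
      by (cases "y \<in> ball x r \<inter> E") simp_all
  qed
  then show "\<exists>r>0. (\<integral>\<^sup>+y\<in>ball x r \<inter> E. ennreal_powr (g' y) p \<partial>M) < \<infinity>"
    using r by (intro exI[of _ r]) (auto intro: le_less_trans)
qed

text \<open>Local integrability makes both line integrals finite on almost every curve, as
  \<open>ac_bound_min\<close> requires.\<close>

lemma good_ug_min:
  assumes E: "open E" and g: "good_ug E g F" "locally_p_integrable p M E g"
    and h: "good_ug E h F" "locally_p_integrable p M E h"
  shows "good_ug E (\<lambda>x. min (g x) (h x)) F"
  unfolding good_ug_def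
proof (intro conjI)
  have [measurable]: "g \<in> borel_measurable borel" "h \<in> borel_measurable borel"
    using g h by (auto intro: good_ugD)
  show "(\<lambda>x. min (g x) (h x)) \<in> borel_measurable borel" by measurable
  have "aec E (\<lambda>l \<gamma>. (line_integral l \<gamma> g < \<infinity> \<and> line_integral l \<gamma> h < \<infinity>) \<and>
     ac_bound (\<lambda>t. F (\<gamma> t)) (\<lambda>t. g (\<gamma> t) * indicator {0..l} t) 0 l \<and>
     ac_bound (\<lambda>t. F (\<gamma> t)) (\<lambda>t. h (\<gamma> t) * indicator {0..l} t) 0 l)"
    by (intro aec_conj E aec_line_integral_finite good_ugD[OF g(1)] good_ugD[OF h(1)] g(2) h(2))
  then show "aec E (\<lambda>l \<gamma>. ac_bound (\<lambda>t. F (\<gamma> t)) (\<lambda>t. min (g (\<gamma> t)) (h (\<gamma> t)) * indicator {0..l} t) 0 l)"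
  proof (rule aec_mono, elim conjE)
    fix l \<gamma> assume \<gamma>: "arc_length_curve E l \<gamma>" and fin: "line_integral l \<gamma> g < \<infinity>" "line_integral l \<gamma> h < \<infinity>"
      and ac: "ac_bound (\<lambda>t. F (\<gamma> t)) (\<lambda>t. g (\<gamma> t) * indicator {0..l} t) 0 l"
        "ac_bound (\<lambda>t. F (\<gamma> t)) (\<lambda>t. h (\<gamma> t) * indicator {0..l} t) 0 l"
    have "ac_bound (\<lambda>t. F (\<gamma> t)) (\<lambda>t. min (g (\<gamma> t) * indicator {0..l} t) (h (\<gamma> t) * indicator {0..l} t)) 0 l"
      by (rule ac_bound_min[OF along_measurable[OF \<gamma>, of g] along_measurable[OF \<gamma>, of h] ac
            along_finite[OF fin(1)] along_finite[OF fin(2)]]) auto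
    then show "ac_bound (\<lambda>t. F (\<gamma> t)) (\<lambda>t. min (g (\<gamma> t)) (h (\<gamma> t)) * indicator {0..l} t) 0 l"
      by (rule ac_bound_mono) (auto simp: indicator_def)
  qed
qed

text \<open>A decreasing limit passes through the line integrals by monotone convergence from above
  along almost every curve; no weak compactness in \<open>L\<^sup>p\<close> is involved.\<close>

lemma good_ug_INF:
  fixes g :: "nat \<Rightarrow> 'a \<Rightarrow> ennreal"
  assumes E: "open E" and g: "\<And>i. good_ug E (g i) F" and loc: "locally_p_integrable p M E (g 0)"
    and dec: "\<And>x. decseq (\<lambda>i. g i x)"
  shows "good_ug E (\<lambda>x. INF i. g i x) F"
  unfolding good_ug_def
proof (intro conjI)
  have [measurable]: "g i \<in> borel_measurable borel" for i using g by (auto intro: good_ugD)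
  show "(\<lambda>x. INF i. g i x) \<in> borel_measurable borel" by measurable
  have "aec E (\<lambda>l \<gamma>. line_integral l \<gamma> (g 0) < \<infinity> \<and>
     (\<forall>i. ac_bound (\<lambda>t. F (\<gamma> t)) (\<lambda>t. g i (\<gamma> t) * indicator {0..l} t) 0 l))"
    by (intro aec_conj aec_countable E aec_line_integral_finite good_ugD[OF g] loc)
  then show "aec E (\<lambda>l \<gamma>. ac_bound (\<lambda>t. F (\<gamma> t)) (\<lambda>t. (INF i. g i (\<gamma> t)) * indicator {0..l} t) 0 l)"
  proof (rule aec_mono, elim conjE, intro ac_boundI)
    fix l \<gamma> c d assume \<gamma>: "arc_length_curve E l \<gamma>" and fin: "line_integral l \<gamma> (g 0) < \<infinity>"
      and ac: "\<forall>i. ac_bound (\<lambda>t. F (\<gamma> t)) (\<lambda>t. g i (\<gamma> t) * indicator {0..l} t) 0 l"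
      and cd: "0 \<le> c" "c \<le> d" "d \<le> l"
    define f where "f i t = g i (\<gamma> t) * indicator {0..l} t * indicator {c..d} t" for i t
    have [measurable]: "f i \<in> borel_measurable lborel" for i
      unfolding f_def using along_measurable[OF \<gamma>, of "g i"] by measurable
    have "decseq f"
    proof (rule decseq_SucI, rule le_funI)
      fix i t show "f (Suc i) t \<le> f i t"
        unfolding f_def by (intro mult_right_mono decseq_SucD[OF dec]) auto
    qed
    moreover have "(\<integral>\<^sup>+t. f 0 t \<partial>lborel) < \<infinity>"
      using fin unfolding line_integral_lborel f_def
      by (rule le_less_trans[rotated]) (auto intro!: nn_integral_mono simp: indicator_def)
    ultimately have "(\<integral>\<^sup>+t. (INF i. f i t) \<partial>lborel) = (INF i. (\<integral>\<^sup>+t. f i t \<partial>lborel))"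
      by (intro nn_integral_monotone_convergence_INF_decseq) auto
    moreover have "ennreal \<bar>F (\<gamma> d) - F (\<gamma> c)\<bar> \<le> (INF i. (\<integral>\<^sup>+t. f i t \<partial>lborel))"
      by (rule INF_greatest) (use ac_boundD[OF ac[rule_format] cd] in \<open>simp add: f_def\<close>)
    moreover have "(\<integral>\<^sup>+t. (INF i. f i t) \<partial>lborel) = (\<integral>\<^sup>+t\<in>{c..d}. (INF i. g i (\<gamma> t)) * indicator {0..l} t \<partial>lborel)"
      by (intro nn_integral_cong) (auto simp: f_def indicator_def)
    ultimately show "ennreal \<bar>F (\<gamma> d) - F (\<gamma> c)\<bar> \<le> (\<integral>\<^sup>+t\<in>{c..d}. (INF i. g i (\<gamma> t)) * indicator {0..l} t \<partial>lborel)"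
      by simp
  qed
qed

lemma sigma_finite: "sigma_finite_measure M"
proof
  obtain x0 :: 'a where True by blast
  have "(\<Union>n::nat. ball x0 (real n)) = UNIV"
    using real_arch_simple reals_Archimedean2 by (fastforce simp: dist_commute)
  then show "\<exists>A. countable A \<and> A \<subseteq> sets M \<and> \<Union>A = space M \<and> (\<forall>a\<in>A. emeasure M a \<noteq> \<infinity>)"
    using emeasure_ball(2) by (intro exI[of _ "range (\<lambda>n::nat. ball x0 (real n))"])
      (auto intro!: sets_borel_M simp: less_top)
qed

text \<open>The functions \<open>1 / (1 + g)\<close> turn the essential infimum of a family that is closed under
  minima into the maximization of an integral.\<close>

theorem ex_minimal_wug:
  assumes E: "open E" and f: "\<And>x. x \<in> E \<Longrightarrow> f x = ereal (F x)"
    and g0: "weak_upper_gradient p M E g0 f" "locally_p_integrable p M E g0"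
  shows "\<exists>g. is_minimal_wug p M E f g"
proof -
  define W where "W = {g. good_ug E g F \<and> locally_p_integrable p M E g}"
  have W_ex: "\<exists>g'\<in>W. AE x in M. x \<in> E \<longrightarrow> g x = g' x"
    if wug: "weak_upper_gradient p M E g f" "locally_p_integrable p M E g" for g
  proof -
    obtain g' where g': "good_ug E g' F" "AE x in M. x \<in> E \<longrightarrow> g x = g' x"
      using wug_imp_good_ug[OF wug(1) E f] by metis
    have "locally_p_integrable p M E g'"
      by (rule locally_p_integrable_mono[OF wug(2) good_ugD(1)[OF g'(1)]])
         (use g'(2) in \<open>auto elim!: eventually_mono\<close>)
    then show ?thesis using g' by (auto simp: W_def)
  qed
  have Wm: "g \<in> borel_measurable borel" if "g \<in> W" for g using that by (auto simp: W_def intro: good_ugD)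
  have W_min: "(\<lambda>x. min (g x) (h x)) \<in> W" if "g \<in> W" "h \<in> W" for g h
  proof -
    have "(\<lambda>x. min (g x) (h x)) \<in> borel_measurable borel" using Wm[OF that(1)] Wm[OF that(2)] by measurable
    then show ?thesis
      using that good_ug_min[OF E] locally_p_integrable_mono[of E g "\<lambda>x. min (g x) (h x)"]
      by (auto simp: W_def)
  qed
  \<comment> \<open>The positive integrable weight makes \<open>J\<close> finite although the
    measure of the space may be infinite.\<close>
  obtain w where w: "w \<in> borel_measurable M" "(\<integral>\<^sup>+x. w x \<partial>M) \<noteq> \<infinity>" "\<And>x. 0 < w x \<and> w x < \<infinity>"
    using sigma_finite_measure.Ex_finite_integrable_function[OF sigma_finite] by auto
  define \<tau> :: "ennreal \<Rightarrow> ennreal" where "\<tau> x = (if x = \<infinity> then 0 else ennreal (1 / (1 + enn2real x)))" for x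
  have \<tau>1: "\<tau> x \<le> 1" for x
    by (auto simp: \<tau>_def divide_le_eq_1 simp flip: ennreal_1 intro!: ennreal_leI)
  have \<tau>_anti: "\<tau> y \<le> \<tau> x" if "x \<le> y" for x y
    using that by (cases x; cases y) (auto simp: \<tau>_def top_unique intro!: ennreal_leI divide_left_mono)
  have \<tau>_le: "x \<le> y" if "\<tau> y \<le> \<tau> x" for x y
    using that by (cases x; cases y)
      (auto simp: \<tau>_def ennreal_le_iff divide_le_cancel frac_le_eq field_simps add_nonneg_eq_0_iff intro!: ennreal_leI split: if_splits)
  have [measurable]: "\<tau> \<in> borel_measurable borel" unfolding \<tau>_def by measurable
  have Emeas [measurable]: "E \<in> sets M" using E by (intro sets_borel_M) auto
  define J where "J g = (\<integral>\<^sup>+x\<in>E. \<tau> (g x) * w x \<partial>M)" for g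
  have Jm: "(\<lambda>x. \<tau> (g x) * w x * indicator E x) \<in> borel_measurable M" if "g \<in> W" for g
    using borel_measurable_M[OF Wm[OF that]] w(1) by measurable
  have J_fin: "J g < \<infinity>" for g
  proof -
    have "J g \<le> (\<integral>\<^sup>+x. 1 * w x \<partial>M)"
      unfolding J_def by (intro nn_integral_mono) (auto simp: indicator_def intro!: mult_right_mono[OF \<tau>1, simplified])
    then show ?thesis using w(2) by (auto simp: less_top top_unique)
  qed
  have J_anti: "J h \<le> J g" if "\<And>x. g x \<le> h x" for g h
    unfolding J_def by (intro nn_integral_mono mult_right_mono \<tau>_anti that) auto
  have "W \<noteq> {}" using W_ex[OF g0] by auto
  then obtain j :: "nat \<Rightarrow> ennreal" where j: "range j \<subseteq> J ` W" "Sup (J ` W) = Sup (range j)"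
    using ennreal_SUP_countable_SUP[of W J] by auto
  have "\<exists>g\<in>W. j i = J g" for i using j(1) by blast
  then obtain g where g: "\<And>i. g i \<in> W" "\<And>i. j i = J (g i)" by metis
  \<comment> \<open>Running minima turn the maximizing sequence into a decreasing one of gradients;
    \<open>J\<close> can only grow under this.\<close>
  define G where "G = rec_nat (g 0) (\<lambda>i h x. min (h x) (g (Suc i) x))"
  have G0: "G 0 = g 0" and GS: "G (Suc i) = (\<lambda>x. min (G i x) (g (Suc i) x))" for i
    by (simp_all add: G_def)
  have GW: "G i \<in> W" for i
  proof (induction i)
    case (Suc i)
    then show ?case unfolding GS by (rule W_min[OF _ g(1)])
  qed (simp add: G0 g(1))
  have G_le: "G i x \<le> g i x" for i x by (cases i) (auto simp: G0 GS)
  have dec: "decseq (\<lambda>i. G i x)" for x by (rule decseq_SucI) (simp add: GS)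
  define gg where "gg x = (INF i. G i x)" for x
  have gg_le: "gg x \<le> G i x" for i x unfolding gg_def by (rule INF_lower) simp
  have ggW: "gg \<in> W"
  proof -
    have "good_ug E gg F"
      unfolding gg_def by (rule good_ug_INF[OF E _ _ dec]) (use GW in \<open>auto simp: W_def\<close>)
    moreover have "locally_p_integrable p M E gg"
      by (rule locally_p_integrable_mono[of E "G 0"])
         (use GW[of 0] gg_le[of _ 0] good_ugD(1)[OF calculation] in \<open>auto simp: W_def\<close>)
    ultimately show ?thesis by (simp add: W_def)
  qed
  have J_max: "J h \<le> J gg" if "h \<in> W" for h
  proof -
    have "J h \<le> Sup (J ` W)" using that by (rule SUP_upper)
    also have "\<dots> \<le> J gg"
      unfolding j(2) by (rule SUP_least) (auto simp: g(2) intro: J_anti order_trans[OF gg_le G_le])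
    finally show ?thesis .
  qed
  have "is_minimal_wug p M E f gg"
    unfolding is_minimal_wug_def
  proof (intro conjI allI impI)
    show "weak_upper_gradient p M E gg f"
      using ggW f by (intro good_ug_imp_wug) (auto simp: W_def)
    show "locally_p_integrable p M E gg" using ggW by (simp add: W_def)
    fix h assume "weak_upper_gradient p M E h f \<and> locally_p_integrable p M E h"
    then obtain h' where h': "h' \<in> W" "AE x in M. x \<in> E \<longrightarrow> h x = h' x" using W_ex by blast
    \<comment> \<open>The minimum with a competitor is again admissible and cannot exceed the
      maximum \<open>J gg\<close>. As \<tau> is strictly decreasing and \<open>w\<close> is
      positive, equality of the integrals gives \<open>gg \<le> k\<close> almost everywhere on
      \<open>E\<close>.\<close>
    define k where "k x = min (gg x) (h' x)" for x
    have kW: "k \<in> W" unfolding k_def by (rule W_min[OF ggW h'(1)])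
    have "J gg = J k"
      by (intro antisym J_max[OF kW] J_anti) (simp add: k_def)
    then have "(\<integral>\<^sup>+x. \<tau> (k x) * w x * indicator E x - \<tau> (gg x) * w x * indicator E x \<partial>M) = 0"
      using J_fin[of gg]
      by (subst nn_integral_diff[OF Jm[OF kW] Jm[OF ggW]])
         (auto simp: J_def k_def intro!: mult_right_mono \<tau>_anti)
    moreover have "(\<lambda>x. \<tau> (k x) * w x * indicator E x - \<tau> (gg x) * w x * indicator E x) \<in> borel_measurable M"
      using Jm[OF kW] Jm[OF ggW] by measurable
    ultimately have ae: "AE x in M. \<tau> (k x) * w x * indicator E x - \<tau> (gg x) * w x * indicator E x = 0"
      by (subst (asm) nn_integral_0_iff_AE) auto
    have "AE x in M. x \<in> E \<longrightarrow> gg x \<le> h x"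
      using ae h'(2)
    proof eventually_elim
      case (elim x)
      show ?case
      proof
        assume x: "x \<in> E"
        have fin: "\<tau> (gg x) * w x < top"
          using \<tau>1[of "gg x"] w(3)[of x] by (auto simp: ennreal_mult_less_top intro: le_less_trans)
        have "\<tau> (k x) * w x - \<tau> (gg x) * w x = 0" using elim(1) x by simp
        then have "\<tau> (k x) * w x \<le> \<tau> (gg x) * w x"
          using fin by (simp add: diff_eq_0_iff_ennreal)
        then have "\<tau> (k x) \<le> \<tau> (gg x)"
          using w(3)[of x] by (metis ennreal_mult_le_mult_iff infinity_ennreal_def less_irrefl mult.commute)
        then have "gg x \<le> k x" by (rule \<tau>_le)
        then show "gg x \<le> h x" using elim(2) x by (simp add: k_def)
      qed
    qed
    then show "AE x in restrict_space M E. gg x \<le> h x"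
      by (subst AE_restrict_space_iff) auto
  qed
  then show ?thesis by blast
qed

text \<open>The choice operator in the definition yields something meaningful only because
  \<open>ex_minimal_wug\<close> supplies a witness.\<close>

lemma minimal_wug:
  assumes "open E" "\<And>x. x \<in> E \<Longrightarrow> f x = ereal (F x)"
    "weak_upper_gradient p M E g f" "locally_p_integrable p M E g"
  shows "weak_upper_gradient p M E (minimal_wug p M E f) f"
    "locally_p_integrable p M E (minimal_wug p M E f)"
    "AE x in M. x \<in> E \<longrightarrow> minimal_wug p M E f x \<le> g x"
proof -
  have *: "is_minimal_wug p M E f (minimal_wug p M E f)"
    unfolding minimal_wug_def by (rule someI_ex[OF ex_minimal_wug[OF assms]])
  then show "weak_upper_gradient p M E (minimal_wug p M E f) f"
    "locally_p_integrable p M E (minimal_wug p M E f)"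
    unfolding is_minimal_wug_def by auto
  have "AE x in restrict_space M E. minimal_wug p M E f x \<le> g x"
    using * assms unfolding is_minimal_wug_def by blast
  then show "AE x in M. x \<in> E \<longrightarrow> minimal_wug p M E f x \<le> g x"
    using assms(1) by (subst (asm) AE_restrict_space_iff) (auto intro: sets_borel_M)
qed

end


section \<open>Functions that are locally Newtonian\<close>

context newtonian_space
begin

lemma Lp_sum: "finite I \<Longrightarrow> (\<And>i. i \<in> I \<Longrightarrow> Lp (\<rho> i)) \<Longrightarrow> Lp (\<lambda>x. \<Sum>i\<in>I. \<rho> i x)"
proof (induction I rule: finite_induct)
  case empty
  then show ?case by (simp add: Lp_def)
next
  case (insert i I)
  then show ?case by (simp add: Lp_add)
qed

lemma Lp_indicator:
  assumes "g \<in> borel_measurable borel" "A \<in> sets borel" "(\<integral>\<^sup>+x\<in>A. ennreal_powr (g x) p \<partial>M) < \<infinity>"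
  shows "Lp (\<lambda>x. g x * indicator A x)"
proof -
  have "(\<integral>\<^sup>+x. ennreal_powr (g x * indicator A x) p \<partial>M) = (\<integral>\<^sup>+x\<in>A. ennreal_powr (g x) p \<partial>M)"
    by (intro nn_integral_cong) (auto simp: indicator_def)
  moreover have "(\<lambda>x. g x * indicator A x) \<in> borel_measurable borel" using assms(1,2) by measurable
  ultimately show ?thesis using assms(3) by (simp add: Lp_def)
qed

lemma newtonian_wug:
  assumes "f \<in> newtonian p M E"
  obtains g where "weak_upper_gradient p M E g f" "(\<integral>\<^sup>+x\<in>E. ennreal_powr (g x) p \<partial>M) < \<infinity>"
proof -
  have "(INF g\<in>{g. weak_upper_gradient p M E g f}. \<integral>\<^sup>+x\<in>E. ennreal_powr (g x) p \<partial>M) < \<infinity>"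
    using assms unfolding newtonian_def newtonian_norm_p_def by auto
  then show ?thesis using that by (auto simp: INF_less_iff)
qed

lemma newtonian_good_ug:
  assumes f: "f \<in> newtonian p M E" and E: "open E" and F: "\<And>x. x \<in> E \<Longrightarrow> f x = ereal (F x)"
  obtains g where "good_ug E g F" "Lp g"
proof -
  obtain h where h: "weak_upper_gradient p M E h f" "(\<integral>\<^sup>+x\<in>E. ennreal_powr (h x) p \<partial>M) < \<infinity>"
    using newtonian_wug[OF f] by metis
  obtain g where g: "good_ug E g F" "\<And>x. x \<notin> E \<Longrightarrow> g x = 0" "AE x in M. x \<in> E \<longrightarrow> h x = g x"
    using wug_imp_good_ug[OF h(1) E F] by metis
  have "(\<integral>\<^sup>+x. ennreal_powr (g x) p \<partial>M) = (\<integral>\<^sup>+x\<in>E. ennreal_powr (h x) p \<partial>M)"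
    by (intro nn_integral_cong_AE, rule AE_mp[OF g(3)]) (auto simp: indicator_def g(2))
  then have "Lp g" using h(2) good_ugD(1)[OF g(1)] by (simp add: Lp_def)
  with g(1) show ?thesis by (rule that)
qed

text \<open>A point of \<open>E\<close> is assigned to the first closed ball \<open>C i\<close> that contains it. As only finitely
  many balls come before, the gradients are switched upwards only when a curve leaves \<open>C i\<close>, and
  the sum over the balls whose predecessors miss the point stays locally in \<open>L\<^sup>p\<close>.\<close>

lemma newtonian_loc_good_ug:
  assumes u: "u \<in> newtonian_loc p M E" and E: "open E" "E \<noteq> {}" and F: "\<And>x. x \<in> E \<Longrightarrow> u x = ereal (F x)"
  obtains g where "good_ug E g F" "locally_p_integrable p M E g" "u \<in> borel_measurable (restrict_space M E)"
proof -
  \<comment> \<open>The gradient lives on an open set \<open>B\<close> around the closed ball: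
    closed balls can be removed from open sets without losing openness, and gradients need an open
    domain.\<close>
  define Q where "Q x r \<longleftrightarrow> cball x r \<subseteq> E \<and> u \<in> borel_measurable (restrict_space M (cball x r)) \<and>
    (\<exists>B g. open B \<and> cball x r \<subseteq> B \<and> B \<subseteq> E \<and> good_ug B g F \<and> Lp g)" for x r
  have ex: "\<exists>r>0. Q x r" if x: "x \<in> E" for x
  proof -
    obtain y s where y: "s > 0" "x \<in> ball y s" "u \<in> newtonian p M (ball y s \<inter> E)"
      using u x unfolding newtonian_loc_def by blast
    have op: "open (ball y s \<inter> E)" using E by auto
    obtain g where g: "good_ug (ball y s \<inter> E) g F" "Lp g"
      using newtonian_good_ug[OF y(3) op F] by (metis IntE)
    obtain r where r: "r > 0" "cball x r \<subseteq> ball y s \<inter> E"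
      using op y(2) x by (metis IntI open_contains_cball)
    have m: "u \<in> borel_measurable (restrict_space M (ball y s \<inter> E))"
      using y(3) unfolding newtonian_def by simp
    have "restrict_space (restrict_space M (ball y s \<inter> E)) (cball x r) = restrict_space M (cball x r)"
      using r(2) op by (subst restrict_restrict_space) (auto simp: Int_absorb1 intro!: sets_borel_M)
    then have "u \<in> borel_measurable (restrict_space M (cball x r))"
      using measurable_restrict_space1[OF m, of "cball x r"] by simp
    then have "Q x r" unfolding Q_def using r g op by blast
    then show ?thesis using r(1) by blast
  qed
  obtain x r where x: "\<And>i::nat. x i \<in> E" "\<And>i. r i > 0" "\<And>i. Q (x i) (r i)" "E \<subseteq> (\<Union>i. ball (x i) (r i))"
    by (rule countable_ball_cover[of E Q, OF E ex], assumption) (rule that)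
  define C where "C i = cball (x i) (r i)" for i
  have "\<forall>i. \<exists>B g. open B \<and> C i \<subseteq> B \<and> B \<subseteq> E \<and> good_ug B g F \<and> Lp g"
    using x(3) unfolding Q_def C_def by blast
  then obtain B g where B: "\<And>i. open (B i)" "\<And>i. C i \<subseteq> B i" "\<And>i. B i \<subseteq> E"
    and g: "\<And>i. good_ug (B i) (g i) F" "\<And>i. Lp (g i)" by metis
  \<comment> \<open>Open, and disjoint from every earlier closed ball. A neighbourhood of a point of
    \<open>ball (x j) (r j)\<close> lies in \<open>C j\<close> and therefore meets only the sets
    \<open>D i\<close> with \<open>i \<le> j\<close>, so the sum \<open>h\<close> is locally
    finite.\<close>
  define D where "D i = B i - (\<Union>j<i. C j)" for i
  have openD: "open (D i)" for i
    unfolding D_def C_def by (intro open_Diff B closed_UN) auto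
  then have [measurable]: "D i \<in> sets borel" for i by simp
  have [measurable]: "g i \<in> borel_measurable borel" for i using g(2) by (rule LpD)
  define h where "h y = (\<Sum>i. g i y * indicator (D i) y)" for y
  have hm: "h \<in> borel_measurable borel" unfolding h_def by measurable
  have h_ge: "g i y \<le> h y" if "y \<in> D i" for i y
    unfolding h_def using sum_le_suminf[of "\<lambda>i. g i y * indicator (D i) y" "{i}"] that by simp
  have first: "\<exists>i. y \<in> C i \<and> y \<in> D i" if "y \<in> E" for y
  proof -
    have "y \<in> (\<Union>i. ball (x i) (r i))" using x(4) that by (rule subsetD)
    then have ex: "\<exists>i. y \<in> C i" by (auto simp: C_def intro: less_imp_le)
    define i where "i = (LEAST i. y \<in> C i)"
    have "y \<in> C i" unfolding i_def by (rule LeastI_ex[OF ex])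
    moreover have "y \<notin> C j" if "j < i" for j using not_less_Least[of j] that unfolding i_def by blast
    ultimately show ?thesis using B(2) unfolding D_def by blast
  qed
  have "locally_p_integrable p M E h"
    unfolding locally_p_integrable_def
  proof (intro conjI ballI)
    show "h \<in> borel_measurable (restrict_space M E)"
      by (intro measurable_restrict_space1 borel_measurable_M hm)
    fix y assume "y \<in> E"
    then obtain j where j: "y \<in> ball (x j) (r j)" using x(4) by blast
    then obtain e where e: "e > 0" "ball y e \<subseteq> C j"
      unfolding C_def by (meson ball_subset_cball open_ball open_contains_ball order_trans)
    have "Lp (\<lambda>z. \<Sum>i\<le>j. g i z)" by (intro Lp_sum g) auto
    then have fin: "(\<integral>\<^sup>+z. ennreal_powr (\<Sum>i\<le>j. g i z) p \<partial>M) < \<infinity>" by (rule LpD)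
    have "(\<integral>\<^sup>+z\<in>ball y e \<inter> E. ennreal_powr (h z) p \<partial>M) \<le> (\<integral>\<^sup>+z. ennreal_powr (\<Sum>i\<le>j. g i z) p \<partial>M)"
    proof (rule nn_integral_mono)
      fix z
      have "h z \<le> (\<Sum>i\<le>j. g i z)" if "z \<in> ball y e"
      proof -
        have "z \<in> C j" using e(2) that by (rule subsetD)
        then have "z \<notin> D i" if "i \<notin> {..j}" for i using that unfolding D_def by (auto simp: not_le)
        then have "h z = (\<Sum>i\<le>j. g i z * indicator (D i) z)"
          unfolding h_def by (intro suminf_finite) auto
        also have "\<dots> \<le> (\<Sum>i\<le>j. g i z)" by (intro sum_mono) (auto simp: indicator_def)
        finally show ?thesis .
      qed
      then show "ennreal_powr (h z) p * indicator (ball y e \<inter> E) z \<le> ennreal_powr (\<Sum>i\<le>j. g i z) p"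
        using p_gt_1 by (cases "z \<in> ball y e \<inter> E") (auto intro!: ennreal_powr_mono)
    qed
    then show "\<exists>r>0. (\<integral>\<^sup>+z\<in>ball y r \<inter> E. ennreal_powr (h z) p \<partial>M) < \<infinity>"
      using e(1) fin by (intro exI[of _ e]) (auto intro: le_less_trans)
  qed
  moreover have "good_ug E h F"
    unfolding good_ug_def
  proof (intro conjI hm)
    have "aec E (\<lambda>l \<gamma>. \<forall>i. \<forall>a b. 0 \<le> a \<longrightarrow> a < b \<longrightarrow> b \<le> l \<longrightarrow> \<gamma> ` {a..b} \<subseteq> B i \<longrightarrow>
       ac_bound (\<lambda>t. F (\<gamma> t)) (\<lambda>t. g i (\<gamma> t) * indicator {0..l} t) a b)"
      by (intro aec_countable E(1) good_ug_sub g(1) B(1))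
    then show "aec E (\<lambda>l \<gamma>. ac_bound (\<lambda>t. F (\<gamma> t)) (\<lambda>t. h (\<gamma> t) * indicator {0..l} t) 0 l)"
    proof (rule aec_mono)
      fix l \<gamma> assume \<gamma>: "arc_length_curve E l \<gamma>"
        and *: "\<forall>i. \<forall>a b. 0 \<le> a \<longrightarrow> a < b \<longrightarrow> b \<le> l \<longrightarrow> \<gamma> ` {a..b} \<subseteq> B i \<longrightarrow>
          ac_bound (\<lambda>t. F (\<gamma> t)) (\<lambda>t. g i (\<gamma> t) * indicator {0..l} t) a b"
      show "ac_bound (\<lambda>t. F (\<gamma> t)) (\<lambda>t. h (\<gamma> t) * indicator {0..l} t) 0 l"
      proof (rule ac_bound_local[OF along_measurable[OF \<gamma> hm]])
        fix t0 assume t0: "0 \<le> t0" "t0 \<le> l"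
        obtain i where i: "\<gamma> t0 \<in> C i" "\<gamma> t0 \<in> D i" using first[OF arc_length_curveD(3)[OF \<gamma> t0]] by blast
        obtain \<delta> where \<delta>: "\<delta> > 0" "ball (\<gamma> t0) \<delta> \<subseteq> D i" using openD[of i] i(2) by (rule openE)
        \<comment> \<open>A curve is 1-Lipschitz, so for this range of parameters it stays in the
          ball around \<open>\<gamma> t0\<close> inside \<open>D i\<close>, where \<open>g i\<close>
          is one of the summands of \<open>h\<close>.\<close>
        define a b where "a = max 0 (t0 - \<delta> / 2)" and "b = min l (t0 + \<delta> / 2)"
        have ab: "0 \<le> a" "a < b" "b \<le> l" "a \<le> t0" "t0 \<le> b"
          using t0 \<delta>(1) arc_length_curveD(1)[OF \<gamma>] by (auto simp: a_def b_def)
        have inD: "\<gamma> t \<in> D i" if "a \<le> t" "t \<le> b" for t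
        proof -
          have "dist (\<gamma> t0) (\<gamma> t) \<le> \<bar>t - t0\<bar>"
            using arc_length_curve_lipschitz[OF \<gamma>, of t0 t] arc_length_curve_lipschitz[OF \<gamma>, of t t0] that ab t0
            by (cases "t0 \<le> t") (auto simp: dist_commute)
          also have "\<dots> < \<delta>" using that \<delta>(1) by (auto simp: a_def b_def)
          finally show ?thesis using \<delta>(2) by auto
        qed
        then have "\<gamma> ` {a..b} \<subseteq> B i" by (auto simp: D_def)
        then have "ac_bound (\<lambda>t. F (\<gamma> t)) (\<lambda>t. g i (\<gamma> t) * indicator {0..l} t) a b"
          using * ab by blast
        then have "ac_bound (\<lambda>t. F (\<gamma> t)) (\<lambda>t. h (\<gamma> t) * indicator {0..l} t) a b"
          by (rule ac_bound_mono) (intro mult_right_mono h_ge inD, auto)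
        then show "\<exists>e>0. ac_bound (\<lambda>t. F (\<gamma> t)) (\<lambda>t. h (\<gamma> t) * indicator {0..l} t) (max 0 (t0 - e)) (min l (t0 + e))"
          using \<delta>(1) by (intro exI[of _ "\<delta> / 2"]) (simp add: a_def b_def)
      qed
    qed
  qed
  moreover have "u \<in> borel_measurable (restrict_space M E)"
  proof (rule measurable_piecewise_restrict[of "range C"])
    have EM: "E \<in> sets M" using E by (intro sets_borel_M) auto
    have CM: "C i \<in> sets M" for i unfolding C_def by (intro sets_borel_M) auto
    show "space (restrict_space M E) \<subseteq> \<Union>(range C)" using first by (auto simp: space_restrict_space)
    fix A assume "A \<in> range C"
    then obtain i where i: "A = C i" by blast
    have CE: "C i \<subseteq> E" using B by blast
    show "A \<inter> space (restrict_space M E) \<in> sets (restrict_space M E)"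
      using CM[of i] CE EM by (auto simp: i sets_restrict_space_iff space_restrict_space)
    have "restrict_space (restrict_space M E) A = restrict_space M (C i)"
      using CM[of i] EM CE by (subst restrict_restrict_space) (auto simp: i Int_absorb1)
    then show "u \<in> borel_measurable (restrict_space (restrict_space M E) A)"
      using x(3)[of i] by (simp add: Q_def C_def)
  qed auto
  ultimately show ?thesis by - (rule that)
qed


section \<open>Curves through sets of capacity zero\<close>

text \<open>Here \<open>e\<close> is the density that excludes curves on which the upper gradient
  inequality fails for some subcurve. The factors \<open>K\<close> and \<kappa> are independent: for
  sets of capacity zero both the gradient and the function are small and both factors are large,
  whereas for parabolicity only the gradient is small and \<kappa> is whatever the function
  admits.\<close>

definition crossing_density :: "('a \<Rightarrow> ennreal) \<Rightarrow> ('a \<Rightarrow> ereal) \<Rightarrow> ('a \<Rightarrow> ennreal) \<Rightarrow> bool" where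
  "crossing_density g f e \<longleftrightarrow> Lp e \<and>
    (\<forall>l \<gamma> t0 \<sigma> K \<kappa>. arc_length_curve UNIV l \<gamma> \<and> 0 \<le> t0 \<and> t0 \<le> l \<and> 1 \<le> f (\<gamma> t0) \<and>
      \<sigma> \<in> borel_measurable borel \<and> line_integral l \<gamma> \<sigma> < \<infinity> \<and> line_integral l \<gamma> e < \<infinity> \<and> K > 0 \<and> \<kappa> > 0 \<and>
      (\<forall>x. ennreal K * g x \<le> \<sigma> x) \<and> (\<forall>x. ennreal \<kappa> * e2ennreal \<bar>f x\<bar> \<le> \<sigma> x) \<longrightarrow>
      ennreal (min (K / 2) (\<kappa> * l / 2)) \<le> line_integral l \<gamma> \<sigma>)"

lemma crossing_densityD:
  assumes "crossing_density g f e" "arc_length_curve UNIV l \<gamma>" "0 \<le> t0" "t0 \<le> l" "1 \<le> f (\<gamma> t0)"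
    "\<sigma> \<in> borel_measurable borel" "line_integral l \<gamma> \<sigma> < \<infinity>" "line_integral l \<gamma> e < \<infinity>" "K > 0" "\<kappa> > 0"
    "\<And>x. ennreal K * g x \<le> \<sigma> x" "\<And>x. ennreal \<kappa> * e2ennreal \<bar>f x\<bar> \<le> \<sigma> x"
  shows "ennreal (min (K / 2) (\<kappa> * l / 2)) \<le> line_integral l \<gamma> \<sigma>"
  using assms unfolding crossing_density_def by blast

text \<open>A curve that passes from the set where \<open>f \<ge> 1\<close> to a point where \<open>\<bar>f\<bar> \<le> 1/2\<close> picks up half of
  the gradient; a curve that does not has length at most twice the integral of \<open>\<bar>f\<bar>\<close>.\<close>

lemma ex_crossing_density:
  assumes g: "weak_upper_gradient p M UNIV g f"
  shows "\<exists>e. crossing_density g f e"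
proof -
  have ae: "aec UNIV (\<lambda>l \<gamma>. oscillation (f (\<gamma> 0)) (f (\<gamma> l)) \<le> line_integral l \<gamma> g)"
    using g unfolding weak_upper_gradient_def by auto
  obtain e where e: "Lp e" "\<And>l \<gamma>. arc_length_curve UNIV l \<gamma> \<Longrightarrow> line_integral l \<gamma> e < \<infinity> \<Longrightarrow>
      \<forall>a b. 0 \<le> a \<longrightarrow> a < b \<longrightarrow> b \<le> l \<longrightarrow> \<gamma> ` {a..b} \<subseteq> UNIV \<longrightarrow>
        oscillation (f (\<gamma> (a + 0))) (f (\<gamma> (a + (b - a)))) \<le> line_integral (b - a) (\<lambda>t. \<gamma> (a + t)) g"
    using aecE[OF aec_sub[OF ae open_UNIV open_UNIV] open_UNIV] by metis
  have "crossing_density g f e"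
    unfolding crossing_density_def
  proof (intro conjI e(1) allI impI, elim conjE)
    fix l \<gamma> t0 \<sigma> K \<kappa>
    assume \<gamma>: "arc_length_curve UNIV l \<gamma>" and t0: "0 \<le> t0" "t0 \<le> l" "1 \<le> f (\<gamma> t0)"
      and \<sigma>: "\<sigma> \<in> borel_measurable borel" "line_integral l \<gamma> \<sigma> < \<infinity>" "line_integral l \<gamma> e < \<infinity>"
      and K: "K > (0::real)" "\<kappa> > (0::real)" "\<forall>x. ennreal K * g x \<le> \<sigma> x" "\<forall>x. ennreal \<kappa> * e2ennreal \<bar>f x\<bar> \<le> \<sigma> x"
    note l = arc_length_curveD(1)[OF \<gamma>]
    have sub: "oscillation (f (\<gamma> a)) (f (\<gamma> b)) \<le> line_integral (b - a) (\<lambda>t. \<gamma> (a + t)) g"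
      if "0 \<le> a" "a < b" "b \<le> l" for a b
      using e(2)[OF \<gamma> \<sigma>(3)] that by simp
    have K_int: "ennreal K * line_integral (b - a) (\<lambda>t. \<gamma> (a + t)) g \<le> line_integral l \<gamma> \<sigma>"
      if "0 \<le> a" "a < b" "b \<le> l" for a b
    proof -
      have "line_integral (b - a) (\<lambda>t. \<gamma> (a + t)) g \<le> line_integral (b - a) (\<lambda>t. \<gamma> (a + t)) (\<lambda>x. ennreal (1 / K) * \<sigma> x)"
      proof (rule line_integral_mono)
        fix t
        have "ennreal (1 / K) * (ennreal K * g (\<gamma> (a + t))) \<le> ennreal (1 / K) * \<sigma> (\<gamma> (a + t))"
          using K(3) by (intro mult_left_mono) auto
        then show "g (\<gamma> (a + t)) \<le> ennreal (1 / K) * \<sigma> (\<gamma> (a + t))"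
          using K(1) by (simp add: mult.assoc[symmetric] ennreal_mult[symmetric])
      qed
      also have "\<dots> = (\<integral>\<^sup>+t\<in>{a..b}. ennreal (1 / K) * \<sigma> (\<gamma> t) \<partial>lborel)"
        using \<sigma>(1) that by (intro line_integral_sub[OF arc_length_curveD(2)[OF \<gamma>]]) auto
      also have "\<dots> \<le> line_integral l \<gamma> (\<lambda>x. ennreal (1 / K) * \<sigma> x)"
        unfolding line_integral_lborel using that by (intro nn_integral_Icc_subset) auto
      also have "\<dots> = ennreal (1 / K) * line_integral l \<gamma> \<sigma>"
        by (rule line_integral_cmult[OF arc_length_curveD(2)[OF \<gamma>] \<sigma>(1)])
      finally have "ennreal K * line_integral (b - a) (\<lambda>t. \<gamma> (a + t)) g \<le> ennreal K * (ennreal (1 / K) * line_integral l \<gamma> \<sigma>)"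
        by (rule mult_left_mono) simp
      then show ?thesis using K(1) by (simp add: mult.assoc[symmetric] ennreal_mult[symmetric])
    qed
    show "ennreal (min (K / 2) (\<kappa> * l / 2)) \<le> line_integral l \<gamma> \<sigma>"
    proof (cases "\<exists>t\<in>{0..l}. \<bar>f (\<gamma> t)\<bar> \<le> ereal (1/2)")
      case True
      then obtain t where t: "0 \<le> t" "t \<le> l" "\<bar>f (\<gamma> t)\<bar> \<le> ereal (1/2)" by auto
      \<comment> \<open>Both orders of the end points are prepared, since \<open>t\<close> may come
        before or after \<open>t0\<close>.\<close>
      have osc: "ennreal (1/2) \<le> oscillation (f (\<gamma> t)) (f (\<gamma> t0))" "ennreal (1/2) \<le> oscillation (f (\<gamma> t0)) (f (\<gamma> t))"
        using t(3) t0(3) by (cases "f (\<gamma> t)"; cases "f (\<gamma> t0)";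
            auto simp: oscillation_def e2ennreal_ereal one_ereal_def intro!: ennreal_leI simp del: ennreal_half)+
      have "t \<noteq> t0" using t(3) t0(3) by (cases "f (\<gamma> t0)") (auto simp: one_ereal_def)
      then obtain a b where ab: "0 \<le> a" "a < b" "b \<le> l" "ennreal (1/2) \<le> oscillation (f (\<gamma> a)) (f (\<gamma> b))"
        using t t0 osc by (cases "t < t0") (auto simp: not_less order_le_less)
      have "ennreal (K / 2) = ennreal K * ennreal (1/2)" using K by (simp add: ennreal_mult[symmetric] del: ennreal_half)
      also have "\<dots> \<le> ennreal K * line_integral (b - a) (\<lambda>t. \<gamma> (a + t)) g"
        using sub[OF ab(1-3)] ab(4) by (intro mult_left_mono) auto
      also have "\<dots> \<le> line_integral l \<gamma> \<sigma>" by (rule K_int[OF ab(1-3)])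
      finally show ?thesis by (rule order_trans[rotated]) (auto intro!: ennreal_leI)
    next
      case False
      have "ennreal (\<kappa> * l / 2) = (\<integral>\<^sup>+t\<in>{0..l}. ennreal (\<kappa> / 2) \<partial>lborel)"
        using l K by (simp add: nn_integral_cmult_indicator ennreal_mult[symmetric])
      also have "\<dots> \<le> line_integral l \<gamma> \<sigma>"
        unfolding line_integral_lborel
      proof (rule nn_integral_mono)
        fix t show "ennreal (\<kappa> / 2) * indicator {0..l} t \<le> \<sigma> (\<gamma> t) * indicator {0..l} t"
        proof (cases "t \<in> {0..l}")
          case True
          then have "ereal (1/2) < \<bar>f (\<gamma> t)\<bar>" using False by (auto simp: not_le)
          then have "ennreal (1/2) \<le> e2ennreal \<bar>f (\<gamma> t)\<bar>"
            by (cases "f (\<gamma> t)") (auto simp: e2ennreal_ereal intro!: ennreal_leI simp del: ennreal_half)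
          then have "ennreal \<kappa> * ennreal (1/2) \<le> ennreal \<kappa> * e2ennreal \<bar>f (\<gamma> t)\<bar>" by (rule mult_left_mono) simp
          also have "\<dots> \<le> \<sigma> (\<gamma> t)" using K(4) by blast
          finally show ?thesis using True K(2) by (simp add: ennreal_mult[symmetric] del: ennreal_half)
        qed simp
      qed
      finally show ?thesis by (rule order_trans[rotated]) (auto intro!: ennreal_leI)
    qed
  qed
  then show ?thesis by blast
qed

end


section \<open>Densities obtained from capacity zero and from parabolicity\<close>

context newtonian_space
begin

text \<open>In contrast to \<open>Lp_countable\<close> the factors \<open>2^j\<close> are prescribed
  and unbounded. The assumed decay cancels their \<open>p\<close>-th powers and leaves a geometric
  series.\<close>

lemma Lp_series:
  fixes a :: "nat \<Rightarrow> 'a \<Rightarrow> ennreal"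
  assumes [measurable]: "\<And>j. a j \<in> borel_measurable borel"
    and int: "\<And>j. (\<integral>\<^sup>+x. ennreal_powr (a j x) p \<partial>M) \<le> ennreal ((1/2)^j / (2^j) powr p)"
  obtains \<sigma> where "Lp \<sigma>" "\<And>j x. ennreal (2^j) * a j x \<le> \<sigma> x"
proof -
  have [measurable]: "a j \<in> borel_measurable M" for j by (intro borel_measurable_M) simp
  define h where "h x = (\<Sum>j. ennreal_powr (ennreal (2^j) * a j x) p)" for x
  have "(\<integral>\<^sup>+x. h x \<partial>M) = (\<Sum>j. (\<integral>\<^sup>+x. ennreal_powr (ennreal (2^j) * a j x) p \<partial>M))"
    unfolding h_def by (rule nn_integral_suminf) measurable
  also have "\<dots> \<le> (\<Sum>j. ennreal ((1/2)^j))"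
  proof (intro suminf_le)
    fix j :: nat
    have "(\<integral>\<^sup>+x. ennreal_powr (ennreal (2^j) * a j x) p \<partial>M) = ennreal ((2^j) powr p) * (\<integral>\<^sup>+x. ennreal_powr (a j x) p \<partial>M)"
      by (subst ennreal_powr_cmult) (auto simp: nn_integral_cmult)
    also have "\<dots> \<le> ennreal ((2^j) powr p) * ennreal ((1/2)^j / (2^j) powr p)"
      by (intro mult_left_mono int) auto
    also have "\<dots> = ennreal ((1/2)^j)" by (simp add: ennreal_mult[symmetric])
    finally show "(\<integral>\<^sup>+x. ennreal_powr (ennreal (2^j) * a j x) p \<partial>M) \<le> ennreal ((1/2)^j)" .
  qed auto
  also have "\<dots> = ennreal (\<Sum>j. (1/2)^j)" by (rule suminf_ennreal2) (auto simp: summable_geometric)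
  finally have fin: "(\<integral>\<^sup>+x. h x \<partial>M) < \<infinity>" by (auto simp: le_less_trans)
  define \<sigma> where "\<sigma> x = ennreal_powr (h x) (1 / p)" for x
  have \<sigma>p: "ennreal_powr (\<sigma> x) p = h x" for x
    unfolding \<sigma>_def using p_gt_1 by (intro ennreal_powr_powr) auto
  show ?thesis
  proof (rule that[of \<sigma>])
    have "\<sigma> \<in> borel_measurable borel" unfolding \<sigma>_def h_def by measurable
    then show "Lp \<sigma>" unfolding Lp_def \<sigma>p using fin by simp
    fix j x
    have "ennreal_powr (ennreal (2^j) * a j x) p \<le> h x"
      unfolding h_def using sum_le_suminf[of "\<lambda>j. ennreal_powr (ennreal (2^j) * a j x) p" "{j}"] by simp
    then have "ennreal_powr (ennreal_powr (ennreal (2^j) * a j x) p) (1 / p) \<le> \<sigma> x"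
      unfolding \<sigma>_def using p_gt_1 by (intro ennreal_powr_mono) auto
    then show "ennreal (2^j) * a j x \<le> \<sigma> x"
      using p_gt_1 by (subst (asm) ennreal_powr_powr) auto
  qed
qed

lemma restrict_UNIV: "restrict_space M UNIV = M"
  using sets.top[of M] by (intro measure_eqI) (auto simp: sets_restrict_space emeasure_restrict_space image_def)

lemma borel_majorant_UNIV:
  fixes h :: "'a \<Rightarrow> ennreal"
  assumes "h \<in> borel_measurable M"
  obtains h' where "h' \<in> borel_measurable borel" "\<And>x. h x \<le> h' x"
    "(\<integral>\<^sup>+x. ennreal_powr (h' x) p \<partial>M) = (\<integral>\<^sup>+x. ennreal_powr (h x) p \<partial>M)"
proof -
  obtain h' where h': "h' \<in> borel_measurable borel" "\<And>x. x \<in> UNIV \<Longrightarrow> h x \<le> h' x" "AE x in M. x \<in> UNIV \<longrightarrow> h x = h' x"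
    using borel_majorant[of h UNIV] assms by (auto simp: restrict_UNIV)
  have "(\<integral>\<^sup>+x. ennreal_powr (h' x) p \<partial>M) = (\<integral>\<^sup>+x. ennreal_powr (h x) p \<partial>M)"
    by (rule nn_integral_cong_AE, rule AE_mp[OF h'(3)]) auto
  then show ?thesis using h' that by simp
qed

lemma wug_measurable: "weak_upper_gradient p M UNIV g f \<Longrightarrow> g \<in> borel_measurable M"
  unfolding weak_upper_gradient_def by (simp add: restrict_UNIV)

lemma newtonian_abs_measurable:
  assumes "f \<in> newtonian p M UNIV"
  shows "(\<lambda>x. e2ennreal \<bar>f x\<bar>) \<in> borel_measurable M"
proof -
  have [measurable]: "f \<in> borel_measurable M" using assms unfolding newtonian_def by (simp add: restrict_UNIV)
  show ?thesis by measurable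
qed

lemma Lp_imp_locally_p_integrable:
  assumes "Lp h"
  shows "locally_p_integrable p M E h"
  unfolding locally_p_integrable_def
proof (intro conjI ballI exI)
  show "h \<in> borel_measurable (restrict_space M E)"
    by (intro measurable_restrict_space1 borel_measurable_M LpD assms)
  fix x
  show "(\<integral>\<^sup>+y\<in>ball x 1 \<inter> E. ennreal_powr (h y) p \<partial>M) < \<infinity>"
    by (rule le_less_trans[OF nn_integral_mono LpD(2)[OF assms]]) (simp add: indicator_def)
qed simp

lemma Lp_along:
  assumes "\<And>x. \<rho> x \<le> ennreal c * \<sigma> x" "arc_length_curve E l \<gamma>" "line_integral l \<gamma> \<sigma> < \<infinity>" "\<sigma> \<in> borel_measurable borel"
  shows "line_integral l \<gamma> \<rho> < \<infinity>"
proof -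
  have "line_integral l \<gamma> \<rho> \<le> line_integral l \<gamma> (\<lambda>x. ennreal c * \<sigma> x)"
    by (rule line_integral_mono) (rule assms(1))
  also have "\<dots> = ennreal c * line_integral l \<gamma> \<sigma>"
    by (rule line_integral_cmult[OF arc_length_curveD(2)[OF assms(2)] assms(4)])
  finally show ?thesis using assms(3) by (auto simp: ennreal_mult_less_top intro: le_less_trans)
qed

lemma ex_crossing_density_countable:
  assumes g: "\<And>j::nat. weak_upper_gradient p M UNIV (g j) (f j)"
  shows "\<exists>e. Lp e \<and> (\<forall>j. crossing_density (g j) (f j) e)"
proof -
  have "\<exists>e. crossing_density (g j) (f j) e" for j
    by (rule ex_crossing_density[OF g])
  then obtain e where e: "\<And>j. crossing_density (g j) (f j) (e j)" by metis
  then have "\<And>j. Lp (e j)" by (simp add: crossing_density_def)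
  from Lp_countable[of e, OF this]
  obtain \<sigma>' c where \<sigma>': "Lp \<sigma>'" "\<And>i x. e i x \<le> ennreal (c i) * \<sigma>' x" by auto
  have "crossing_density (g j) (f j) \<sigma>'" for j
    unfolding crossing_density_def
  proof (intro conjI \<sigma>'(1) allI impI, elim conjE)
    fix l \<gamma> t0 \<sigma> K \<kappa>
    assume *: "arc_length_curve UNIV l \<gamma>" "0 \<le> t0" "t0 \<le> l" "1 \<le> f j (\<gamma> t0)"
      "\<sigma> \<in> borel_measurable borel" "line_integral l \<gamma> \<sigma> < \<infinity>" "line_integral l \<gamma> \<sigma>' < \<infinity>" "K > (0::real)" "\<kappa> > (0::real)"
      "\<forall>x. ennreal K * g j x \<le> \<sigma> x" "\<forall>x. ennreal \<kappa> * e2ennreal \<bar>f j x\<bar> \<le> \<sigma> x"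
    have "line_integral l \<gamma> (e j) < \<infinity>"
      by (rule Lp_along[OF \<sigma>'(2) *(1,7) LpD(1)[OF \<sigma>'(1)]])
    from crossing_densityD[OF e *(1-6) this *(8,9) *(10,11)[rule_format]]
    show "ennreal (min (K / 2) (\<kappa> * l / 2)) \<le> line_integral l \<gamma> \<sigma>" .
  qed
  with \<sigma>'(1) show ?thesis by blast
qed

text \<open>Take admissible functions whose norms are so small that \<open>2^j\<close> times the
  function and \<open>2^j\<close> times its gradient are below one density for all \<open>j\<close>.
  A curve of length \<open>l\<close> through \<open>E\<close> then has integral at least
  \<open>2^j * min (1/2) (l/2)\<close> for every \<open>j\<close>.\<close>

lemma capacity_zero_density:
  assumes "sobolev_capacity p M E = 0"
  obtains \<rho> where "Lp \<rho>"
    "\<And>l \<gamma> t. arc_length_curve UNIV l \<gamma> \<Longrightarrow> 0 \<le> t \<Longrightarrow> t \<le> l \<Longrightarrow> \<gamma> t \<in> E \<Longrightarrow> line_integral l \<gamma> \<rho> = \<infinity>"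
proof -
  define \<epsilon> where "\<epsilon> j = ennreal ((1/2)^j / (2^j) powr p)" for j :: nat
  have "\<exists>f. f \<in> newtonian p M UNIV \<and> (\<forall>x\<in>E. 1 \<le> f x) \<and> newtonian_norm_p p M UNIV f < \<epsilon> j" for j
  proof -
    have "sobolev_capacity p M E < \<epsilon> j" unfolding assms \<epsilon>_def by simp
    then show ?thesis unfolding sobolev_capacity_def by (simp add: INF_less_iff conj_assoc)
  qed
  then obtain f where f: "\<And>j. f j \<in> newtonian p M UNIV" "\<And>j x. x \<in> E \<Longrightarrow> 1 \<le> f j x"
    "\<And>j. newtonian_norm_p p M UNIV (f j) < \<epsilon> j" by metis
  have "\<exists>g. weak_upper_gradient p M UNIV g (f j) \<and> (\<integral>\<^sup>+x. ennreal_powr (g x) p \<partial>M) < \<epsilon> j" for j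
  proof -
    have "(INF g\<in>{g. weak_upper_gradient p M UNIV g (f j)}. \<integral>\<^sup>+x\<in>UNIV. ennreal_powr (g x) p \<partial>M) < \<epsilon> j"
      by (rule le_less_trans[OF _ f(3)[of j]]) (simp add: newtonian_norm_p_def)
    then show ?thesis by (auto simp: INF_less_iff)
  qed
  then obtain g where g: "\<And>j. weak_upper_gradient p M UNIV (g j) (f j)" "\<And>j. (\<integral>\<^sup>+x. ennreal_powr (g j x) p \<partial>M) < \<epsilon> j"
    by metis
  have f_int: "(\<integral>\<^sup>+x. ennreal_powr (e2ennreal \<bar>f j x\<bar>) p \<partial>M) < \<epsilon> j" for j
    by (rule le_less_trans[OF _ f(3)[of j]]) (simp add: newtonian_norm_p_def)
  have "\<forall>j. \<exists>h. h \<in> borel_measurable borel \<and> (\<forall>x. g j x \<le> h x) \<and> (\<integral>\<^sup>+x. ennreal_powr (h x) p \<partial>M) \<le> \<epsilon> j"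
    using borel_majorant_UNIV[OF wug_measurable[OF g(1)]] g(2) by (metis less_imp_le)
  then obtain g' where g': "\<And>j. g' j \<in> borel_measurable borel" "\<And>j x. g j x \<le> g' j x" "\<And>j. (\<integral>\<^sup>+x. ennreal_powr (g' j x) p \<partial>M) \<le> \<epsilon> j"
    by metis
  have "\<forall>j. \<exists>h. h \<in> borel_measurable borel \<and> (\<forall>x. e2ennreal \<bar>f j x\<bar> \<le> h x) \<and> (\<integral>\<^sup>+x. ennreal_powr (h x) p \<partial>M) \<le> \<epsilon> j"
    using borel_majorant_UNIV[OF newtonian_abs_measurable[OF f(1)]] f_int by (metis less_imp_le)
  then obtain f' where f': "\<And>j. f' j \<in> borel_measurable borel" "\<And>j x. e2ennreal \<bar>f j x\<bar> \<le> f' j x"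
    "\<And>j. (\<integral>\<^sup>+x. ennreal_powr (f' j x) p \<partial>M) \<le> \<epsilon> j"
    by metis
  obtain \<sigma>g where \<sigma>g: "Lp \<sigma>g" "\<And>j x. ennreal (2^j) * g' j x \<le> \<sigma>g x"
    using Lp_series[of g'] g'(1,3) unfolding \<epsilon>_def by metis
  obtain \<sigma>f where \<sigma>f: "Lp \<sigma>f" "\<And>j x. ennreal (2^j) * f' j x \<le> \<sigma>f x"
    using Lp_series[of f'] f'(1,3) unfolding \<epsilon>_def by metis
  obtain e where e: "Lp e" "\<And>j. crossing_density (g j) (f j) e"
    using ex_crossing_density_countable[of g f] g(1) by metis
  define \<rho> where "\<rho> x = (\<sigma>g x + \<sigma>f x) + e x" for x
  have \<rho>: "Lp \<rho>" unfolding \<rho>_def by (intro Lp_add \<sigma>g(1) \<sigma>f(1) e(1))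
  show ?thesis
  proof (rule that[OF \<rho>], rule ccontr)
    fix l \<gamma> t assume \<gamma>: "arc_length_curve UNIV l \<gamma>" and t: "0 \<le> t" "t \<le> l" "\<gamma> t \<in> E"
      and "line_integral l \<gamma> \<rho> \<noteq> \<infinity>"
    then have fin: "line_integral l \<gamma> \<rho> < \<infinity>" by (simp add: less_top)
    have l: "l > 0" by (rule arc_length_curveD(1)[OF \<gamma>])
    have fe: "line_integral l \<gamma> e < \<infinity>"
      by (rule Lp_along[of e 1 \<rho>, OF _ \<gamma> fin LpD(1)[OF \<rho>]]) (simp add: \<rho>_def)
    have ge: "ennreal (min (2^j / 2) (2^j * l / 2)) \<le> line_integral l \<gamma> \<rho>" for j :: nat
    proof (rule crossing_densityD[OF e(2) \<gamma> t(1,2) _ LpD(1)[OF \<rho>] fin fe])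
      show "1 \<le> f j (\<gamma> t)" by (rule f(2)[OF t(3)])
      fix x
      have "ennreal (2^j) * g j x \<le> ennreal (2^j) * g' j x" by (intro mult_left_mono g'(2)) simp
      also have "\<dots> \<le> \<rho> x" using \<sigma>g(2)[of j x] by (simp add: \<rho>_def add.assoc add_increasing2)
      finally show "ennreal (2^j) * g j x \<le> \<rho> x" .
      have "ennreal (2^j) * e2ennreal \<bar>f j x\<bar> \<le> ennreal (2^j) * f' j x" by (intro mult_left_mono f'(2)) simp
      also have "\<dots> \<le> \<sigma>f x" by (rule \<sigma>f(2))
      also have "\<dots> \<le> \<rho> x" by (simp add: \<rho>_def add_increasing add_increasing2)
      finally show "ennreal (2^j) * e2ennreal \<bar>f j x\<bar> \<le> \<rho> x" .
    qed auto
    define m where "m = min (1 / 2) (l / 2)"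
    have m: "m > 0" using l by (simp add: m_def)
    obtain r where r: "line_integral l \<gamma> \<rho> = ennreal r" "0 \<le> r" using fin by (cases "line_integral l \<gamma> \<rho>") auto
    obtain j :: nat where j: "r / m < 2^j" using real_arch_pow[of 2 "r / m"] by auto
    have "r < 2^j * m" using j m by (simp add: field_simps)
    moreover have "2^j * m = min (2^j / 2) (2^j * l / 2)" by (simp add: m_def min_mult_distrib_left)
    ultimately show False using ge[of j] r by (simp add: ennreal_le_iff del: min.bounded_iff min_less_iff_conj)
  qed
qed

text \<open>The functions that are 1 on growing balls have small gradients, but nothing is known
  about the size of their own norms. So the functions are dominated only up to constants
  \<open>c j\<close>, and this is made up for by the length of curves that go far away.\<close>

lemma parabolic_density:
  assumes "p_parabolic p M"
  obtains \<rho> where "Lp \<rho>"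
    "\<And>x C. \<exists>R. \<forall>l \<gamma>. arc_length_curve UNIV l \<gamma> \<longrightarrow> \<gamma> 0 = x \<longrightarrow> R \<le> dist x (\<gamma> l) \<longrightarrow> ennreal C \<le> line_integral l \<gamma> \<rho>"
proof -
  obtain x0 :: 'a where True by blast
  define \<epsilon> where "\<epsilon> j = ennreal ((1/2)^j / (2^j) powr p)" for j :: nat
  have \<epsilon>: "\<epsilon> j > 0" for j unfolding \<epsilon>_def by simp
  have "\<exists>u. u \<in> newtonian p M UNIV \<and> (\<forall>x. indicator (cball x0 (real j)) x \<le> u x \<and> u x \<le> 1) \<and>
    (\<integral>\<^sup>+x. ennreal_powr (minimal_wug p M UNIV u x) p \<partial>M) < \<epsilon> j" for j
  proof -
    have "compact (cball x0 (real j))" by (intro closed_bounded_imp_compact) auto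
    then have "variational_capacity p M (cball x0 (real j)) < \<epsilon> j"
      using assms \<epsilon> unfolding p_parabolic_def by simp
    then show ?thesis unfolding variational_capacity_def by (simp add: INF_less_iff conj_assoc)
  qed
  then obtain u where u: "\<And>j. u j \<in> newtonian p M UNIV"
    "\<And>j x. indicator (cball x0 (real j)) x \<le> u j x" "\<And>j x. u j x \<le> 1"
    "\<And>j. (\<integral>\<^sup>+x. ennreal_powr (minimal_wug p M UNIV (u j) x) p \<partial>M) < \<epsilon> j" by metis
  define g where "g j = minimal_wug p M UNIV (u j)" for j
  have ureal: "u j x = ereal (real_of_ereal (u j x))" for j x
  proof -
    have "0 \<le> u j x" by (rule order_trans[OF _ u(2)]) (simp add: indicator_def)
    then show ?thesis using u(3)[of j x] by (cases "u j x") auto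
  qed
  have g: "weak_upper_gradient p M UNIV (g j) (u j)" for j
  proof -
    obtain h where h: "good_ug UNIV h (\<lambda>x. real_of_ereal (u j x))" "Lp h"
      using newtonian_good_ug[OF u(1) open_UNIV ureal] by metis
    show ?thesis
      unfolding g_def
      by (rule minimal_wug(1)[OF open_UNIV ureal good_ug_imp_wug[OF h(1) ureal] Lp_imp_locally_p_integrable[OF h(2)]])
  qed
  have "\<forall>j. \<exists>h. h \<in> borel_measurable borel \<and> (\<forall>x. g j x \<le> h x) \<and> (\<integral>\<^sup>+x. ennreal_powr (h x) p \<partial>M) \<le> \<epsilon> j"
    using borel_majorant_UNIV[OF wug_measurable[OF g]] u(4)[folded g_def] by (metis less_imp_le)
  then obtain g' where g': "\<And>j. g' j \<in> borel_measurable borel" "\<And>j x. g j x \<le> g' j x" "\<And>j. (\<integral>\<^sup>+x. ennreal_powr (g' j x) p \<partial>M) \<le> \<epsilon> j"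
    by metis
  have u_int: "(\<integral>\<^sup>+x. ennreal_powr (e2ennreal \<bar>u j x\<bar>) p \<partial>M) < \<infinity>" for j
    using u(1)[of j] by (auto simp: newtonian_def newtonian_norm_p_def)
  have "\<forall>j. \<exists>h. Lp h \<and> (\<forall>x. e2ennreal \<bar>u j x\<bar> \<le> h x)"
    using borel_majorant_UNIV[OF newtonian_abs_measurable[OF u(1)]] u_int unfolding Lp_def by metis
  then obtain u' where u': "\<And>j. Lp (u' j)" "\<And>j x. e2ennreal \<bar>u j x\<bar> \<le> u' j x" by metis
  obtain \<sigma>g where \<sigma>g: "Lp \<sigma>g" "\<And>j x. ennreal (2^j) * g' j x \<le> \<sigma>g x"
    using Lp_series[of g'] g'(1,3) unfolding \<epsilon>_def by metis
  obtain \<sigma>u c where \<sigma>u: "Lp \<sigma>u" "\<And>j. c j > (0::real)" "\<And>j x. u' j x \<le> ennreal (c j) * \<sigma>u x"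
    using Lp_countable[of u', OF u'(1)] by auto
  obtain e where e: "Lp e" "\<And>j. crossing_density (g j) (u j) e"
    using ex_crossing_density_countable[of g u] g by metis
  define \<rho> where "\<rho> x = (\<sigma>g x + \<sigma>u x) + e x" for x
  have \<rho>: "Lp \<rho>" unfolding \<rho>_def by (intro Lp_add \<sigma>g(1) \<sigma>u(1) e(1))
  show ?thesis
  proof (rule that[OF \<rho>])
    fix x :: 'a and C :: real
    \<comment> \<open>\<open>j1\<close> puts \<open>x\<close> into the ball where \<open>u j\<close>
      is 1, and \<open>j2\<close> makes \<open>2^j / 2\<close> at least \<open>C\<close>.\<close>
    obtain j1 :: nat where j1: "dist x0 x \<le> real j1" using real_arch_simple by blast
    obtain j2 :: nat where j2: "2 * C < 2^j2" using real_arch_pow[of 2 "2 * C"] by auto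
    define j where "j = max j1 j2"
    have "(2::real)^j2 \<le> 2^j" by (rule power_increasing) (auto simp: j_def)
    then have j: "dist x0 x \<le> real j" "2 * C \<le> 2^j" using j1 j2 by (simp add: j_def, linarith)
    \<comment> \<open>A curve from \<open>x\<close> to distance \<open>R\<close> has length at least
      \<open>2 * C * c j\<close>, so the second term of the crossing estimate, with \<kappa> equal
      to \<open>1 / c j\<close>, is at least \<open>C\<close>.\<close>
    define R where "R = \<bar>2 * C * c j\<bar>"
    show "\<exists>R. \<forall>l \<gamma>. arc_length_curve UNIV l \<gamma> \<longrightarrow> \<gamma> 0 = x \<longrightarrow> R \<le> dist x (\<gamma> l) \<longrightarrow> ennreal C \<le> line_integral l \<gamma> \<rho>"
    proof (intro exI[of _ R] allI impI)
      fix l \<gamma> assume \<gamma>: "arc_length_curve UNIV l \<gamma>" "\<gamma> 0 = x" "R \<le> dist x (\<gamma> l)"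
      have l: "l > 0" by (rule arc_length_curveD(1)[OF \<gamma>(1)])
      show "ennreal C \<le> line_integral l \<gamma> \<rho>"
      proof (cases "line_integral l \<gamma> \<rho> = \<infinity>")
        case False
        then have fin: "line_integral l \<gamma> \<rho> < \<infinity>" by (simp add: less_top)
        have fe: "line_integral l \<gamma> e < \<infinity>"
          by (rule Lp_along[of e 1 \<rho>, OF _ \<gamma>(1) fin LpD(1)[OF \<rho>]]) (simp add: \<rho>_def)
        have "R \<le> l" using \<gamma>(2,3) arc_length_curve_lipschitz[OF \<gamma>(1), of 0 l] l by simp
        then have "C \<le> (1 / c j) * l / 2" using \<sigma>u(2)[of j] by (auto simp: R_def field_simps)
        then have "ennreal C \<le> ennreal (min (2^j / 2) ((1 / c j) * l / 2))"
          using j(2) by (intro ennreal_leI) auto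
        also have "\<dots> \<le> line_integral l \<gamma> \<rho>"
        proof (rule crossing_densityD[OF e(2) \<gamma>(1) order_refl _ _ LpD(1)[OF \<rho>] fin fe])
          have "indicator (cball x0 (real j)) (\<gamma> 0) = (1::ereal)" using j(1) \<gamma>(2) by simp
          then show "1 \<le> u j (\<gamma> 0)" using u(2)[of j "\<gamma> 0"] by simp
          show "1 / c j > 0" using \<sigma>u(2)[of j] by simp
          fix x
          have "ennreal (2^j) * g j x \<le> ennreal (2^j) * g' j x" by (intro mult_left_mono g'(2)) simp
          also have "\<dots> \<le> \<rho> x" using \<sigma>g(2)[of j x] by (simp add: \<rho>_def add.assoc add_increasing2)
          finally show "ennreal (2^j) * g j x \<le> \<rho> x" .
          have "ennreal (1 / c j) * e2ennreal \<bar>u j x\<bar> \<le> ennreal (1 / c j) * (ennreal (c j) * \<sigma>u x)"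
            by (intro mult_left_mono order_trans[OF u'(2) \<sigma>u(3)]) simp
          also have "\<dots> = \<sigma>u x" using \<sigma>u(2)[of j] by (simp add: mult.assoc[symmetric] ennreal_mult[symmetric])
          also have "\<dots> \<le> \<rho> x" by (simp add: \<rho>_def add_increasing add_increasing2)
          finally show "ennreal (1 / c j) * e2ennreal \<bar>u j x\<bar> \<le> \<rho> x" .
        qed (use l in auto)
        finally show ?thesis .
      qed simp
    qed
  qed
qed

end


section \<open>Lower semicontinuous majorants\<close>

text \<open>The library has this for Polish spaces as a type class only.\<close>

lemma finite_borel_measure_regular:
  fixes \<nu> :: "'a::metric_space measure"
  assumes sets: "sets \<nu> = sets borel" and fin: "emeasure \<nu> UNIV < \<infinity>"
    and A: "A \<in> sets borel" and e: "e > 0"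
  shows "\<exists>F U. closed F \<and> open U \<and> F \<subseteq> A \<and> A \<subseteq> U \<and> emeasure \<nu> (U - F) < ennreal e"
proof -
  have fin': "emeasure \<nu> S \<noteq> \<infinity>" for S
  proof -
    have "emeasure \<nu> S \<le> emeasure \<nu> UNIV"
      using sets_eq_imp_space_eq[OF sets] emeasure_space[of \<nu> S] by simp
    then show ?thesis using fin by (auto simp: top_unique)
  qed
  have "A \<in> sigma_sets UNIV {S. open S}" using A by (simp add: borel_def)
  then show ?thesis using e
  proof (induction arbitrary: e)
    case (Basic A)
    \<comment> \<open>The distance to the empty set is 0 by convention, hence the separate case of
      the whole space.\<close>
    define F where "F n = (if A = UNIV then UNIV else {x. 1 / Suc n \<le> infdist x (- A)})" for n :: nat
    have F: "closed (F n)" for n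
      unfolding F_def by (auto intro!: closed_Collect_le continuous_intros)
    have FA: "F n \<subseteq> A" for n
    proof
      fix x assume x: "x \<in> F n"
      show "x \<in> A"
      proof (rule ccontr)
        assume "x \<notin> A"
        then have "infdist x (- A) = 0" by simp
        moreover have "0 < 1 / real (Suc n)" by simp
        ultimately show False using x \<open>x \<notin> A\<close> by (auto simp: F_def split: if_splits)
      qed
    qed
    have dec: "decseq (\<lambda>n. A - F n)"
    proof (rule decseq_SucI)
      fix n
      have "1 / real (Suc (Suc n)) \<le> 1 / real (Suc n)" by (intro divide_left_mono) auto
      then show "A - F (Suc n) \<subseteq> A - F n" by (auto simp: F_def)
    qed
    have "(\<Inter>n. A - F n) = {}"
    proof (rule ccontr)
      assume "(\<Inter>n. A - F n) \<noteq> {}"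
      then obtain x where x: "x \<in> A" "\<And>n. x \<notin> F n" by auto
      have A: "A \<noteq> UNIV" using x(2) unfolding F_def by auto
      have "closed (- A)" using Basic by auto
      then have "infdist x (- A) > 0"
        using x(1) A in_closed_iff_infdist_zero[of "- A" x] infdist_nonneg[of x "- A"] by (auto simp: order_le_less)
      then obtain n :: nat where "1 / Suc n < infdist x (- A)" by (rule nat_approx_posE)
      then show False using x(2)[of n] A by (simp add: F_def)
    qed
    moreover have "(INF n. emeasure \<nu> (A - F n)) = emeasure \<nu> (\<Inter>n. A - F n)"
      using Basic F by (intro INF_emeasure_decseq dec) (auto simp: sets fin'[simplified])
    ultimately have "(INF n. emeasure \<nu> (A - F n)) < ennreal e"
      using Basic by (simp only: emeasure_empty) simp
    then obtain n where "emeasure \<nu> (A - F n) < ennreal e" by (auto simp: INF_less_iff)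
    then show ?case using F FA Basic by (intro exI[of _ "F n"] exI[of _ A]) auto
  next
    case Empty
    then show ?case by (intro exI[of _ "{}"] conjI) simp_all
  next
    case (Compl A)
    obtain F U where FU: "closed F" "open U" "F \<subseteq> A" "A \<subseteq> U" "emeasure \<nu> (U - F) < ennreal e"
      using Compl.IH[OF Compl.prems] by metis
    have "- F - (- U) = U - F" by blast
    then have "emeasure \<nu> (- F - (- U)) < ennreal e" using FU(5) by simp
    moreover have "closed (- U)" "open (- F)" "- U \<subseteq> UNIV - A" "UNIV - A \<subseteq> - F"
      using FU by (auto simp: closed_Compl open_Compl)
    ultimately show ?case by blast
  next
    case (Union A)
    \<comment> \<open>The errors add up to \<open>e / 2\<close>, which leaves room for a strict
      inequality. Only finite unions of the closed sets are closed, so continuity from above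
      replaces the countable union by a finite one.\<close>
    define d where "d i = e / 2 * (1/2)^Suc i" for i
    have d: "d i > 0" for i using Union.prems by (simp add: d_def)
    have "\<exists>F U. closed F \<and> open U \<and> F \<subseteq> A i \<and> A i \<subseteq> U \<and> emeasure \<nu> (U - F) < ennreal (d i)" for i
      by (rule Union.IH) (rule d)
    then obtain F U where FU: "\<And>i. closed (F i)" "\<And>i. open (U i)" "\<And>i. F i \<subseteq> A i" "\<And>i. A i \<subseteq> U i"
      "\<And>i. emeasure \<nu> (U i - F i) < ennreal (d i)" by metis
    have "d sums (e / 2)"
      using sums_mult[OF power_half_series, of "e / 2"] unfolding d_def by (simp only: mult_1_right)
    then have "summable d" and sd: "suminf d = e / 2" by (simp_all only: sums_iff)
    let ?U = "\<Union>i. U i" and ?F = "\<lambda>n. \<Union>i<n. F i"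
    have cF: "closed (?F n)" for n using FU(1) by (intro closed_UN) auto
    have "emeasure \<nu> (?U - (\<Union>i. F i)) \<le> emeasure \<nu> (\<Union>i. U i - F i)"
      using FU by (intro emeasure_mono) (auto simp: sets)
    also have "\<dots> \<le> (\<Sum>i. emeasure \<nu> (U i - F i))"
      using FU by (intro emeasure_subadditive_countably) (auto simp: sets)
    also have "\<dots> \<le> (\<Sum>i. ennreal (d i))"
      using FU(5) by (intro suminf_le) (auto intro: less_imp_le)
    also have "\<dots> = ennreal (e / 2)"
      using d \<open>summable d\<close> by (subst suminf_ennreal2) (auto simp: sd less_imp_le)
    also have "\<dots> < ennreal e" using Union.prems by (intro ennreal_lessI) auto
    finally have "emeasure \<nu> (?U - (\<Union>i. F i)) < ennreal e" .
    moreover have "(INF n. emeasure \<nu> (?U - ?F n)) = emeasure \<nu> (\<Inter>n. ?U - ?F n)"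
      using FU cF by (intro INF_emeasure_decseq) (auto simp: sets fin'[simplified] decseq_def intro!: less_le_trans)
    moreover have "(\<Inter>n. ?U - ?F n) = ?U - (\<Union>i. F i)" by auto
    ultimately have "(INF n. emeasure \<nu> (?U - ?F n)) < ennreal e" by simp
    then obtain n where n: "emeasure \<nu> (?U - ?F n) < ennreal e" by (auto simp: INF_less_iff)
    show ?case
    proof (intro exI conjI)
      show "closed (?F n)" "open ?U" "emeasure \<nu> (?U - ?F n) < ennreal e" using cF FU n by auto
      show "?F n \<subseteq> \<Union>(range A)" "\<Union>(range A) \<subseteq> ?U" using FU(3,4) by blast+
    qed
  qed
qed

section \<open>Lower semicontinuous functions with values in \<open>ennreal\<close>\<close>

definition lsc :: "('a::metric_space \<Rightarrow> ennreal) \<Rightarrow> bool" where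
  "lsc f \<longleftrightarrow> (\<forall>x X. X \<longlonglongrightarrow> x \<longrightarrow> f x \<le> liminf (\<lambda>n. f (X n)))"

lemma lscD: "lsc f \<Longrightarrow> X \<longlonglongrightarrow> x \<Longrightarrow> f x \<le> liminf (\<lambda>n. f (X n))"
  unfolding lsc_def by blast

lemma lsc_borel_measurable:
  fixes f :: "'a::metric_space \<Rightarrow> ennreal"
  assumes "lsc f" shows "f \<in> borel_measurable borel"
proof (rule borel_measurableI_greater)
  fix y
  have "closed {x. f x \<le> y}"
    unfolding closed_sequential_limits
  proof (intro allI impI, elim conjE)
    fix X and x :: 'a assume "\<forall>n. X n \<in> {x. f x \<le> y}" "X \<longlonglongrightarrow> x"
    then have "f x \<le> liminf (\<lambda>n. f (X n))" "liminf (\<lambda>n. f (X n)) \<le> liminf (\<lambda>n::nat. y)"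
      using lscD[OF assms] by (auto intro!: Liminf_mono)
    then show "x \<in> {x. f x \<le> y}" by (simp add: Liminf_const)
  qed
  moreover have "- {x. f x \<le> y} = {x \<in> space borel. y < f x}" by (auto simp: not_le)
  ultimately show "{x \<in> space borel. y < f x} \<in> sets borel" by (metis borel_open open_Compl)
qed

lemma lsc_const: "lsc (\<lambda>x. c)"
  unfolding lsc_def by (simp add: Liminf_const)

lemma lsc_indicator:
  fixes f :: "'a::metric_space \<Rightarrow> ennreal"
  assumes "lsc f" "open U" shows "lsc (\<lambda>x. f x * indicator U x)"
  unfolding lsc_def
proof (intro allI impI)
  fix x :: 'a and X assume X: "X \<longlonglongrightarrow> x"
  show "f x * indicator U x \<le> liminf (\<lambda>n. f (X n) * indicator U (X n))"
  proof (cases "x \<in> U")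
    case True
    have "eventually (\<lambda>n. X n \<in> U) sequentially" using X assms(2) True by (rule topological_tendstoD)
    then have "liminf (\<lambda>n. f (X n)) \<le> liminf (\<lambda>n. f (X n) * indicator U (X n))"
      by (intro Liminf_mono) (auto elim: eventually_mono)
    then show ?thesis using lscD[OF assms(1) X] True by (simp add: order_trans)
  qed simp
qed

text \<open>Fatou's lemma for the counting measure.\<close>

lemma lsc_suminf:
  fixes f :: "nat \<Rightarrow> 'a::metric_space \<Rightarrow> ennreal"
  assumes "\<And>i. lsc (f i)" shows "lsc (\<lambda>x. \<Sum>i. f i x)"
  unfolding lsc_def
proof (intro allI impI)
  fix x :: 'a and X assume X: "X \<longlonglongrightarrow> x"
  have "(\<Sum>i. f i x) \<le> (\<Sum>i. liminf (\<lambda>n. f i (X n)))"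
    by (intro suminf_le lscD[OF assms X]) auto
  also have "\<dots> = (\<integral>\<^sup>+i. liminf (\<lambda>n. f i (X n)) \<partial>count_space UNIV)"
    by (rule nn_integral_count_space_nat[symmetric])
  also have "\<dots> \<le> liminf (\<lambda>n. \<integral>\<^sup>+i. f i (X n) \<partial>count_space UNIV)"
    by (rule nn_integral_liminf) simp
  finally show "(\<Sum>i. f i x) \<le> liminf (\<lambda>n. \<Sum>i. f i (X n))"
    by (simp add: nn_integral_count_space_nat)
qed

text \<open>The power map is an increasing bijection, so each strict bound on the power is a strict
  bound on \<open>f\<close>, and lower semicontinuity is a statement about such bounds.\<close>

lemma lsc_ennreal_powr:
  fixes f :: "'a::metric_space \<Rightarrow> ennreal"
  assumes "lsc f" "p > 0" shows "lsc (\<lambda>x. ennreal_powr (f x) p)"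
  unfolding lsc_def
proof (intro allI impI)
  have le: "y < ennreal_powr z p \<longleftrightarrow> ennreal_powr y (1 / p) < z" for y z
  proof -
    have "ennreal_powr z p \<le> y \<longleftrightarrow> z \<le> ennreal_powr y (1 / p)"
    proof
      assume "ennreal_powr z p \<le> y"
      then have "ennreal_powr (ennreal_powr z p) (1 / p) \<le> ennreal_powr y (1 / p)"
        using assms(2) by (intro ennreal_powr_mono) auto
      then show "z \<le> ennreal_powr y (1 / p)" using assms(2) by (subst (asm) ennreal_powr_powr) auto
    next
      assume "z \<le> ennreal_powr y (1 / p)"
      then have "ennreal_powr z p \<le> ennreal_powr (ennreal_powr y (1 / p)) p"
        using assms(2) by (intro ennreal_powr_mono) auto
      then show "ennreal_powr z p \<le> y" using assms(2) by (subst (asm) ennreal_powr_powr) auto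
    qed
    then show ?thesis by (meson not_le)
  qed
  fix x :: 'a and X assume X: "X \<longlonglongrightarrow> x"
  have "\<forall>y<f x. eventually (\<lambda>n. y < f (X n)) sequentially"
    using lscD[OF assms(1) X] by (simp only: le_Liminf_iff)
  then show "ennreal_powr (f x) p \<le> liminf (\<lambda>n. ennreal_powr (f (X n)) p)"
    by (simp add: le_Liminf_iff le)
qed

context newtonian_space
begin

text \<open>Weighted indicators of concentric open balls, with weights so small that they and their
  products with the measures of the balls are summable. The function is the weight in the
  Vitali--Caratheodory argument; its lower bounds on balls later bound the lengths of curves of
  bounded cost.\<close>

lemma ex_integrable_lsc:
  "\<exists>\<delta> :: 'a \<Rightarrow> ennreal. lsc \<delta> \<and> (\<integral>\<^sup>+x. \<delta> x \<partial>M) < \<infinity> \<and> (\<forall>x. \<delta> x < \<infinity> \<and> 0 < \<delta> x) \<and>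
    (\<forall>x R. \<exists>d>0. \<forall>y\<in>ball x R. ennreal d \<le> \<delta> y)"
proof -
  obtain x0 :: 'a where True by blast
  define B where "B i = ball x0 (real i)" for i :: nat
  have BM: "B i \<in> sets M" for i unfolding B_def by (intro sets_borel_M) auto
  define a where "a i = (1/2)^i / (1 + measure M (B i))" for i
  have a: "a i > 0" for i unfolding a_def by (intro divide_pos_pos add_pos_nonneg) auto
  have a_le: "a i \<le> (1/2)^i" and a_le': "a i * measure M (B i) \<le> (1/2)^i" for i
  proof -
    have "0 < 1 + measure M (B i)" by (intro add_pos_nonneg) auto
    then show "a i \<le> (1/2)^i" "a i * measure M (B i) \<le> (1/2)^i"
      by (auto simp: a_def divide_simps mult_left_le mult_le_cancel_left1 intro!: mult_left_mono)
  qed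
  define \<delta> where "\<delta> x = (\<Sum>i. ennreal (a i) * indicator (B i) x)" for x
  have half: "(\<Sum>i. ennreal ((1/2)^i)) < \<infinity>"
    by (subst suminf_ennreal2) (auto simp: summable_geometric)
  have ge: "ennreal (a i) \<le> \<delta> y" if "y \<in> B i" for i y
    unfolding \<delta>_def using sum_le_suminf[of "\<lambda>i. ennreal (a i) * indicator (B i) y" "{i}"] that by simp
  have ball: "\<exists>d>0. \<forall>y\<in>ball x R. ennreal d \<le> \<delta> y" for x R
  proof -
    obtain i :: nat where i: "dist x0 x + R \<le> real i" using real_arch_simple by blast
    have "y \<in> B i" if "y \<in> ball x R" for y
      using that i dist_triangle[of x0 y x] by (auto simp: B_def)
    then show ?thesis using ge a by blast
  qed
  show ?thesis
  proof (intro exI[of _ \<delta>] conjI allI ball)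
    show "lsc \<delta>" unfolding \<delta>_def by (intro lsc_suminf lsc_indicator lsc_const) (simp add: B_def)
    have "(\<integral>\<^sup>+x. \<delta> x \<partial>M) = (\<Sum>i. ennreal (a i) * emeasure M (B i))"
      unfolding \<delta>_def using BM by (subst nn_integral_suminf) (auto simp: nn_integral_cmult_indicator)
    also have "\<dots> \<le> (\<Sum>i. ennreal ((1/2)^i))"
    proof (intro suminf_le)
      fix i
      have "emeasure M (B i) = ennreal (measure M (B i))"
        using emeasure_ball(2) unfolding B_def by (intro emeasure_eq_ennreal_measure) (auto simp: less_top)
      then show "ennreal (a i) * emeasure M (B i) \<le> ennreal ((1/2)^i)"
        using a_le'[of i] a[of i] by (simp add: ennreal_mult[symmetric] ennreal_leI)
    qed auto
    finally show "(\<integral>\<^sup>+x. \<delta> x \<partial>M) < \<infinity>" using half by (rule le_less_trans)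
    fix x
    have "\<delta> x \<le> (\<Sum>i. ennreal ((1/2)^i))"
      unfolding \<delta>_def using a_le by (intro suminf_le) (auto simp: indicator_def intro!: ennreal_leI)
    then show "\<delta> x < \<infinity>" using half by (rule le_less_trans)
    obtain d where "d > 0" "\<forall>y\<in>ball x 1. ennreal d \<le> \<delta> y" using ball by blast
    then have "0 < ennreal d" "ennreal d \<le> \<delta> x" by auto
    then show "0 < \<delta> x" by (rule less_le_trans)
  qed
qed

text \<open>Vitali--Caratheodory: with a positive integrable \<open>\<delta>\<close> the function \<open>\<rho>\<^sup>p\<close> is
  comparable to \<open>\<delta>\<close> times the number of \<open>n\<close> with \<open>\<rho>\<^sup>p > n \<delta>\<close>, and these superlevel sets are
  enlarged to open sets.\<close>

lemma ex_lsc_majorant: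
  assumes \<rho>: "Lp \<rho>"
  shows "\<exists>\<sigma>. Lp \<sigma> \<and> lsc \<sigma> \<and> (\<forall>x. \<rho> x \<le> \<sigma> x) \<and> (\<forall>x R. \<exists>d>0. \<forall>y\<in>ball x R. ennreal d \<le> \<sigma> y)"
proof -
  obtain \<delta> :: "'a \<Rightarrow> ennreal" where \<delta>: "lsc \<delta>" "(\<integral>\<^sup>+x. \<delta> x \<partial>M) < \<infinity>" "\<And>x. \<delta> x < \<infinity>" "\<And>x. 0 < \<delta> x"
    "\<And>x R. \<exists>d>0. \<forall>y\<in>ball x R. ennreal d \<le> \<delta> y"
    using ex_integrable_lsc by blast
  obtain B where B: "sets B = sets borel" "M = completion B" by (rule obtain_borel)
  have [measurable]: "\<delta> \<in> borel_measurable borel" by (rule lsc_borel_measurable[OF \<delta>(1)])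
  have mB: "f \<in> borel_measurable borel \<Longrightarrow> f \<in> borel_measurable B" for f :: "'a \<Rightarrow> ennreal"
    using measurable_cong_sets[OF B(1) refl] by auto
  have \<delta>B[measurable]: "\<delta> \<in> borel_measurable B" by (rule mB) simp
  define h where "h x = ennreal_powr (\<rho> x) p" for x
  have [measurable]: "\<rho> \<in> borel_measurable borel" using \<rho> by (rule LpD)
  have hm[measurable]: "h \<in> borel_measurable borel" unfolding h_def by measurable
  have h_fin: "(\<integral>\<^sup>+x. h x \<partial>M) < \<infinity>" unfolding h_def using \<rho> by (rule LpD)
  define \<nu> where "\<nu> = density B \<delta>"
  have \<nu>: "sets \<nu> = sets borel" by (simp add: \<nu>_def B(1))
  have em\<nu>: "emeasure \<nu> A = (\<integral>\<^sup>+x. \<delta> x * indicator A x \<partial>M)" if "A \<in> sets borel" for A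
    unfolding \<nu>_def using that B by (simp add: emeasure_density nn_integral_completion)
  have \<nu>fin: "emeasure \<nu> UNIV < \<infinity>" using em\<nu>[of UNIV] \<delta>(2) by simp
  \<comment> \<open>These sets decrease in \<open>n\<close>. Measuring them by \<nu>, with density
    \<delta>, makes the sum of their measures at most the integral of \<open>h\<close>.\<close>
  define A where "A n = {x. of_nat (Suc n) * \<delta> x < h x}" for n :: nat
  have A: "A n \<in> sets borel" for n unfolding A_def by measurable
  have "\<exists>U. open U \<and> A n \<subseteq> U \<and> emeasure \<nu> U \<le> emeasure \<nu> (A n) + ennreal ((1/2)^n)" for n
  proof -
    obtain F U where FU: "closed F" "open U" "F \<subseteq> A n" "A n \<subseteq> U" "emeasure \<nu> (U - F) < ennreal ((1/2)^n)"
      using finite_borel_measure_regular[OF \<nu> \<nu>fin A[of n], of "(1/2)^n"] by auto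
    have "emeasure \<nu> U \<le> emeasure \<nu> (A n \<union> (U - F))"
      using FU A by (intro emeasure_mono) (auto simp: \<nu>)
    also have "\<dots> \<le> emeasure \<nu> (A n) + emeasure \<nu> (U - F)"
      using FU A by (intro emeasure_subadditive) (auto simp: \<nu>)
    also have "\<dots> \<le> emeasure \<nu> (A n) + ennreal ((1/2)^n)" using FU(5) by (intro add_left_mono less_imp_le)
    finally show ?thesis using FU by blast
  qed
  then obtain U where U: "\<And>n. open (U n)" "\<And>n. A n \<subseteq> U n"
    "\<And>n. emeasure \<nu> (U n) \<le> emeasure \<nu> (A n) + ennreal ((1/2)^n)" by metis
  \<comment> \<open>The whole space at index 0 contributes one extra \<delta>: if \<open>m\<close>
    is the first index with \<open>x \<notin> A m\<close>, then \<open>h x\<close> is at most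
    \<open>Suc m\<close> times \<open>\<delta> x\<close>, while the sets \<open>U n\<close> with
    \<open>n < m\<close> account for only \<open>m\<close> of these terms.\<close>
  define k where "k x = (\<Sum>n. \<delta> x * indicator (case n of 0 \<Rightarrow> UNIV | Suc n \<Rightarrow> U n) x)" for x
  have k_lsc: "lsc k"
    unfolding k_def by (intro lsc_suminf lsc_indicator \<delta>(1)) (auto split: nat.split simp: U(1))
  have k_eq: "k x = \<delta> x + (\<Sum>n. \<delta> x * indicator (U n) x)" for x
    unfolding k_def by (subst suminf_offset[of _ 1]) (auto simp: summable_on_def)
  have k_ge: "h x \<le> k x" for x
  proof -
    have part: "of_nat (Suc m) * \<delta> x \<le> k x" if "\<And>n. n < m \<Longrightarrow> x \<in> A n" for m
    proof -
      have "of_nat (Suc m) * \<delta> x = \<delta> x + (\<Sum>n<m. \<delta> x * indicator (U n) x)"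
        using that U(2) by (simp add: distrib_right subset_iff)
      also have "\<dots> \<le> k x" unfolding k_eq by (intro add_left_mono sum_le_suminf) auto
      finally show ?thesis .
    qed
    show ?thesis
    proof (cases "\<exists>n. x \<notin> A n")
      case True
      define m where "m = (LEAST n. x \<notin> A n)"
      have "x \<notin> A m" unfolding m_def by (rule LeastI_ex[OF True])
      then have "h x \<le> of_nat (Suc m) * \<delta> x" by (simp add: A_def not_less)
      also have "\<dots> \<le> k x" by (rule part) (use not_less_Least in \<open>auto simp: m_def\<close>)
      finally show ?thesis .
    next
      \<comment> \<open>The point lies in all \<open>A n\<close>, so infinitely many copies of the
        positive number \<open>\<delta> x\<close> are added and \<open>k x\<close> is
        \<infinity>.\<close>
      case False
      obtain d where d: "\<delta> x = ennreal d" "0 \<le> d" using \<delta>(3)[of x] by (cases "\<delta> x") auto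
      then have "d > 0" using \<delta>(4)[of x] by simp
      have "k x = \<infinity>"
      proof (rule ccontr)
        assume "k x \<noteq> \<infinity>"
        then obtain r where r: "k x = ennreal r" "0 \<le> r" by (cases "k x") auto
        obtain m :: nat where m: "r < real m * d" using \<open>d > 0\<close> reals_Archimedean3 by blast
        have "real (Suc m) * d \<le> r"
          using part[of m] False r d by (simp add: ennreal_of_nat_eq_real_of_nat ennreal_mult[symmetric] del: of_nat_Suc)
        then show False using m \<open>d > 0\<close> by (simp add: distrib_right)
      qed
      then show ?thesis by simp
    qed
  qed
  have sumA: "(\<Sum>n<m. \<delta> x * indicator (A n) x) \<le> h x" for m x
  proof (induction m)
    case (Suc m)
    show ?case
    proof (cases "x \<in> A m")
      case True
      have "(\<Sum>n<Suc m. \<delta> x * indicator (A n) x) \<le> (\<Sum>n<Suc m. \<delta> x)"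
        by (intro sum_mono) (auto simp: indicator_def)
      also have "\<dots> = of_nat (Suc m) * \<delta> x" by (simp only: sum_constant card_lessThan)
      also have "\<dots> \<le> h x" using True by (simp add: A_def less_imp_le)
      finally show ?thesis .
    qed (use Suc in simp)
  qed simp
  have "(\<integral>\<^sup>+x. k x \<partial>M) < \<infinity>"
  proof -
    have [measurable]: "\<delta> \<in> borel_measurable M" by (rule borel_measurable_M) simp
    have [measurable]: "U n \<in> sets M" "A n \<in> sets M" for n using U(1) A by (auto intro: sets_borel_M)
    have geom: "(\<Sum>n. ennreal ((1/2)^n)) < \<infinity>"
      by (subst suminf_ennreal2) (auto simp: summable_geometric)
    have "(\<Sum>n. emeasure \<nu> (A n)) = (\<integral>\<^sup>+x. (\<Sum>n. \<delta> x * indicator (A n) x) \<partial>M)"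
      using A by (subst nn_integral_suminf) (auto simp: em\<nu>)
    also have "\<dots> \<le> (\<integral>\<^sup>+x. h x \<partial>M)"
    proof (rule nn_integral_mono)
      fix x show "(\<Sum>n. \<delta> x * indicator (A n) x) \<le> h x"
        by (rule suminf_le_const[OF _ sumA]) simp
    qed
    finally have \<nu>A: "(\<Sum>n. emeasure \<nu> (A n)) < \<infinity>" using h_fin by (rule le_less_trans)
    have "(\<integral>\<^sup>+x. (\<Sum>n. \<delta> x * indicator (U n) x) \<partial>M) = (\<Sum>n. emeasure \<nu> (U n))"
      using U(1) by (subst nn_integral_suminf) (auto simp: em\<nu>)
    also have "\<dots> \<le> (\<Sum>n. emeasure \<nu> (A n) + ennreal ((1/2)^n))"
      by (intro suminf_le U(3)) auto
    also have "\<dots> = (\<Sum>n. emeasure \<nu> (A n)) + (\<Sum>n. ennreal ((1/2)^n))"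
      by (rule suminf_add[symmetric]) auto
    also have "\<dots> < \<infinity>" using \<nu>A geom by simp
    finally have "(\<integral>\<^sup>+x. (\<Sum>n. \<delta> x * indicator (U n) x) \<partial>M) < \<infinity>" .
    moreover have "(\<integral>\<^sup>+x. k x \<partial>M) = (\<integral>\<^sup>+x. \<delta> x \<partial>M) + (\<integral>\<^sup>+x. (\<Sum>n. \<delta> x * indicator (U n) x) \<partial>M)"
      unfolding k_eq by (rule nn_integral_add) measurable
    ultimately show ?thesis using \<delta>(2) by simp
  qed
  define \<sigma> where "\<sigma> x = ennreal_powr (k x) (1 / p)" for x
  have \<sigma>p: "ennreal_powr (\<sigma> x) p = k x" for x
    unfolding \<sigma>_def using p_gt_1 by (intro ennreal_powr_powr) auto
  have \<sigma>_lsc: "lsc \<sigma>" unfolding \<sigma>_def using p_gt_1 by (intro lsc_ennreal_powr k_lsc) auto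
  show ?thesis
  proof (intro exI[of _ \<sigma>] conjI allI \<sigma>_lsc)
    show "Lp \<sigma>" using lsc_borel_measurable[OF \<sigma>_lsc] \<open>(\<integral>\<^sup>+x. k x \<partial>M) < \<infinity>\<close> by (simp add: Lp_def \<sigma>p)
    show "\<rho> x \<le> \<sigma> x" for x
    proof -
      have "ennreal_powr (h x) (1 / p) \<le> \<sigma> x"
        unfolding \<sigma>_def using p_gt_1 by (intro ennreal_powr_mono k_ge) auto
      then show ?thesis unfolding h_def using p_gt_1 by (subst (asm) ennreal_powr_powr) auto
    qed
    fix x R
    obtain d where d: "d > 0" "\<forall>y\<in>ball x R. ennreal d \<le> \<delta> y" using \<delta>(5) by blast
    show "\<exists>d>0. \<forall>y\<in>ball x R. ennreal d \<le> \<sigma> y"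
    proof (intro exI[of _ "d powr (1 / p)"] conjI ballI)
      fix y assume "y \<in> ball x R"
      then have "ennreal d \<le> \<delta> y" using d(2) by blast
      also have "\<dots> \<le> k y" by (simp add: k_eq)
      finally have "ennreal d \<le> k y" .
      then have "ennreal_powr (ennreal d) (1 / p) \<le> \<sigma> y"
        unfolding \<sigma>_def using p_gt_1 by (intro ennreal_powr_mono) auto
      then show "ennreal (d powr (1 / p)) \<le> \<sigma> y" using d(1) by (simp add: ennreal_powr_ennreal)
    qed (use d in simp)
  qed
qed

end


section \<open>Lipschitz curves and the cost of reaching a closed set\<close>

text \<open>Lipschitz maps of the whole line replace arc length curves in the definition of the
  cost, because they are preserved by concatenation, reversal and pointwise limits and include
  constant maps.\<close>

definition lip1 :: "(real \<Rightarrow> 'a::metric_space) \<Rightarrow> bool" where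
  "lip1 \<gamma> \<longleftrightarrow> (\<forall>s t. dist (\<gamma> s) (\<gamma> t) \<le> \<bar>s - t\<bar>)"

lemma lip1D: "lip1 \<gamma> \<Longrightarrow> dist (\<gamma> s) (\<gamma> t) \<le> \<bar>s - t\<bar>"
  unfolding lip1_def by blast

lemma lip1I_le:
  assumes "\<And>s t. s \<le> t \<Longrightarrow> dist (\<gamma> s) (\<gamma> t) \<le> t - s"
  shows "lip1 \<gamma>"
  unfolding lip1_def
proof (intro allI)
  fix s t show "dist (\<gamma> s) (\<gamma> t) \<le> \<bar>s - t\<bar>"
    using assms[of s t] assms[of t s] by (cases "s \<le> t") (auto simp: dist_commute)
qed

lemma lip1_continuous: "lip1 \<gamma> \<Longrightarrow> continuous_on S \<gamma>"
proof (rule continuous_onI)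
  fix x e :: real assume "lip1 \<gamma>" "0 < e"
  then show "\<exists>d>0. \<forall>x'\<in>S. dist x' x < d \<longrightarrow> dist (\<gamma> x') (\<gamma> x) \<le> e"
    by (intro exI[of _ e]) (auto simp: dist_real_def intro: order_trans[OF lip1D])
qed

lemma lip1_measurable:
  fixes \<rho> :: "'a::metric_space \<Rightarrow> ennreal"
  assumes "lip1 \<gamma>" "\<rho> \<in> borel_measurable borel"
  shows "(\<lambda>t. \<rho> (\<gamma> t)) \<in> borel_measurable borel"
  by (rule measurable_compose[OF borel_measurable_continuous_onI[OF lip1_continuous[OF assms(1)]] assms(2)])

lemma lip1_tendsto:
  assumes "\<And>n. lip1 (\<gamma> n)" "(\<lambda>n. \<gamma> n t) \<longlonglongrightarrow> x" "l \<longlonglongrightarrow> t"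
  shows "(\<lambda>n. \<gamma> n (l n)) \<longlonglongrightarrow> x"
proof -
  have "(\<lambda>n. \<bar>l n - t\<bar> + dist (\<gamma> n t) x) \<longlonglongrightarrow> \<bar>t - t\<bar> + 0"
    by (intro tendsto_intros assms(3) tendsto_dist_iff[THEN iffD1, OF assms(2)])
  then have "(\<lambda>n. \<bar>l n - t\<bar> + dist (\<gamma> n t) x) \<longlonglongrightarrow> 0" by simp
  then have "(\<lambda>n. dist (\<gamma> n (l n)) x) \<longlonglongrightarrow> 0"
  proof (rule tendsto_sandwich[OF _ _ tendsto_const, rotated 2])
    show "\<forall>\<^sub>F n in sequentially. dist (\<gamma> n (l n)) x \<le> \<bar>l n - t\<bar> + dist (\<gamma> n t) x"
    proof (rule always_eventually, rule allI)
      fix n show "dist (\<gamma> n (l n)) x \<le> \<bar>l n - t\<bar> + dist (\<gamma> n t) x"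
        using dist_triangle[of "\<gamma> n (l n)" x "\<gamma> n t"] lip1D[OF assms(1), of n "l n" t] by linarith
    qed
  qed simp
  then show ?thesis by (rule tendsto_dist_iff[THEN iffD2])
qed

lemma borel_measurable_times_Icc:
  fixes h :: "real \<Rightarrow> ennreal"
  assumes [measurable]: "h \<in> borel_measurable borel"
  shows "(\<lambda>t. h t * indicator {a..b} t) \<in> borel_measurable borel"
  by measurable

text \<open>The distance to \<open>F\<close> in the conformally changed length element with density
  \<rho>; the infimum is \<infinity> if no curve from \<open>x\<close> reaches
  \<open>F\<close>.\<close>

definition cost :: "('a::metric_space \<Rightarrow> ennreal) \<Rightarrow> 'a set \<Rightarrow> 'a \<Rightarrow> ennreal" where
  "cost \<rho> F x = (INF (l, \<gamma>)\<in>{(l, \<gamma>). 0 \<le> l \<and> lip1 \<gamma> \<and> \<gamma> 0 = x \<and> \<gamma> l \<in> F}. \<integral>\<^sup>+t\<in>{0..l}. \<rho> (\<gamma> t) \<partial>lborel)"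

lemma cost_le:
  assumes "0 \<le> l" "lip1 \<gamma>" "\<gamma> 0 = x" "\<gamma> l \<in> F"
  shows "cost \<rho> F x \<le> (\<integral>\<^sup>+t\<in>{0..l}. \<rho> (\<gamma> t) \<partial>lborel)"
  unfolding cost_def by (rule INF_lower2[of "(l, \<gamma>)"]) (use assms in auto)

lemma cost_less:
  assumes "cost \<rho> F x < c"
  shows "\<exists>l \<gamma>. 0 \<le> l \<and> lip1 \<gamma> \<and> \<gamma> 0 = x \<and> \<gamma> l \<in> F \<and> (\<integral>\<^sup>+t\<in>{0..l}. \<rho> (\<gamma> t) \<partial>lborel) < c"
  using assms unfolding cost_def INF_less_iff by auto

lemma cost_eq_0:
  assumes "x \<in> F" shows "cost \<rho> F x = 0"
proof -
  have "lip1 (\<lambda>_. x)" by (simp add: lip1_def)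
  then have "cost \<rho> F x \<le> (\<integral>\<^sup>+t\<in>{0..0::real}. \<rho> x \<partial>lborel)"
    using cost_le[of 0 "\<lambda>_. x" x F \<rho>] assms by simp
  also have "(\<integral>\<^sup>+t\<in>{0..0::real}. \<rho> x \<partial>lborel) = \<rho> x * emeasure lborel {0..0::real}"
    by (rule nn_integral_cmult_indicator) simp
  finally show ?thesis by simp
qed

text \<open>Follow the given curve and then a nearly optimal one from its end. Together with the
  reversed version this makes \<rho> an upper gradient of the cost.\<close>

lemma cost_triangle:
  fixes \<rho> :: "'a::metric_space \<Rightarrow> ennreal"
  assumes \<rho>: "\<rho> \<in> borel_measurable borel" and l: "0 \<le> l" and \<gamma>: "lip1 \<gamma>" "\<gamma> 0 = x" "\<gamma> l = y"
  shows "cost \<rho> F x \<le> (\<integral>\<^sup>+t\<in>{0..l}. \<rho> (\<gamma> t) \<partial>lborel) + cost \<rho> F y"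
proof -
  let ?A = "\<integral>\<^sup>+t\<in>{0..l}. \<rho> (\<gamma> t) \<partial>lborel"
  have le: "cost \<rho> F x \<le> ?A + (\<integral>\<^sup>+t\<in>{0..l'}. \<rho> (\<gamma>' t) \<partial>lborel)"
    if \<gamma>': "0 \<le> l'" "lip1 \<gamma>'" "\<gamma>' 0 = y" "\<gamma>' l' \<in> F" for l' \<gamma>'
  proof -
    define \<delta> where "\<delta> t = (if t \<le> l then \<gamma> t else \<gamma>' (t - l))" for t
    have \<delta>: "lip1 \<delta>"
    proof (rule lip1I_le)
      fix s t :: real assume st: "s \<le> t"
      consider "t \<le> l" | "s \<le> l" "l < t" | "l < s" by linarith
      then show "dist (\<delta> s) (\<delta> t) \<le> t - s"
      proof cases
        case 1
        then show ?thesis using lip1D[OF \<gamma>(1), of s t] st by (simp add: \<delta>_def)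
      next
        case 2
        have "dist (\<gamma> s) (\<gamma>' (t - l)) \<le> dist (\<gamma> s) y + dist y (\<gamma>' (t - l))" by (rule dist_triangle)
        also have "\<dots> \<le> (l - s) + (t - l)"
          using lip1D[OF \<gamma>(1), of s l] lip1D[OF \<gamma>'(2), of 0 "t - l"] 2 \<gamma>(3) \<gamma>'(3) by (intro add_mono) auto
        finally show ?thesis using 2 by (simp add: \<delta>_def)
      next
        case 3
        then show ?thesis using lip1D[OF \<gamma>'(2), of "s - l" "t - l"] st by (simp add: \<delta>_def)
      qed
    qed
    have \<delta>': "\<delta> t = \<gamma>' (t - l)" if "l \<le> t" for t
      using that \<gamma>(3) \<gamma>'(3) by (auto simp: \<delta>_def order_le_less)
    have m: "(\<lambda>t. \<rho> (\<delta> t)) \<in> borel_measurable borel" by (rule lip1_measurable[OF \<delta> \<rho>])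
    have "cost \<rho> F x \<le> (\<integral>\<^sup>+t\<in>{0..l + l'}. \<rho> (\<delta> t) \<partial>lborel)"
    proof (rule cost_le[OF _ \<delta>])
      show "0 \<le> l + l'" using l \<gamma>'(1) by simp
      show "\<delta> 0 = x" using l \<gamma>(2) by (simp add: \<delta>_def)
      show "\<delta> (l + l') \<in> F" using \<delta>'[of "l + l'"] \<gamma>'(1,4) by simp
    qed
    also have "\<dots> = (\<integral>\<^sup>+t\<in>{0..l}. \<rho> (\<delta> t) \<partial>lborel) + (\<integral>\<^sup>+t\<in>{l..l + l'}. \<rho> (\<delta> t) \<partial>lborel)"
      by (rule nn_integral_Icc_split[OF m]) (use l \<gamma>' in auto)
    also have "(\<integral>\<^sup>+t\<in>{0..l}. \<rho> (\<delta> t) \<partial>lborel) = ?A"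
      by (intro nn_integral_cong) (auto simp: \<delta>_def indicator_def)
    also have "(\<integral>\<^sup>+t\<in>{l..l + l'}. \<rho> (\<delta> t) \<partial>lborel) = (\<integral>\<^sup>+t\<in>{0..l + l' - l}. \<rho> (\<delta> (l + t)) \<partial>lborel)"
      by (rule nn_integral_lborel_shift[OF borel_measurable_times_Icc[OF m], symmetric])
    also have "\<dots> = (\<integral>\<^sup>+t\<in>{0..l'}. \<rho> (\<gamma>' t) \<partial>lborel)"
      by (intro nn_integral_cong) (auto simp: \<delta>' indicator_def)
    finally show ?thesis .
  qed
  show ?thesis
  proof (cases "cost \<rho> F y = \<infinity>")
    case False
    show ?thesis
    proof (rule ennreal_le_epsilon)
      fix e :: real assume "0 < e"
      then have less: "cost \<rho> F y < cost \<rho> F y + ennreal e"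
        using False ennreal_add_left_cancel_less[of "cost \<rho> F y" 0 "ennreal e"] by (simp add: less_top)
      obtain l' \<gamma>' where \<gamma>': "0 \<le> l'" "lip1 \<gamma>'" "\<gamma>' 0 = y" "\<gamma>' l' \<in> F"
        "(\<integral>\<^sup>+t\<in>{0..l'}. \<rho> (\<gamma>' t) \<partial>lborel) < cost \<rho> F y + ennreal e"
        using cost_less[OF less] by blast
      have "cost \<rho> F x \<le> ?A + (\<integral>\<^sup>+t\<in>{0..l'}. \<rho> (\<gamma>' t) \<partial>lborel)" by (rule le[OF \<gamma>'(1-4)])
      also have "\<dots> \<le> ?A + (cost \<rho> F y + ennreal e)" using \<gamma>'(5) by (intro add_left_mono less_imp_le)
      finally show "cost \<rho> F x \<le> ?A + cost \<rho> F y + ennreal e" by (simp add: add.assoc)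
    qed
  qed simp
qed

lemma cost_triangle':
  fixes \<rho> :: "'a::metric_space \<Rightarrow> ennreal"
  assumes \<rho>: "\<rho> \<in> borel_measurable borel" and l: "0 \<le> l" and \<gamma>: "lip1 \<gamma>" "\<gamma> 0 = x" "\<gamma> l = y"
  shows "cost \<rho> F y \<le> (\<integral>\<^sup>+t\<in>{0..l}. \<rho> (\<gamma> t) \<partial>lborel) + cost \<rho> F x"
proof -
  have "lip1 (\<lambda>t. \<gamma> (l - t))"
    unfolding lip1_def
  proof (intro allI)
    fix s t show "dist (\<gamma> (l - s)) (\<gamma> (l - t)) \<le> \<bar>s - t\<bar>"
      using lip1D[OF \<gamma>(1), of "l - s" "l - t"] by simp
  qed
  then have "cost \<rho> F y \<le> (\<integral>\<^sup>+t\<in>{0..l}. \<rho> (\<gamma> (l - t)) \<partial>lborel) + cost \<rho> F x"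
    using \<gamma> l by (intro cost_triangle[OF \<rho>]) auto
  also have "(\<integral>\<^sup>+t\<in>{0..l}. \<rho> (\<gamma> (l - t)) \<partial>lborel) = (\<integral>\<^sup>+t\<in>{0..l}. \<rho> (\<gamma> t) \<partial>lborel)"
    by (rule nn_integral_lborel_reflect[OF borel_measurable_times_Icc[OF lip1_measurable[OF \<gamma>(1) \<rho>]]])
  finally show ?thesis .
qed

text \<open>Fatou's lemma: a parameter below \<open>L\<close> is eventually below
  \<open>l n\<close>, and the parameter \<open>L\<close> itself is a null set.\<close>

lemma nn_integral_lsc_curves:
  fixes \<rho> :: "'a::metric_space \<Rightarrow> ennreal"
  assumes \<rho>: "lsc \<rho>" and \<gamma>: "\<And>n. lip1 (\<gamma> n)" "\<And>t. (\<lambda>n. \<gamma> n t) \<longlonglongrightarrow> \<delta> t" and l: "l \<longlonglongrightarrow> L"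
  shows "(\<integral>\<^sup>+t\<in>{0..L}. \<rho> (\<delta> t) \<partial>lborel) \<le> liminf (\<lambda>n. \<integral>\<^sup>+t\<in>{0..l n}. \<rho> (\<gamma> n t) \<partial>lborel)"
proof -
  have [measurable]: "(\<lambda>t. \<rho> (\<gamma> n t)) \<in> borel_measurable borel" for n
    by (rule lip1_measurable[OF \<gamma>(1) lsc_borel_measurable[OF \<rho>]])
  have "(\<integral>\<^sup>+t\<in>{0..L}. \<rho> (\<delta> t) \<partial>lborel) \<le> (\<integral>\<^sup>+t. liminf (\<lambda>n. \<rho> (\<gamma> n t) * indicator {0..l n} t) \<partial>lborel)"
  proof (rule nn_integral_mono_AE, rule AE_mp[OF AE_lborel_singleton[of L]], rule AE_I2, rule impI)
    fix t assume "t \<noteq> L"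
    show "\<rho> (\<delta> t) * indicator {0..L} t \<le> liminf (\<lambda>n. \<rho> (\<gamma> n t) * indicator {0..l n} t)"
    proof (cases "t \<in> {0..L}")
      case True
      then have "t < L" using \<open>t \<noteq> L\<close> by simp
      then have "eventually (\<lambda>n. t < l n) sequentially" using l by (rule order_tendstoD(1)[rotated])
      then have le: "liminf (\<lambda>n. \<rho> (\<gamma> n t)) \<le> liminf (\<lambda>n. \<rho> (\<gamma> n t) * indicator {0..l n} t)"
        using True by (intro Liminf_mono) (auto elim: eventually_mono)
      show ?thesis using order_trans[OF lscD[OF \<rho> \<gamma>(2)[of t]] le] True by simp
    qed simp
  qed
  also have "\<dots> \<le> liminf (\<lambda>n. \<integral>\<^sup>+t\<in>{0..l n}. \<rho> (\<gamma> n t) \<partial>lborel)"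
    by (rule nn_integral_liminf) measurable
  finally show ?thesis .
qed

text \<open>Cutting a curve at its first hit keeps it in the complement of \<open>F\<close> before
  that, where \<rho> has a positive lower bound in the application.\<close>

lemma first_hit:
  fixes \<gamma> :: "real \<Rightarrow> 'a::metric_space"
  assumes "closed F" "lip1 \<gamma>" "0 \<le> l" "\<gamma> l \<in> F"
  obtains l' where "0 \<le> l'" "l' \<le> l" "\<gamma> l' \<in> F" "\<And>t. 0 \<le> t \<Longrightarrow> t < l' \<Longrightarrow> \<gamma> t \<notin> F"
proof -
  define Z where "Z = {0..l} \<inter> \<gamma> -` F"
  have "closed Z" unfolding Z_def by (rule continuous_closed_preimage[OF lip1_continuous[OF assms(2)] _ assms(1)]) simp
  then have "compact ({0..l} \<inter> Z)" by (intro compact_Int_closed) auto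
  moreover have "{0..l} \<inter> Z = Z" by (auto simp: Z_def)
  ultimately have Z: "compact Z" by simp
  have "Z \<noteq> {}" using assms by (auto simp: Z_def)
  obtain s where s: "s \<in> Z" "\<And>t. t \<in> Z \<Longrightarrow> s \<le> t"
    using compact_attains_inf[OF Z \<open>Z \<noteq> {}\<close>] by auto
  have "\<gamma> t \<notin> F" if "0 \<le> t" "t < s" for t
    using s(2)[of t] that s(1) unfolding Z_def by auto
  then show ?thesis using s(1) that[of s] by (auto simp: Z_def)
qed

context newtonian_space
begin

text \<open>The Arzela--Ascoli argument. Convergence is first arranged at rational parameters; the
  common Lipschitz constant then makes the values at any parameter a Cauchy sequence in a compact
  set.\<close>

lemma lip1_subsequence:
  fixes \<gamma> :: "nat \<Rightarrow> real \<Rightarrow> 'a"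
  assumes lip: "\<And>n. lip1 (\<gamma> n)" and bdd: "bounded (range (\<lambda>n. \<gamma> n 0))"
  obtains r \<delta> where "strict_mono (r :: nat \<Rightarrow> nat)" "lip1 \<delta>" "\<And>t. (\<lambda>n. \<gamma> (r n) t) \<longlonglongrightarrow> \<delta> t"
proof -
  obtain x0 R where R: "\<And>n. dist x0 (\<gamma> n 0) \<le> R"
    using bdd unfolding bounded_def by auto
  define K where "K t = cball x0 (R + \<bar>t\<bar>)" for t :: real
  have K: "compact (K t)" for t unfolding K_def by (intro closed_bounded_imp_compact) auto
  have inK: "\<gamma> n t \<in> K t" for n t
    using dist_triangle[of x0 "\<gamma> n t" "\<gamma> n 0"] R[of n] lip1D[OF lip, of n 0 t] by (auto simp: K_def)
  define f where "f n q = \<gamma> n (of_rat q)" for n and q :: rat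
  \<comment> \<open>Tychonoff's theorem; with rational indices the product is countable, so
    compactness gives convergent subsequences.\<close>
  have "compactin (product_topology (\<lambda>_::rat. euclidean) UNIV) (PiE UNIV (\<lambda>q. K (of_rat q)))"
    using K by (subst compactin_PiE) auto
  then have "compact (PiE UNIV (\<lambda>q::rat. K (of_rat q)))"
    by (simp add: euclidean_product_topology compactin_euclidean_iff)
  then have "seq_compact (PiE UNIV (\<lambda>q::rat. K (of_rat q)))" by (rule compact_imp_seq_compact)
  moreover have "f n \<in> PiE UNIV (\<lambda>q::rat. K (of_rat q))" for n by (auto simp: f_def inK)
  ultimately obtain g r where r: "strict_mono (r :: nat \<Rightarrow> nat)" "(f \<circ> r) \<longlonglongrightarrow> g"
    using seq_compactE[of "PiE UNIV (\<lambda>q::rat. K (of_rat q))" f] by metis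
  have conv_q: "(\<lambda>n. \<gamma> (r n) (of_rat q)) \<longlonglongrightarrow> g q" for q
  proof -
    have "isCont (\<lambda>h :: rat \<Rightarrow> 'a. h q) g"
      by (rule continuous_on_interior[OF continuous_on_product_coordinates]) simp
    from isCont_tendsto_compose[OF this r(2)] show ?thesis by (simp add: f_def)
  qed
  have "\<exists>y. (\<lambda>n. \<gamma> (r n) t) \<longlonglongrightarrow> y" for t
  proof -
    have "Cauchy (\<lambda>n. \<gamma> (r n) t)"
    proof (rule metric_CauchyI)
      fix e :: real assume e: "0 < e"
      obtain q :: rat where q: "t < of_rat q" "of_rat q < t + e / 3"
        using of_rat_dense[of t "t + e / 3"] e by auto
      have "Cauchy (\<lambda>n. \<gamma> (r n) (of_rat q))" using conv_q by (rule LIMSEQ_imp_Cauchy)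
      then obtain N where N: "\<And>m n. N \<le> m \<Longrightarrow> N \<le> n \<Longrightarrow> dist (\<gamma> (r m) (of_rat q)) (\<gamma> (r n) (of_rat q)) < e / 3"
        using metric_CauchyD[of _ "e / 3"] e by (metis divide_pos_pos zero_less_numeral)
      show "\<exists>N. \<forall>m\<ge>N. \<forall>n\<ge>N. dist (\<gamma> (r m) t) (\<gamma> (r n) t) < e"
      proof (intro exI[of _ N] allI impI)
        fix m n assume mn: "N \<le> m" "N \<le> n"
        have "dist (\<gamma> (r m) t) (\<gamma> (r n) t) \<le> dist (\<gamma> (r m) t) (\<gamma> (r m) (of_rat q))
          + (dist (\<gamma> (r m) (of_rat q)) (\<gamma> (r n) (of_rat q)) + dist (\<gamma> (r n) (of_rat q)) (\<gamma> (r n) t))"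
          by (meson add_left_mono dist_triangle order_trans)
        moreover have "dist (\<gamma> (r m) t) (\<gamma> (r m) (of_rat q)) < e / 3" "dist (\<gamma> (r n) (of_rat q)) (\<gamma> (r n) t) < e / 3"
          using lip1D[OF lip, of "r m" t "of_rat q"] lip1D[OF lip, of "r n" "of_rat q" t] q by auto
        ultimately show "dist (\<gamma> (r m) t) (\<gamma> (r n) t) < e" using N[OF mn] by linarith
      qed
    qed
    moreover have "complete (K t)" using K by (rule compact_imp_complete)
    moreover have "\<forall>n. \<gamma> (r n) t \<in> K t" using inK by blast
    ultimately obtain y where "(\<lambda>n. \<gamma> (r n) t) \<longlonglongrightarrow> y" by (meson completeE)
    then show ?thesis by blast
  qed
  then obtain \<delta> where \<delta>: "\<And>t. (\<lambda>n. \<gamma> (r n) t) \<longlonglongrightarrow> \<delta> t" by metis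
  have "lip1 \<delta>"
    unfolding lip1_def
  proof (intro allI)
    fix s t
    have "(\<lambda>n. dist (\<gamma> (r n) s) (\<gamma> (r n) t)) \<longlonglongrightarrow> dist (\<delta> s) (\<delta> t)" by (intro tendsto_dist \<delta>)
    then show "dist (\<delta> s) (\<delta> t) \<le> \<bar>s - t\<bar>"
      by (rule LIMSEQ_le_const2) (use lip1D[OF lip] in auto)
  qed
  with r(1) show ?thesis using \<delta> by (rule that)
qed

text \<open>Bounded lengths and convergent starting points provide a limit curve. The targets may
  shrink: a constant target gives lower semicontinuity of the cost, and shrinking neighbourhoods of
  a closed set give a curve that hits the set.\<close>

lemma curve_limit:
  fixes \<gamma> :: "nat \<Rightarrow> real \<Rightarrow> 'a" and c :: "nat \<Rightarrow> ennreal"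
  assumes \<rho>: "lsc \<rho>" and lip: "\<And>n. lip1 (\<gamma> n)" and l: "\<And>n. 0 \<le> l n" "\<And>n. l n \<le> B"
    and x: "(\<lambda>n. \<gamma> n 0) \<longlonglongrightarrow> x" and F: "\<And>n. closed (F n)" "decseq F" "\<And>n. \<gamma> n (l n) \<in> F n"
    and c: "\<And>n. (\<integral>\<^sup>+t\<in>{0..l n}. \<rho> (\<gamma> n t) \<partial>lborel) \<le> c n" "c \<longlonglongrightarrow> C"
  shows "\<exists>L \<delta>. 0 \<le> L \<and> lip1 \<delta> \<and> \<delta> 0 = x \<and> (\<forall>n. \<delta> L \<in> F n) \<and> (\<integral>\<^sup>+t\<in>{0..L}. \<rho> (\<delta> t) \<partial>lborel) \<le> C"
proof -
  have "seq_compact {0..B}" by (intro compact_imp_seq_compact) simp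
  then obtain L r1 where r1: "L \<in> {0..B}" "strict_mono (r1 :: nat \<Rightarrow> nat)" "(l \<circ> r1) \<longlonglongrightarrow> L"
    using seq_compactE[of "{0..B}" l] l by (metis atLeastAtMost_iff)
  have "bounded (range (\<lambda>n. \<gamma> (r1 n) 0))"
    using convergent_imp_bounded[OF x] by (rule bounded_subset) auto
  then obtain r2 \<delta> where r2: "strict_mono (r2 :: nat \<Rightarrow> nat)" "lip1 \<delta>" "\<And>t. (\<lambda>n. \<gamma> (r1 (r2 n)) t) \<longlonglongrightarrow> \<delta> t"
    using lip1_subsequence[of "\<lambda>n. \<gamma> (r1 n)"] lip by metis
  define r where "r n = r1 (r2 n)" for n
  have r: "strict_mono r" using strict_mono_o[OF r1(2) r2(1)] by (simp add: r_def[abs_def] o_def)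
  have lr: "(\<lambda>n. l (r n)) \<longlonglongrightarrow> L"
    using LIMSEQ_subseq_LIMSEQ[OF r1(3) r2(1)] by (simp add: r_def o_def)
  have conv: "(\<lambda>n. \<gamma> (r n) t) \<longlonglongrightarrow> \<delta> t" for t using r2(3)[of t] by (simp add: r_def)
  have "\<delta> 0 = x"
    using LIMSEQ_unique[OF conv[of 0]] LIMSEQ_subseq_LIMSEQ[OF x r] by (simp add: o_def)
  moreover have "\<delta> L \<in> F n" for n
  proof (rule Lim_in_closed_set[OF F(1)])
    show "(\<lambda>k. \<gamma> (r k) (l (r k))) \<longlonglongrightarrow> \<delta> L" by (rule lip1_tendsto[OF lip conv lr])
    show "eventually (\<lambda>k. \<gamma> (r k) (l (r k)) \<in> F n) sequentially"
      using eventually_ge_at_top[of n]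
    proof eventually_elim
      case (elim k)
      then have "n \<le> r k" using seq_suble[OF r, of k] by simp
      then show ?case using F(3)[of "r k"] decseqD[OF F(2)] by blast
    qed
  qed simp
  moreover have "(\<integral>\<^sup>+t\<in>{0..L}. \<rho> (\<delta> t) \<partial>lborel) \<le> C"
  proof -
    have "(\<integral>\<^sup>+t\<in>{0..L}. \<rho> (\<delta> t) \<partial>lborel) \<le> liminf (\<lambda>n. \<integral>\<^sup>+t\<in>{0..l (r n)}. \<rho> (\<gamma> (r n) t) \<partial>lborel)"
      by (rule nn_integral_lsc_curves[OF \<rho> lip conv lr])
    also have "\<dots> \<le> liminf (\<lambda>n. c (r n))" by (intro Liminf_mono) (simp add: c(1))
    also have "\<dots> = C"
      using LIMSEQ_subseq_LIMSEQ[OF c(2) r] by (intro lim_imp_Liminf) (auto simp: o_def)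
    finally show ?thesis .
  qed
  ultimately show ?thesis using r1(1) r2(2) by (intro exI[of _ L] exI[of _ \<delta>]) auto
qed

text \<open>The lower bound on \<rho> is not asked for at the final parameter, since a curve cut at
  its first hit ends outside the region where the bound is known.\<close>

lemma lip1_length_bound:
  assumes "lip1 \<gamma>" "0 \<le> l" "\<And>t. 0 \<le> t \<Longrightarrow> t < l \<Longrightarrow> ennreal d \<le> \<rho> (\<gamma> t)" "d > 0"
    "(\<integral>\<^sup>+t\<in>{0..l}. \<rho> (\<gamma> t) \<partial>lborel) \<le> ennreal c" "0 \<le> c"
  shows "l \<le> c / d"
proof -
  have "ennreal (d * l) = (\<integral>\<^sup>+t\<in>{0..l}. ennreal d \<partial>lborel)"
    using assms by (simp add: nn_integral_cmult_indicator ennreal_mult)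
  also have "\<dots> \<le> (\<integral>\<^sup>+t\<in>{0..l}. \<rho> (\<gamma> t) \<partial>lborel)"
    by (rule nn_integral_mono_AE, rule AE_mp[OF AE_lborel_singleton[of l]], rule AE_I2)
       (use assms(3) in \<open>auto simp: indicator_def\<close>)
  also have "\<dots> \<le> ennreal c" by fact
  finally have "d * l \<le> c" using assms(6) by (simp add: ennreal_le_iff)
  then show ?thesis using assms(4) by (simp add: field_simps)
qed

text \<open>Nearly optimal curves, cut where they first meet \<open>F\<close>, run in a bounded set
  on which \<rho> is at least \<open>d\<close>. So their lengths are bounded and they have a limit
  curve that competes for the cost at \<open>x\<close>.\<close>

lemma cost_lsc:
  fixes \<rho> :: "'a \<Rightarrow> ennreal"
  assumes \<rho>: "lsc \<rho>" and pos: "\<And>x R. \<exists>d>0. \<forall>y\<in>ball x R. ennreal d \<le> \<rho> y"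
    and F: "closed F" "- F \<subseteq> ball x0 R"
  shows "lsc (cost \<rho> F)"
  unfolding lsc_def
proof (intro allI impI)
  fix x :: 'a and X assume X: "X \<longlonglongrightarrow> x"
  obtain d where d: "d > 0" "\<And>y. y \<in> ball x0 R \<Longrightarrow> ennreal d \<le> \<rho> y" using pos by metis
  show "cost \<rho> F x \<le> liminf (\<lambda>n. cost \<rho> F (X n))"
    unfolding le_Liminf_iff
  proof (intro allI impI, rule ccontr)
    fix y assume y: "y < cost \<rho> F x" and ne: "\<not> eventually (\<lambda>n. y < cost \<rho> F (X n)) sequentially"
    obtain b where b: "y = ennreal b" "0 \<le> b" using y by (cases y) auto
    have "\<forall>N. \<exists>n>N. cost \<rho> F (X n) \<le> y"
      using ne unfolding eventually_sequentially by (metis linorder_not_le order_less_le not_less_eq_eq Suc_leI)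
    then have inf: "infinite {n. cost \<rho> F (X n) \<le> y}" by (simp add: infinite_nat_iff_unbounded)
    obtain r :: "nat \<Rightarrow> nat" where r: "strict_mono r" "\<And>n. cost \<rho> F (X (r n)) \<le> y"
      using infinite_enumerate[OF inf] by auto
    define P where "P n l \<gamma> \<longleftrightarrow> 0 \<le> l \<and> lip1 \<gamma> \<and> \<gamma> 0 = X (r n) \<and> \<gamma> l \<in> F \<and> l \<le> (b + 1) / d \<and>
      (\<integral>\<^sup>+t\<in>{0..l}. \<rho> (\<gamma> t) \<partial>lborel) \<le> ennreal (b + 1 / Suc n)" for n l \<gamma>
    have "\<exists>l \<gamma>. P n l \<gamma>" for n
    proof -
      have less: "cost \<rho> F (X (r n)) < ennreal (b + 1 / Suc n)"
        using r(2)[of n] b by (intro le_less_trans[OF r(2)]) (simp add: ennreal_less_iff)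
      obtain l \<gamma> where \<gamma>: "0 \<le> l" "lip1 \<gamma>" "\<gamma> 0 = X (r n)" "\<gamma> l \<in> F"
        "(\<integral>\<^sup>+t\<in>{0..l}. \<rho> (\<gamma> t) \<partial>lborel) < ennreal (b + 1 / Suc n)"
        using cost_less[OF less] by blast
      obtain l' where l': "0 \<le> l'" "l' \<le> l" "\<gamma> l' \<in> F" "\<And>t. 0 \<le> t \<Longrightarrow> t < l' \<Longrightarrow> \<gamma> t \<notin> F"
        using first_hit[OF F(1) \<gamma>(2,1,4)] by metis
      have le: "(\<integral>\<^sup>+t\<in>{0..l'}. \<rho> (\<gamma> t) \<partial>lborel) \<le> ennreal (b + 1 / Suc n)"
        by (rule order_trans[OF nn_integral_Icc_subset[of 0 0 l' l] less_imp_le[OF \<gamma>(5)]]) (use l' in auto)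
      also have "\<dots> \<le> ennreal (b + 1)" by (intro ennreal_leI) simp
      finally have le': "(\<integral>\<^sup>+t\<in>{0..l'}. \<rho> (\<gamma> t) \<partial>lborel) \<le> ennreal (b + 1)" .
      have "l' \<le> (b + 1) / d"
      proof (rule lip1_length_bound[OF \<gamma>(2) l'(1) _ d(1) le'])
        fix t assume "0 \<le> t" "t < l'"
        then have "\<gamma> t \<in> - F" using l'(4) by blast
        then show "ennreal d \<le> \<rho> (\<gamma> t)" using F(2) by (intro d(2)) blast
      qed (use b in simp)
      then have "P n l' \<gamma>" using l' \<gamma>(2,3) le unfolding P_def by blast
      then show ?thesis by blast
    qed
    then obtain l \<gamma> where "\<And>n. P n (l n) (\<gamma> n)" by metis
    then have *: "\<And>n. 0 \<le> l n" "\<And>n. lip1 (\<gamma> n)" "\<And>n. \<gamma> n 0 = X (r n)" "\<And>n. \<gamma> n (l n) \<in> F"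
      "\<And>n. l n \<le> (b + 1) / d" "\<And>n. (\<integral>\<^sup>+t\<in>{0..l n}. \<rho> (\<gamma> n t) \<partial>lborel) \<le> ennreal (b + 1 / Suc n)"
      unfolding P_def by blast+
    have "(\<lambda>n. ennreal (b + 1 / Suc n)) \<longlonglongrightarrow> ennreal (b + 0)"
      by (intro tendsto_ennrealI tendsto_add tendsto_const LIMSEQ_Suc[OF lim_1_over_n])
    moreover have "(\<lambda>n. \<gamma> n 0) \<longlonglongrightarrow> x"
      using LIMSEQ_subseq_LIMSEQ[OF X r(1)] *(3) by (simp add: o_def)
    ultimately have "\<exists>L \<delta>. 0 \<le> L \<and> lip1 \<delta> \<and> \<delta> 0 = x \<and> (\<forall>n::nat. \<delta> L \<in> F) \<and>
        (\<integral>\<^sup>+t\<in>{0..L}. \<rho> (\<delta> t) \<partial>lborel) \<le> ennreal b"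
      by (intro curve_limit[where \<gamma>=\<gamma> and l=l and B="(b + 1) / d" and F="\<lambda>_. F" and c="\<lambda>n. ennreal (b + 1 / Suc n)"]
          \<rho> * F(1)) (simp_all add: decseq_def)
    then obtain L \<delta> where "0 \<le> L" "lip1 \<delta>" "\<delta> 0 = x" "\<delta> L \<in> F" "(\<integral>\<^sup>+t\<in>{0..L}. \<rho> (\<delta> t) \<partial>lborel) \<le> ennreal b"
      by blast
    then have "cost \<rho> F x \<le> y" using cost_le[of L \<delta> x F \<rho>] b by (auto intro: order_trans)
    then show False using y by simp
  qed
qed

text \<open>Curves of bounded cost neither leave a large ball nor hit \<open>E\<close>, so by compactness they stay
  away from the neighbourhoods of \<open>E\<close>.\<close>

lemma cost_tendsto_infinity:
  fixes \<rho> :: "'a \<Rightarrow> ennreal"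
  assumes \<rho>: "lsc \<rho>" and pos: "\<And>x R. \<exists>d>0. \<forall>y\<in>ball x R. ennreal d \<le> \<rho> y"
    and hit: "\<And>l \<gamma> t. arc_length_curve UNIV l \<gamma> \<Longrightarrow> 0 \<le> t \<Longrightarrow> t \<le> l \<Longrightarrow> \<gamma> t \<in> E \<Longrightarrow> line_integral l \<gamma> \<rho> = \<infinity>"
    and exit: "\<And>x C. \<exists>R. \<forall>l \<gamma>. arc_length_curve UNIV l \<gamma> \<longrightarrow> \<gamma> 0 = x \<longrightarrow> R \<le> dist x (\<gamma> l) \<longrightarrow> ennreal C \<le> line_integral l \<gamma> \<rho>"
    and E: "closed E" "x \<notin> E" and C: "0 \<le> C"
  shows "\<exists>N. \<forall>n\<ge>N. ennreal C \<le> cost \<rho> ({y. E \<noteq> {} \<and> infdist y E \<le> 1 / Suc n} \<union> {y. real n \<le> dist x0 y}) x"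
proof (rule ccontr)
  \<comment> \<open>The guard \<open>E \<noteq> {}\<close> is there because \<open>infdist\<close>
    to the empty set is 0, which would put every point into the first set.\<close>
  define F where "F n = {y. E \<noteq> {} \<and> infdist y E \<le> 1 / Suc n} \<union> {y. real n \<le> dist x0 y}" for n :: nat
  have \<rho>m: "\<rho> \<in> borel_measurable borel" by (rule lsc_borel_measurable[OF \<rho>])
  assume "\<not> (\<exists>N. \<forall>n\<ge>N. ennreal C \<le> cost \<rho> ({y. E \<noteq> {} \<and> infdist y E \<le> 1 / Suc n} \<union> {y. real n \<le> dist x0 y}) x)"
  then have neg: "\<exists>n\<ge>N. cost \<rho> (F n) x < ennreal C" for N unfolding F_def by (meson not_le)
  obtain R where R: "\<And>l \<gamma>. arc_length_curve UNIV l \<gamma> \<Longrightarrow> \<gamma> 0 = x \<Longrightarrow> R \<le> dist x (\<gamma> l) \<Longrightarrow> ennreal C \<le> line_integral l \<gamma> \<rho>"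
    using exit by metis
  \<comment> \<open>At distance at least 1 from \<open>x\<close> a point differs from
    \<open>x\<close>, so the curve leading to it can be reparameterized as a nonconstant arc length
    curve.\<close>
  define R' where "R' = max R 1"
  obtain d where d: "d > 0" "\<And>y. y \<in> ball x R' \<Longrightarrow> ennreal d \<le> \<rho> y" using pos by metis
  have stay: "dist x (\<gamma> t) < R'"
    if \<gamma>: "lip1 \<gamma>" "\<gamma> 0 = x" "(\<integral>\<^sup>+t\<in>{0..l}. \<rho> (\<gamma> t) \<partial>lborel) < ennreal C" "0 \<le> t" "t \<le> l" for \<gamma> l t
  proof (rule ccontr)
    assume "\<not> dist x (\<gamma> t) < R'"
    then have far: "R \<le> dist x (\<gamma> t)" "1 \<le> dist x (\<gamma> t)" by (auto simp: R'_def)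
    then have "\<gamma> 0 \<noteq> \<gamma> t" using \<gamma>(2) by auto
    then obtain L \<gamma>' where \<gamma>': "arc_length_curve (\<gamma> ` {0..t}) L \<gamma>'" "\<gamma>' 0 = \<gamma> 0" "\<gamma>' L = \<gamma> t"
      "(\<integral>\<^sup>+t\<in>{0..L}. \<rho> (\<gamma>' t) \<partial>lborel) \<le> (\<integral>\<^sup>+t\<in>{0..t}. \<rho> (\<gamma> t) \<partial>lborel)"
      using arc_length_reparam[OF lip1D[OF \<gamma>(1)] \<gamma>(4)] \<rho>m by metis
    have "ennreal C \<le> line_integral L \<gamma>' \<rho>"
      using \<gamma>'(2,3) far \<gamma>(2) by (intro R arc_length_curve_mono[OF \<gamma>'(1)]) auto
    also have "\<dots> \<le> (\<integral>\<^sup>+t\<in>{0..t}. \<rho> (\<gamma> t) \<partial>lborel)" using \<gamma>'(4) by (simp add: line_integral_lborel)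
    also have "\<dots> \<le> (\<integral>\<^sup>+t\<in>{0..l}. \<rho> (\<gamma> t) \<partial>lborel)" by (rule nn_integral_Icc_subset) (use \<gamma>(5) in auto)
    finally show False using \<gamma>(3) by simp
  qed
  \<comment> \<open>From this index on a curve of cost below \<open>C\<close> cannot end in the
    outer part of \<open>F n\<close>, so it ends near \<open>E\<close>.\<close>
  obtain N0 :: nat where N0: "dist x0 x + R' \<le> real N0" using real_arch_simple by blast
  define P where "P N l \<gamma> \<longleftrightarrow> 0 \<le> l \<and> lip1 \<gamma> \<and> \<gamma> 0 = x \<and> l \<le> C / d \<and> E \<noteq> {} \<and> infdist (\<gamma> l) E \<le> 1 / Suc N \<and>
      (\<integral>\<^sup>+t\<in>{0..l}. \<rho> (\<gamma> t) \<partial>lborel) \<le> ennreal C" for N l \<gamma>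
  have "\<exists>l \<gamma>. P N l \<gamma>" for N
  proof -
    obtain n where n: "max N N0 \<le> n" "cost \<rho> (F n) x < ennreal C" using neg by blast
    obtain l \<gamma> where \<gamma>: "0 \<le> l" "lip1 \<gamma>" "\<gamma> 0 = x" "\<gamma> l \<in> F n" "(\<integral>\<^sup>+t\<in>{0..l}. \<rho> (\<gamma> t) \<partial>lborel) < ennreal C"
      using cost_less[OF n(2)] by blast
    have "dist x0 (\<gamma> l) < real n"
      using stay[OF \<gamma>(2,3,5) \<gamma>(1) order_refl] dist_triangle[of x0 "\<gamma> l" x] N0 n(1) by simp
    then have "E \<noteq> {}" "infdist (\<gamma> l) E \<le> 1 / Suc n" using \<gamma>(4) by (auto simp: F_def)
    moreover have "1 / real (Suc n) \<le> 1 / Suc N" using n(1) by (intro divide_left_mono) auto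
    moreover have "l \<le> C / d"
      using stay[OF \<gamma>(2,3,5)] d \<gamma>(5) C by (intro lip1_length_bound[OF \<gamma>(2,1), of d \<rho>]) auto
    ultimately have "P N l \<gamma>" using \<gamma> unfolding P_def by auto
    then show ?thesis by blast
  qed
  then obtain l \<gamma> where "\<And>n. P n (l n) (\<gamma> n)" by metis
  then have *: "\<And>n. 0 \<le> l n" "\<And>n. lip1 (\<gamma> n)" "\<And>n. \<gamma> n 0 = x" "\<And>n. l n \<le> C / d"
    "E \<noteq> {}" "\<And>n. infdist (\<gamma> n (l n)) E \<le> 1 / Suc n" "\<And>n. (\<integral>\<^sup>+t\<in>{0..l n}. \<rho> (\<gamma> n t) \<partial>lborel) \<le> ennreal C"
    unfolding P_def by blast+
  define G where "G n = {y. infdist y E \<le> 1 / real (Suc n)}" for n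
  have "closed (G n)" for n unfolding G_def by (auto intro!: closed_Collect_le continuous_intros)
  moreover have "decseq G"
  proof (rule decseq_SucI)
    fix n
    have "1 / real (Suc (Suc n)) \<le> 1 / Suc n" by (intro divide_left_mono) auto
    then show "G (Suc n) \<subseteq> G n" unfolding G_def by auto
  qed
  moreover have "\<gamma> n (l n) \<in> G n" for n using *(6) by (simp add: G_def)
  ultimately have "\<exists>L \<delta>. 0 \<le> L \<and> lip1 \<delta> \<and> \<delta> 0 = x \<and> (\<forall>n. \<delta> L \<in> G n) \<and>
      (\<integral>\<^sup>+t\<in>{0..L}. \<rho> (\<delta> t) \<partial>lborel) \<le> ennreal C"
    by (intro curve_limit[where \<gamma>=\<gamma> and l=l and B="C / d" and F=G and c="\<lambda>_. ennreal C"] \<rho> *) (simp_all add: *(3))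
  then obtain L \<delta> where \<delta>: "0 \<le> L" "lip1 \<delta>" "\<delta> 0 = x" "\<And>n. \<delta> L \<in> G n"
    "(\<integral>\<^sup>+t\<in>{0..L}. \<rho> (\<delta> t) \<partial>lborel) \<le> ennreal C"
    by blast
  \<comment> \<open>The limit curve ends in all neighbourhoods \<open>G n\<close>, hence in the
    closed set \<open>E\<close>. Its arc length version hits \<open>E\<close> at finite cost,
    contrary to \<open>hit\<close>.\<close>
  have "infdist (\<delta> L) E \<le> 0"
  proof (rule ccontr)
    assume "\<not> infdist (\<delta> L) E \<le> 0"
    then obtain n where "1 / real (Suc n) < infdist (\<delta> L) E" using nat_approx_posE[of "infdist (\<delta> L) E"] by (metis not_le)
    then show False using \<delta>(4)[of n] by (simp add: G_def)
  qed
  then have "\<delta> L \<in> E" using E(1) *(5) in_closed_iff_infdist_zero[of E "\<delta> L"] infdist_nonneg[of "\<delta> L" E] by auto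
  then have "\<delta> 0 \<noteq> \<delta> L" using \<delta>(3) E(2) by auto
  then obtain L' \<gamma>' where \<gamma>': "arc_length_curve (\<delta> ` {0..L}) L' \<gamma>'" "\<gamma>' 0 = \<delta> 0" "\<gamma>' L' = \<delta> L"
      "(\<integral>\<^sup>+t\<in>{0..L'}. \<rho> (\<gamma>' t) \<partial>lborel) \<le> (\<integral>\<^sup>+t\<in>{0..L}. \<rho> (\<delta> t) \<partial>lborel)"
    using arc_length_reparam[OF lip1D[OF \<delta>(2)] \<delta>(1)] \<rho>m by metis
  have "line_integral L' \<gamma>' \<rho> = \<infinity>"
    using arc_length_curveD(1)[OF \<gamma>'(1)] \<gamma>'(3) \<open>\<delta> L \<in> E\<close>
    by (intro hit[OF arc_length_curve_mono[OF \<gamma>'(1)], of L']) auto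
  then show False using \<gamma>'(4) \<delta>(5) by (auto simp: line_integral_lborel top_unique)
qed

end


section \<open>Superminimizers outside a set of capacity zero\<close>

context newtonian_space
begin

text \<open>The densities for the complement and for infinity are added, and a lower semicontinuous
  majorant inherits both properties. In a bounded space no curve reaches a distance above the
  diameter, so the last property holds trivially.\<close>

lemma ex_density:
  assumes cap: "sobolev_capacity p M E = 0" and par: "bounded (UNIV :: 'a set) \<or> p_parabolic p M"
  shows "\<exists>\<rho>. Lp \<rho> \<and> lsc \<rho> \<and> (\<forall>x R. \<exists>d>0. \<forall>y\<in>ball x R. ennreal d \<le> \<rho> y) \<and>
    (\<forall>l \<gamma> t. arc_length_curve UNIV l \<gamma> \<longrightarrow> 0 \<le> t \<longrightarrow> t \<le> l \<longrightarrow> \<gamma> t \<in> E \<longrightarrow> line_integral l \<gamma> \<rho> = \<infinity>) \<and>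
    (\<forall>x C. \<exists>R. \<forall>l \<gamma>. arc_length_curve UNIV l \<gamma> \<longrightarrow> \<gamma> 0 = x \<longrightarrow> R \<le> dist x (\<gamma> l) \<longrightarrow> ennreal C \<le> line_integral l \<gamma> \<rho>)"
proof -
  obtain \<rho>1 where \<rho>1: "Lp \<rho>1"
    "\<And>l \<gamma> t. arc_length_curve UNIV l \<gamma> \<Longrightarrow> 0 \<le> t \<Longrightarrow> t \<le> l \<Longrightarrow> \<gamma> t \<in> E \<Longrightarrow> line_integral l \<gamma> \<rho>1 = \<infinity>"
    using capacity_zero_density[OF cap] by blast
  define Q where "Q \<rho> \<longleftrightarrow> (\<forall>x C. \<exists>R. \<forall>l \<gamma>. arc_length_curve UNIV l \<gamma> \<longrightarrow> \<gamma> 0 = x \<longrightarrow> R \<le> dist x (\<gamma> l) \<longrightarrow> ennreal C \<le> line_integral l \<gamma> \<rho>)" for \<rho> :: "'a \<Rightarrow> ennreal"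
  have "\<exists>\<rho>2. Lp \<rho>2 \<and> Q \<rho>2"
    using par
  proof
    assume "bounded (UNIV :: 'a set)"
    then obtain B where B: "\<And>x y :: 'a. dist x y \<le> B" unfolding bounded_two_points by auto
    have "Q (\<lambda>_. 0)"
      unfolding Q_def
    proof (intro allI exI[of _ "B + 1"] impI)
      fix x :: 'a and C l :: real and \<gamma> assume "B + 1 \<le> dist x (\<gamma> l)"
      then show "ennreal C \<le> line_integral l \<gamma> (\<lambda>_. 0)" using B[of x "\<gamma> l"] by linarith
    qed
    then show ?thesis by (intro exI[of _ "\<lambda>_. 0"]) (simp add: Lp_def)
  next
    assume "p_parabolic p M"
    from parabolic_density[OF this] show ?thesis unfolding Q_def by metis
  qed
  then obtain \<rho>2 where \<rho>2: "Lp \<rho>2" "Q \<rho>2" by blast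
  obtain \<rho> where \<rho>: "Lp \<rho>" "lsc \<rho>" "\<And>x. \<rho>1 x + \<rho>2 x \<le> \<rho> x" "\<forall>x R. \<exists>d>0. \<forall>y\<in>ball x R. ennreal d \<le> \<rho> y"
    using ex_lsc_majorant[OF Lp_add[OF \<rho>1(1) \<rho>2(1)]] by blast
  have 1: "line_integral l \<gamma> \<rho>1 \<le> line_integral l \<gamma> \<rho>" for l \<gamma>
    by (rule line_integral_mono) (rule order_trans[OF _ \<rho>(3)], simp)
  have 2: "line_integral l \<gamma> \<rho>2 \<le> line_integral l \<gamma> \<rho>" for l \<gamma>
    by (rule line_integral_mono) (rule order_trans[OF _ \<rho>(3)], simp)
  have "line_integral l \<gamma> \<rho> = \<infinity>" if "arc_length_curve UNIV l \<gamma>" "0 \<le> t" "t \<le> l" "\<gamma> t \<in> E" for l \<gamma> t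
    using 1[of l \<gamma>] \<rho>1(2)[OF that] by (simp add: top_unique)
  moreover have "Q \<rho>"
    unfolding Q_def
  proof (intro allI)
    fix x :: 'a and C :: real
    obtain R where "\<forall>l \<gamma>. arc_length_curve UNIV l \<gamma> \<longrightarrow> \<gamma> 0 = x \<longrightarrow> R \<le> dist x (\<gamma> l) \<longrightarrow> ennreal C \<le> line_integral l \<gamma> \<rho>2"
      using \<rho>2(2) unfolding Q_def by blast
    then show "\<exists>R. \<forall>l \<gamma>. arc_length_curve UNIV l \<gamma> \<longrightarrow> \<gamma> 0 = x \<longrightarrow> R \<le> dist x (\<gamma> l) \<longrightarrow> ennreal C \<le> line_integral l \<gamma> \<rho>"
      using 2 order_trans by blast
  qed
  ultimately show ?thesis using \<rho> unfolding Q_def by blast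
qed

text \<open>Almost every curve in the space is a curve in \<Omega>. The premise \<open>shift\<close>
  only removes the zero shift of the parameter that \<open>aec_sub\<close> introduces.\<close>

lemma aec_UNIV:
  assumes \<Omega>: "open \<Omega>" and avoid: "aec UNIV (\<lambda>l \<gamma>. \<forall>t\<in>{0..l}. \<gamma> t \<in> \<Omega>)" and P: "aec \<Omega> P"
    and shift: "\<And>l \<gamma>. P l (\<lambda>t. \<gamma> (0 + t)) \<Longrightarrow> P l \<gamma>"
  shows "aec UNIV (\<lambda>l \<gamma>. (\<forall>t\<in>{0..l}. \<gamma> t \<in> \<Omega>) \<and> P l \<gamma>)"
proof (rule aec_mono[OF aec_conj[OF open_UNIV avoid aec_sub[OF P open_UNIV \<Omega>]]], elim conjE, intro conjI)
  fix l \<gamma> assume "arc_length_curve UNIV l \<gamma>" and in\<Omega>: "\<forall>t\<in>{0..l}. \<gamma> t \<in> \<Omega>"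
    and *: "\<forall>a b. 0 \<le> a \<longrightarrow> a < b \<longrightarrow> b \<le> l \<longrightarrow> \<gamma> ` {a..b} \<subseteq> \<Omega> \<longrightarrow> P (b - a) (\<lambda>t. \<gamma> (a + t))"
  then have "P (l - 0) (\<lambda>t. \<gamma> (0 + t))" using arc_length_curveD(1) by blast
  then show "P l \<gamma>" by simp
qed

text \<open>The values of \<open>F\<close> and \<open>g\<close> off \<Omega> are irrelevant, since
  almost no curve sees them. So a capacity zero set is removable for gradients, whatever extension
  is taken.\<close>

lemma good_ug_UNIV:
  assumes "open \<Omega>" "aec UNIV (\<lambda>l \<gamma>. \<forall>t\<in>{0..l}. \<gamma> t \<in> \<Omega>)" "good_ug \<Omega> g F"
  shows "good_ug UNIV g F"
  unfolding good_ug_def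
  by (intro conjI good_ugD(1)[OF assms(3)] aec_mono[OF aec_UNIV[OF assms(1,2) good_ugD(2)[OF assms(3)]]]) auto

lemma locally_p_integrable_mono':
  assumes "locally_p_integrable p M E g" "g' \<in> borel_measurable (restrict_space M E)"
    "\<And>x. x \<in> E \<Longrightarrow> g' x \<le> g x"
  shows "locally_p_integrable p M E g'"
  unfolding locally_p_integrable_def
proof (intro conjI ballI assms(2))
  fix x assume "x \<in> E"
  then obtain r where r: "r > 0" "(\<integral>\<^sup>+y\<in>ball x r \<inter> E. ennreal_powr (g y) p \<partial>M) < \<infinity>"
    using assms(1) unfolding locally_p_integrable_def by blast
  have "(\<integral>\<^sup>+y\<in>ball x r \<inter> E. ennreal_powr (g' y) p \<partial>M) \<le> (\<integral>\<^sup>+y\<in>ball x r \<inter> E. ennreal_powr (g y) p \<partial>M)"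
  proof (rule nn_integral_mono)
    fix y
    have "y \<in> ball x r \<inter> E \<Longrightarrow> ennreal_powr (g' y) p \<le> ennreal_powr (g y) p"
      using p_gt_1 assms(3) by (intro ennreal_powr_mono) auto
    then show "ennreal_powr (g' y) p * indicator (ball x r \<inter> E) y \<le> ennreal_powr (g y) p * indicator (ball x r \<inter> E) y"
      by (cases "y \<in> ball x r \<inter> E") simp_all
  qed
  then show "\<exists>r>0. (\<integral>\<^sup>+y\<in>ball x r \<inter> E. ennreal_powr (g' y) p \<partial>M) < \<infinity>"
    using r by (intro exI[of _ r]) (auto intro: le_less_trans)
qed

lemma locally_p_integrable_add:
  assumes g: "locally_p_integrable p M E g" "g \<in> borel_measurable borel" and h: "Lp h" and E: "open E"
  shows "locally_p_integrable p M E (\<lambda>x. g x + h x)"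
  unfolding locally_p_integrable_def
proof (intro conjI ballI)
  have [measurable]: "g \<in> borel_measurable borel" "h \<in> borel_measurable borel" using g(2) LpD(1)[OF h] by auto
  show "(\<lambda>x. g x + h x) \<in> borel_measurable (restrict_space M E)"
    by (intro measurable_restrict_space1 borel_measurable_M) measurable
  fix x assume "x \<in> E"
  then obtain r where r: "r > 0" "(\<integral>\<^sup>+y\<in>ball x r \<inter> E. ennreal_powr (g y) p \<partial>M) < \<infinity>"
    using g(1) unfolding locally_p_integrable_def by blast
  have B[measurable]: "ball x r \<inter> E \<in> sets borel" using E by auto
  have "Lp (\<lambda>y. g y * indicator (ball x r \<inter> E) y + h y)"
    by (intro Lp_add Lp_indicator h g(2) B r(2))
  then have "(\<integral>\<^sup>+y. ennreal_powr (g y * indicator (ball x r \<inter> E) y + h y) p \<partial>M) < \<infinity>" by (rule LpD)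
  moreover have "(\<integral>\<^sup>+y\<in>ball x r \<inter> E. ennreal_powr (g y + h y) p \<partial>M) \<le> (\<integral>\<^sup>+y. ennreal_powr (g y * indicator (ball x r \<inter> E) y + h y) p \<partial>M)"
  proof (rule nn_integral_mono)
    fix y show "ennreal_powr (g y + h y) p * indicator (ball x r \<inter> E) y \<le> ennreal_powr (g y * indicator (ball x r \<inter> E) y + h y) p"
      by (cases "y \<in> ball x r \<inter> E") simp_all
  qed
  ultimately show "\<exists>r>0. (\<integral>\<^sup>+y\<in>ball x r \<inter> E. ennreal_powr (g y + h y) p \<partial>M) < \<infinity>"
    using r(1) by (intro exI[of _ r]) (auto intro: le_less_trans)
qed

lemma locally_p_integrable_compact:
  assumes g: "locally_p_integrable p M E g" "g \<in> borel_measurable borel" and E: "open E"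
    and K: "compact K" "K \<subseteq> E"
  shows "(\<integral>\<^sup>+x\<in>K. ennreal_powr (g x) p \<partial>M) < \<infinity>"
proof -
  have "\<forall>x\<in>E. \<exists>r>0. (\<integral>\<^sup>+y\<in>ball x r \<inter> E. ennreal_powr (g y) p \<partial>M) < \<infinity>"
    using g unfolding locally_p_integrable_def by blast
  then obtain r where r: "\<And>x. x \<in> E \<Longrightarrow> r x > 0" "\<And>x. x \<in> E \<Longrightarrow> (\<integral>\<^sup>+y\<in>ball x (r x) \<inter> E. ennreal_powr (g y) p \<partial>M) < \<infinity>"
    by metis
  have "K \<subseteq> (\<Union>x\<in>K. ball x (r x))"
  proof
    fix x assume "x \<in> K"
    then show "x \<in> (\<Union>x\<in>K. ball x (r x))" using r(1)[of x] K(2) by (intro UN_I[of x]) auto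
  qed
  then obtain J where J: "J \<subseteq> K" "finite J" "K \<subseteq> (\<Union>x\<in>J. ball x (r x))"
    using compactE_image[OF K(1), of K "\<lambda>x. ball x (r x)"] by (metis open_ball)
  have gm: "g \<in> borel_measurable M" by (rule borel_measurable_M[OF g(2)])
  have B: "ball x (r x) \<inter> E \<in> sets M" for x using E by (intro sets_borel_M) auto
  have "(\<integral>\<^sup>+x\<in>K. ennreal_powr (g x) p \<partial>M) \<le> (\<integral>\<^sup>+y. (\<Sum>x\<in>J. ennreal_powr (g y) p * indicator (ball x (r x) \<inter> E) y) \<partial>M)"
  proof (rule nn_integral_mono)
    fix y show "ennreal_powr (g y) p * indicator K y \<le> (\<Sum>x\<in>J. ennreal_powr (g y) p * indicator (ball x (r x) \<inter> E) y)"
    proof (cases "y \<in> K")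
      case True
      then obtain x where x: "x \<in> J" "y \<in> ball x (r x)" using J(3) by blast
      have "ennreal_powr (g y) p * indicator (ball x (r x) \<inter> E) y \<le> (\<Sum>x\<in>J. ennreal_powr (g y) p * indicator (ball x (r x) \<inter> E) y)"
        by (rule member_le_sum) (use x J in auto)
      then show ?thesis using True x K(2) by auto
    qed simp
  qed
  also have "\<dots> = (\<Sum>x\<in>J. (\<integral>\<^sup>+y\<in>ball x (r x) \<inter> E. ennreal_powr (g y) p \<partial>M))"
    by (intro nn_integral_sum borel_measurable_times_ennreal borel_measurable_indicator borel_measurable_ennreal_powr gm B)
  also have "\<dots> < \<infinity>" using r(2) J K(2) by auto
  finally show ?thesis .
qed


subsection \<open>Cutoff functions\<close>

text \<open>The triangle inequality for the cost holds along every curve, so the exceptional density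
  is 0. Truncation at 1 makes the function real-valued even where the cost is \<infinity>.\<close>

lemma cutoff_good_ug:
  fixes \<rho> :: "'a \<Rightarrow> ennreal"
  assumes \<rho>: "\<rho> \<in> borel_measurable borel" and m: "cost \<rho> F \<in> borel_measurable borel"
  shows "good_ug UNIV (\<lambda>x. \<epsilon> * \<rho> x) (\<lambda>x. enn2real (min 1 (\<epsilon> * cost \<rho> F x)))"
  unfolding good_ug_def
proof (intro conjI)
  show m\<rho>: "(\<lambda>x. \<epsilon> * \<rho> x) \<in> borel_measurable borel" using \<rho> by measurable
  show "aec UNIV (\<lambda>l \<gamma>. ac_bound (\<lambda>t. enn2real (min 1 (\<epsilon> * cost \<rho> F (\<gamma> t)))) (\<lambda>t. \<epsilon> * \<rho> (\<gamma> t) * indicator {0..l} t) 0 l)"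
  proof (rule aecI[of "\<lambda>_. 0"], simp add: Lp_def, simp, rule ac_boundI)
    \<comment> \<open>The piece of the curve between \<open>c\<close> and \<open>d\<close> is turned
      into a Lipschitz curve starting at parameter 0, to which the two triangle inequalities
      apply.\<close>
    fix l c d and \<gamma> :: "real \<Rightarrow> 'a" assume \<gamma>: "arc_length_curve UNIV l \<gamma>" and cd: "0 \<le> c" "c \<le> d" "d \<le> l"
    define \<gamma>' where "\<gamma>' t = \<gamma> (max 0 (min l (c + t)))" for t
    have lip: "lip1 \<gamma>'"
      unfolding lip1_def \<gamma>'_def using lipschitz_curve_clamp[OF \<gamma>] by (metis add_diff_cancel_left)
    have ends: "\<gamma>' 0 = \<gamma> c" "\<gamma>' (d - c) = \<gamma> d" using cd by (simp_all add: \<gamma>'_def)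
    have "(\<integral>\<^sup>+t\<in>{0..d - c}. \<rho> (\<gamma>' t) \<partial>lborel) = (\<integral>\<^sup>+t\<in>{0..d - c}. \<rho> (\<gamma> (c + t)) \<partial>lborel)"
      using cd by (intro nn_integral_cong) (auto simp: \<gamma>'_def indicator_def)
    also have "\<dots> = (\<integral>\<^sup>+t\<in>{c..d}. \<rho> (\<gamma> t) \<partial>lborel)"
      by (rule nn_integral_lborel_shift[OF borel_measurable_along_curve[OF continuous_on_subset[OF arc_length_curveD(2)[OF \<gamma>]] \<rho>]])
         (use cd in auto)
    finally have int: "(\<integral>\<^sup>+t\<in>{0..d - c}. \<rho> (\<gamma>' t) \<partial>lborel) = (\<integral>\<^sup>+t\<in>{c..d}. \<rho> (\<gamma> t) \<partial>lborel)" .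
    define I where "I = \<epsilon> * (\<integral>\<^sup>+t\<in>{c..d}. \<rho> (\<gamma> t) \<partial>lborel)"
    have 1: "\<epsilon> * cost \<rho> F (\<gamma> c) \<le> I + \<epsilon> * cost \<rho> F (\<gamma> d)" "\<epsilon> * cost \<rho> F (\<gamma> d) \<le> I + \<epsilon> * cost \<rho> F (\<gamma> c)"
      unfolding I_def distrib_left[symmetric]
      using cost_triangle[OF \<rho> _ lip ends, of F] cost_triangle'[OF \<rho> _ lip ends, of F] cd
      by (intro mult_left_mono; simp add: int)+
    have real_le: "ennreal (enn2real (min 1 a) - enn2real (min 1 b)) \<le> I" if "a \<le> I + b" for a b
    proof (cases "I = \<infinity>")
      case False
      have "min 1 a \<le> I + min 1 b"
      proof (cases "b \<le> 1")
        case True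
        then show ?thesis using that by (simp add: min_absorb2 min.coboundedI2)
      next
        case False
        have "min 1 a \<le> 1" by simp
        also have "\<dots> \<le> I + 1" by simp
        finally show ?thesis using False by (simp add: min_absorb1)
      qed
      moreover obtain r s t where "min 1 a = ennreal r" "0 \<le> r" "min 1 b = ennreal s" "0 \<le> s" "I = ennreal t" "0 \<le> t"
        using False by (cases "min 1 a"; cases "min 1 b"; cases I) (auto simp: min_def split: if_splits)
      ultimately show ?thesis by (auto simp flip: ennreal_plus simp: ennreal_le_iff intro!: ennreal_leI)
    qed simp
    have "ennreal \<bar>enn2real (min 1 (\<epsilon> * cost \<rho> F (\<gamma> d))) - enn2real (min 1 (\<epsilon> * cost \<rho> F (\<gamma> c)))\<bar> \<le> I"
      using real_le[OF 1(1)] real_le[OF 1(2)] by (auto simp: abs_real_def)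
    also have "I = (\<integral>\<^sup>+t. \<epsilon> * (\<rho> (\<gamma> t) * indicator {c..d} t) \<partial>lborel)"
      unfolding I_def
      by (rule nn_integral_cmult[symmetric])
         (use borel_measurable_along_curve[OF continuous_on_subset[OF arc_length_curveD(2)[OF \<gamma>]] \<rho>, of c d] cd in simp)
    also have "\<dots> = (\<integral>\<^sup>+t\<in>{c..d}. \<epsilon> * \<rho> (\<gamma> t) * indicator {0..l} t \<partial>lborel)"
      using cd by (intro nn_integral_cong) (auto simp: indicator_def)
    finally show "ennreal \<bar>enn2real (min 1 (\<epsilon> * cost \<rho> F (\<gamma> d))) - enn2real (min 1 (\<epsilon> * cost \<rho> F (\<gamma> c)))\<bar>
      \<le> (\<integral>\<^sup>+t\<in>{c..d}. \<epsilon> * \<rho> (\<gamma> t) * indicator {0..l} t \<partial>lborel)" .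
  qed
qed

lemma good_ug_affine:
  assumes "good_ug E g F" "c > 0"
  shows "good_ug E (\<lambda>x. ennreal c * g x) (\<lambda>x. a + c * F x)"
  unfolding good_ug_def
proof (intro conjI)
  have gm: "g \<in> borel_measurable borel" using assms(1) by (rule good_ugD)
  then show "(\<lambda>x. ennreal c * g x) \<in> borel_measurable borel" by measurable
  show "aec E (\<lambda>l \<gamma>. ac_bound (\<lambda>t. a + c * F (\<gamma> t)) (\<lambda>t. ennreal c * g (\<gamma> t) * indicator {0..l} t) 0 l)"
  proof (rule aec_mono[OF good_ugD(2)[OF assms(1)]], rule ac_boundI)
    fix l \<gamma> x y assume \<gamma>: "arc_length_curve E l \<gamma>" and xy: "0 \<le> x" "x \<le> y" "y \<le> l"
      and ac: "ac_bound (\<lambda>t. F (\<gamma> t)) (\<lambda>t. g (\<gamma> t) * indicator {0..l} t) 0 l"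
    have "ennreal \<bar>(a + c * F (\<gamma> y)) - (a + c * F (\<gamma> x))\<bar> = ennreal c * ennreal \<bar>F (\<gamma> y) - F (\<gamma> x)\<bar>"
      using assms(2) by (simp add: ennreal_mult[symmetric] abs_mult right_diff_distrib[symmetric])
    also have "\<dots> \<le> ennreal c * (\<integral>\<^sup>+t\<in>{x..y}. g (\<gamma> t) * indicator {0..l} t \<partial>lborel)"
      by (intro mult_left_mono ac_boundD[OF ac xy]) simp
    also have "\<dots> = (\<integral>\<^sup>+t\<in>{x..y}. ennreal c * g (\<gamma> t) * indicator {0..l} t \<partial>lborel)"
      using borel_measurable_times_Icc[OF along_measurable[OF \<gamma> gm], of x y]
      by (subst nn_integral_cmult[symmetric]) (auto simp: mult.assoc)
    finally show "ennreal \<bar>(a + c * F (\<gamma> y)) - (a + c * F (\<gamma> x))\<bar> \<le> (\<integral>\<^sup>+t\<in>{x..y}. ennreal c * g (\<gamma> t) * indicator {0..l} t \<partial>lborel)" .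
  qed
qed

end


text \<open>Applies to sums, differences, maxima and positive parts of two functions, which all
  satisfy the increment condition.\<close>

lemma ac_bound_combine:
  assumes 1: "ac_bound G h a b" and 2: "ac_bound G' h' a b"
    and [measurable]: "h \<in> borel_measurable borel" "h' \<in> borel_measurable borel"
    and le: "\<And>x y. a \<le> x \<Longrightarrow> x \<le> y \<Longrightarrow> y \<le> b \<Longrightarrow> \<bar>F y - F x\<bar> \<le> \<bar>G y - G x\<bar> + \<bar>G' y - G' x\<bar>"
  shows "ac_bound F (\<lambda>t. h t + h' t) a b"
proof (rule ac_boundI)
  fix c d assume cd: "a \<le> c" "c \<le> d" "d \<le> b"
  have "ennreal \<bar>F d - F c\<bar> \<le> ennreal \<bar>G d - G c\<bar> + ennreal \<bar>G' d - G' c\<bar>"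
    using le[OF cd] by (simp add: ennreal_leI flip: ennreal_plus)
  also have "\<dots> \<le> (\<integral>\<^sup>+t\<in>{c..d}. h t \<partial>lborel) + (\<integral>\<^sup>+t\<in>{c..d}. h' t \<partial>lborel)"
    by (intro add_mono ac_boundD[OF 1 cd] ac_boundD[OF 2 cd])
  also have "\<dots> = (\<integral>\<^sup>+t\<in>{c..d}. (h t + h' t) \<partial>lborel)"
    by (subst nn_integral_add[symmetric]) (auto simp: distrib_right)
  finally show "ennreal \<bar>F d - F c\<bar> \<le> (\<integral>\<^sup>+t\<in>{c..d}. (h t + h' t) \<partial>lborel)" .
qed

context newtonian_space
begin

lemma real_part_measurable:
  assumes "open E" "u \<in> borel_measurable (restrict_space M E)" "\<And>x. x \<in> E \<Longrightarrow> u x = ereal (U x)"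
  shows "U \<in> borel_measurable (restrict_space M E)"
proof -
  have "(\<lambda>x. real_of_ereal (u x)) \<in> borel_measurable (restrict_space M E)" using assms(2) by measurable
  moreover have "real_of_ereal (u x) = U x" if "x \<in> space (restrict_space M E)" for x
    using that assms(3)[of x] by (simp add: space_restrict_space)
  ultimately show ?thesis by (metis (no_types, lifting) measurable_cong)
qed

text \<open>The test function is \<open>(w - u)\<^sub>+\<close>, so that \<open>u + \<phi> = max u w\<close> has the gradient of \<open>w\<close> where
  \<open>w > u\<close>.\<close>

lemma superminimizer_energy:
  assumes \<Omega>: "open \<Omega>" "\<Omega> \<noteq> {}" and avoid: "aec UNIV (\<lambda>l \<gamma>. \<forall>t\<in>{0..l}. \<gamma> t \<in> \<Omega>)"
    and sm: "superminimizer p M \<Omega> u" and u: "\<And>x. x \<in> \<Omega> \<Longrightarrow> u x = ereal (U x)"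
    and m: "\<And>x. x \<in> \<Omega> \<Longrightarrow> m \<le> U x"
    and w: "good_ug UNIV \<sigma> w" "Lp \<sigma>" "w \<in> borel_measurable borel" "\<And>x. w x \<le> k"
    and K: "open K" "\<And>x. x \<notin> K \<Longrightarrow> w x \<le> m" "K \<subseteq> Kc" "compact Kc" "Kc \<subseteq> \<Omega>"
  shows "(\<integral>\<^sup>+x\<in>{x\<in>\<Omega>. U x < w x}. ennreal_powr (minimal_wug p M \<Omega> u x) p \<partial>M) \<le> (\<integral>\<^sup>+x. ennreal_powr (\<sigma> x) p \<partial>M)"
proof -
  have nl: "u \<in> newtonian_loc p M \<Omega>" using sm unfolding superminimizer_def by blast
  obtain g0 where g0: "good_ug \<Omega> g0 U" "locally_p_integrable p M \<Omega> g0" and um: "u \<in> borel_measurable (restrict_space M \<Omega>)"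
    by (rule newtonian_loc_good_ug[OF nl \<Omega> u])
  define g where "g = minimal_wug p M \<Omega> u"
  have g: "weak_upper_gradient p M \<Omega> g u" "locally_p_integrable p M \<Omega> g"
    unfolding g_def by (rule minimal_wug[OF \<Omega>(1) u good_ug_imp_wug[OF g0(1) u] g0(2)]; assumption)+
  obtain g' where g': "good_ug \<Omega> g' U" "AE x in M. x \<in> \<Omega> \<longrightarrow> g x = g' x"
    by (rule wug_imp_good_ug[OF g(1) \<Omega>(1) u])
  have [measurable]: "g' \<in> borel_measurable borel" "\<sigma> \<in> borel_measurable borel" "w \<in> borel_measurable borel"
    "K \<in> sets borel" "\<Omega> \<in> sets borel"
    using good_ugD(1)[OF g'(1)] LpD(1)[OF w(2)] w(3) K(1) \<Omega>(1) by auto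
  have g'_loc: "locally_p_integrable p M \<Omega> g'"
    by (rule locally_p_integrable_mono[OF g(2)]) (use g'(2) in \<open>auto elim!: eventually_mono\<close>)
  \<comment> \<open>A crude common gradient of the positive part, the difference and the maximum of
    \<open>w\<close> and \<open>U\<close>; the sharper gradients below are obtained by cutting it
    down.\<close>
  define H where "H x = g' x + \<sigma> x" for x
  have Hm[measurable]: "H \<in> borel_measurable borel" unfolding H_def by measurable
  have H_loc: "locally_p_integrable p M \<Omega> H"
    unfolding H_def by (rule locally_p_integrable_add[OF g'_loc _ w(2) \<Omega>(1)]) measurable
  have gU: "good_ug UNIV g' U" by (rule good_ug_UNIV[OF \<Omega>(1) avoid g'(1)])
  define good where "good l \<gamma> \<longleftrightarrow> ((\<forall>t\<in>{0..l}. \<gamma> t \<in> \<Omega>) \<and> line_integral l \<gamma> H < \<infinity>) \<and>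
    ac_bound (\<lambda>t. U (\<gamma> t)) (\<lambda>t. g' (\<gamma> t) * indicator {0..l} t) 0 l \<and>
    ac_bound (\<lambda>t. w (\<gamma> t)) (\<lambda>t. \<sigma> (\<gamma> t) * indicator {0..l} t) 0 l" for l and \<gamma> :: "real \<Rightarrow> 'a"
  have good: "aec UNIV good"
    unfolding good_def
    by (intro aec_conj open_UNIV good_ugD(2)[OF gU] good_ugD(2)[OF w(1)]
        aec_UNIV[OF \<Omega>(1) avoid aec_line_integral_finite[OF H_loc Hm \<Omega>(1)]]) simp
  have good\<Omega>: "aec \<Omega> good"
  proof (rule aec_mono[OF aec_sub[OF good \<Omega>(1) open_UNIV]])
    fix l \<gamma> assume \<gamma>: "arc_length_curve \<Omega> l \<gamma>"
      and *: "\<forall>a b. 0 \<le> a \<longrightarrow> a < b \<longrightarrow> b \<le> l \<longrightarrow> \<gamma> ` {a..b} \<subseteq> UNIV \<longrightarrow> good (b - a) (\<lambda>t. \<gamma> (a + t))"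
    then have "good (l - 0) (\<lambda>t. \<gamma> (0 + t))" using arc_length_curveD(1)[OF \<gamma>] by blast
    then show "good l \<gamma>" by simp
  qed
  define \<phi> where "\<phi> x = (if x \<in> \<Omega> then max 0 (w x - U x) else 0)" for x
  have \<phi>0: "0 \<le> \<phi> x" for x by (simp add: \<phi>_def)
  have \<phi>K: "x \<in> K" "x \<in> \<Omega>" "U x < w x" if "0 < \<phi> x" for x
    using that m[of x] K(2)[of x] by (force simp: \<phi>_def split: if_splits)+
  have Um: "U \<in> borel_measurable (restrict_space M \<Omega>)" by (rule real_part_measurable[OF \<Omega>(1) um u])
  have \<phi>m[measurable]: "\<phi> \<in> borel_measurable M"
  proof -
    have wm: "w \<in> borel_measurable (restrict_space M \<Omega>)"
      by (intro measurable_restrict_space1 measurable_mono[THEN subsetD, of borel _ borel M] w(3)) (auto simp: sets_borel_M)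
    have "(\<lambda>x. max 0 (w x - U x)) \<in> borel_measurable (restrict_space M \<Omega>)" using Um wm by measurable
    then have "(\<lambda>x. indicator \<Omega> x *\<^sub>R max 0 (w x - U x)) \<in> borel_measurable M"
      by (subst (asm) borel_measurable_restrict_space_iff) (auto intro: sets_borel_M)
    moreover have "(\<lambda>x. indicator \<Omega> x *\<^sub>R max 0 (w x - U x)) = \<phi>" by (auto simp: \<phi>_def)
    ultimately show ?thesis by simp
  qed
  \<comment> \<open>The gradient \<open>g'\<close> is only locally integrable in \<Omega>, so it is
    kept just on \<open>K\<close>, which lies in a compact subset of \<Omega>.\<close>
  have Lp_H: "Lp (\<lambda>x. g' x * indicator K x + \<sigma> x)"
  proof (intro Lp_add Lp_indicator w(2))
    show "(\<integral>\<^sup>+x\<in>K. ennreal_powr (g' x) p \<partial>M) < \<infinity>"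
      by (rule le_less_trans[OF nn_integral_mono locally_p_integrable_compact[OF g'_loc _ \<Omega>(1) K(4,5)]])
         (use K(3) in \<open>auto simp: indicator_def\<close>)
  qed measurable
  have ug_\<phi>: "good_ug UNIV (\<lambda>x. g' x * indicator K x + \<sigma> x) \<phi>"
    unfolding good_ug_def
  proof (intro conjI aec_mono[OF good])
    show "(\<lambda>x. g' x * indicator K x + \<sigma> x) \<in> borel_measurable borel" by measurable
    fix l \<gamma> assume \<gamma>: "arc_length_curve UNIV l \<gamma>" and "good l \<gamma>"
    then have in\<Omega>: "\<And>t. 0 \<le> t \<Longrightarrow> t \<le> l \<Longrightarrow> \<gamma> t \<in> \<Omega>" and fin: "line_integral l \<gamma> H < \<infinity>"
      and acU: "ac_bound (\<lambda>t. U (\<gamma> t)) (\<lambda>t. g' (\<gamma> t) * indicator {0..l} t) 0 l"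
      and acw: "ac_bound (\<lambda>t. w (\<gamma> t)) (\<lambda>t. \<sigma> (\<gamma> t) * indicator {0..l} t) 0 l"
      unfolding good_def by auto
    have "ac_bound (\<lambda>t. \<phi> (\<gamma> t)) (\<lambda>t. g' (\<gamma> t) * indicator {0..l} t + \<sigma> (\<gamma> t) * indicator {0..l} t) 0 l"
      by (rule ac_bound_combine[OF acU acw along_measurable[OF \<gamma>] along_measurable[OF \<gamma>]])
         (auto simp: \<phi>_def in\<Omega>)
    then have ac: "ac_bound (\<lambda>t. \<phi> (\<gamma> t)) (\<lambda>t. H (\<gamma> t) * indicator {0..l} t) 0 l"
      by (rule ac_bound_mono) (auto simp: H_def indicator_def)
    define S where "S = - ({0..l} \<inter> \<gamma> -` (- K))"
    have "closed ({0..l} \<inter> \<gamma> -` (- K))"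
      by (rule continuous_closed_preimage[OF arc_length_curveD(2)[OF \<gamma>]]) (use K(1) in auto)
    then have S: "S \<in> sets borel" unfolding S_def by (intro borel_open open_Compl)
    \<comment> \<open>The test function vanishes off \<open>K\<close>, so by
      \<open>ac_bound_nonneg\<close> the gradient may be dropped there.\<close>
    have "ac_bound (\<lambda>t. \<phi> (\<gamma> t)) (\<lambda>t. H (\<gamma> t) * indicator {0..l} t * indicator S t) 0 l"
      by (rule ac_bound_nonneg[OF along_measurable[OF \<gamma> Hm] S ac along_finite[OF fin] \<phi>0])
         (use \<phi>K in \<open>auto simp: S_def\<close>)
    then show "ac_bound (\<lambda>t. \<phi> (\<gamma> t)) (\<lambda>t. (g' (\<gamma> t) * indicator K (\<gamma> t) + \<sigma> (\<gamma> t)) * indicator {0..l} t) 0 l"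
      by (rule ac_bound_mono) (auto simp: H_def indicator_def S_def)
  qed
  have newt: "(\<lambda>x. ereal (\<phi> x)) \<in> newtonian p M UNIV"
    unfolding newtonian_def newtonian_norm_p_def
  proof (intro CollectI conjI)
    show "(\<lambda>x. ereal (\<phi> x)) \<in> borel_measurable (restrict_space M UNIV)" by (simp add: restrict_UNIV)
    obtain x0 :: 'a and R where R: "Kc \<subseteq> ball x0 R"
      using bounded_subset_ballD[OF compact_imp_bounded[OF K(4)]] by blast
    \<comment> \<open>The test function is at most \<open>k - m\<close> and vanishes off a bounded
      set, hence it has a finite \<open>p\<close>-norm.\<close>
    have "(\<integral>\<^sup>+x\<in>UNIV. ennreal_powr (e2ennreal \<bar>ereal (\<phi> x)\<bar>) p \<partial>M) \<le> (\<integral>\<^sup>+x. ennreal ((k - m) powr p) * indicator (ball x0 R) x \<partial>M)"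
    proof (rule nn_integral_mono)
      fix x
      show "ennreal_powr (e2ennreal \<bar>ereal (\<phi> x)\<bar>) p * indicator UNIV x \<le> ennreal ((k - m) powr p) * indicator (ball x0 R) x"
      proof (cases "0 < \<phi> x")
        case True
        have "x \<in> ball x0 R" using \<phi>K[OF True] K(3) R by blast
        moreover have "\<phi> x \<le> k - m" using \<phi>K[OF True] m[of x] w(4)[of x] by (auto simp: \<phi>_def)
        then have "\<phi> x powr p \<le> (k - m) powr p" using True p_gt_1 by (intro powr_mono2) auto
        ultimately show ?thesis using True by (simp add: e2ennreal_ereal ennreal_powr_ennreal ennreal_leI)
      next
        case False
        then have "\<phi> x = 0" using \<phi>0[of x] by simp
        then show ?thesis by simp
      qed
    qed
    also have "\<dots> = ennreal ((k - m) powr p) * emeasure M (ball x0 R)"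
      by (rule nn_integral_cmult_indicator) (auto intro: sets_borel_M)
    also have "\<dots> < \<infinity>" using emeasure_ball(2)[of x0 R] by (simp add: ennreal_mult_less_top)
    finally have 1: "(\<integral>\<^sup>+x\<in>UNIV. ennreal_powr (e2ennreal \<bar>ereal (\<phi> x)\<bar>) p \<partial>M) < \<infinity>" .
    have "(INF g\<in>{g. weak_upper_gradient p M UNIV g (\<lambda>x. ereal (\<phi> x))}. \<integral>\<^sup>+x\<in>UNIV. ennreal_powr (g x) p \<partial>M) < \<infinity>"
      unfolding INF_less_iff
      using good_ug_imp_wug[OF ug_\<phi>, of "\<lambda>x. ereal (\<phi> x)"] LpD(2)[OF Lp_H]
      by (intro bexI[of _ "\<lambda>x. g' x * indicator K x + \<sigma> x"]) simp_all
    with 1 show "(\<integral>\<^sup>+x\<in>UNIV. ennreal_powr (e2ennreal \<bar>ereal (\<phi> x)\<bar>) p \<partial>M) +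
      (INF g\<in>{g. weak_upper_gradient p M UNIV g (\<lambda>x. ereal (\<phi> x))}. \<integral>\<^sup>+x\<in>UNIV. ennreal_powr (g x) p \<partial>M) < \<infinity>" by simp
  qed
  then have zero: "(\<lambda>x. ereal (\<phi> x)) \<in> newtonian_zero p M \<Omega>"
    unfolding newtonian_zero_def by (auto simp: \<phi>_def zero_ereal_def intro!: bexI[of _ "\<lambda>x. ereal (\<phi> x)"])
  define f where "f y = u y + ereal (\<phi> y)" for y
  define V where "V x = max (U x) (w x)" for x
  have fV: "f x = ereal (V x)" if "x \<in> \<Omega>" for x
    using u[OF that] that by (auto simp: f_def V_def \<phi>_def max_def)
  \<comment> \<open>The gradient of \<open>max U w\<close>: where \<open>w > U\<close> only that of
    \<open>w\<close> remains. As \<phi> is merely \<open>M\<close>-measurable, \<open>h\<close> need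
    not be Borel, so its gradient property is proved by \<open>wugI\<close> directly.\<close>
  define h where "h x = \<sigma> x + g' x * indicator {x. \<phi> x = 0} x" for x
  have h_meas: "h \<in> borel_measurable M"
  proof -
    have [measurable]: "g' \<in> borel_measurable M" "\<sigma> \<in> borel_measurable M" by (auto intro: borel_measurable_M)
    have [measurable]: "{x. \<phi> x = 0} \<in> sets M" using borel_measurable_eq[OF \<phi>m borel_measurable_const[of 0]] by simp
    show ?thesis unfolding h_def by measurable
  qed
  have h_meas': "h \<in> borel_measurable (restrict_space M \<Omega>)" by (rule measurable_restrict_space1[OF h_meas])
  have h_loc: "locally_p_integrable p M \<Omega> h"
    by (rule locally_p_integrable_mono'[OF H_loc h_meas']) (auto simp: h_def H_def indicator_def add.commute)
  have h_wug: "weak_upper_gradient p M \<Omega> h f"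
  proof (rule wugI[OF h_meas' fV aec_mono[OF good\<Omega>]], assumption)
    fix l \<gamma> assume \<gamma>: "arc_length_curve \<Omega> l \<gamma>" and "good l \<gamma>"
    then have in\<Omega>: "\<And>t. 0 \<le> t \<Longrightarrow> t \<le> l \<Longrightarrow> \<gamma> t \<in> \<Omega>" and fin: "line_integral l \<gamma> H < \<infinity>"
      and acU: "ac_bound (\<lambda>t. U (\<gamma> t)) (\<lambda>t. g' (\<gamma> t) * indicator {0..l} t) 0 l"
      and acw: "ac_bound (\<lambda>t. w (\<gamma> t)) (\<lambda>t. \<sigma> (\<gamma> t) * indicator {0..l} t) 0 l"
      unfolding good_def by auto
    have comb: "ac_bound F (\<lambda>t. H (\<gamma> t) * indicator {0..l} t) 0 l"
      if "\<And>x y. \<bar>F y - F x\<bar> \<le> \<bar>U (\<gamma> y) - U (\<gamma> x)\<bar> + \<bar>w (\<gamma> y) - w (\<gamma> x)\<bar>" for F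
      by (rule ac_bound_mono[OF ac_bound_combine[OF acU acw along_measurable[OF \<gamma>] along_measurable[OF \<gamma>]]])
         (use that in \<open>auto simp: H_def indicator_def\<close>)
    have acV: "ac_bound (\<lambda>t. V (\<gamma> t)) (\<lambda>t. H (\<gamma> t) * indicator {0..l} t) 0 l"
      by (rule comb) (auto simp: V_def max_def)
    \<comment> \<open>The set where \<open>w > U\<close> need not be open in the space, but along
      almost every curve \<open>w - U\<close> is continuous, so the set of parameters is relatively
      open and \<open>ac_bound_open\<close> applies.\<close>
    have "ac_bound (\<lambda>t. w (\<gamma> t) - U (\<gamma> t)) (\<lambda>t. H (\<gamma> t) * indicator {0..l} t) 0 l"
      by (rule comb) auto
    from ac_bound_continuous[OF this along_measurable[OF \<gamma> Hm] along_finite[OF fin]]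
    have "continuous_on {0..l} (\<lambda>t. w (\<gamma> t) - U (\<gamma> t))" .
    then obtain O' where O': "open O'" "O' \<inter> {0..l} = (\<lambda>t. w (\<gamma> t) - U (\<gamma> t)) -` {0<..} \<inter> {0..l}"
      unfolding continuous_on_open_invariant by (metis open_greaterThan)
    have pos: "t \<in> O' \<longleftrightarrow> U (\<gamma> t) < w (\<gamma> t)" if "0 \<le> t" "t \<le> l" for t
    proof -
      have "t \<in> O' \<inter> {0..l} \<longleftrightarrow> 0 < w (\<gamma> t) - U (\<gamma> t)" unfolding O'(2) using that by auto
      then show ?thesis using that by auto
    qed
    have "ac_bound (\<lambda>t. V (\<gamma> t)) (\<lambda>t. if t \<in> O' then \<sigma> (\<gamma> t) * indicator {0..l} t else H (\<gamma> t) * indicator {0..l} t) 0 l"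
    proof (rule ac_bound_open[OF along_measurable[OF \<gamma> Hm] along_measurable[OF \<gamma>] O'(1) acV along_finite[OF fin]])
      fix x y assume xy: "0 \<le> x" "x \<le> y" "y \<le> l" "{x..y} \<subseteq> O'"
      then have "U (\<gamma> x) < w (\<gamma> x)" "U (\<gamma> y) < w (\<gamma> y)" using pos[of x] pos[of y] by auto
      then show "ennreal \<bar>V (\<gamma> y) - V (\<gamma> x)\<bar> \<le> (\<integral>\<^sup>+t\<in>{x..y}. \<sigma> (\<gamma> t) * indicator {0..l} t \<partial>lborel)"
        using ac_boundD[OF acw xy(1-3)] by (simp add: V_def)
    qed measurable
    then show "ac_bound (\<lambda>t. V (\<gamma> t)) (\<lambda>t. h (\<gamma> t) * indicator {0..l} t) 0 l"
    proof (rule ac_bound_mono)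
      fix t assume t: "0 \<le> t" "t \<le> l"
      show "(if t \<in> O' then \<sigma> (\<gamma> t) * indicator {0..l} t else H (\<gamma> t) * indicator {0..l} t) \<le> h (\<gamma> t) * indicator {0..l} t"
      proof (cases "t \<in> O'")
        case False
        then have "\<phi> (\<gamma> t) = 0" using pos[OF t] by (simp add: \<phi>_def)
        then show ?thesis using t False by (simp add: h_def H_def add.commute)
      qed (use t in \<open>simp add: h_def\<close>)
    qed
  qed
  have ae: "AE x in M. x \<in> \<Omega> \<longrightarrow> minimal_wug p M \<Omega> f x \<le> h x"
    by (rule minimal_wug(3)[OF \<Omega>(1) fV h_wug h_loc])
  have set_eq: "{x \<in> \<Omega>. ereal (\<phi> x) \<noteq> 0} = {x \<in> \<Omega>. U x < w x}"
    by (auto simp: \<phi>_def zero_ereal_def max_def)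
  have "(\<integral>\<^sup>+x\<in>{x\<in>\<Omega>. ereal (\<phi> x) \<noteq> 0}. ennreal_powr (minimal_wug p M \<Omega> u x) p \<partial>M)
      \<le> (\<integral>\<^sup>+x\<in>{x\<in>\<Omega>. ereal (\<phi> x) \<noteq> 0}. ennreal_powr (minimal_wug p M \<Omega> (\<lambda>y. u y + ereal (\<phi> y)) x) p \<partial>M)"
    using sm zero \<phi>0 unfolding superminimizer_def by fastforce
  also have "(\<lambda>y. u y + ereal (\<phi> y)) = f" by (simp add: f_def[abs_def])
  also have "(\<integral>\<^sup>+x\<in>{x\<in>\<Omega>. ereal (\<phi> x) \<noteq> 0}. ennreal_powr (minimal_wug p M \<Omega> f x) p \<partial>M) \<le> (\<integral>\<^sup>+x. ennreal_powr (\<sigma> x) p \<partial>M)"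
  proof (rule nn_integral_mono_AE, rule AE_mp[OF ae], rule AE_I2, rule impI)
    fix x assume "x \<in> \<Omega> \<longrightarrow> minimal_wug p M \<Omega> f x \<le> h x"
    then have "ennreal_powr (minimal_wug p M \<Omega> f x) p \<le> ennreal_powr (\<sigma> x) p" if "x \<in> \<Omega>" "\<phi> x \<noteq> 0"
      using that p_gt_1 by (intro ennreal_powr_mono) (auto simp: h_def)
    then show "ennreal_powr (minimal_wug p M \<Omega> f x) p * indicator {x \<in> \<Omega>. ereal (\<phi> x) \<noteq> 0} x \<le> ennreal_powr (\<sigma> x) p"
      by (auto simp: indicator_def zero_ereal_def)
  qed
  finally show ?thesis unfolding set_eq .
qed

end


section \<open>Vanishing energy and constancy of superharmonic functions\<close>

context newtonian_space
begin

lemma aec_avoid: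
  assumes "Lp \<rho>"
    and "\<forall>l \<gamma> t. arc_length_curve UNIV l \<gamma> \<longrightarrow> 0 \<le> t \<longrightarrow> t \<le> l \<longrightarrow> \<gamma> t \<in> E \<longrightarrow> line_integral l \<gamma> \<rho> = \<infinity>"
  shows "aec UNIV (\<lambda>l \<gamma>. \<forall>t\<in>{0..l}. \<gamma> t \<in> - E)"
proof (rule aecI[OF assms(1) open_UNIV], rule ballI, rule ComplI)
  fix l t and \<gamma> :: "real \<Rightarrow> 'a"
  assume "arc_length_curve UNIV l \<gamma>" "line_integral l \<gamma> \<rho> < \<infinity>" "t \<in> {0..l}" "\<gamma> t \<in> E"
  then show False using assms(2) by (metis atLeastAtMost_iff less_irrefl)
qed

text \<open>For fixed \<epsilon> the comparison functions \<open>w n\<close> all satisfy the same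
  energy bound, with the constant \<open>(c * \<epsilon>) powr p * I\<close>, and at each point of
  \<Omega> they reach \<open>k\<close> for large \<open>n\<close>. Fatou's lemma in \<open>n\<close>
  and then small \<epsilon> give the claim.\<close>

lemma superminimizer_energy_zero:
  assumes \<Omega>: "open \<Omega>" "\<Omega> \<noteq> {}" and cap: "sobolev_capacity p M (- \<Omega>) = 0"
    and par: "bounded (UNIV :: 'a set) \<or> p_parabolic p M"
    and sm: "superminimizer p M \<Omega> u" and u: "\<And>x. x \<in> \<Omega> \<Longrightarrow> u x = ereal (U x)"
    and m: "\<And>x. x \<in> \<Omega> \<Longrightarrow> m \<le> U x"
  shows "(\<integral>\<^sup>+x\<in>{x\<in>\<Omega>. U x < k}. ennreal_powr (minimal_wug p M \<Omega> u x) p \<partial>M) = 0"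
proof (cases "m < k")
  case False
  then have "{x\<in>\<Omega>. U x < k} = {}" using m by fastforce
  then show ?thesis by simp
next
  case mk: True
  define c where "c = k - m"
  have c: "c > 0" using mk by (simp add: c_def)
  define E where "E = - \<Omega>"
  obtain x0 :: 'a where True by blast
  obtain \<rho> where \<rho>: "Lp \<rho>" "lsc \<rho>" and pos: "\<forall>x R. \<exists>d>0. \<forall>y\<in>ball x R. ennreal d \<le> \<rho> y"
    and hit: "\<forall>l \<gamma> t. arc_length_curve UNIV l \<gamma> \<longrightarrow> 0 \<le> t \<longrightarrow> t \<le> l \<longrightarrow> \<gamma> t \<in> E \<longrightarrow> line_integral l \<gamma> \<rho> = \<infinity>"
    and exit: "\<forall>x C. \<exists>R. \<forall>l \<gamma>. arc_length_curve UNIV l \<gamma> \<longrightarrow> \<gamma> 0 = x \<longrightarrow> R \<le> dist x (\<gamma> l) \<longrightarrow> ennreal C \<le> line_integral l \<gamma> \<rho>"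
    using ex_density[OF cap par] unfolding E_def by blast
  have avoid: "aec UNIV (\<lambda>l \<gamma>. \<forall>t\<in>{0..l}. \<gamma> t \<in> \<Omega>)"
    using aec_avoid[OF \<rho>(1) hit] by (simp add: E_def)
  have E: "closed E" using \<Omega>(1) by (simp add: E_def closed_Compl)
  have \<rho>m: "\<rho> \<in> borel_measurable borel" by (rule lsc_borel_measurable[OF \<rho>(2)])
  \<comment> \<open>Closed neighbourhoods of the complement of \<Omega> together with the exterior
    of a large ball; the guard \<open>E \<noteq> {}\<close> again counters the convention for
    \<open>infdist\<close>.\<close>
  define F where "F n = {y. E \<noteq> {} \<and> infdist y E \<le> 1 / Suc n} \<union> {y. real n \<le> dist x0 y}" for n :: nat
  have F: "closed (F n)" for n
  proof -
    have "closed {y. infdist y E \<le> 1 / Suc n}" "closed {y. real n \<le> dist x0 y}"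
      by (auto intro!: closed_Collect_le continuous_intros)
    then show ?thesis unfolding F_def by (cases "E = {}") (auto intro: closed_Un)
  qed
  have FB: "- F n \<subseteq> ball x0 (real n)" for n by (auto simp: F_def)
  \<comment> \<open>A compact subset of \<Omega> that contains the open complement of
    \<open>F n\<close>; outside of that complement the cost vanishes and \<open>w n\<close> equals
    \<open>m\<close>.\<close>
  define Kc where "Kc n = {y. E \<noteq> {} \<longrightarrow> 1 / Suc n \<le> infdist y E} \<inter> cball x0 (real n)" for n :: nat
  have Kc: "compact (Kc n)" "- F n \<subseteq> Kc n" "Kc n \<subseteq> \<Omega>" for n
  proof -
    have "closed {y. 1 / Suc n \<le> infdist y E}"
      by (auto intro!: closed_Collect_le continuous_intros)
    then have "closed {y. E \<noteq> {} \<longrightarrow> 1 / Suc n \<le> infdist y E}" by (cases "E = {}") auto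
    then show "compact (Kc n)" unfolding Kc_def by (intro closed_bounded_imp_compact closed_Int) (auto intro: bounded_subset)
    show "- F n \<subseteq> Kc n" by (auto simp: F_def Kc_def)
    show "Kc n \<subseteq> \<Omega>"
    proof
      fix y assume y: "y \<in> Kc n"
      show "y \<in> \<Omega>"
      proof (rule ccontr)
        assume "y \<notin> \<Omega>"
        then have "y \<in> E" by (simp add: E_def)
        then have "E \<noteq> {}" "infdist y E = 0" by auto
        then show False using y by (auto simp: Kc_def)
      qed
    qed
  qed
  have cost_m: "cost \<rho> (F n) \<in> borel_measurable borel" for n
    by (rule lsc_borel_measurable[OF cost_lsc[OF \<rho>(2) pos[rule_format] F FB]])
  define I where "I = enn2real (\<integral>\<^sup>+x. ennreal_powr (\<rho> x) p \<partial>M)"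
  have I: "(\<integral>\<^sup>+x. ennreal_powr (\<rho> x) p \<partial>M) = ennreal I" "0 \<le> I"
    using LpD(2)[OF \<rho>(1)] by (simp_all add: I_def)
  define g where "g = minimal_wug p M \<Omega> u"
  have nl: "u \<in> newtonian_loc p M \<Omega>" using sm unfolding superminimizer_def by blast
  obtain g0 where g0: "good_ug \<Omega> g0 U" "locally_p_integrable p M \<Omega> g0" and um: "u \<in> borel_measurable (restrict_space M \<Omega>)"
    by (rule newtonian_loc_good_ug[OF nl \<Omega> u])
  have gm: "g \<in> borel_measurable (restrict_space M \<Omega>)"
    using minimal_wug(2)[OF \<Omega>(1) u good_ug_imp_wug[OF g0(1) u] g0(2)]
    unfolding g_def locally_p_integrable_def by blast
  have \<Omega>M: "\<Omega> \<in> sets M" using \<Omega>(1) by (intro sets_borel_M) auto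
  have Um: "U \<in> borel_measurable (restrict_space M \<Omega>)" by (rule real_part_measurable[OF \<Omega>(1) um u])
  have G_meas: "(\<lambda>x. ennreal_powr (g x) p * indicator {x\<in>\<Omega>. U x < w x} x) \<in> borel_measurable M"
    if w: "w \<in> borel_measurable borel" for w :: "'a \<Rightarrow> real"
  proof -
    have "w \<in> borel_measurable M"
      by (rule measurable_mono[THEN subsetD, of borel borel borel M]) (auto simp: sets_borel_M w)
    then have "w \<in> borel_measurable (restrict_space M \<Omega>)" by (rule measurable_restrict_space1)
    then have "{x \<in> space (restrict_space M \<Omega>). U x < w x} \<in> sets (restrict_space M \<Omega>)" using Um by measurable
    then have [measurable]: "{x\<in>\<Omega>. U x < w x} \<in> sets M"
      using \<Omega>M by (simp add: sets_restrict_space_iff space_restrict_space)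
    have "(\<lambda>x. ennreal_powr (g x) p) \<in> borel_measurable (restrict_space M \<Omega>)" using gm by measurable
    then have [measurable]: "(\<lambda>x. ennreal_powr (g x) p * indicator \<Omega> x) \<in> borel_measurable M"
      using \<Omega>M by (subst (asm) borel_measurable_restrict_space_iff_ennreal) auto
    have "(\<lambda>x. (ennreal_powr (g x) p * indicator \<Omega> x) * indicator {x\<in>\<Omega>. U x < w x} x) \<in> borel_measurable M"
      by measurable
    moreover have "(\<lambda>x. (ennreal_powr (g x) p * indicator \<Omega> x) * indicator {x\<in>\<Omega>. U x < w x} x) =
        (\<lambda>x. ennreal_powr (g x) p * indicator {x\<in>\<Omega>. U x < w x} x)"
      by (auto simp: indicator_def)
    ultimately show ?thesis by simp
  qed
  have bound: "(\<integral>\<^sup>+x\<in>{x\<in>\<Omega>. U x < k}. ennreal_powr (g x) p \<partial>M) \<le> ennreal ((c * \<epsilon>) powr p * I)" if \<epsilon>: "\<epsilon> > 0" for \<epsilon>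
  proof -
    \<comment> \<open>The cutoff is stretched to take values between \<open>m\<close> and
      \<open>k\<close>: at most the lower bound of \<open>U\<close> near the complement and at
      infinity, and the target level \<open>k\<close> elsewhere.\<close>
    define w where "w n x = m + c * enn2real (min 1 (ennreal \<epsilon> * cost \<rho> (F n) x))" for n x
    have eta: "enn2real (min 1 y) \<le> 1" for y :: ennreal
      by (cases y) (auto simp: min_def enn2real_mono simp flip: ennreal_1 split: if_splits intro!: enn2real_leI)
    have ug: "good_ug UNIV (\<lambda>x. ennreal c * (ennreal \<epsilon> * \<rho> x)) (w n)" for n
      unfolding w_def by (rule good_ug_affine[OF cutoff_good_ug[OF \<rho>m cost_m] c])
    have Lp: "Lp (\<lambda>x. ennreal c * (ennreal \<epsilon> * \<rho> x))"
      by (intro Lp_cmult \<rho>(1) \<epsilon> c)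
    have wm: "w n \<in> borel_measurable borel" for n
      unfolding w_def using cost_m[of n] by measurable
    have wk: "w n x \<le> k" for n x
    proof -
      have "w n x \<le> m + c * 1"
        unfolding w_def by (intro add_left_mono mult_left_mono eta) (use c in simp)
      then show ?thesis by (simp add: c_def)
    qed
    have wF: "w n x \<le> m" if "x \<notin> - F n" for n x
      using that cost_eq_0[of x "F n" \<rho>] by (simp add: w_def)
    have e: "(\<integral>\<^sup>+x\<in>{x\<in>\<Omega>. U x < w n x}. ennreal_powr (g x) p \<partial>M) \<le> ennreal ((c * \<epsilon>) powr p * I)" for n
    proof -
      have "(\<integral>\<^sup>+x\<in>{x\<in>\<Omega>. U x < w n x}. ennreal_powr (g x) p \<partial>M) \<le> (\<integral>\<^sup>+x. ennreal_powr (ennreal c * (ennreal \<epsilon> * \<rho> x)) p \<partial>M)"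
        unfolding g_def
        by (rule superminimizer_energy[OF \<Omega> avoid sm u m ug Lp wm wk _ wF Kc(2,1,3)])
           (auto intro: open_Compl F)
      also have "\<dots> = (\<integral>\<^sup>+x. ennreal ((c * \<epsilon>) powr p) * ennreal_powr (\<rho> x) p \<partial>M)"
        using c \<epsilon> by (intro nn_integral_cong) (simp add: ennreal_powr_cmult mult.assoc[symmetric] ennreal_mult[symmetric])
      also have "\<dots> = ennreal ((c * \<epsilon>) powr p) * ennreal I"
        using borel_measurable_M[OF \<rho>m] by (subst nn_integral_cmult) (auto simp: I)
      finally show ?thesis using I(2) by (simp add: ennreal_mult)
    qed
    have "(\<integral>\<^sup>+x\<in>{x\<in>\<Omega>. U x < k}. ennreal_powr (g x) p \<partial>M)
        \<le> (\<integral>\<^sup>+x. liminf (\<lambda>n. ennreal_powr (g x) p * indicator {x\<in>\<Omega>. U x < w n x} x) \<partial>M)"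
    proof (rule nn_integral_mono)
      fix x
      show "ennreal_powr (g x) p * indicator {x\<in>\<Omega>. U x < k} x \<le> liminf (\<lambda>n. ennreal_powr (g x) p * indicator {x\<in>\<Omega>. U x < w n x} x)"
      proof (cases "x \<in> \<Omega> \<and> U x < k")
        case True
        have "\<exists>N. \<forall>n\<ge>N. ennreal (1 / \<epsilon>) \<le> cost \<rho> (F n) x"
          unfolding F_def
          by (rule cost_tendsto_infinity[OF \<rho>(2) pos[rule_format] hit[rule_format] exit[rule_format] E])
             (use True \<epsilon> in \<open>auto simp: E_def\<close>)
        then obtain N where N: "\<And>n. N \<le> n \<Longrightarrow> ennreal (1 / \<epsilon>) \<le> cost \<rho> (F n) x" by blast
        \<comment> \<open>Once the cost is at least \<open>1 / \<epsilon>\<close>, the truncation at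
          1 takes effect and the value is exactly \<open>k\<close>.\<close>
        have "w n x = k" if "N \<le> n" for n
        proof -
          have "ennreal \<epsilon> * ennreal (1 / \<epsilon>) \<le> ennreal \<epsilon> * cost \<rho> (F n) x" by (rule mult_left_mono[OF N[OF that]]) simp
          then have "1 \<le> ennreal \<epsilon> * cost \<rho> (F n) x" using \<epsilon> by (simp add: ennreal_mult[symmetric])
          then show ?thesis by (simp add: w_def min_absorb1 c_def)
        qed
        then have "eventually (\<lambda>n. ennreal_powr (g x) p \<le> ennreal_powr (g x) p * indicator {x\<in>\<Omega>. U x < w n x} x) sequentially"
          using True by (intro eventually_sequentiallyI[of N]) simp
        then have "liminf (\<lambda>n::nat. ennreal_powr (g x) p) \<le> liminf (\<lambda>n. ennreal_powr (g x) p * indicator {x\<in>\<Omega>. U x < w n x} x)"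
          by (rule Liminf_mono)
        then show ?thesis using True by (simp add: Liminf_const)
      qed auto
    qed
    also have "\<dots> \<le> liminf (\<lambda>n. \<integral>\<^sup>+x\<in>{x\<in>\<Omega>. U x < w n x}. ennreal_powr (g x) p \<partial>M)"
      by (rule nn_integral_liminf) (rule G_meas[OF wm])
    also have "\<dots> \<le> liminf (\<lambda>n::nat. ennreal ((c * \<epsilon>) powr p * I))"
      by (intro Liminf_mono always_eventually allI e)
    finally show ?thesis by (simp add: Liminf_const)
  qed
  have "(\<integral>\<^sup>+x\<in>{x\<in>\<Omega>. U x < k}. ennreal_powr (g x) p \<partial>M) \<le> 0"
  proof (rule ennreal_le_epsilon)
    fix e :: real assume e: "0 < e"
    \<comment> \<open>The number \<epsilon> is made so that \<open>(c * \<epsilon>) powr p\<close>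
      equals \<open>q\<close>; dividing by \<open>I + 1\<close> covers the case that
      \<open>I\<close> is 0.\<close>
    define q where "q = e / (I + 1)"
    have q: "q > 0" using e I(2) by (simp add: q_def)
    define \<epsilon> where "\<epsilon> = q powr (1 / p) / c"
    have "\<epsilon> > 0" using q c by (simp add: \<epsilon>_def)
    have "(c * \<epsilon>) powr p = q"
      using q c p_gt_1 by (simp add: \<epsilon>_def powr_powr)
    moreover have "q * I \<le> e" using e I(2) by (simp add: q_def field_simps)
    ultimately have "(c * \<epsilon>) powr p * I \<le> e" by simp
    then have "ennreal ((c * \<epsilon>) powr p * I) \<le> ennreal e" by (rule ennreal_leI)
    then show "(\<integral>\<^sup>+x\<in>{x\<in>\<Omega>. U x < k}. ennreal_powr (g x) p \<partial>M) \<le> 0 + ennreal e"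
      using bound[OF \<open>\<epsilon> > 0\<close>] by (simp only: add_0_left order_trans)
  qed
  then show ?thesis by (simp add: g_def)
qed

lemma superminimizer_zero_ug:
  assumes \<Omega>: "open \<Omega>" "\<Omega> \<noteq> {}" and cap: "sobolev_capacity p M (- \<Omega>) = 0"
    and par: "bounded (UNIV :: 'a set) \<or> p_parabolic p M"
    and sm: "superminimizer p M \<Omega> u" and u: "\<And>x. x \<in> \<Omega> \<Longrightarrow> u x = ereal (U x)"
    and m: "\<And>x. x \<in> \<Omega> \<Longrightarrow> m \<le> U x" and k: "\<And>x. x \<in> \<Omega> \<Longrightarrow> U x \<le> k"
  shows "good_ug UNIV (\<lambda>_. 0) U" "u \<in> borel_measurable (restrict_space M \<Omega>)"
proof -
  obtain \<rho> where \<rho>: "Lp \<rho>"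
    and hit: "\<forall>l \<gamma> t. arc_length_curve UNIV l \<gamma> \<longrightarrow> 0 \<le> t \<longrightarrow> t \<le> l \<longrightarrow> \<gamma> t \<in> - \<Omega> \<longrightarrow> line_integral l \<gamma> \<rho> = \<infinity>"
    using ex_density[OF cap par] by blast
  have avoid: "aec UNIV (\<lambda>l \<gamma>. \<forall>t\<in>{0..l}. \<gamma> t \<in> \<Omega>)"
    using aec_avoid[OF \<rho> hit] by simp
  have nl: "u \<in> newtonian_loc p M \<Omega>" using sm unfolding superminimizer_def by blast
  obtain g0 where g0: "good_ug \<Omega> g0 U" "locally_p_integrable p M \<Omega> g0" and um: "u \<in> borel_measurable (restrict_space M \<Omega>)"
    by (rule newtonian_loc_good_ug[OF nl \<Omega> u])
  show "u \<in> borel_measurable (restrict_space M \<Omega>)" by (rule um)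
  define g where "g = minimal_wug p M \<Omega> u"
  have g: "weak_upper_gradient p M \<Omega> g u" "locally_p_integrable p M \<Omega> g"
    unfolding g_def by (rule minimal_wug[OF \<Omega>(1) u good_ug_imp_wug[OF g0(1) u] g0(2)]; assumption)+
  obtain g' where g': "good_ug \<Omega> g' U" "AE x in M. x \<in> \<Omega> \<longrightarrow> g x = g' x"
    by (rule wug_imp_good_ug[OF g(1) \<Omega>(1) u])
  have g'm: "g' \<in> borel_measurable borel" by (rule good_ugD[OF g'(1)])
  have g'_loc: "locally_p_integrable p M \<Omega> g'"
    by (rule locally_p_integrable_mono[OF g(2) g'm]) (use g'(2) in \<open>auto elim!: eventually_mono\<close>)
  have \<Omega>M: "\<Omega> \<in> sets M" using \<Omega>(1) by (intro sets_borel_M) auto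
  have "(\<lambda>x. ennreal_powr (g x) p * indicator {x\<in>\<Omega>. U x < k} x) \<in> borel_measurable M"
  proof -
    have Um: "U \<in> borel_measurable (restrict_space M \<Omega>)" by (rule real_part_measurable[OF \<Omega>(1) um u])
    then have "{x \<in> space (restrict_space M \<Omega>). U x < k} \<in> sets (restrict_space M \<Omega>)" by measurable
    then have [measurable]: "{x\<in>\<Omega>. U x < k} \<in> sets M"
      using \<Omega>M by (simp add: sets_restrict_space_iff space_restrict_space)
    have "g \<in> borel_measurable (restrict_space M \<Omega>)" using g(2) unfolding locally_p_integrable_def by blast
    then have "(\<lambda>x. ennreal_powr (g x) p) \<in> borel_measurable (restrict_space M \<Omega>)" by measurable
    then have [measurable]: "(\<lambda>x. ennreal_powr (g x) p * indicator \<Omega> x) \<in> borel_measurable M"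
      using \<Omega>M by (subst (asm) borel_measurable_restrict_space_iff_ennreal) auto
    have "(\<lambda>x. (ennreal_powr (g x) p * indicator \<Omega> x) * indicator {x\<in>\<Omega>. U x < k} x) \<in> borel_measurable M"
      by measurable
    moreover have "(\<lambda>x. (ennreal_powr (g x) p * indicator \<Omega> x) * indicator {x\<in>\<Omega>. U x < k} x) =
        (\<lambda>x. ennreal_powr (g x) p * indicator {x\<in>\<Omega>. U x < k} x)"
      by (auto simp: indicator_def)
    ultimately show ?thesis by simp
  qed
  then have "AE x in M. ennreal_powr (g x) p * indicator {x\<in>\<Omega>. U x < k} x = 0"
    using superminimizer_energy_zero[OF \<Omega> cap par sm u m, of k] by (simp add: nn_integral_0_iff_AE g_def)
  then have "AE x in M. x \<in> \<Omega> \<longrightarrow> U x < k \<longrightarrow> g' x = 0"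
    using g'(2) by eventually_elim (auto simp: indicator_def)
  then obtain N where N: "N \<in> null_sets M" "\<And>x. x \<notin> N \<Longrightarrow> x \<in> \<Omega> \<Longrightarrow> U x < k \<Longrightarrow> g' x = 0"
    by (rule AE_E3) auto
  have ae: "aec UNIV (\<lambda>l \<gamma>. (((\<forall>t\<in>{0..l}. \<gamma> t \<in> \<Omega>) \<and> line_integral l \<gamma> g' < \<infinity>) \<and>
      ac_bound (\<lambda>t. U (\<gamma> t)) (\<lambda>t. g' (\<gamma> t) * indicator {0..l} t) 0 l) \<and>
      (AE t in lborel. t \<in> {0..l} \<longrightarrow> \<gamma> t \<notin> N))"
    by (intro aec_conj open_UNIV good_ugD(2)[OF good_ug_UNIV[OF \<Omega>(1) avoid g'(1)]] aec_null[OF N(1)]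
        aec_UNIV[OF \<Omega>(1) avoid aec_line_integral_finite[OF g'_loc g'm \<Omega>(1)]]) simp
  show "good_ug UNIV (\<lambda>_. 0) U"
    unfolding good_ug_def
  proof (intro conjI aec_mono[OF ae], simp)
    fix l \<gamma> assume \<gamma>: "arc_length_curve UNIV l \<gamma>"
      and "(((\<forall>t\<in>{0..l}. \<gamma> t \<in> \<Omega>) \<and> line_integral l \<gamma> g' < \<infinity>) \<and>
      ac_bound (\<lambda>t. U (\<gamma> t)) (\<lambda>t. g' (\<gamma> t) * indicator {0..l} t) 0 l) \<and>
      (AE t in lborel. t \<in> {0..l} \<longrightarrow> \<gamma> t \<notin> N)"
    then have in\<Omega>: "\<And>t. 0 \<le> t \<Longrightarrow> t \<le> l \<Longrightarrow> \<gamma> t \<in> \<Omega>" and fin: "line_integral l \<gamma> g' < \<infinity>"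
      and ac: "ac_bound (\<lambda>t. U (\<gamma> t)) (\<lambda>t. g' (\<gamma> t) * indicator {0..l} t) 0 l"
      and null: "AE t in lborel. t \<in> {0..l} \<longrightarrow> \<gamma> t \<notin> N" by auto
    \<comment> \<open>The increments of \<open>k - U\<close> are those of \<open>U\<close> up to
      sign, and \<open>k - U\<close> is nonnegative, as \<open>ac_bound_nonneg\<close>
      requires.\<close>
    have acD: "ac_bound (\<lambda>t. k - U (\<gamma> t)) (\<lambda>t. g' (\<gamma> t) * indicator {0..l} t) 0 l"
      using ac unfolding ac_bound_def by (simp add: abs_minus_commute)
    note mg = along_measurable[OF \<gamma> g'm]
    from ac_bound_continuous[OF ac mg along_finite[OF fin]]
    have "closed ({0..l} \<inter> (\<lambda>t. U (\<gamma> t)) -` {k..})" by (rule continuous_closed_preimage) auto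
    then have S: "- ({0..l} \<inter> (\<lambda>t. U (\<gamma> t)) -` {k..}) \<in> sets borel" by (intro borel_open open_Compl)
    have ac0: "ac_bound (\<lambda>t. k - U (\<gamma> t)) (\<lambda>t. g' (\<gamma> t) * indicator {0..l} t * indicator (- ({0..l} \<inter> (\<lambda>t. U (\<gamma> t)) -` {k..})) t) 0 l"
      by (rule ac_bound_nonneg[OF mg S acD along_finite[OF fin]]) (use k in\<Omega> in auto)
    show "ac_bound (\<lambda>t. U (\<gamma> t)) (\<lambda>t. 0 * indicator {0..l} t) 0 l"
    proof (rule ac_boundI)
      fix x y assume xy: "0 \<le> x" "x \<le> y" "y \<le> l"
      have "ennreal \<bar>(k - U (\<gamma> y)) - (k - U (\<gamma> x))\<bar> \<le>
        (\<integral>\<^sup>+t\<in>{x..y}. g' (\<gamma> t) * indicator {0..l} t * indicator (- ({0..l} \<inter> (\<lambda>t. U (\<gamma> t)) -` {k..})) t \<partial>lborel)"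
        by (rule ac_boundD[OF ac0 xy])
      also have "\<dots> = (\<integral>\<^sup>+t. 0 \<partial>(lborel :: real measure))"
      proof (rule nn_integral_cong_AE, rule AE_mp[OF null], rule AE_I2, rule impI)
        fix t assume t: "t \<in> {0..l} \<longrightarrow> \<gamma> t \<notin> N"
        show "g' (\<gamma> t) * indicator {0..l} t * indicator (- ({0..l} \<inter> (\<lambda>t. U (\<gamma> t)) -` {k..})) t * indicator {x..y} t = 0"
          using N(2)[of "\<gamma> t"] in\<Omega>[of t] t by (auto simp: indicator_def)
      qed
      finally show "ennreal \<bar>U (\<gamma> y) - U (\<gamma> x)\<bar> \<le> (\<integral>\<^sup>+t\<in>{x..y}. 0 * indicator {0..l} t \<partial>lborel)"
        by (simp add: abs_minus_commute)
    qed
  qed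
qed

text \<open>With gradient 0 the right-hand side of the Poincare inequality is 0, so the mean
  oscillation on the ball vanishes. Boundedness supplies the integrability on the larger
  ball.\<close>

lemma poincare_locally_constant:
  assumes P: "local_poincare p M" and ug: "good_ug UNIV (\<lambda>_. 0) V" and Vm: "V \<in> borel_measurable M"
    and bdd: "\<And>x. \<bar>V x\<bar> \<le> B"
  shows "\<exists>r c. r > 0 \<and> (AE y in M. y \<in> ball x r \<longrightarrow> V y = c)"
proof -
  obtain r where r: "r > 0" "poincare_within p M (ball x r)"
    using P unfolding local_poincare_def by blast
  then show ?thesis
    unfolding poincare_within_def
  proof (elim exE conjE)
    fix C s :: real
    assume PI: "\<forall>z t (u::'a \<Rightarrow> ereal) (g::'a \<Rightarrow> ennreal).
      t > 0 \<and> ball z t \<subseteq> ball x r \<and> u \<in> borel_measurable (restrict_space M (ball z (s * t))) \<and>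
      (\<integral>\<^sup>+y\<in>ball z (s * t). e2ennreal \<bar>u y\<bar> \<partial>M) < \<infinity> \<and> weak_upper_gradient p M (ball z (s * t)) g u \<longrightarrow>
      (\<integral>\<^sup>+y\<in>ball z t. e2ennreal \<bar>u y - ereal (set_average M (ball z t) u)\<bar> \<partial>M) / emeasure M (ball z t)
      \<le> ennreal (C * t) * ennreal_powr ((\<integral>\<^sup>+y\<in>ball z (s * t). ennreal_powr (g y) p \<partial>M) / emeasure M (ball z (s * t))) (1 / p)"
  define u where "u y = ereal (V y)" for y
  define c where "c = set_average M (ball x r) u"
  have "(\<integral>\<^sup>+y\<in>ball x r. e2ennreal \<bar>u y - ereal c\<bar> \<partial>M) / emeasure M (ball x r)
      \<le> ennreal (C * r) * ennreal_powr ((\<integral>\<^sup>+y\<in>ball x (s * r). ennreal_powr 0 p \<partial>M) / emeasure M (ball x (s * r))) (1 / p)"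
    unfolding c_def
  proof (rule PI[rule_format], intro conjI)
    show "r > 0" "ball x r \<subseteq> ball x r" using r(1) by auto
    show "u \<in> borel_measurable (restrict_space M (ball x (s * r)))"
      unfolding u_def using Vm by (intro measurable_restrict_space1) measurable
    have "(\<integral>\<^sup>+y\<in>ball x (s * r). e2ennreal \<bar>u y\<bar> \<partial>M) \<le> (\<integral>\<^sup>+y. ennreal B * indicator (ball x (s * r)) y \<partial>M)"
    proof (rule nn_integral_mono)
      fix y show "e2ennreal \<bar>u y\<bar> * indicator (ball x (s * r)) y \<le> ennreal B * indicator (ball x (s * r)) y"
        using bdd[of y] by (intro mult_right_mono) (simp_all add: u_def e2ennreal_ereal ennreal_leI)
    qed
    also have "\<dots> = ennreal B * emeasure M (ball x (s * r))"
      by (rule nn_integral_cmult_indicator) (auto intro: sets_borel_M)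
    also have "\<dots> < \<infinity>" using emeasure_ball(2)[of x "s * r"] by (simp add: ennreal_mult_less_top)
    finally show "(\<integral>\<^sup>+y\<in>ball x (s * r). e2ennreal \<bar>u y\<bar> \<partial>M) < \<infinity>" .
    show "weak_upper_gradient p M (ball x (s * r)) (\<lambda>_. 0) u"
      by (rule good_ug_imp_wug[OF good_ug_subset[OF ug]]) (auto simp: u_def)
  qed
  then have "(\<integral>\<^sup>+y\<in>ball x r. e2ennreal \<bar>u y - ereal c\<bar> \<partial>M) / emeasure M (ball x r) = 0" by simp
  then have "(\<integral>\<^sup>+y\<in>ball x r. e2ennreal \<bar>u y - ereal c\<bar> \<partial>M) = 0"
    using emeasure_ball(2)[of x r] by (auto simp: divide_ennreal_def)
  moreover have "(\<lambda>y. e2ennreal \<bar>u y - ereal c\<bar> * indicator (ball x r) y) \<in> borel_measurable M"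
  proof -
    have [measurable]: "ball x r \<in> sets M" by (intro sets_borel_M) simp
    show ?thesis unfolding u_def using Vm by measurable
  qed
  ultimately have "AE y in M. e2ennreal \<bar>u y - ereal c\<bar> * indicator (ball x r) y = 0"
    by (simp add: nn_integral_0_iff_AE)
  then have "AE y in M. y \<in> ball x r \<longrightarrow> V y = c"
    by eventually_elim (auto simp: u_def e2ennreal_ereal indicator_def split: if_splits)
  then show ?thesis using r(1) by blast
  qed
qed

text \<open>A nonempty open set contains a ball and has positive measure, so a statement without
  reference to the point cannot hold almost everywhere on it unless it is true.\<close>

lemma open_not_null:
  assumes "open A" "A \<noteq> {}" and "AE x in M. x \<in> A \<longrightarrow> P"
  shows P
proof (rule ccontr)
  assume "\<not> P"
  then have "AE x in M. x \<notin> A" using assms(3) by (auto elim: eventually_mono)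
  moreover have AM: "A \<in> sets M" using assms(1) by (intro sets_borel_M) auto
  ultimately have "emeasure M A = 0" by (subst (asm) AE_iff_measurable[OF AM]) auto
  moreover obtain x e where "e > 0" "ball x e \<subseteq> A" using assms(1,2) by (metis ex_in_conv openE)
  then have "0 < emeasure M A" using emeasure_ball(1)[of e x] emeasure_mono[OF _ AM] by (metis less_le_trans)
  ultimately show False by simp
qed

text \<open>A ball around \<open>a\<close> and a ball around one of its points overlap in a nonempty
  open set, on which both constants are attained almost everywhere. So the constant is locally
  constant in the centre, and connectedness applies.\<close>

lemma ae_constant:
  assumes con: "connected (UNIV :: 'a set)"
    and loc: "\<And>x. \<exists>r c. r > 0 \<and> (AE y in M. y \<in> ball x r \<longrightarrow> V y = c)"
  obtains c :: real where "\<And>x. \<exists>r>0. AE y in M. y \<in> ball x r \<longrightarrow> V y = c"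
proof -
  obtain r c where rc: "\<And>x. r x > 0" "\<And>x. AE y in M. y \<in> ball x (r x) \<longrightarrow> V y = c x"
    using loc by metis
  have "\<forall>a\<in>UNIV. eventually (\<lambda>b. c a = c b) (at a within UNIV)"
  proof
    fix a :: 'a
    have "c a = c b" if "b \<in> ball a (r a)" for b
    proof (rule open_not_null[of "ball a (r a) \<inter> ball b (r b)"])
      show "open (ball a (r a) \<inter> ball b (r b))" by auto
      have "b \<in> ball b (r b)" using rc(1) by simp
      then show "ball a (r a) \<inter> ball b (r b) \<noteq> {}" using that by blast
      show "AE y in M. y \<in> ball a (r a) \<inter> ball b (r b) \<longrightarrow> c a = c b"
        using rc(2)[of a] rc(2)[of b] by eventually_elim auto
    qed
    then show "eventually (\<lambda>b. c a = c b) (at a within UNIV)"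
      unfolding eventually_at using rc(1)[of a] by (auto simp: dist_commute)
  qed
  then have "c a = c b" for a b
    by (intro connected_local_const[OF con]) auto
  then show ?thesis using rc that[of "c undefined"] by metis
qed

text \<open>The essential infima over small balls are all equal to \<open>c\<close>, and
  \<open>u x\<close> is their limit.\<close>

lemma lsc_regularized_ae_constant:
  assumes \<Omega>: "open \<Omega>" "x \<in> \<Omega>" and u: "lsc_regularized M \<Omega> u"
    and c: "r > 0" "AE y in M. y \<in> ball x r \<longrightarrow> y \<in> \<Omega> \<longrightarrow> u y = c"
  shows "u x = c"
proof -
  have "ess_inf_on M (ball x s \<inter> \<Omega>) u = c" if s: "0 < s" "s < r" for s
  proof -
    let ?A = "ball x s \<inter> \<Omega>"
    have "x \<in> ?A" using \<Omega> s by simp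
    then have A: "open ?A" "?A \<noteq> {}" "?A \<in> sets M" using \<Omega>(1) by (blast, blast, auto intro!: sets_borel_M)
    have c': "AE y in M. y \<in> ?A \<longrightarrow> u y = c" using c(2) by eventually_elim (use s in auto)
    have iff: "(AE y in restrict_space M ?A. d \<le> u y) \<longleftrightarrow> d \<le> c" for d
    proof -
      have "(AE y in restrict_space M ?A. d \<le> u y) \<longleftrightarrow> (AE y in M. y \<in> ?A \<longrightarrow> d \<le> u y)"
        using A by (subst AE_restrict_space_iff) auto
      also have "\<dots> \<longleftrightarrow> (AE y in M. y \<in> ?A \<longrightarrow> d \<le> c)"
      proof
        assume "AE y in M. y \<in> ?A \<longrightarrow> d \<le> u y"
        then show "AE y in M. y \<in> ?A \<longrightarrow> d \<le> c" using c' by eventually_elim auto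
      next
        assume "AE y in M. y \<in> ?A \<longrightarrow> d \<le> c"
        then show "AE y in M. y \<in> ?A \<longrightarrow> d \<le> u y" using c' by eventually_elim auto
      qed
      also have "\<dots> \<longleftrightarrow> d \<le> c" using open_not_null[OF A(1,2)] by auto
      finally show ?thesis .
    qed
    have "{d. AE y in restrict_space M ?A. d \<le> u y} = {..c}" using iff by auto
    then show ?thesis by (simp add: ess_inf_on_def)
  qed
  then have "eventually (\<lambda>s. ess_inf_on M (ball x s \<inter> \<Omega>) u = c) (at_right 0)"
    unfolding eventually_at_right_field using c(1) by blast
  then have "((\<lambda>s. ess_inf_on M (ball x s \<inter> \<Omega>) u) \<longlongrightarrow> c) (at_right 0)" by (rule tendsto_eventually)
  moreover have "((\<lambda>s. ess_inf_on M (ball x s \<inter> \<Omega>) u) \<longlongrightarrow> u x) (at_right 0)"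
    using u \<Omega>(2) unfolding lsc_regularized_def by blast
  ultimately show ?thesis by (intro tendsto_unique[of "at_right (0::real)"]) auto
qed

text \<open>Each truncation at a level \<open>k \<ge> m\<close> is constant in \<Omega>. Two
  different values of \<open>u\<close>, one of which may be \<infinity>, would be separated by a
  real level, and the truncation at that level would not be constant. Constancy is reached through
  the connected space, so different components of \<Omega> share the value.\<close>

theorem superharmonic_bounded_below_constant:
  assumes \<Omega>: "open \<Omega>" and cap: "sobolev_capacity p M (- \<Omega>) = 0"
    and par: "bounded (UNIV :: 'a set) \<or> p_parabolic p M"
    and con: "connected (UNIV :: 'a set)" and P: "local_poincare p M"
    and u: "superharmonic p M \<Omega> u" and m: "\<And>x. x \<in> \<Omega> \<Longrightarrow> ereal m \<le> u x"
    and xy: "x \<in> \<Omega>" "y \<in> \<Omega>"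
  shows "u x = u y"
proof -
  have *: "min (u x) (ereal k) = min (u y) (ereal k)" if "m \<le> k" for k
  proof -
    define v where "v z = min (u z) (ereal k)" for z
    \<comment> \<open>Off \<Omega> any value between \<open>m\<close> and \<open>k\<close> would do;
      \<open>m\<close> keeps \<open>U\<close> bounded and measurable on the whole space, as the
      Poincare inequality needs.\<close>
    define U where "U z = (if z \<in> \<Omega> then real_of_ereal (v z) else m)" for z
    have sm: "superminimizer p M \<Omega> v" and lr: "lsc_regularized M \<Omega> v"
      using u unfolding superharmonic_def v_def by auto
    have v: "ereal m \<le> v z" "v z \<le> ereal k" if "z \<in> \<Omega>" for z
      using m[OF that] \<open>m \<le> k\<close> by (auto simp: v_def)
    have vU: "v z = ereal (U z)" if "z \<in> \<Omega>" for z
      using v[OF that] that by (cases "v z") (auto simp: U_def)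
    have U: "m \<le> U z" "U z \<le> k" for z
    proof -
      have "m \<le> U z \<and> U z \<le> k"
      proof (cases "z \<in> \<Omega>")
        case True
        then have "ereal m \<le> ereal (U z)" "ereal (U z) \<le> ereal k" using v[OF True] vU[OF True] by simp_all
        then show ?thesis by simp
      next
        case False
        then show ?thesis using \<open>m \<le> k\<close> by (simp add: U_def)
      qed
      then show "m \<le> U z" "U z \<le> k" by simp_all
    qed
    have ne: "\<Omega> \<noteq> {}" using xy by blast
    note zero = superminimizer_zero_ug[OF \<Omega> ne cap par sm vU U]
    have Um: "U \<in> borel_measurable M"
    proof -
      have \<Omega>M[measurable]: "\<Omega> \<in> sets M" using \<Omega> by (intro sets_borel_M) auto
      have "U \<in> borel_measurable (restrict_space M \<Omega>)" by (rule real_part_measurable[OF \<Omega> zero(2) vU])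
      then have [measurable]: "(\<lambda>z. indicator \<Omega> z *\<^sub>R U z) \<in> borel_measurable M"
        using \<Omega>M by (subst (asm) borel_measurable_restrict_space_iff) auto
      have "(\<lambda>z. indicator \<Omega> z *\<^sub>R U z + (1 - indicator \<Omega> z) * m) \<in> borel_measurable M"
        by measurable
      moreover have "(\<lambda>z. indicator \<Omega> z *\<^sub>R U z + (1 - indicator \<Omega> z) * m) = U"
        by (auto simp: U_def indicator_def)
      ultimately show ?thesis by simp
    qed
    have Ub: "\<bar>U z\<bar> \<le> max \<bar>m\<bar> \<bar>k\<bar>" for z using U[of z] by linarith
    obtain c where c: "\<And>z. \<exists>r>0. AE y in M. y \<in> ball z r \<longrightarrow> U y = c"
      using ae_constant[OF con poincare_locally_constant[OF P zero(1) Um Ub]] by blast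
    have "v z = ereal c" if z: "z \<in> \<Omega>" for z
    proof -
      obtain r where r: "r > 0" "AE y in M. y \<in> ball z r \<longrightarrow> U y = c" using c by blast
      have "AE y in M. y \<in> ball z r \<longrightarrow> y \<in> \<Omega> \<longrightarrow> v y = ereal c"
        using r(2) by eventually_elim (auto simp: vU)
      then show ?thesis by (rule lsc_regularized_ae_constant[OF \<Omega> z lr r(1)])
    qed
    then show ?thesis using xy by (simp add: v_def)
  qed
  show ?thesis
  proof (rule ccontr)
    assume "u x \<noteq> u y"
    then consider "u x < u y" | "u y < u x" by (rule linorder_neqE)
    then show False
    proof cases
      case 1
      then obtain k where k: "u x < ereal k" "ereal k < u y" using ereal_dense2 by blast
      then have "m \<le> k" using m[OF xy(1)] by (metis ereal_less_eq(3) less_imp_le order_trans)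
      from *[OF this] show False using k by (auto simp: min_def split: if_splits)
    next
      case 2
      then obtain k where k: "u y < ereal k" "ereal k < u x" using ereal_dense2 by blast
      then have "m \<le> k" using m[OF xy(2)] by (metis ereal_less_eq(3) less_imp_le order_trans)
      from *[OF this] show False using k by (auto simp: min_def split: if_splits)
    qed
  qed
qed

end


section \<open>Constants as competitors\<close>

context newtonian_space
begin

lemma good_ug_const: "open E \<Longrightarrow> good_ug E (\<lambda>_. 0) (\<lambda>_. a)"
  unfolding good_ug_def by (auto intro!: aecI[of "\<lambda>_. 0"] ac_boundI simp: Lp_def)

text \<open>The minimal gradient of a constant vanishes almost everywhere, so the left-hand energy
  is 0 for every test function.\<close>

lemma superharmonic_const:
  assumes \<Omega>: "open \<Omega>"
  shows "superharmonic p M \<Omega> (\<lambda>_. ereal c)"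
  unfolding superharmonic_def
proof (intro conjI ballI allI)
  fix k :: real
  define a where "a = min c k"
  have min: "(\<lambda>x. min (ereal c) (ereal k)) = (\<lambda>x::'a. ereal a)" by (simp add: a_def min_def)
  have wug0: "weak_upper_gradient p M E (\<lambda>_. 0) (\<lambda>_. ereal a)" if "open E" for E
    by (rule good_ug_imp_wug[OF good_ug_const[OF that]]) simp
  have Lp0: "Lp (\<lambda>_. 0)" by (simp add: Lp_def)
  show "superminimizer p M \<Omega> (\<lambda>x. min (ereal c) (ereal k))"
    unfolding min superminimizer_def
  proof (intro conjI ballI impI)
    show "(\<lambda>_. ereal a) \<in> newtonian_loc p M \<Omega>"
      unfolding newtonian_loc_def
    proof (intro CollectI ballI)
      fix x assume x: "x \<in> \<Omega>"
      let ?B = "ball x 1 \<inter> \<Omega>"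
      have B: "open ?B" using \<Omega> by auto
      then have BM: "?B \<in> sets M" by (intro sets_borel_M) auto
      have "(\<integral>\<^sup>+y\<in>?B. ennreal_powr (e2ennreal \<bar>ereal a\<bar>) p \<partial>M) = ennreal (\<bar>a\<bar> powr p) * emeasure M ?B"
        using BM by (simp add: e2ennreal_ereal ennreal_powr_ennreal nn_integral_cmult_indicator)
      also have "\<dots> \<le> ennreal (\<bar>a\<bar> powr p) * emeasure M (ball x 1)"
        by (intro mult_left_mono emeasure_mono) (auto intro: sets_borel_M)
      also have "\<dots> < \<infinity>" using emeasure_ball(2)[of x 1] by (simp add: ennreal_mult_less_top)
      finally have 1: "(\<integral>\<^sup>+y\<in>?B. ennreal_powr (e2ennreal \<bar>ereal a\<bar>) p \<partial>M) < \<infinity>" .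
      have 2: "(INF g\<in>{g. weak_upper_gradient p M ?B g (\<lambda>_. ereal a)}. \<integral>\<^sup>+x\<in>?B. ennreal_powr (g x) p \<partial>M) < \<infinity>"
        unfolding INF_less_iff by (intro bexI[of _ "\<lambda>_. 0"]) (simp_all add: wug0[OF B])
      have "(\<lambda>_. ereal a) \<in> newtonian p M ?B"
        unfolding newtonian_def newtonian_norm_p_def using 1 2 by simp
      then show "\<exists>y\<in>\<Omega>. \<exists>r>0. x \<in> ball y r \<and> (\<lambda>_. ereal a) \<in> newtonian p M (ball y r \<inter> \<Omega>)"
        using x by (intro bexI[of _ x] exI[of _ 1]) simp_all
    qed
  next
    fix \<phi> :: "'a \<Rightarrow> ereal"
    have "AE x in M. x \<in> \<Omega> \<longrightarrow> minimal_wug p M \<Omega> (\<lambda>_. ereal a) x \<le> 0"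
      by (rule minimal_wug(3)[OF \<Omega> refl wug0[OF \<Omega>] Lp_imp_locally_p_integrable[OF Lp0]])
    then have "AE x in M. ennreal_powr (minimal_wug p M \<Omega> (\<lambda>_. ereal a) x) p * indicator {x \<in> \<Omega>. \<phi> x \<noteq> 0} x = 0"
      by eventually_elim (auto simp: indicator_def)
    then have "(\<integral>\<^sup>+x\<in>{x\<in>\<Omega>. \<phi> x \<noteq> 0}. ennreal_powr (minimal_wug p M \<Omega> (\<lambda>_. ereal a) x) p \<partial>M) = (\<integral>\<^sup>+x. 0 \<partial>M)"
      by (rule nn_integral_cong_AE)
    then show "(\<integral>\<^sup>+x\<in>{x\<in>\<Omega>. \<phi> x \<noteq> 0}. ennreal_powr (minimal_wug p M \<Omega> (\<lambda>_. ereal a) x) p \<partial>M)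
        \<le> (\<integral>\<^sup>+x\<in>{x\<in>\<Omega>. \<phi> x \<noteq> 0}. ennreal_powr (minimal_wug p M \<Omega> (\<lambda>y. ereal a + \<phi> y) x) p \<partial>M)"
      by simp
  qed
  show "lsc_regularized M \<Omega> (\<lambda>x. min (ereal c) (ereal k))"
    unfolding min lsc_regularized_def
  proof (intro ballI tendsto_eventually)
    fix x assume x: "x \<in> \<Omega>"
    have "ess_inf_on M (ball x s \<inter> \<Omega>) (\<lambda>_. ereal a) = ereal a" if s: "0 < s" for s
    proof -
      let ?A = "ball x s \<inter> \<Omega>"
      have "x \<in> ?A" using x s by simp
      then have A: "open ?A" "?A \<noteq> {}" "?A \<in> sets M" using \<Omega> by (blast, blast, auto intro!: sets_borel_M)
      have "(AE y in restrict_space M ?A. d \<le> ereal a) \<longleftrightarrow> d \<le> ereal a" for d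
        using A(3) open_not_null[OF A(1,2)] by (subst AE_restrict_space_iff) auto
      then have "{d. AE y in restrict_space M ?A. d \<le> ereal a} = {..ereal a}" by auto
      then show ?thesis by (simp add: ess_inf_on_def)
    qed
    then show "eventually (\<lambda>s. ess_inf_on M (ball x s \<inter> \<Omega>) (\<lambda>_. ereal a) = ereal a) (at_right 0)"
      unfolding eventually_at_right_field by (intro exI[of _ 1]) auto
  qed
next
  fix C assume "C \<in> components \<Omega>"
  then show "\<exists>x\<in>C. ereal c \<noteq> \<infinity>" using in_components_nonempty[of C \<Omega>] by auto
qed simp

end


section \<open>The extended boundary\<close>

text \<open>In terms of the original space: open sets have open traces, and those containing the
  point at infinity contain the complement of a compact set. The second claim also records that this
  point is present only in an unbounded space.\<close>

lemma openin_extended_space: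
  assumes "openin extended_space (U :: 'a::metric_space option set)"
  shows "open (Some -` U)"
    and "None \<in> U \<Longrightarrow> \<exists>C. compact C \<and> - C \<subseteq> Some -` U \<and> \<not> bounded (UNIV :: 'a set)"
proof -
  obtain V where V: "openin (Alexandroff_compactification euclidean) V" "Some -` U = Some -` V"
      "None \<in> U \<longrightarrow> None \<in> V \<and> \<not> bounded (UNIV :: 'a set)"
    using assms unfolding extended_space_def by (auto simp: openin_subtopology split: if_splits)
  show "open (Some -` U)"
    unfolding V(2) using openin_continuous_map_preimage[OF continuous_map_Some V(1)]
    by (simp add: vimage_def)
  assume "None \<in> U"
  then have N: "None \<in> V" "\<not> bounded (UNIV :: 'a set)" using V(3) by auto
  then obtain C where C: "compact C" "V = insert None (Some ` (- C))"
    using V(1) by (auto simp: openin_Alexandroff_compactification Compl_eq_Diff_UNIV)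
  then have "- C \<subseteq> Some -` U" unfolding V(2) by auto
  then show "\<exists>C. compact C \<and> - C \<subseteq> Some -` U \<and> \<not> bounded (UNIV :: 'a set)" using C N by blast
qed

lemma extended_boundary_topspace:
  "extended_boundary \<Omega> \<subseteq> topspace (extended_space :: 'a::metric_space option topology)"
proof
  fix z :: "'a option" assume z: "z \<in> extended_boundary \<Omega>"
  show "z \<in> topspace extended_space"
  proof (cases z)
    case None
    then have "\<not> bounded \<Omega>" using z by (auto simp: extended_boundary_def split: if_splits)
    then have "\<not> bounded (UNIV :: 'a set)" using bounded_subset by blast
    then show ?thesis using None by (simp add: extended_space_def)
  qed (auto simp: extended_space_def)
qed

text \<open>Lower limits and limits say something only along a proper filter. A frontier point is in
  the closure of \<Omega>, and an unbounded \<Omega> is not contained in a compact set.\<close>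

lemma approach_nontrivial:
  fixes \<Omega> :: "'a::metric_space set"
  assumes z: "z \<in> extended_boundary \<Omega>"
  shows "approach \<Omega> z \<noteq> bot"
proof
  assume "approach \<Omega> z = bot"
  then have "eventually (\<lambda>_. False) (approach \<Omega> z)" by simp
  then have "\<exists>Q. eventually Q (nhdsin extended_space z) \<and> (\<forall>x. Q (Some x) \<longrightarrow> x \<in> \<Omega> \<longrightarrow> False)"
    unfolding approach_def eventually_inf_principal eventually_filtercomap .
  then obtain Q where Q: "eventually Q (nhdsin extended_space z) \<and> (\<forall>x. Q (Some x) \<longrightarrow> x \<in> \<Omega> \<longrightarrow> False)" ..
  have "z \<in> topspace extended_space" using extended_boundary_topspace z by (rule subsetD)
  then have "\<exists>U. openin extended_space U \<and> z \<in> U \<and> (\<forall>y\<in>U. Q y)"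
    using conjunct1[OF Q] unfolding eventually_nhdsin by simp
  then obtain U where U: "openin extended_space U" "z \<in> U" "\<forall>y\<in>U. Q y" by (elim exE conjE)
  have miss: "Some -` U \<inter> \<Omega> = {}" using U(3) Q by auto
  show False
  proof (cases z)
    case (Some x)
    then have "x \<in> closure \<Omega>" using z by (auto simp: extended_boundary_def frontier_def split: if_splits)
    moreover have "x \<in> Some -` U" using U(2) Some by simp
    ultimately show False
      using miss open_Int_closure_eq_empty[OF openin_extended_space(1)[OF U(1)], of \<Omega>] by auto
  next
    case None
    then have "\<not> bounded \<Omega>" using z by (auto simp: extended_boundary_def split: if_splits)
    have "None \<in> U" using U(2) None by simp
    from openin_extended_space(2)[OF U(1) this] obtain C where C: "compact C" "- C \<subseteq> Some -` U"
      by (elim exE conjE)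
    then have "\<Omega> \<subseteq> C" using miss by blast
    then show False using \<open>\<not> bounded \<Omega>\<close> bounded_subset[OF compact_imp_bounded[OF C(1)]] by simp
  qed
qed

lemma eventually_approach: "eventually (\<lambda>x. x \<in> \<Omega>) (approach \<Omega> z)"
  unfolding approach_def by (simp add: eventually_inf_principal)

text \<open>For bounded \<Omega> the frontier is closed and bounded, hence compact by properness;
  for unbounded \<Omega> adding the point at infinity gives a closed subset of the
  compactification.\<close>

lemma (in newtonian_space) compactin_extended_boundary:
  "compactin extended_space (extended_boundary (\<Omega> :: 'a set))"
proof -
  have fr: "compactin (Alexandroff_compactification euclidean) (Some ` frontier \<Omega>)" if "bounded \<Omega>"
  proof (rule image_compactin[OF _ continuous_map_Some])
    have "bounded (frontier \<Omega>)"
      by (rule bounded_subset[OF bounded_closure[OF that]]) (auto simp: frontier_def)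
    then show "compactin euclidean (frontier \<Omega>)" by (simp add: closed_bounded_imp_compact)
  qed
  show ?thesis
  proof (cases "bounded \<Omega>")
    case True
    then show ?thesis
      using fr by (auto simp: extended_boundary_def extended_space_def compactin_subtopology)
  next
    case False
    then have unb: "\<not> bounded (UNIV :: 'a set)" using bounded_subset by blast
    have "closedin (Alexandroff_compactification euclidean) (insert None (Some ` frontier \<Omega>))"
    proof -
      have "topspace (Alexandroff_compactification euclidean) - insert None (Some ` frontier \<Omega>) = Some ` (- frontier \<Omega>)"
        by (auto simp: image_iff)
      moreover have "openin (Alexandroff_compactification euclidean) (Some ` (- frontier \<Omega>))"
        by (auto simp: openin_Alexandroff_compactification open_Compl)
      ultimately show ?thesis by (auto simp: closedin_def)
    qed
    then have "compactin (Alexandroff_compactification euclidean) (insert None (Some ` frontier \<Omega>))"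
      using closedin_compact_space[OF compact_space_Alexandroff_compactification] by blast
    then show ?thesis using False unb by (simp add: extended_boundary_def extended_space_def)
  qed
qed

text \<open>Makes the supremum and the infimum of the data real numbers, so that the constants with
  these values are admissible in the Perron families.\<close>

lemma (in newtonian_space) boundary_data_bounded:
  assumes "f \<in> continuous_boundary_data (\<Omega> :: 'a set)"
  obtains B where "\<And>z. z \<in> extended_boundary \<Omega> \<Longrightarrow> \<bar>f z\<bar> \<le> B"
proof -
  have "compactin (subtopology extended_space (extended_boundary \<Omega>)) (extended_boundary \<Omega>)"
    using compactin_extended_boundary by (simp add: compactin_subtopology)
  then have "compactin euclideanreal (f ` extended_boundary \<Omega>)"
    using assms unfolding continuous_boundary_data_def by (intro image_compactin) auto
  then have "bounded (f ` extended_boundary \<Omega>)" by (simp add: compact_imp_bounded)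
  then obtain B where "\<forall>y\<in>f ` extended_boundary \<Omega>. norm y \<le> B" unfolding bounded_iff by (elim exE)
  then show ?thesis by (intro that[of B]) simp
qed

text \<open>The distance is truncated at 1 so that it is constant off a ball, which is relatively
  compact, and extends continuously by 1 to the point at infinity. It separates \<open>x\<close>
  from all other points.\<close>

lemma (in newtonian_space) continuous_truncated_dist:
  "continuous_map extended_space euclideanreal (\<lambda>t. case t of None \<Rightarrow> 1 | Some y \<Rightarrow> min 1 (dist (x :: 'a) y))"
    (is "continuous_map _ _ ?h")
proof -
  have "continuous_map (Alexandroff_compactification euclidean) euclideanreal ?h"
    unfolding continuous_map_def
  proof (intro conjI allI impI)
    fix T :: "real set" assume "openin euclideanreal T"
    then have T: "open T" by simp
    let ?g = "\<lambda>y. min 1 (dist x y)"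
    have g: "continuous_on UNIV ?g" by (intro continuous_intros)
    show "openin (Alexandroff_compactification euclidean) {t \<in> topspace (Alexandroff_compactification euclidean). ?h t \<in> T}"
    proof (cases "1 \<in> T")
      case False
      have "{t \<in> topspace (Alexandroff_compactification euclidean). ?h t \<in> T} = Some ` (?g -` T)"
      proof (rule set_eqI)
        fix t show "(t \<in> {t \<in> topspace (Alexandroff_compactification euclidean). ?h t \<in> T}) = (t \<in> Some ` (?g -` T))"
          using False by (cases t) (auto simp: image_iff)
      qed
      moreover have "open (?g -` T)" by (rule open_vimage[OF T g])
      ultimately show ?thesis by (auto simp: openin_Alexandroff_compactification)
    next
      case True
      have "closed (?g -` (- T))" by (rule closed_vimage[OF _ g]) (use T in auto)
      moreover have "?g -` (- T) \<subseteq> cball x 1" using True by (auto simp: min_def split: if_splits)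
      ultimately have C: "compact (?g -` (- T))" "closed (?g -` (- T))"
        by (auto intro!: closed_bounded_imp_compact bounded_subset[OF bounded_cball])
      have "{t \<in> topspace (Alexandroff_compactification euclidean). ?h t \<in> T} = insert None (Some ` (UNIV - ?g -` (- T)))"
      proof (rule set_eqI)
        fix t show "(t \<in> {t \<in> topspace (Alexandroff_compactification euclidean). ?h t \<in> T}) =
            (t \<in> insert None (Some ` (UNIV - ?g -` (- T))))"
          using True by (cases t) (auto simp: image_iff)
      qed
      then show ?thesis using C by (auto simp: openin_Alexandroff_compactification)
    qed
  qed auto
  then show ?thesis
    unfolding extended_space_def by (auto intro: continuous_map_from_subtopology)
qed


section \<open>Perron solutions\<close>

context newtonian_space
begin

text \<open>An admissible function is constant in \<Omega>, so its lower limit at each boundary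
  point is its value, which therefore dominates the data everywhere; the least such constant is
  itself admissible. For the lower solution signs are reversed.\<close>

lemma perron_solutions:
  assumes \<Omega>: "open \<Omega>" and cap: "sobolev_capacity p M (- \<Omega>) = 0"
    and par: "bounded (UNIV :: 'a set) \<or> p_parabolic p M"
    and con: "connected (UNIV :: 'a set)" and P: "local_poincare p M"
    and ne: "extended_boundary \<Omega> \<noteq> {}" and f: "f \<in> continuous_boundary_data \<Omega>" and x: "x \<in> \<Omega>"
  shows "upper_perron p M \<Omega> (\<lambda>z. ereal (f z)) x = (SUP z\<in>extended_boundary \<Omega>. ereal (f z))"
    and "lower_perron p M \<Omega> (\<lambda>z. ereal (f z)) x = (INF z\<in>extended_boundary \<Omega>. ereal (f z))"
proof -
  let ?B = "extended_boundary \<Omega>"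
  obtain B where B: "\<And>z. z \<in> ?B \<Longrightarrow> \<bar>f z\<bar> \<le> B" using boundary_data_bounded[OF f] by blast
  obtain z0 where z0: "z0 \<in> ?B" using ne by (elim ex_in_conv[THEN iffD2, THEN exE])
  note nt = approach_nontrivial
  show "upper_perron p M \<Omega> (\<lambda>z. ereal (f z)) x = (SUP z\<in>?B. ereal (f z))" (is "_ = ?S")
  proof (rule antisym)
    have "?S \<le> ereal B" by (rule SUP_least) (use B in force)
    moreover have "ereal (f z0) \<le> ?S" using z0 by (rule SUP_upper)
    ultimately obtain s where s: "?S = ereal s" by (cases ?S) auto
    show "upper_perron p M \<Omega> (\<lambda>z. ereal (f z)) x \<le> ?S"
      unfolding upper_perron_def
    proof (rule INF_lower2[of "\<lambda>_. ereal s"])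
      have "ereal (f z) \<le> Liminf (approach \<Omega> z) (\<lambda>_. ereal s)" if "z \<in> ?B" for z
        using SUP_upper[OF that, of "\<lambda>z. ereal (f z)"] unfolding s by (intro Liminf_bounded) simp
      then show "(\<lambda>_. ereal s) \<in> {u. superharmonic p M \<Omega> u \<and> (\<exists>m::real. \<forall>y\<in>\<Omega>. ereal m \<le> u y) \<and>
          (\<forall>z\<in>?B. ereal (f z) \<le> Liminf (approach \<Omega> z) u)}"
        using superharmonic_const[OF \<Omega>, of s] by auto
    qed (simp add: s)
    show "?S \<le> upper_perron p M \<Omega> (\<lambda>z. ereal (f z)) x"
      unfolding upper_perron_def
    proof (intro INF_greatest SUP_least)
      fix u z assume u: "u \<in> {u. superharmonic p M \<Omega> u \<and> (\<exists>m::real. \<forall>y\<in>\<Omega>. ereal m \<le> u y) \<and>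
          (\<forall>z\<in>?B. ereal (f z) \<le> Liminf (approach \<Omega> z) u)}" and z: "z \<in> ?B"
      then obtain m where m: "\<And>y. y \<in> \<Omega> \<Longrightarrow> ereal m \<le> u y" and sh: "superharmonic p M \<Omega> u" by blast
      have "u y = u x" if "y \<in> \<Omega>" for y
        by (rule superharmonic_bounded_below_constant[OF \<Omega> cap par con P sh m that x])
      then have "eventually (\<lambda>y. u y = u x) (approach \<Omega> z)"
        using eventually_approach by (rule eventually_mono[rotated])
      then have "Liminf (approach \<Omega> z) u = u x"
        by (rule trans[OF Liminf_eq Liminf_const[OF nt[OF z]]])
      then show "ereal (f z) \<le> u x" using u z by auto
    qed
  qed
  show "lower_perron p M \<Omega> (\<lambda>z. ereal (f z)) x = (INF z\<in>?B. ereal (f z))" (is "_ = ?I")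
  proof (rule antisym)
    have "ereal (- B) \<le> ?I" by (rule INF_greatest) (use B in force)
    moreover have "?I \<le> ereal (f z0)" using z0 by (rule INF_lower)
    ultimately obtain s where s: "?I = ereal s" by (cases ?I) auto
    show "?I \<le> lower_perron p M \<Omega> (\<lambda>z. ereal (f z)) x"
      unfolding lower_perron_def
    proof (rule SUP_upper2[of "\<lambda>_. ereal s"])
      have "Limsup (approach \<Omega> z) (\<lambda>_. ereal s) \<le> ereal (f z)" if "z \<in> ?B" for z
        using INF_lower[OF that, of "\<lambda>z. ereal (f z)"] unfolding s by (intro Limsup_bounded) simp
      then show "(\<lambda>_. ereal s) \<in> {v. subharmonic p M \<Omega> v \<and> (\<exists>m::real. \<forall>y\<in>\<Omega>. v y \<le> ereal m) \<and>
          (\<forall>z\<in>?B. Limsup (approach \<Omega> z) v \<le> ereal (f z))}"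
        using superharmonic_const[OF \<Omega>, of "- s"] by (auto simp: subharmonic_def)
    qed (simp add: s)
    show "lower_perron p M \<Omega> (\<lambda>z. ereal (f z)) x \<le> ?I"
      unfolding lower_perron_def
    proof (intro SUP_least INF_greatest)
      fix v z assume v: "v \<in> {v. subharmonic p M \<Omega> v \<and> (\<exists>m::real. \<forall>y\<in>\<Omega>. v y \<le> ereal m) \<and>
          (\<forall>z\<in>?B. Limsup (approach \<Omega> z) v \<le> ereal (f z))}" and z: "z \<in> ?B"
      then obtain m where m: "\<And>y. y \<in> \<Omega> \<Longrightarrow> v y \<le> ereal m" and sh: "superharmonic p M \<Omega> (\<lambda>x. - v x)"
        unfolding subharmonic_def by blast
      have m': "ereal (- m) \<le> - v y" if "y \<in> \<Omega>" for y
        using m[OF that] by (simp add: ereal_minus_le_minus flip: uminus_ereal.simps)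
      have "v y = v x" if "y \<in> \<Omega>" for y
        using superharmonic_bounded_below_constant[OF \<Omega> cap par con P sh m' that x] by simp
      then have "eventually (\<lambda>y. v y = v x) (approach \<Omega> z)"
        using eventually_approach by (rule eventually_mono[rotated])
      then have "Limsup (approach \<Omega> z) v = v x"
        by (rule trans[OF Limsup_eq Limsup_const[OF nt[OF z]]])
      then show "v x \<le> ereal (f z)" using v z by auto
    qed
  qed
qed

text \<open>For a finite \<open>z\<close> the truncated distance from \<open>z\<close> vanishes only
  there. If \<open>z\<close> is the point at infinity, the negative of the distance from
  \<open>w\<close> is smaller at \<open>z\<close> than at \<open>w\<close>.\<close>

lemma boundary_data_below_sup:
  assumes z: "z \<in> extended_boundary (\<Omega> :: 'a set)" and w: "w \<in> extended_boundary \<Omega>" "z \<noteq> w"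
  obtains f where "f \<in> continuous_boundary_data \<Omega>" "f z < f w"
proof -
  define h where "h x t = (case t of None \<Rightarrow> 1 | Some y \<Rightarrow> min 1 (dist x y))" for x :: 'a and t
  have h: "continuous_map (subtopology extended_space (extended_boundary \<Omega>)) euclideanreal (h x)" for x
    unfolding h_def by (rule continuous_map_from_subtopology[OF continuous_truncated_dist])
  show ?thesis
  proof (cases z)
    case (Some x)
    show ?thesis
    proof (rule that[of "h x"])
      show "h x \<in> continuous_boundary_data \<Omega>" using h by (simp add: continuous_boundary_data_def)
      show "h x z < h x w" using Some w(2) by (cases w) (auto simp: h_def)
    qed
  next
    case None
    then obtain y where y: "w = Some y" using w(2) by (cases w) auto
    have "continuous_map (subtopology extended_space (extended_boundary \<Omega>)) euclideanreal (\<lambda>t. - h y t)"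
      by (rule continuous_map_minus[OF h])
    then show ?thesis
      using None y by (intro that[of "\<lambda>t. - h y t"]) (auto simp: continuous_boundary_data_def h_def)
  qed
qed

end

theorem proposition11p2:
  fixes p :: real and M :: "'a::metric_space measure" and \<Omega> :: "'a set"
  assumes "1 < p"
    and "complete_borel_measure M" and "balls_pos_finite M"
    and "proper_space TYPE('a)" and "connected (UNIV :: 'a set)"
    and "locally_doubling M" and "local_poincare p M"
    and "open \<Omega>" and "\<Omega> \<noteq> {}"
    and "bounded (UNIV :: 'a set) \<or> p_parabolic p M"
    and "sobolev_capacity p M (- \<Omega>) = 0"
    and "extended_boundary \<Omega> \<noteq> {}"
  shows "(\<forall>f\<in>continuous_boundary_data \<Omega>. \<forall>x\<in>\<Omega>.
            upper_perron p M \<Omega> (\<lambda>z. ereal (f z)) x = (SUP z\<in>extended_boundary \<Omega>. ereal (f z)) \<and>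
            lower_perron p M \<Omega> (\<lambda>z. ereal (f z)) x = (INF z\<in>extended_boundary \<Omega>. ereal (f z))) \<and>
         (\<forall>f\<in>continuous_boundary_data \<Omega>. \<not> f constant_on extended_boundary \<Omega> \<longrightarrow>
            \<not> resolutive p M \<Omega> (\<lambda>z. ereal (f z))) \<and>
         ((\<exists>z\<in>extended_boundary \<Omega>. \<exists>w\<in>extended_boundary \<Omega>. z \<noteq> w) \<longrightarrow>
            (\<forall>z\<in>extended_boundary \<Omega>. \<not> regular_point p M \<Omega> z))"
proof -
  interpret newtonian_space p M using assms(1-4) by unfold_locales
  note perron = perron_solutions[OF assms(8,11,10,5,7,12)]
  obtain x where x: "x \<in> \<Omega>" using assms(9) by blast
  have "f constant_on extended_boundary \<Omega>"
    if f: "f \<in> continuous_boundary_data \<Omega>" and r: "resolutive p M \<Omega> (\<lambda>z. ereal (f z))" for f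
  proof -
    \<comment> \<open>At one point of \<Omega> the two Perron solutions agree by resolutivity, and
      their values there are the supremum and the infimum of the data.\<close>
    have eq: "(SUP z\<in>extended_boundary \<Omega>. ereal (f z)) = (INF z\<in>extended_boundary \<Omega>. ereal (f z))"
      using r x perron[OF f x] unfolding resolutive_def by auto
    have "ereal (f z) \<le> ereal (f w)" if "z \<in> extended_boundary \<Omega>" "w \<in> extended_boundary \<Omega>" for z w
      using order_trans[OF SUP_upper[OF that(1), of "\<lambda>z. ereal (f z)"] order_trans[OF eq_refl[OF eq] INF_lower[OF that(2)]]] .
    then show ?thesis unfolding constant_on_def by (metis antisym ereal_less_eq(3))
  qed
  moreover have "\<not> regular_point p M \<Omega> z"
    if ex: "\<exists>z\<in>extended_boundary \<Omega>. \<exists>w\<in>extended_boundary \<Omega>. z \<noteq> w" and z: "z \<in> extended_boundary \<Omega>" for z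
  proof
    assume reg: "regular_point p M \<Omega> z"
    obtain w where w: "w \<in> extended_boundary \<Omega>" "z \<noteq> w" using ex by metis
    \<comment> \<open>With data smaller at \<open>z\<close> than at \<open>w\<close> the upper
      solution, constantly equal to the supremum, cannot tend to \<open>f z\<close>.\<close>
    obtain f where f: "f \<in> continuous_boundary_data \<Omega>" "f z < f w" using boundary_data_below_sup[OF z w] by blast
    let ?S = "SUP z\<in>extended_boundary \<Omega>. ereal (f z)"
    have "eventually (\<lambda>y. upper_perron p M \<Omega> (\<lambda>w. ereal (f w)) y = ?S) (approach \<Omega> z)"
      using eventually_approach by (rule eventually_mono) (rule perron(1)[OF f(1)])
    then have "(upper_perron p M \<Omega> (\<lambda>w. ereal (f w)) \<longlongrightarrow> ?S) (approach \<Omega> z)" by (rule tendsto_eventually)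
    moreover have "(upper_perron p M \<Omega> (\<lambda>w. ereal (f w)) \<longlongrightarrow> ereal (f z)) (approach \<Omega> z)"
      using reg f(1) unfolding regular_point_def by blast
    ultimately have "?S = ereal (f z)" by (rule tendsto_unique[OF approach_nontrivial[OF z]])
    moreover have "ereal (f w) \<le> ?S" using w(1) by (rule SUP_upper)
    ultimately show False using f(2) by simp
  qed
  ultimately show ?thesis using perron by blast
qed

end
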